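(* The functor $K^\ast$ from condensed cubesets to condensed simplicial sets (defined in the context) preserves limits and is faithful on the full subcategory of concrete condensed cubesets. Moreover, if $X$ is a concrete fibrant condensed cubeset, then: (i) the condensed simplicial set $K^\ast X$ is a Kan complex; (ii) for every point $x_0\colon\ast\to X$ and every $n\ge 1$, the condensed structure group $\pi_n(X,x_0)$ is isomorphic to the condensed homotopy group $\pi_n(K^\ast X,x_0)$. In particular, there exists a limit preserving functor with these properties.
   Context: **Cubesets.** The category $\square$ has objects $\{0,1\}^n$, $n\ge 0$, and morphisms the maps $\{0,1\}^n\to\{0,1\}^m$ that are restrictions of affine linear maps $\mathbb Z^n\to\mathbb Z^m$. A cubeset is a presheaf of sets $X$ on $\square$; write $X(n)$ for its value at $\{0,1\}^n$. It is concrete if $X(n)\to X(0)^{\{0,1\}^n}$ (restriction to vertices) is injective for all $n$. The $n$-corner ($n\ge1$) is the union, inside the representable cubeset of $\{0,1\}^n$, of all faces of dimension less than $n$ not containing $(1,\dots,1)$ (equivalently of the faces $[x_j=0]$). A cubeset is fibrant if every map from an $n$-corner to it extends to the $n$-cube, for all $n\geq 1$. **Structure groups.** For $X$ a concrete fibrant cubeset, $x_0\in X(0)$, $n\ge1$, let $B_n(X,x_0)$ be the set of $c\in X(n)$ with $c(v)=x_0$ for all $v\ne(1,\dots,1)$. Identify $c\sim d$ iff the configuration $\{0,1\}^{n+1}\to X(0)$ equal to $c$ on one of the two opposite faces in a coordinate direction and $d$ on the other is in $X(n+1)$. Then $\pi_n(X,x_0)=B_n(X,x_0)/\!\sim$,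 with group law: $[c]\cdot[d]=[e]$ iff for suitable representatives there is $q\in X(n+1)$ with $q(1,\dots,1,1,0)=c(1,\dots,1)$, $q(1,\dots,1,0,1)=d(1,\dots,1)$, $q(1,\dots,1,1,1)=e(1,\dots,1)$ and all other values $x_0$. (This is a well-defined abelian group.) **Kernel $K$.** $\mathrm{Sub}[n]$ denotes the set of nonempty subsets of $\{0,\dots,n\}$; $\Delta$ is the simplex category; $\sigma\colon[k]\to[n]$ in $\Delta$ induces $\sigma_\ast\colon\mathrm{Sub}[k]\to\mathrm{Sub}[n]$ by direct image. A formal $k$-cube with labels in $[k]$ is a map $A\colon\{0,1\}^k\to\mathrm{Sub}[k]$; its label functions are $f_i\colon\{0,1\}^k\to\{0,1\}$, $f_i(x)=1\iff i\in A(x)$. It is degenerable if for every $0\le i<k$ two conditions hold: identifying labels $i$ and $i+1$ (pushing forward along the degeneracy $[k]\to[k-1]$ hitting $i$ twice) gives a map not depending on the coordinate $x_i$ (coordinates are $x_0,\dots,x_{k-1}$). Let $K_n(m)$ be the set of all composites $\sigma_\ast\circ A\circ\phi\colon\{0,1\}^m\to\mathrm{Sub}[n]$ with $\phi\colon\{0,1\}^m\to\{0,1\}^k$ in $\square$, $A$ a degenerable formal $k$-cube, $\sigma\colon[k]\to[n]$ in $\Delta$, $k\ge0$. This is a cosimplicial cubeset $K$. For a cubeset $X$, $K^\ast X$ is the simplicial set $[n]\mapsto\mathrm{Hom}(K_n,X)$ (Hom of cubesets). **Condensed version.** Fix an uncountable strong limit cardinal $\kappa$; $\mathrm{Extr}_\kappa$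 is the category of extremally disconnected compact Hausdorff spaces of cardinality $<\kappa$. A condensed set is a functor $\mathrm{Extr}_\kappa^{op}\to\mathrm{Set}$ taking finite disjoint unions to products. Condensed cubesets (cubespaces), resp. condensed simplicial sets, are finite-product-preserving functors $\mathrm{Extr}_\kappa^{op}\to$ cubesets, resp. simplicial sets (equivalently presheaves on $\square$, resp. $\Delta$, with values in condensed sets). A condensed cubeset $X$ is concrete (fibrant) if each cubeset $X(E)$, $E\in\mathrm{Extr}_\kappa$, is. Define $(K^\ast X)(E)=K^\ast(X(E))$. A condensed simplicial set $Y$ is a Kan complex if each $Y(E)$ is. Condensed structure groups and condensed homotopy groups are defined pointwise: $E\mapsto\pi_n(X(E),x_0|_E)$ and $E\mapsto\pi_n(Y(E),x_0|_E)$ (simplicial homotopy groups), where a point $x_0\colon\ast\to X$ gives basepoints $x_0|_E\in X(E)(0)=K^\ast_0(X(E))$. *)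

theory Defs
  imports "HOL-Analysis.Analysis" "HOL-Algebra.Group"
begin

unbundle cardinal_syntax

section \<open>Categories, functors, limits\<close>

text \<open>Arrows do not carry their source and target, so \<open>Idn\<close> and \<open>Cmp\<close> take the objects as
  arguments: \<open>Cmp C x y z g f\<close> is the composite of \<open>f : x \<rightarrow> y\<close> and \<open>g : y \<rightarrow> z\<close>.\<close>

record ('o, 'm) category =
  Obj :: "'o set"
  Arr :: "'o \<Rightarrow> 'o \<Rightarrow> 'm set"
  Idn :: "'o \<Rightarrow> 'm"
  Cmp :: "'o \<Rightarrow> 'o \<Rightarrow> 'o \<Rightarrow> 'm \<Rightarrow> 'm \<Rightarrow> 'm"

definition is_category :: "('o, 'm) category \<Rightarrow> bool" where
  "is_category C \<longleftrightarrow>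
     (\<forall>x\<in>Obj C. Idn C x \<in> Arr C x x) \<and>
     (\<forall>x\<in>Obj C. \<forall>y\<in>Obj C. \<forall>z\<in>Obj C. \<forall>f\<in>Arr C x y. \<forall>g\<in>Arr C y z.
        Cmp C x y z g f \<in> Arr C x z) \<and>
     (\<forall>x\<in>Obj C. \<forall>y\<in>Obj C. \<forall>f\<in>Arr C x y.
        Cmp C x x y f (Idn C x) = f \<and> Cmp C x y y (Idn C y) f = f) \<and>
     (\<forall>w\<in>Obj C. \<forall>x\<in>Obj C. \<forall>y\<in>Obj C. \<forall>z\<in>Obj C.
        \<forall>f\<in>Arr C w x. \<forall>g\<in>Arr C x y. \<forall>h\<in>Arr C y z.
        Cmp C w y z h (Cmp C w x y g f) = Cmp C w x z (Cmp C x y z h g) f)"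

definition op_cat :: "('o, 'm) category \<Rightarrow> ('o, 'm) category" where
  "op_cat C = \<lparr>Obj = Obj C, Arr = (\<lambda>x y. Arr C y x), Idn = Idn C,
     Cmp = (\<lambda>x y z g f. Cmp C z y x f g)\<rparr>"

definition full_sub :: "('o, 'm) category \<Rightarrow> ('o \<Rightarrow> bool) \<Rightarrow> ('o, 'm) category" where
  "full_sub C P = C\<lparr>Obj := {x \<in> Obj C. P x}\<rparr>"

record ('o, 'm, 'p, 'q) cfunctor =
  FObj :: "'o \<Rightarrow> 'p"
  FArr :: "'o \<Rightarrow> 'o \<Rightarrow> 'm \<Rightarrow> 'q"

definition is_functor ::
  "('o, 'm) category \<Rightarrow> ('p, 'q) category \<Rightarrow> ('o, 'm, 'p, 'q) cfunctor \<Rightarrow> bool" where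
  "is_functor C D F \<longleftrightarrow>
     (\<forall>x\<in>Obj C. FObj F x \<in> Obj D) \<and>
     (\<forall>x\<in>Obj C. \<forall>y\<in>Obj C. \<forall>f\<in>Arr C x y. FArr F x y f \<in> Arr D (FObj F x) (FObj F y)) \<and>
     (\<forall>x\<in>Obj C. FArr F x x (Idn C x) = Idn D (FObj F x)) \<and>
     (\<forall>x\<in>Obj C. \<forall>y\<in>Obj C. \<forall>z\<in>Obj C. \<forall>f\<in>Arr C x y. \<forall>g\<in>Arr C y z.
        FArr F x z (Cmp C x y z g f) =
        Cmp D (FObj F x) (FObj F y) (FObj F z) (FArr F y z g) (FArr F x y f))"

definition comp_functor ::
  "('p, 'q, 'r, 's) cfunctor \<Rightarrow> ('o, 'm, 'p, 'q) cfunctor \<Rightarrow> ('o, 'm, 'r, 's) cfunctor" where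
  "comp_functor G F = \<lparr>FObj = (\<lambda>x. FObj G (FObj F x)),
     FArr = (\<lambda>x y f. FArr G (FObj F x) (FObj F y) (FArr F x y f))\<rparr>"

definition functor_cat ::
  "('o, 'm) category \<Rightarrow> ('p, 'q) category \<Rightarrow> (('o, 'm, 'p, 'q) cfunctor, 'o \<Rightarrow> 'q) category" where
  "functor_cat C D = \<lparr>
     Obj = {F. is_functor C D F},
     Arr = (\<lambda>F G. {\<eta> \<in> (\<Pi>\<^sub>E x\<in>Obj C. Arr D (FObj F x) (FObj G x)).
        \<forall>x\<in>Obj C. \<forall>y\<in>Obj C. \<forall>f\<in>Arr C x y.
          Cmp D (FObj F x) (FObj F y) (FObj G y) (\<eta> y) (FArr F x y f) =
          Cmp D (FObj F x) (FObj G x) (FObj G y) (FArr G x y f) (\<eta> x)}),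
     Idn = (\<lambda>F. \<lambda>x\<in>Obj C. Idn D (FObj F x)),
     Cmp = (\<lambda>F G H \<beta> \<alpha>. \<lambda>x\<in>Obj C. Cmp D (FObj F x) (FObj G x) (FObj H x) (\<beta> x) (\<alpha> x))\<rparr>"

definition postcompose ::
  "('o, 'm) category \<Rightarrow> ('p, 'q, 'r, 's) cfunctor \<Rightarrow>
   (('o, 'm, 'p, 'q) cfunctor, 'o \<Rightarrow> 'q, ('o, 'm, 'r, 's) cfunctor, 'o \<Rightarrow> 's) cfunctor" where
  "postcompose C G = \<lparr>FObj = comp_functor G,
     FArr = (\<lambda>X Y \<eta>. \<lambda>c\<in>Obj C. FArr G (FObj X c) (FObj Y c) (\<eta> c))\<rparr>"

definition is_cone ::
  "('j, 'i) category \<Rightarrow> ('o, 'm) category \<Rightarrow> ('j, 'i, 'o, 'm) cfunctor \<Rightarrow>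
   'o \<Rightarrow> ('j \<Rightarrow> 'm) \<Rightarrow> bool" where
  "is_cone J C D L \<pi> \<longleftrightarrow>
     L \<in> Obj C \<and> \<pi> \<in> (\<Pi>\<^sub>E j\<in>Obj J. Arr C L (FObj D j)) \<and>
     (\<forall>i\<in>Obj J. \<forall>j\<in>Obj J. \<forall>f\<in>Arr J i j.
        Cmp C L (FObj D i) (FObj D j) (FArr D i j f) (\<pi> i) = \<pi> j)"

definition is_limit_cone ::
  "('j, 'i) category \<Rightarrow> ('o, 'm) category \<Rightarrow> ('j, 'i, 'o, 'm) cfunctor \<Rightarrow>
   'o \<Rightarrow> ('j \<Rightarrow> 'm) \<Rightarrow> bool" where
  "is_limit_cone J C D L \<pi> \<longleftrightarrow>
     is_cone J C D L \<pi> \<and>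
     (\<forall>M \<mu>. is_cone J C D M \<mu> \<longrightarrow>
        (\<exists>!h. h \<in> Arr C M L \<and> (\<forall>j\<in>Obj J. Cmp C M L (FObj D j) (\<pi> j) h = \<mu> j)))"

definition preserves_limits_of_shape ::
  "('j, 'i) category \<Rightarrow> ('o, 'm) category \<Rightarrow> ('p, 'q) category \<Rightarrow>
   ('o, 'm, 'p, 'q) cfunctor \<Rightarrow> bool" where
  "preserves_limits_of_shape J C D F \<longleftrightarrow>
     (\<forall>G L \<pi>. is_functor J C G \<and> is_limit_cone J C G L \<pi> \<longrightarrow>
        is_limit_cone J D (comp_functor F G) (FObj F L)
          (\<lambda>j\<in>Obj J. FArr F L (FObj G j) (\<pi> j)))"

definition is_faithful :: "('o, 'm) category \<Rightarrow> ('o, 'm, 'p, 'q) cfunctor \<Rightarrow> bool" where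
  "is_faithful C F \<longleftrightarrow> (\<forall>x\<in>Obj C. \<forall>y\<in>Obj C. inj_on (FArr F x y) (Arr C x y))"


section \<open>Presheaves of sets\<close>

text \<open>For \<open>f \<in> Arr B x y\<close>, \<open>Act P x y f\<close> is the induced map \<open>Val P y \<rightarrow> Val P x\<close>.
  Morphisms are defined between presheaves with different value types, because the presheaves
  mapped out of (corners, horns, the \<open>K\<close>) do not have the value type of their target.\<close>

record ('o, 'm, 'a) presheaf =
  Val :: "'o \<Rightarrow> 'a set"
  Act :: "'o \<Rightarrow> 'o \<Rightarrow> 'm \<Rightarrow> 'a \<Rightarrow> 'a"

definition is_presheaf :: "('o, 'm) category \<Rightarrow> ('o, 'm, 'a) presheaf \<Rightarrow> bool" where
  "is_presheaf B P \<longleftrightarrow>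
     (\<forall>x\<in>Obj B. \<forall>y\<in>Obj B. \<forall>f\<in>Arr B x y. Act P x y f \<in> Val P y \<rightarrow> Val P x) \<and>
     (\<forall>x\<in>Obj B. \<forall>a\<in>Val P x. Act P x x (Idn B x) a = a) \<and>
     (\<forall>x\<in>Obj B. \<forall>y\<in>Obj B. \<forall>z\<in>Obj B. \<forall>f\<in>Arr B x y. \<forall>g\<in>Arr B y z. \<forall>a\<in>Val P z.
        Act P x z (Cmp B x y z g f) a = Act P x y f (Act P y z g a))"

definition presheaf_hom ::
  "('o, 'm) category \<Rightarrow> ('o, 'm, 'b) presheaf \<Rightarrow> ('o, 'm, 'a) presheaf \<Rightarrow> ('o \<Rightarrow> 'b \<Rightarrow> 'a) set" where
  "presheaf_hom B P Q =
     {\<theta> \<in> (\<Pi>\<^sub>E x\<in>Obj B. Val P x \<rightarrow>\<^sub>E Val Q x).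
        \<forall>x\<in>Obj B. \<forall>y\<in>Obj B. \<forall>f\<in>Arr B x y. \<forall>a\<in>Val P y.
          \<theta> x (Act P x y f a) = Act Q x y f (\<theta> y a)}"

text \<open>The type \<open>'a\<close> plays the role of the universe of sets: the values are arbitrary subsets of
  \<open>'a\<close>, and universal properties are tested against presheaves with values in \<open>'a\<close>.\<close>

definition presheaf_cat ::
  "('o, 'm) category \<Rightarrow> (('o, 'm, 'a) presheaf, 'o \<Rightarrow> 'a \<Rightarrow> 'a) category" where
  "presheaf_cat B = \<lparr>
     Obj = {P. is_presheaf B P},
     Arr = presheaf_hom B,
     Idn = (\<lambda>P. \<lambda>x\<in>Obj B. \<lambda>a\<in>Val P x. a),
     Cmp = (\<lambda>P Q R \<beta> \<alpha>. \<lambda>x\<in>Obj B. \<lambda>a\<in>Val P x. \<beta> x (\<alpha> x a))\<rparr>"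

definition representable :: "('o, 'm) category \<Rightarrow> 'o \<Rightarrow> ('o, 'm, 'm) presheaf" where
  "representable B n = \<lparr>Val = (\<lambda>m. Arr B m n), Act = (\<lambda>l m f g. Cmp B l m n g f)\<rparr>"

text \<open>\<open>S\<close> is meant to be a subpresheaf of \<open>P\<close>.\<close>

definition extends_from ::
  "('o, 'm) category \<Rightarrow> ('o, 'm, 'b) presheaf \<Rightarrow> ('o, 'm, 'b) presheaf \<Rightarrow>
   ('o, 'm, 'a) presheaf \<Rightarrow> bool" where
  "extends_from B S P X \<longleftrightarrow>
     (\<forall>\<theta>\<in>presheaf_hom B S X. \<exists>\<eta>\<in>presheaf_hom B P X.
        \<forall>m\<in>Obj B. \<forall>a\<in>Val S m. \<eta> m a = \<theta> m a)"


section \<open>Cubesets\<close>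

definition cube :: "nat \<Rightarrow> (nat \<Rightarrow> int) set" where
  "cube n = {..<n} \<rightarrow>\<^sub>E {0, 1}"

definition Box :: "(nat, (nat \<Rightarrow> int) \<Rightarrow> (nat \<Rightarrow> int)) category" where
  "Box = \<lparr>
     Obj = UNIV,
     Arr = (\<lambda>n m. {\<phi> \<in> cube n \<rightarrow>\<^sub>E cube m.
        \<exists>(a :: nat \<Rightarrow> nat \<Rightarrow> int) b. \<forall>v\<in>cube n. \<forall>i<m. \<phi> v i = b i + (\<Sum>j<n. a i j * v j)}),
     Idn = (\<lambda>n. \<lambda>v\<in>cube n. v),
     Cmp = (\<lambda>l m n g f. compose (cube l) g f)\<rparr>"

type_synonym 'a cubeset = "(nat, (nat \<Rightarrow> int) \<Rightarrow> (nat \<Rightarrow> int), 'a) presheaf"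

definition vertex :: "'a cubeset \<Rightarrow> nat \<Rightarrow> 'a \<Rightarrow> (nat \<Rightarrow> int) \<Rightarrow> 'a" where
  "vertex X n c v = Act X 0 n (\<lambda>_\<in>cube 0. v) c"

definition concrete_cubeset :: "'a cubeset \<Rightarrow> bool" where
  "concrete_cubeset X \<longleftrightarrow> (\<forall>n. inj_on (\<lambda>c. \<lambda>v\<in>cube n. vertex X n c v) (Val X n))"

definition corner :: "nat \<Rightarrow> ((nat \<Rightarrow> int) \<Rightarrow> (nat \<Rightarrow> int)) cubeset" where
  "corner n = (representable Box n)
     \<lparr>Val := (\<lambda>m. {\<phi> \<in> Arr Box m n. \<exists>j<n. \<forall>v\<in>cube m. \<phi> v j = 0})\<rparr>"

definition fibrant_cubeset :: "'a cubeset \<Rightarrow> bool" where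
  "fibrant_cubeset X \<longleftrightarrow> (\<forall>n\<ge>1. extends_from Box (corner n) (representable Box n) X)"

text \<open>\<open>cube 0\<close> has the single element \<open>\<lambda>_. undefined\<close>.\<close>

definition const_cube :: "'a cubeset \<Rightarrow> nat \<Rightarrow> 'a \<Rightarrow> 'a" where
  "const_cube X n x = Act X n 0 (\<lambda>_\<in>cube n. (\<lambda>_. undefined)) x"


section \<open>Structure groups\<close>

text \<open>\<open>insert_coord n j e v\<close> is the image of \<open>v \<in> cube n\<close> in the face \<open>x\<^sub>j = e\<close> of \<open>cube (n + 1)\<close>.\<close>

definition insert_coord :: "nat \<Rightarrow> nat \<Rightarrow> int \<Rightarrow> (nat \<Rightarrow> int) \<Rightarrow> nat \<Rightarrow> int" where
  "insert_coord n j e v = (\<lambda>i\<in>{..<Suc n}. if i < j then v i else if i = j then e else v (i - 1))"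

definition ones :: "nat \<Rightarrow> nat \<Rightarrow> int" where
  "ones n = (\<lambda>i\<in>{..<n}. 1)"

definition pointed_cubes :: "'a cubeset \<Rightarrow> nat \<Rightarrow> 'a \<Rightarrow> 'a set" where
  "pointed_cubes X n x = {c \<in> Val X n. \<forall>v\<in>cube n. v \<noteq> ones n \<longrightarrow> vertex X n c v = x}"

definition cube_rel :: "'a cubeset \<Rightarrow> nat \<Rightarrow> 'a \<Rightarrow> ('a \<times> 'a) set" where
  "cube_rel X n x = {(c, d). c \<in> pointed_cubes X n x \<and> d \<in> pointed_cubes X n x \<and>
     (\<exists>q\<in>Val X (Suc n). \<exists>j\<le>n. \<forall>v\<in>cube n.
        vertex X (Suc n) q (insert_coord n j 0 v) = vertex X n c v \<and>
        vertex X (Suc n) q (insert_coord n j 1 v) = vertex X n d v)}"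

text \<open>Coordinates are numbered from \<open>0\<close>, so the last two coordinates of \<open>cube (n + 1)\<close> are
  \<open>n - 1\<close> and \<open>n\<close>.\<close>

definition cube_product :: "'a cubeset \<Rightarrow> nat \<Rightarrow> 'a \<Rightarrow> 'a \<Rightarrow> 'a \<Rightarrow> 'a \<Rightarrow> bool" where
  "cube_product X n x c d e \<longleftrightarrow>
     (\<exists>q\<in>Val X (Suc n). \<forall>v\<in>cube (Suc n). vertex X (Suc n) q v =
        (if v = (ones (Suc n))(n := 0) then vertex X n c (ones n)
         else if v = (ones (Suc n))(n - 1 := 0) then vertex X n d (ones n)
         else if v = ones (Suc n) then vertex X n e (ones n)
         else x))"

definition structure_group :: "'a cubeset \<Rightarrow> nat \<Rightarrow> 'a \<Rightarrow> 'a set monoid" where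
  "structure_group X n x = \<lparr>
     carrier = pointed_cubes X n x // cube_rel X n x,
     mult = (\<lambda>S T. THE R. R \<in> pointed_cubes X n x // cube_rel X n x \<and>
        (\<exists>c\<in>S. \<exists>d\<in>T. \<exists>e\<in>R. cube_product X n x c d e)),
     one = cube_rel X n x `` {const_cube X n x}\<rparr>"


section \<open>Simplicial sets and simplicial homotopy groups\<close>

definition Simplex :: "(nat, nat \<Rightarrow> nat) category" where
  "Simplex = \<lparr>
     Obj = UNIV,
     Arr = (\<lambda>n m. {\<sigma> \<in> {..n} \<rightarrow>\<^sub>E {..m}. mono_on {..n} \<sigma>}),
     Idn = (\<lambda>n. \<lambda>i\<in>{..n}. i),
     Cmp = (\<lambda>l m n g f. compose {..l} g f)\<rparr>"

type_synonym 'a simplicial_set = "(nat, nat \<Rightarrow> nat, 'a) presheaf"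

definition horn :: "nat \<Rightarrow> nat \<Rightarrow> (nat \<Rightarrow> nat) simplicial_set" where
  "horn n k = (representable Simplex n)
     \<lparr>Val := (\<lambda>m. {\<sigma> \<in> Arr Simplex m n. \<exists>j\<le>n. j \<noteq> k \<and> j \<notin> \<sigma> ` {..m}})\<rparr>"

definition Kan_complex :: "'a simplicial_set \<Rightarrow> bool" where
  "Kan_complex Y \<longleftrightarrow>
     (\<forall>n\<ge>1. \<forall>k\<le>n. extends_from Simplex (horn n k) (representable Simplex n) Y)"

definition face :: "'a simplicial_set \<Rightarrow> nat \<Rightarrow> nat \<Rightarrow> 'a \<Rightarrow> 'a" where
  "face Y n i = Act Y n (Suc n) (\<lambda>j\<in>{..n}. if j < i then j else Suc j)"

definition const_simplex :: "'a simplicial_set \<Rightarrow> nat \<Rightarrow> 'a \<Rightarrow> 'a" where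
  "const_simplex Y n y = Act Y n 0 (\<lambda>_\<in>{..n}. 0) y"

text \<open>The combinatorial definition of the homotopy groups of a Kan complex (Kan, May) for
  \<open>n \<ge> 1\<close>: classes of \<open>n\<close>-simplices all of whose faces are the basepoint, with
  \<open>[s] [t] = [d\<^sub>n w]\<close> for \<open>w\<close> with \<open>d\<^bsub>n-1\<^esub> w = s\<close>, \<open>d\<^bsub>n+1\<^esub> w = t\<close> and trivial other faces.\<close>

definition pointed_simplices :: "'a simplicial_set \<Rightarrow> nat \<Rightarrow> 'a \<Rightarrow> 'a set" where
  "pointed_simplices Y n y =
     {s \<in> Val Y n. \<forall>i\<le>n. face Y (n - 1) i s = const_simplex Y (n - 1) y}"

definition simplex_rel :: "'a simplicial_set \<Rightarrow> nat \<Rightarrow> 'a \<Rightarrow> ('a \<times> 'a) set" where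
  "simplex_rel Y n y = {(s, t). s \<in> pointed_simplices Y n y \<and> t \<in> pointed_simplices Y n y \<and>
     (\<exists>w\<in>Val Y (Suc n). face Y n n w = s \<and> face Y n (Suc n) w = t \<and>
        (\<forall>i<n. face Y n i w = const_simplex Y n y))}"

definition simplex_product :: "'a simplicial_set \<Rightarrow> nat \<Rightarrow> 'a \<Rightarrow> 'a \<Rightarrow> 'a \<Rightarrow> 'a \<Rightarrow> bool" where
  "simplex_product Y n y s t r \<longleftrightarrow>
     (\<exists>w\<in>Val Y (Suc n). face Y n (n - 1) w = s \<and> face Y n (Suc n) w = t \<and> face Y n n w = r \<and>
        (\<forall>i<n - 1. face Y n i w = const_simplex Y n y))"

definition homotopy_group :: "'a simplicial_set \<Rightarrow> nat \<Rightarrow> 'a \<Rightarrow> 'a set monoid" where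
  "homotopy_group Y n y = \<lparr>
     carrier = pointed_simplices Y n y // simplex_rel Y n y,
     mult = (\<lambda>S T. THE R. R \<in> pointed_simplices Y n y // simplex_rel Y n y \<and>
        (\<exists>s\<in>S. \<exists>t\<in>T. \<exists>r\<in>R. simplex_product Y n y s t r)),
     one = simplex_rel Y n y `` {const_simplex Y n y}\<rparr>"


section \<open>The cosimplicial cubeset \<open>K\<close> and the functor \<open>K\<^sup>*\<close>\<close>

definition Sub :: "nat \<Rightarrow> nat set set" where
  "Sub n = {A. A \<subseteq> {..n} \<and> A \<noteq> {}}"

text \<open>The map \<open>[k] \<rightarrow> [k - 1]\<close> identifying \<open>i\<close> and \<open>i + 1\<close>.\<close>

definition codegeneracy :: "nat \<Rightarrow> nat \<Rightarrow> nat" where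
  "codegeneracy i j = (if j \<le> i then j else j - 1)"

text \<open>In terms of the label functions \<open>f\<^sub>j v = (j \<in> A v)\<close>, the condition at \<open>i\<close> says that
  neither \<open>f\<^sub>i \<or> f\<^bsub>i+1\<^esub>\<close> nor any \<open>f\<^sub>j\<close> with \<open>j \<notin> {i, i + 1}\<close> depends on the coordinate \<open>i\<close>.\<close>

definition degenerable :: "nat \<Rightarrow> ((nat \<Rightarrow> int) \<Rightarrow> nat set) \<Rightarrow> bool" where
  "degenerable k A \<longleftrightarrow> A \<in> cube k \<rightarrow>\<^sub>E Sub k \<and>
     (\<forall>i<k. \<forall>u\<in>cube k. \<forall>v\<in>cube k. (\<forall>j. j \<noteq> i \<longrightarrow> u j = v j) \<longrightarrow>
        codegeneracy i ` A u = codegeneracy i ` A v)"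

definition K :: "nat \<Rightarrow> ((nat \<Rightarrow> int) \<Rightarrow> nat set) cubeset" where
  "K n = \<lparr>
     Val = (\<lambda>m. {(\<lambda>v\<in>cube m. \<sigma> ` A (\<phi> v)) | \<sigma> A \<phi> k.
        \<phi> \<in> Arr Box m k \<and> degenerable k A \<and> \<sigma> \<in> Arr Simplex k n}),
     Act = (\<lambda>l m \<phi> a. compose (cube l) a \<phi>)\<rparr>"

type_synonym 'a K_map = "nat \<Rightarrow> ((nat \<Rightarrow> int) \<Rightarrow> nat set) \<Rightarrow> 'a"

definition Kstar ::
  "('a cubeset, nat \<Rightarrow> 'a \<Rightarrow> 'a, 'a K_map simplicial_set, nat \<Rightarrow> 'a K_map \<Rightarrow> 'a K_map) cfunctor"
where
  "Kstar = \<lparr>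
     FObj = (\<lambda>X. \<lparr>
        Val = (\<lambda>n. presheaf_hom Box (K n) X),
        Act = (\<lambda>m n \<sigma> \<theta>. \<lambda>p. \<lambda>a\<in>Val (K m) p. \<theta> p (\<lambda>v\<in>cube p. \<sigma> ` a v))\<rparr>),
     FArr = (\<lambda>X Y \<eta>. \<lambda>n. \<lambda>\<theta>\<in>presheaf_hom Box (K n) X.
        \<lambda>p. \<lambda>a\<in>Val (K n) p. \<eta> p (\<theta> p a))\<rparr>"

text \<open>\<open>K 0\<close> is the point, so \<open>K\<^sup>*\<close> has the same \<open>0\<close>-simplices as \<open>X\<close> has points; \<open>Kstar_point X\<close> is
  this identification.\<close>

definition Kstar_point :: "'a cubeset \<Rightarrow> 'a \<Rightarrow> 'a K_map" where
  "Kstar_point X x = (\<lambda>p. \<lambda>a\<in>Val (K 0) p. const_cube X p x)"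


section \<open>Condensed objects\<close>

definition uncountable_strong_limit :: "'k rel \<Rightarrow> bool" where
  "uncountable_strong_limit \<kappa> \<longleftrightarrow> Card_order \<kappa> \<and> natLeq <o \<kappa> \<and>
     (\<forall>A :: 'k set. |A| <o \<kappa> \<longrightarrow> |Pow A| <o \<kappa>)"

definition extremally_disconnected :: "'k topology \<Rightarrow> bool" where
  "extremally_disconnected E \<longleftrightarrow> (\<forall>U. openin E U \<longrightarrow> openin E (E closure_of U))"

text \<open>\<open>\<kappa>\<close> is a cardinal on the type \<open>'k\<close>, so every space of cardinality less than \<open>\<kappa>\<close> is homeomorphic
  to one whose points are in \<open>'k\<close>.\<close>

definition Extr :: "'k rel \<Rightarrow> ('k topology, 'k \<Rightarrow> 'k) category" where
  "Extr \<kappa> = \<lparr>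
     Obj = {E. compact_space E \<and> Hausdorff_space E \<and> extremally_disconnected E \<and>
        |topspace E| <o \<kappa>},
     Arr = (\<lambda>E F. {f \<in> topspace E \<rightarrow>\<^sub>E topspace F. continuous_map E F f}),
     Idn = (\<lambda>E. \<lambda>x\<in>topspace E. x),
     Cmp = (\<lambda>D E F g f. compose (topspace D) g f)\<rparr>"

type_synonym ('k, 'o, 'm, 'a) condensed =
  "('k topology, 'k \<Rightarrow> 'k, ('o, 'm, 'a) presheaf, 'o \<Rightarrow> 'a \<Rightarrow> 'a) cfunctor"

text \<open>Finite products of presheaves are computed objectwise. The family \<open>\<iota>\<close> exhibits \<open>E\<close> as the
  disjoint union of the \<open>Es i\<close>, \<open>i \<in> I\<close>; the case \<open>I = {}\<close> says that the value at the empty space is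
  terminal.\<close>

definition disjoint_unions_to_products ::
  "'k rel \<Rightarrow> ('o, 'm) category \<Rightarrow> ('k, 'o, 'm, 'a) condensed \<Rightarrow> bool" where
  "disjoint_unions_to_products \<kappa> B X \<longleftrightarrow>
     (\<forall>(I :: nat set) Es E \<iota>.
        finite I \<and> E \<in> Obj (Extr \<kappa>) \<and>
        (\<forall>i\<in>I. Es i \<in> Obj (Extr \<kappa>) \<and> \<iota> i \<in> Arr (Extr \<kappa>) (Es i) E) \<and>
        homeomorphic_map (sum_topology Es I) E (\<lambda>(i, e). \<iota> i e) \<longrightarrow>
        (\<forall>n\<in>Obj B. bij_betw (\<lambda>x. \<lambda>i\<in>I. FArr X E (Es i) (\<iota> i) n x)
           (Val (FObj X E) n) (\<Pi>\<^sub>E i\<in>I. Val (FObj X (Es i)) n)))"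

definition condensed_cat ::
  "'k rel \<Rightarrow> ('o, 'm) category \<Rightarrow>
   (('k, 'o, 'm, 'a) condensed, 'k topology \<Rightarrow> 'o \<Rightarrow> 'a \<Rightarrow> 'a) category" where
  "condensed_cat \<kappa> B = full_sub (functor_cat (op_cat (Extr \<kappa>)) (presheaf_cat B))
     (disjoint_unions_to_products \<kappa> B)"

type_synonym ('k, 'a) cubespace = "('k, nat, (nat \<Rightarrow> int) \<Rightarrow> (nat \<Rightarrow> int), 'a) condensed"

type_synonym ('k, 'a) condensed_simplicial_set = "('k, nat, nat \<Rightarrow> nat, 'a) condensed"

abbreviation cubespaces ::
  "'k rel \<Rightarrow> (('k, 'a) cubespace, 'k topology \<Rightarrow> nat \<Rightarrow> 'a \<Rightarrow> 'a) category" where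
  "cubespaces \<kappa> \<equiv> condensed_cat \<kappa> Box"

abbreviation condensed_simplicial_sets ::
  "'k rel \<Rightarrow> (('k, 'a) condensed_simplicial_set, 'k topology \<Rightarrow> nat \<Rightarrow> 'a \<Rightarrow> 'a) category" where
  "condensed_simplicial_sets \<kappa> \<equiv> condensed_cat \<kappa> Simplex"

definition concrete :: "'k rel \<Rightarrow> ('k, 'a) cubespace \<Rightarrow> bool" where
  "concrete \<kappa> X \<longleftrightarrow> (\<forall>E\<in>Obj (Extr \<kappa>). concrete_cubeset (FObj X E))"

definition fibrant :: "'k rel \<Rightarrow> ('k, 'a) cubespace \<Rightarrow> bool" where
  "fibrant \<kappa> X \<longleftrightarrow> (\<forall>E\<in>Obj (Extr \<kappa>). fibrant_cubeset (FObj X E))"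

definition condensed_Kan :: "'k rel \<Rightarrow> ('k, 'a) condensed_simplicial_set \<Rightarrow> bool" where
  "condensed_Kan \<kappa> Y \<longleftrightarrow> (\<forall>E\<in>Obj (Extr \<kappa>). Kan_complex (FObj Y E))"

text \<open>A functor from cubespaces with values in \<open>'a\<close> to condensed simplicial sets with values
  in \<open>'b\<close>.\<close>

type_synonym ('k, 'a, 'b) realization =
  "(('k, 'a) cubespace, 'k topology \<Rightarrow> nat \<Rightarrow> 'a \<Rightarrow> 'a,
    ('k, 'b) condensed_simplicial_set, 'k topology \<Rightarrow> nat \<Rightarrow> 'b \<Rightarrow> 'b) cfunctor"

text \<open>\<open>K\<^sup>*\<close> on condensed objects is applied pointwise: \<open>(K\<^sup>* X)(E) = K\<^sup>* (X(E))\<close>.\<close>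

definition condensed_Kstar :: "'k rel \<Rightarrow> ('k, 'a, 'a K_map) realization" where
  "condensed_Kstar \<kappa> = postcompose (op_cat (Extr \<kappa>)) Kstar"

text \<open>The one-point cubespace. A map from it to \<open>X\<close> is a point of \<open>X\<close>.\<close>

definition point_cubespace :: "'k rel \<Rightarrow> ('k, 'a) cubespace" where
  "point_cubespace \<kappa> = \<lparr>
     FObj = (\<lambda>E. \<lparr>Val = (\<lambda>n. {undefined}), Act = (\<lambda>m n \<phi> x. x)\<rparr>),
     FArr = (\<lambda>E F f. \<lambda>n. \<lambda>x\<in>{undefined}. x)\<rparr>"

text \<open>For a point \<open>x0\<close> of \<open>X\<close>, \<open>basepoint x0 E\<close> is the element \<open>x0|E\<close> of \<open>X(E)(0)\<close>.\<close>

definition basepoint :: "('k topology \<Rightarrow> nat \<Rightarrow> 'a \<Rightarrow> 'a) \<Rightarrow> 'k topology \<Rightarrow> 'a" where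
  "basepoint x0 E = x0 E 0 undefined"

text \<open>Condensed groups as contravariant functors on \<open>Extr \<kappa>\<close>; the basepoint is given by a family
  \<open>x E \<in> X(E)(0)\<close>.\<close>

type_synonym ('k, 'g) condensed_group = "('k topology, 'k \<Rightarrow> 'k, 'g monoid, 'g \<Rightarrow> 'g) cfunctor"

definition condensed_structure_group ::
  "('k, 'a) cubespace \<Rightarrow> nat \<Rightarrow> ('k topology \<Rightarrow> 'a) \<Rightarrow> ('k, 'a set) condensed_group" where
  "condensed_structure_group X n x = \<lparr>
     FObj = (\<lambda>E. structure_group (FObj X E) n (x E)),
     FArr = (\<lambda>E F f. \<lambda>S\<in>carrier (structure_group (FObj X E) n (x E)).
        cube_rel (FObj X F) n (x F) `` (FArr X E F f n ` S))\<rparr>"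

definition condensed_homotopy_group ::
  "('k, 'a) condensed_simplicial_set \<Rightarrow> nat \<Rightarrow> ('k topology \<Rightarrow> 'a) \<Rightarrow>
   ('k, 'a set) condensed_group" where
  "condensed_homotopy_group Y n y = \<lparr>
     FObj = (\<lambda>E. homotopy_group (FObj Y E) n (y E)),
     FArr = (\<lambda>E F f. \<lambda>S\<in>carrier (homotopy_group (FObj Y E) n (y E)).
        simplex_rel (FObj Y F) n (y F) `` (FArr Y E F f n ` S))\<rparr>"

definition condensed_group_isomorphic ::
  "'k rel \<Rightarrow> ('k, 'g) condensed_group \<Rightarrow> ('k, 'h) condensed_group \<Rightarrow> bool" where
  "condensed_group_isomorphic \<kappa> G H \<longleftrightarrow>
     (\<exists>\<psi>. (\<forall>E\<in>Obj (Extr \<kappa>). \<psi> E \<in> iso (FObj G E) (FObj H E)) \<and>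
        (\<forall>E\<in>Obj (Extr \<kappa>). \<forall>F\<in>Obj (Extr \<kappa>). \<forall>f\<in>Arr (op_cat (Extr \<kappa>)) E F.
          \<forall>g\<in>carrier (FObj G E). \<psi> F (FArr G E F f g) = FArr H E F f (\<psi> E g)))"

text \<open>The basepoint of \<open>F(X)\<close> induced by a point \<open>x0 : * \<rightarrow> X\<close>, for a functor \<open>F\<close> preserving limits:
  \<open>F(x0)\<close> applied to the unique \<open>0\<close>-simplex of \<open>F(*)\<close>.\<close>

definition image_basepoint ::
  "'k rel \<Rightarrow> ('k, 'a, 'b) realization \<Rightarrow>
   ('k, 'a) cubespace \<Rightarrow> ('k topology \<Rightarrow> nat \<Rightarrow> 'a \<Rightarrow> 'a) \<Rightarrow> 'k topology \<Rightarrow> 'b" where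
  "image_basepoint \<kappa> F X x0 E =
     FArr F (point_cubespace \<kappa>) X x0 E 0
       (the_elem (Val (FObj (FObj F (point_cubespace \<kappa>)) E) 0))"

end

theory Submission
  imports Defs
begin

text \<open>For a concrete fibrant cubeset \<open>X\<close>, an \<open>n\<close>-simplex of \<open>K\<^sup>* X\<close> is determined by the function \<open>g\<close> from
  \<open>Sub[n]\<close> to the points of \<open>X\<close> that it induces on vertices. Filling corners shows that such a \<open>g\<close> comes from
  a simplex as soon as it sends a few special cubes of labels to cubes of \<open>X\<close>: those in which no two adjacent
  labels vary. Only two of these conditions involve all
  of \<open>{0..n}\<close> and are not determined by proper faces, namely those where the even, respectively the odd,
  labels vary. Hence a horn extends: \<open>g\<close> is chosen at the full set by one corner filling and at the missing
  face by another. The same description identifies pointed \<open>n\<close>-simplices with pointed \<open>n\<close>-cubes through their top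
  vertex, and the relation and the product on both sides with the same filled squares.

  For limits, the condensed cubeset represented by an extremally disconnected space \<open>E\<close> and a cube
  \<open>{0,1}\<^sup>n\<close> shows that limits are computed on every \<open>X(E)(n)\<close>, and \<open>Hom(K\<^sub>n, -)\<close> preserves pointwise limits.\<close>

section \<open>Systems of cubes with corner filling\<close>

text \<open>If coordinate \<open>i\<close> matters for a degenerable cube, it influences only the
  labels \<open>i\<close> and \<open>i + 1\<close>, and on either side of it at least one of the two
  is present. So a varying label sits next to labels that are present, and what counts is on how
  many sides. With neighbours on one side it switches along an edge; with neighbours on both sides
  it switches under a conjunction of two coordinates, i.e. along a square with three equal corners.
  Gluing cubes makes both of these equivalence relations, so conditions can be traded: among the
  label sets \<open>Z\<close>, \<open>Z + s\<close>, \<open>Z + t\<close>, \<open>Z + s + t\<close>,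
  three sides of the square give the fourth. Trading \<open>s\<close> for \<open>t\<close> consumes
  conditions that avoid \<open>s\<close> or \<open>t\<close>. For a horn without the face opposite
  to \<open>k\<close>, these are known only if neither label is \<open>k\<close>. Hence
  \<open>k\<close> never moves, and two parity patterns remain, one in which \<open>k\<close> varies
  and one in which it is fixed. They correspond to the two unknown values of the horn, at {0..n} and
  at {0..n} - {k}.\<close>

text \<open>Vertices of a cube are functions \<open>nat \<Rightarrow> bool\<close>, of which only finitely many coordinates matter. A map
  of cubes that is the restriction of an affine linear map has coordinates that are constant, equal to
  some \<open>x\<^sub>j\<close> or equal to some \<open>1 - x\<^sub>j\<close>: these are the literals.\<close>

definition literals :: "((nat \<Rightarrow> bool) \<Rightarrow> bool) set" where
  "literals = {f. (\<exists>b. f = (\<lambda>_. b)) \<or> (\<exists>j b. f = (\<lambda>x. x j = b))}"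

lemma literals_const [simp]: "(\<lambda>_. b) \<in> literals"
  and literals_var [simp]: "(\<lambda>x. x j) \<in> literals"
  and literals_neg [simp]: "(\<lambda>x. \<not> x j) \<in> literals"
  and literals_eq [simp]: "(\<lambda>x. x j = b) \<in> literals"
proof -
  have "(\<lambda>x. x j) = (\<lambda>x. x j = True)" "(\<lambda>x. \<not> x j) = (\<lambda>x. x j = False)" by auto
  then show "(\<lambda>x. x j) \<in> literals" "(\<lambda>x. \<not> x j) \<in> literals"
    unfolding literals_def by blast+
qed (unfold literals_def, blast+)

text \<open>Pass from \<open>x\<close> to \<open>y\<close> through hybrids that agree with
  \<open>y\<close> below \<open>m\<close> and with \<open>x\<close> from \<open>m\<close> on. Each
  step changes a coordinate in \<open>D\<close>, where \<open>x\<close> and \<open>y\<close> agree,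
  or one outside \<open>D\<close>, which \<open>f\<close> does not notice.\<close>

lemma depends_only_on:
  fixes f :: "(nat \<Rightarrow> bool) \<Rightarrow> 'b"
  assumes upd: "\<And>i x b. i < k \<Longrightarrow> i \<notin> D \<Longrightarrow> f (x(i := b)) = f x"
    and fin: "\<And>x y. (\<And>i. i < k \<Longrightarrow> x i = y i) \<Longrightarrow> f x = f y"
    and eq: "\<And>i. i < k \<Longrightarrow> i \<in> D \<Longrightarrow> x i = y i"
  shows "f x = f y"
proof -
  have "m \<le> k \<Longrightarrow> f (\<lambda>i. if i < m then y i else x i) = f x" for m
  proof (induction m)
    case 0
    then show ?case by simp
  next
    case (Suc m)
    let ?h = "\<lambda>i. if i < m then y i else x i"
    have h: "(\<lambda>i. if i < Suc m then y i else x i) = ?h(m := y m)" by (auto simp: less_Suc_eq)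
    show ?case
    proof (cases "m \<in> D")
      case True
      then have "?h(m := y m) = ?h" using eq[of m] Suc.prems by (intro ext) simp
      then show ?thesis using h Suc by simp
    next
      case False
      then show ?thesis using h upd[of m ?h "y m"] Suc by simp
    qed
  qed
  from this[of k] show ?thesis using fin[of "\<lambda>i. if i < k then y i else x i" y] by simp
qed

text \<open>\<open>S p q r s\<close> is meant to say that the square with rows \<open>p, q\<close> and \<open>r, s\<close> is filled.\<close>

locale square_rel =
  fixes S :: "'v \<Rightarrow> 'v \<Rightarrow> 'v \<Rightarrow> 'v \<Rightarrow> bool"
  assumes glue: "S p q r s \<Longrightarrow> S r s t u \<Longrightarrow> S p q t u"
    and flip: "S p q r s \<Longrightarrow> S r s p q"
    and swap: "S p q r s \<Longrightarrow> S p r q s"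
    and deg: "S p q r s \<Longrightarrow> S p q p q"
begin

lemma flip': "S p q r s \<Longrightarrow> S q p s r"
  using flip swap by blast

lemma glue': "S p q r s \<Longrightarrow> S q t s u \<Longrightarrow> S p t r u"
  using glue swap by blast

lemma deg': "S p q r s \<Longrightarrow> S p p r r"
  using deg swap by blast

text \<open>Two strengths of being joined: \<open>E1\<close> is an edge, written as a square that is
  constant in one direction, while \<open>E2\<close> asks that one corner of the constant square
  \<open>p\<close> may be replaced by \<open>q\<close>.\<close>

definition E1 :: "'v \<Rightarrow> 'v \<Rightarrow> bool" where "E1 p q \<longleftrightarrow> S p p q q"
definition E2 :: "'v \<Rightarrow> 'v \<Rightarrow> bool" where "E2 p q \<longleftrightarrow> S p p p q"

lemma E1_sym: "E1 p q \<Longrightarrow> E1 q p"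
  unfolding E1_def by (rule flip)

lemma E1_trans: "E1 p q \<Longrightarrow> E1 q r \<Longrightarrow> E1 p r"
  unfolding E1_def by (rule glue)

lemma E2_E1: "E2 p q \<Longrightarrow> E1 p q"
  unfolding E1_def E2_def by (rule deg'[OF flip'])

lemma E2_sym:
  assumes "E2 p q" shows "E2 q p"
proof -
  have "S q q p p" using E2_E1[OF assms] unfolding E1_def by (rule flip)
  moreover have "S p p q p" using assms unfolding E2_def by (rule flip')
  ultimately show ?thesis unfolding E2_def by (rule glue)
qed

lemma E2_trans:
  assumes "E2 p q" "E2 q r" shows "E2 p r"
proof -
  have "S p p q r" using E2_E1[OF assms(1)] assms(2) unfolding E1_def E2_def by (rule glue)
  with assms(1) show ?thesis unfolding E2_def by (rule glue')
qed

text \<open>The flag \<open>w\<close> will record whether a label switches under two coordinates or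
  under one, so that the exchange argument treats both strengths in a single proof.\<close>

definition E :: "bool \<Rightarrow> 'v \<Rightarrow> 'v \<Rightarrow> bool" where
  "E w p q \<longleftrightarrow> (if w then E2 p q else E1 p q)"

lemma E_sym: "E w p q \<Longrightarrow> E w q p"
  unfolding E_def by (simp add: E1_sym E2_sym split: if_splits)

lemma E_trans: "E w p q \<Longrightarrow> E w q r \<Longrightarrow> E w p r"
  unfolding E_def by (auto intro: E1_trans E2_trans split: if_splits)

lemma E_mono: "E w p q \<Longrightarrow> (w' \<Longrightarrow> w) \<Longrightarrow> E w' p q"
  unfolding E_def by (auto intro: E2_E1 split: if_splits)

text \<open>Three stacked squares with rows (p, q), (p, p), (r, r), (r, s). So values related by
  \<open>E2\<close> may be placed at the corners of a square at will.\<close>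

lemma E2_arbitrary:
  assumes "E2 p q" "E2 p r" "E2 r s" shows "S p q r s"
proof -
  have "S p q p p" using assms(1) flip unfolding E2_def by blast
  moreover have "S p p r r" using E2_E1[OF assms(2)] unfolding E1_def .
  moreover have "S r r r s" using assms(3) unfolding E2_def .
  ultimately show ?thesis using glue by blast
qed

end

text \<open>Cubes are functions of infinite sequences that depend on finitely many entries. Thus a
  cube counts as a degenerate cube of every larger dimension, and coordinates are renamed without
  bookkeeping of dimensions. For the same reason \<open>corner\<close> speaks of an arbitrary finite
  set \<open>J\<close> of coordinates.\<close>

locale cube_system =
  fixes Q :: "((nat \<Rightarrow> bool) \<Rightarrow> 'p) set"
  assumes finitary: "c \<in> Q \<Longrightarrow> \<exists>m. \<forall>x y. (\<forall>i<m. x i = y i) \<longrightarrow> c x = c y"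
    and subst: "c \<in> Q \<Longrightarrow> (\<And>i. s i \<in> literals) \<Longrightarrow> (\<lambda>x. c (\<lambda>i. s i x)) \<in> Q"
    and corner: "finite J \<Longrightarrow> J \<noteq> {} \<Longrightarrow> (\<And>x y. (\<And>i. i \<in> J \<Longrightarrow> x i = y i) \<Longrightarrow> c x = c y)
      \<Longrightarrow> (\<And>j. j \<in> J \<Longrightarrow> (\<lambda>x. c (x(j := False))) \<in> Q)
      \<Longrightarrow> \<exists>p. (\<lambda>x. if \<forall>j\<in>J. x j then p else c x) \<in> Q"
begin

lemma subst_eq:
  assumes "c \<in> Q" "\<And>i. (\<lambda>x. y x i) \<in> literals" "\<And>x. d x = c (y x)"
  shows "d \<in> Q"
  using subst[of c "\<lambda>i x. y x i"] assms by presburger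

lemma const_in_Q: "c \<in> Q \<Longrightarrow> (\<lambda>_. c x) \<in> Q"
  using subst[of c "\<lambda>i _. x i"] by simp

text \<open>A down-closed family \<open>U\<close> is a union of faces through the zero vertex. For a
  minimal missing face \<open>A\<close> all proper subsets lie in \<open>U\<close>, so the known
  part is a corner and can be filled; the induction counts the missing faces.\<close>

lemma simplicial_extension:
  fixes f :: "nat set \<Rightarrow> 'p"
  assumes "finite J" "{} \<in> U" "U \<subseteq> Pow J" "\<And>A B. A \<in> U \<Longrightarrow> B \<subseteq> A \<Longrightarrow> B \<in> U"
    and "\<And>A. A \<in> U \<Longrightarrow> (\<lambda>x. f {i\<in>A. x i}) \<in> Q"
  shows "\<exists>f'. (\<lambda>x. f' {i\<in>J. x i}) \<in> Q \<and> (\<forall>A\<in>U. f' A = f A)"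
  using assms(2-)
proof (induction "card (Pow J - U)" arbitrary: U f rule: less_induct)
  case less
  show ?case
  proof (cases "U = Pow J")
    case True
    then have "(\<lambda>x. f {i\<in>J. x i}) \<in> Q" by (intro less.prems(4)) simp
    then show ?thesis by (intro exI[of _ f]) simp
  next
    case False
    have fJ: "finite (Pow J)" using \<open>finite J\<close> by simp
    have "Pow J - U \<noteq> {}" using False less.prems by blast
    then obtain A where A: "A \<in> Pow J - U" and min: "\<forall>B\<in>Pow J - U. B \<subseteq> A \<longrightarrow> A = B"
      using finite_has_minimal[of "Pow J - U"] finite_Diff[OF fJ] by metis
    have sub: "B \<in> U" if "B \<subset> A" for B
      using min that A by blast
    have A0: "A \<noteq> {}" using A less.prems by blast
    have fA: "finite A" using A \<open>finite J\<close> finite_subset by blast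
    let ?c = "\<lambda>x::nat\<Rightarrow>bool. f {i\<in>A. x i}"
    have "\<exists>p. (\<lambda>x. if \<forall>j\<in>A. x j then p else ?c x) \<in> Q"
    proof (rule corner[OF fA A0])
      fix x y :: "nat \<Rightarrow> bool" assume "\<And>i. i \<in> A \<Longrightarrow> x i = y i"
      then have "{i\<in>A. x i} = {i\<in>A. y i}" by blast
      then show "?c x = ?c y" by simp
    next
      fix j assume "j \<in> A"
      then have "A - {j} \<in> U" using sub by blast
      then have "(\<lambda>x. f {i \<in> A - {j}. x i}) \<in> Q" by (rule less.prems(4))
      moreover have "{i \<in> A - {j}. x i} = {i \<in> A. (x(j := False)) i}" for x by auto
      ultimately show "(\<lambda>x. ?c (x(j := False))) \<in> Q" by simp
    qed
    then obtain p where p: "(\<lambda>x. if \<forall>j\<in>A. x j then p else ?c x) \<in> Q" by blast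
    let ?f = "f(A := p)"
    have "(\<lambda>x. ?f {i\<in>B. x i}) \<in> Q" if "B \<in> insert A U" for B
    proof (cases "B = A")
      case True
      have "(\<lambda>x. ?f {i\<in>A. x i}) = (\<lambda>x. if \<forall>j\<in>A. x j then p else ?c x)"
        by (rule ext) auto
      then show ?thesis using p True by simp
    next
      case False
      then have "B \<in> U" using that by blast
      then have "{i\<in>B. x i} \<noteq> A" for x using less.prems(3)[of B "{i\<in>B. x i}"] A by auto
      then show ?thesis using less.prems(4)[OF \<open>B \<in> U\<close>] by simp
    qed
    moreover have "card (Pow J - insert A U) < card (Pow J - U)"
      using A fJ by (intro psubset_card_mono) auto
    moreover have "B \<in> insert A U" if "C \<in> insert A U" "B \<subseteq> C" for B C
      using that sub less.prems(3) by (cases "B = A") auto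
    ultimately obtain f' where "(\<lambda>x. f' {i\<in>J. x i}) \<in> Q" "\<forall>B\<in>insert A U. f' B = ?f B"
      using less.hyps[of "insert A U" ?f] less.prems A by auto
    then show ?thesis using A by (intro exI[of _ f']) auto
  qed
qed

definition indep :: "((nat \<Rightarrow> bool) \<Rightarrow> 'q) \<Rightarrow> nat \<Rightarrow> bool" where
  "indep c a \<longleftrightarrow> (\<forall>x b. c (x(a := b)) = c x)"

text \<open>Composition from corner filling: the two cubes are laid along two directions that start
  at their common face, the rest is filled in, and the composite is read off on the
  antidiagonal.\<close>

lemma glue:
  assumes q1: "(\<lambda>x. if x a then c1 x else c0 x) \<in> Q" and q2: "(\<lambda>x. if x a then c2 x else c1 x) \<in> Q"
    and ind: "indep c0 a" "indep c1 a" "indep c2 a"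
  shows "(\<lambda>x. if x a then c2 x else c0 x) \<in> Q"
proof -
  obtain m1 where m1: "\<And>x y. (\<And>i. i < m1 \<Longrightarrow> x i = y i) \<Longrightarrow>
      (if x a then c1 x else c0 x) = (if y a then c1 y else c0 y)"
    using finitary[OF q1] by auto
  obtain m2 where m2: "\<And>x y. (\<And>i. i < m2 \<Longrightarrow> x i = y i) \<Longrightarrow>
      (if x a then c2 x else c1 x) = (if y a then c2 y else c1 y)"
    using finitary[OF q2] by auto
  \<comment> \<open>A coordinate on which neither cube depends; it serves as the second
    direction.\<close>
  define m where "m = Suc (m1 + m2 + a)"
  have upd: "c0 (x(a := b)) = c0 x" "c1 (x(a := b)) = c1 x" "c2 (x(a := b)) = c2 x" for x b
    using ind unfolding indep_def by auto
  have dep0: "c0 x = c0 y" if "\<And>i. i < m \<Longrightarrow> i \<noteq> a \<Longrightarrow> x i = y i" for x y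
    using m1[of "x(a := False)" "y(a := False)"] that by (auto simp: m_def upd)
  have dep1: "c1 x = c1 y" if "\<And>i. i < m \<Longrightarrow> i \<noteq> a \<Longrightarrow> x i = y i" for x y
    using m1[of "x(a := True)" "y(a := True)"] that by (auto simp: m_def upd)
  have dep2: "c2 x = c2 y" if "\<And>i. i < m \<Longrightarrow> i \<noteq> a \<Longrightarrow> x i = y i" for x y
    using m2[of "x(a := True)" "y(a := True)"] that by (auto simp: m_def upd)
  have am: "a < m" by (simp add: m_def)
  \<comment> \<open>The common face \<open>c1\<close> is at the origin, direction \<open>a\<close>
    leads back to \<open>c0\<close> and direction \<open>m\<close> on to \<open>c2\<close>. Only
    faces without both directions are prescribed.\<close>
  define f where "f B = (let x = (\<lambda>i. i \<in> B) in
    if a \<in> B then c0 x else if m \<in> B then c2 x else c1 x)" for B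
  define U where "U = {B. B \<subseteq> {..m} \<and> \<not> (a \<in> B \<and> m \<in> B)}"
  have "\<exists>f'. (\<lambda>x. f' {i\<in>{..m}. x i}) \<in> Q \<and> (\<forall>A\<in>U. f' A = f A)"
  proof (rule simplicial_extension)
    fix A assume A: "A \<in> U"
    show "(\<lambda>x. f {i\<in>A. x i}) \<in> Q"
    proof (cases "m \<in> A")
      case True
      then have aA: "a \<notin> A" using A by (auto simp: U_def)
      let ?y = "\<lambda>x i. if i = a then x m else i \<in> A \<and> x i"
      show ?thesis
      proof (rule subst_eq[OF q2, where y = ?y])
        fix x
        have "c1 (\<lambda>i. i \<in> A \<and> x i) = c1 (?y x)"
          by (rule dep1) auto
        moreover have "c2 (\<lambda>i. i \<in> A \<and> x i) = c2 (?y x)"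
          by (rule dep2) auto
        ultimately
        show "f {i \<in> A. x i} = (if ?y x a then c2 (?y x) else c1 (?y x))"
          using aA True by (simp add: f_def Let_def)
      next
        show "(\<lambda>x. ?y x i) \<in> literals" for i by (cases "i = a"; cases "i \<in> A") auto
      qed
    next
      case False
      let ?y = "\<lambda>x i. if i = a then (a \<in> A \<longrightarrow> \<not> x a) else i \<in> A \<and> x i"
      show ?thesis
      proof (rule subst_eq[OF q1, where y = ?y])
        fix x
        have "c1 (\<lambda>i. i \<in> A \<and> x i) = c1 (?y x)"
          by (rule dep1) auto
        moreover have "c0 (\<lambda>i. i \<in> A \<and> x i) = c0 (?y x)"
          by (rule dep0) auto
        ultimately
        show "f {i \<in> A. x i} = (if ?y x a then c1 (?y x) else c0 (?y x))"
          using False by (simp add: f_def Let_def)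
      next
        show "(\<lambda>x. ?y x i) \<in> literals" for i by (cases "i = a"; cases "i \<in> A") auto
      qed
    qed
  qed (auto simp: U_def)
  then obtain f' where f': "(\<lambda>x. f' {i\<in>{..m}. x i}) \<in> Q" "\<And>A. A \<in> U \<Longrightarrow> f' A = f A" by blast
  \<comment> \<open>The antidiagonal: \<open>a\<close> on and \<open>m\<close> off gives
    \<open>c0\<close>, \<open>a\<close> off and \<open>m\<close> on gives \<open>c2\<close>.\<close>
  let ?y = "\<lambda>x i. if i = a then \<not> x a else if i = m then x a else x i"
  show ?thesis
  proof (rule subst_eq[OF f'(1), where y = ?y])
    fix x
    let ?B = "{i \<in> {..m}. ?y x i}"
    have "?B \<in> U" using am by (auto simp: U_def)
    then have "f' ?B = f ?B" by (rule f'(2))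
    also have "\<dots> = (if x a then c2 x else c0 x)"
    proof -
      have "c2 (\<lambda>i. i \<in> ?B) = c2 x" by (rule dep2) auto
      moreover have "c0 (\<lambda>i. i \<in> ?B) = c0 x" by (rule dep0) auto
      ultimately show ?thesis using am unfolding f_def Let_def by simp
    qed
    finally show "(if x a then c2 x else c0 x) = f' ?B" by simp
  next
    show "(\<lambda>x. ?y x i) \<in> literals" for i by (cases "i = a"; cases "i = m") auto
  qed
qed

text \<open>A square in the directions \<open>a\<close> and \<open>b\<close> whose corners are
  themselves cubes \<open>c v\<close> in the remaining coordinates.\<close>

definition sq :: "('v \<Rightarrow> (nat \<Rightarrow> bool) \<Rightarrow> 'p) \<Rightarrow> nat \<Rightarrow> nat \<Rightarrow> 'v \<Rightarrow> 'v \<Rightarrow> 'v \<Rightarrow> 'v \<Rightarrow> bool" where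
  "sq c a b p q r s \<longleftrightarrow>
     (\<lambda>x. c (if x a then (if x b then s else r) else (if x b then q else p)) x) \<in> Q"

lemma square_rel_sq:
  assumes ab: "a \<noteq> b" and ind: "\<And>v. indep (c v) a" "\<And>v. indep (c v) b"
  shows "square_rel (sq c a b)"
proof
  have upd: "c v (x(a := e)) = c v x" "c v (x(b := e)) = c v x" for v x e
    using ind unfolding indep_def by auto
  fix p q r s t u
  show "sq c a b p q t u" if "sq c a b p q r s" "sq c a b r s t u"
  proof -
    have split: "(\<lambda>x. c (if x a then if x b then s else r else if x b then q else p) x) =
      (\<lambda>x. if x a then c (if x b then s else r) x else c (if x b then q else p) x)" for p q r s
      by (rule ext) simp
    have i: "indep (\<lambda>x. c (if x b then s else r) x) a" for r s
      using ab by (simp add: indep_def upd)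
    show ?thesis using that unfolding sq_def split
      by (rule glue) (rule i)+
  qed
  assume S: "sq c a b p q r s"
  \<comment> \<open>Reversing \<open>a\<close>, setting it to 0, and interchanging \<open>a\<close>
    with \<open>b\<close> are maps of cubes; they yield \<open>flip\<close>, \<open>deg\<close> and
    \<open>swap\<close>.\<close>
  have lit: "(\<lambda>x. (x(a := \<not> x a)) i) \<in> literals" "(\<lambda>x. (x(a := False)) i) \<in> literals"
    "(\<lambda>x. (x(a := x b, b := x a)) i) \<in> literals" for i
    by (cases "i = a"; cases "i = b"; simp)+
  show "sq c a b r s p q" unfolding sq_def
    by (rule subst_eq[where y = "\<lambda>x. x(a := \<not> x a)", OF S[unfolded sq_def]]) (simp add: lit del: fun_upd_apply, use ab in \<open>simp add: upd\<close>)
  show "sq c a b p r q s" unfolding sq_def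
    by (rule subst_eq[where y = "\<lambda>x. x(a := x b, b := x a)", OF S[unfolded sq_def]]) (simp add: lit del: fun_upd_apply, use ab in \<open>simp add: upd\<close>)
  show "sq c a b p q p q" unfolding sq_def
    by (rule subst_eq[where y = "\<lambda>x. x(a := False)", OF S[unfolded sq_def]]) (simp add: lit del: fun_upd_apply, use ab in \<open>simp add: upd\<close>)
qed

end

text \<open>\<open>cfg Z T\<close> is a cube of labels in which the labels of \<open>Z\<close> are always present and each \<open>t \<in> T\<close> is present
  under a conjunction of (at most) two coordinates of its own, one for each side on which \<open>t\<close> has a
  neighbour in \<open>Z\<close>; \<open>sep\<close> says that no two labels of \<open>T\<close> are adjacent. These cubes suffice to test whether
  \<open>g\<close> defines a simplex of \<open>K\<^sup>* X\<close>.\<close>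

definition pres :: "nat set \<Rightarrow> nat \<Rightarrow> (nat \<Rightarrow> bool) \<Rightarrow> bool" where
  "pres Z t x \<longleftrightarrow> ((\<exists>z\<in>Z. z < t) \<longrightarrow> x (2 * t)) \<and> ((\<exists>z\<in>Z. t < z) \<longrightarrow> x (Suc (2 * t)))"

definition cfg :: "nat set \<Rightarrow> nat set \<Rightarrow> (nat \<Rightarrow> bool) \<Rightarrow> nat set" where
  "cfg Z T x = Z \<union> {t \<in> T. pres Z t x}"

definition sep :: "nat set \<Rightarrow> nat set \<Rightarrow> bool" where
  "sep Z T \<longleftrightarrow> finite (Z \<union> T) \<and> Z \<noteq> {} \<and> Z \<inter> T = {} \<and>
     (\<forall>t\<in>T. \<forall>t'\<in>T. t < t' \<longrightarrow> (\<exists>z\<in>Z. t < z \<and> z < t'))"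

definition both :: "nat set \<Rightarrow> nat \<Rightarrow> bool" where
  "both Z t \<longleftrightarrow> (\<exists>z\<in>Z. z < t) \<and> (\<exists>z\<in>Z. t < z)"

lemma sepD:
  assumes "sep Z T"
  shows "finite Z" "finite T" "Z \<noteq> {}" "t \<in> T \<Longrightarrow> t \<notin> Z"
    "t \<in> T \<Longrightarrow> t' \<in> T \<Longrightarrow> t < t' \<Longrightarrow> \<exists>z\<in>Z. t < z \<and> z < t'"
  using assms unfolding sep_def by auto

lemma sep_subset: "sep Z T \<Longrightarrow> T' \<subseteq> T \<Longrightarrow> sep Z T'"
  unfolding sep_def by (auto intro: finite_subset dest: subsetD) (meson subsetD)

lemma sep_move:
  assumes "sep Z (insert t T)"
  shows "sep (insert t Z) (T - {t})"
  using assms unfolding sep_def by (auto; blast)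

text \<open>An element of \<open>Z\<close> lies between \<open>t\<close> and \<open>t'\<close>, so
  on either side of \<open>t'\<close> the label \<open>t\<close> adds no neighbour that was not
  already matched by one in \<open>Z\<close>.\<close>

lemma exists_side:
  assumes "sep Z (insert t T)" "t \<notin> T" "t' \<in> T"
  shows "(\<exists>z\<in>insert t Z. z < t') \<longleftrightarrow> (\<exists>z\<in>Z. z < t')"
    and "(\<exists>z\<in>insert t Z. t' < z) \<longleftrightarrow> (\<exists>z\<in>Z. t' < z)"
  using sepD(5)[OF assms(1), of t t'] sepD(5)[OF assms(1), of t' t] assms(2,3) by auto

lemma pres_insert:
  assumes "sep Z (insert t T)" "t \<notin> T" "t' \<in> T"
  shows "pres (insert t Z) t' = pres Z t'"
  unfolding pres_def exists_side[OF assms] by (rule refl)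

section \<open>Conditions given by test cubes, and how they are exchanged\<close>

context cube_system begin

definition cond :: "(nat set \<Rightarrow> 'p) \<Rightarrow> nat set \<Rightarrow> nat set \<Rightarrow> bool" where
  "cond g Z T \<longleftrightarrow> (\<lambda>x. g (cfg Z T x)) \<in> Q"

definition good :: "(nat set \<Rightarrow> 'p) \<Rightarrow> nat set \<Rightarrow> bool" where
  "good g S \<longleftrightarrow> (\<forall>Z T. sep Z T \<longrightarrow> Z \<union> T \<subseteq> S \<longrightarrow> cond g Z T)"

text \<open>Set both coordinates of \<open>t\<close> to 0. Since \<open>Z\<close> has an element,
  which differs from \<open>t\<close>, at least one of the two occurs in the presence condition, so
  \<open>t\<close> is absent on that face.\<close>

lemma cond_absent:
  assumes "cond g Z (insert t T)" "Z \<noteq> {}" "t \<notin> Z" "t \<notin> T"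
  shows "cond g Z T"
  unfolding cond_def
proof (rule subst_eq[where y = "\<lambda>x. x(2 * t := False, Suc (2 * t) := False)", OF assms(1)[unfolded cond_def]])
  show "(\<lambda>x. (x(2 * t := False, Suc (2 * t) := False)) i) \<in> literals" for i
    by (cases "i = 2 * t"; cases "i = Suc (2 * t)"; simp)
  fix x :: "nat \<Rightarrow> bool"
  let ?y = "x(2 * t := False, Suc (2 * t) := False)"
  obtain z where "z \<in> Z" "z < t \<or> t < z" using assms(2,3) by (metis all_not_in_conv linorder_neqE_nat)
  then have "\<not> pres Z t ?y" by (auto simp: pres_def)
  moreover have "pres Z t' ?y = pres Z t' x" if "t' \<in> T" for t'
    using that assms(4) by (auto simp: pres_def)
  ultimately have "cfg Z (insert t T) ?y = cfg Z T x" by (auto simp: cfg_def)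
  then show "g (cfg Z T x) = g (cfg Z (insert t T) ?y)" by simp
qed

lemma cond_present:
  assumes "cond g Z (insert t T)" "sep Z (insert t T)" "t \<notin> T"
  shows "cond g (insert t Z) T"
  unfolding cond_def
proof (rule subst_eq[where y = "\<lambda>x. x(2 * t := True, Suc (2 * t) := True)", OF assms(1)[unfolded cond_def]])
  show "(\<lambda>x. (x(2 * t := True, Suc (2 * t) := True)) i) \<in> literals" for i
    by (cases "i = 2 * t"; cases "i = Suc (2 * t)"; simp)
  fix x :: "nat \<Rightarrow> bool"
  let ?y = "x(2 * t := True, Suc (2 * t) := True)"
  have "pres Z t ?y" by (auto simp: pres_def)
  moreover have "pres Z t' ?y = pres (insert t Z) t' x" if "t' \<in> T" for t'
    unfolding pres_insert[OF assms(2,3) that] using that assms(3) by (auto simp: pres_def)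
  ultimately have "cfg Z (insert t T) ?y = cfg (insert t Z) T x" by (auto simp: cfg_def)
  then show "g (cfg (insert t Z) T x) = g (cfg Z (insert t T) ?y)" by simp
qed

text \<open>The label set \<open>v\<close> takes the place of the fixed labels while those of
  \<open>T\<close> keep varying. Such a cube is one corner of a square whose passive directions are
  the coordinates of \<open>T\<close>.\<close>

definition slot :: "(nat set \<Rightarrow> 'p) \<Rightarrow> nat set \<Rightarrow> nat set \<Rightarrow> nat set \<Rightarrow> (nat \<Rightarrow> bool) \<Rightarrow> 'p" where
  "slot g Z T v x = g (v \<union> {t \<in> T. pres Z t x})"

lemma indep_slot:
  assumes "\<forall>t\<in>T. a \<noteq> 2 * t \<and> a \<noteq> Suc (2 * t)"
  shows "indep (slot g Z T v) a"
proof -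
  have "pres Z t (x(a := b)) = pres Z t x" if "t \<in> T" for t x b
    using that assms by (auto simp: pres_def)
  then show ?thesis unfolding indep_def slot_def by (metis (mono_tags, lifting) Collect_cong)
qed

lemma E_sq_iff:
  assumes "a \<noteq> b" "\<And>v. indep (c v) a" "\<And>v. indep (c v) b"
  shows "square_rel.E (sq c a b) w p q \<longleftrightarrow> (\<lambda>x. c (if x a \<and> (w \<longrightarrow> x b) then q else p) x) \<in> Q"
proof -
  interpret square_rel "sq c a b" by (rule square_rel_sq[OF assms])
  have "(\<lambda>x. c (if x a \<and> (w \<longrightarrow> x b) then q else p) x) =
    (\<lambda>x. c (if x a then if x b then q else (if w then p else q) else if x b then p else p) x)" by auto
  then show ?thesis unfolding E_def E1_def E2_def sq_def by simp
qed

text \<open>Isolates one varying label: the condition says that \<open>Z\<close> and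
  \<open>Z + t\<close> are joined, in the strong form exactly if \<open>t\<close> has neighbours on
  both sides. The directions \<open>a\<close>, \<open>b\<close> are free and presence is computed
  from \<open>Z0\<close>, so that conditions with different \<open>Z\<close> become statements about
  one and the same square relation.\<close>

lemma cond_iff_edge:
  assumes Z: "Z \<noteq> {}" and t: "t \<notin> Z" "t \<notin> T"
    and P: "\<And>t'. t' \<in> T \<Longrightarrow> pres Z t' = pres Z0 t'"
    and ab: "a \<noteq> b" "\<forall>t\<in>T. a \<noteq> 2 * t \<and> a \<noteq> Suc (2 * t)" "\<forall>t\<in>T. b \<noteq> 2 * t \<and> b \<noteq> Suc (2 * t)"
  shows "cond g Z (insert t T) \<longleftrightarrow> square_rel.E (sq (slot g Z0 T) a b) (both Z t) Z (insert t Z)"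
proof -
  interpret square_rel "sq (slot g Z0 T) a b"
    using ab by (intro square_rel_sq indep_slot) auto
  have slot: "slot g Z0 T v = slot g Z T v" for v
    unfolding slot_def using P by (intro ext arg_cong[of _ _ g]) auto
  have E: "E (both Z t) Z (insert t Z) \<longleftrightarrow>
      (\<lambda>x. slot g Z T (if x a \<and> (both Z t \<longrightarrow> x b) then insert t Z else Z) x) \<in> Q"
    unfolding slot[symmetric] by (rule E_sq_iff) (use ab indep_slot in auto)
  have side: "(\<exists>z\<in>Z. z < t) \<or> (\<exists>z\<in>Z. t < z)" using Z t by (metis all_not_in_conv linorder_neqE_nat)
  have pt: "pres Z t (x(2*t := e, Suc (2*t) := f)) \<longleftrightarrow>
      ((\<exists>z\<in>Z. z < t) \<longrightarrow> e) \<and> ((\<exists>z\<in>Z. t < z) \<longrightarrow> f)" for x e f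
    by (auto simp: pres_def)
  have pT: "pres Z t' (x(2*t := e, Suc (2*t) := f)) = pres Z t' x" if "t' \<in> T" for t' x e f
    using that t by (auto simp: pres_def)
  have pab: "pres Z t' (x(a := e, b := f)) = pres Z t' x" if "t' \<in> T" for t' x e f
    using that ab by (auto simp: pres_def)
  have lit1: "(\<lambda>x. (x(2*t := x a, Suc (2*t) := x b)) i) \<in> literals" for i a b
    by (cases "i = 2 * t"; cases "i = Suc (2 * t)"; simp)
  have lit2: "(\<lambda>x. (x(a := x c, b := x d)) i) \<in> literals" for i c d
    by (cases "i = a"; cases "i = b"; simp)
  show ?thesis
  proof
    assume c: "cond g Z (insert t T)"
    define e where "e = (if \<exists>z\<in>Z. z < t then a else b)"
    \<comment> \<open>If \<open>t\<close> has neighbours on one side only, just one of its two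
      coordinates counts, and both may be fed from \<open>a\<close>.\<close>
    define f where "f = (if both Z t then b else a)"
    let ?y = "\<lambda>x. x(2*t := x a, Suc (2*t) := x f)"
    have *: "pres Z t (?y x) \<longleftrightarrow> x a \<and> (both Z t \<longrightarrow> x b)" for x
      unfolding pt f_def using side by (auto simp: both_def)
    have "slot g Z T (if x a \<and> (both Z t \<longrightarrow> x b) then insert t Z else Z) x = g (cfg Z (insert t T) (?y x))" for x
      unfolding *[symmetric] slot_def cfg_def using pT[of _ x "x a" "x f"]
      by (intro arg_cong[of _ _ g]) auto
    then show "E (both Z t) Z (insert t Z)" unfolding E
      by (rule subst_eq[OF c[unfolded cond_def] lit1])
  next
    assume c: "E (both Z t) Z (insert t Z)"
    \<comment> \<open>A coordinate that the presence of \<open>t\<close> certainly involves.\<close>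
    define d where "d = (if \<exists>z\<in>Z. z < t then 2 * t else Suc (2*t))"
    let ?y = "\<lambda>x. x(a := x d, b := x (Suc (2*t)))"
    have *: "pres Z t x \<longleftrightarrow> ?y x a \<and> (both Z t \<longrightarrow> ?y x b)" for x
      unfolding pres_def d_def using side ab(1) by (auto simp: both_def)
    have "g (cfg Z (insert t T) x) =
        slot g Z T (if ?y x a \<and> (both Z t \<longrightarrow> ?y x b) then insert t Z else Z) (?y x)" for x
      unfolding *[symmetric] slot_def cfg_def using pab[of _ x "x d" "x (Suc (2*t))"]
      by (intro arg_cong[of _ _ g]) auto
    then show "cond g Z (insert t T)" unfolding cond_def
      by (rule subst_eq[OF c[unfolded E] lit2])
  qed
qed

text \<open>The label sets \<open>Z\<close>, \<open>Z + s\<close>, \<open>Z + t\<close>,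
  \<open>Z + s + t\<close> form a square of edges, and symmetry and transitivity of \<open>E\<close>
  turn three sides into the fourth. The hypotheses on \<open>both\<close> make the three given sides
  at least as strong as the wanted one.\<close>

lemma exchange:
  assumes s: "sep Z (insert s T)" "s \<notin> T" and t: "sep Z (insert t T)" "t \<notin> T" and "s \<noteq> t"
  shows exchange_up: "cond g Z (insert t T) \<Longrightarrow> cond g Z (insert s T) \<Longrightarrow>
      cond g (insert t Z) (insert s T) \<Longrightarrow>
      (both (insert s Z) t \<Longrightarrow> both Z t \<and> both Z s \<and> both (insert t Z) s) \<Longrightarrow>
      cond g (insert s Z) (insert t T)"
    and exchange_down: "cond g (insert s Z) (insert t T) \<Longrightarrow> cond g Z (insert s T) \<Longrightarrow>
      cond g (insert t Z) (insert s T) \<Longrightarrow>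
      (both Z t \<Longrightarrow> both Z s \<and> both (insert t Z) s) \<Longrightarrow>
      cond g Z (insert t T)"
proof -
  let ?a = "2 * t" and ?b = "Suc (2 * t)"
  have ab: "?a \<noteq> ?b" "\<forall>u\<in>T. ?a \<noteq> 2 * u \<and> ?a \<noteq> Suc (2 * u)" "\<forall>u\<in>T. ?b \<noteq> 2 * u \<and> ?b \<noteq> Suc (2 * u)"
    using t(2) by auto presburger+
  interpret square_rel "sq (slot g Z T) ?a ?b"
    using ab by (intro square_rel_sq indep_slot) auto
  have Z: "Z \<noteq> {}" "s \<notin> Z" "t \<notin> Z" using sepD[OF s(1)] sepD[OF t(1)] by auto
  note iff = cond_iff_edge[where a = "?a" and b = "?b" and T = T and g = g, OF _ _ _ _ ab]
  have e1: "cond g Z (insert t T) \<longleftrightarrow> E (both Z t) Z (insert t Z)"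
    by (rule iff) (use Z t in auto)
  have e2: "cond g Z (insert s T) \<longleftrightarrow> E (both Z s) Z (insert s Z)"
    by (rule iff) (use Z s in auto)
  have e3: "cond g (insert s Z) (insert t T) \<longleftrightarrow> E (both (insert s Z) t) (insert s Z) (insert t (insert s Z))"
    by (rule iff) (use Z t s pres_insert[OF s] \<open>s \<noteq> t\<close> in auto)
  have e4: "cond g (insert t Z) (insert s T) \<longleftrightarrow> E (both (insert t Z) s) (insert t Z) (insert t (insert s Z))"
    unfolding insert_commute[of t s] by (rule iff) (use Z t s pres_insert[OF t] \<open>s \<noteq> t\<close> in auto)
  show "cond g (insert s Z) (insert t T)"
    if "cond g Z (insert t T)" "cond g Z (insert s T)" "cond g (insert t Z) (insert s T)"
      "both (insert s Z) t \<Longrightarrow> both Z t \<and> both Z s \<and> both (insert t Z) s"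
  proof -
    let ?w = "both (insert s Z) t"
    have "E ?w Z (insert t Z)" "E ?w Z (insert s Z)" "E ?w (insert t Z) (insert t (insert s Z))"
      using that e1 e2 e4 E_mono by blast+
    then show ?thesis unfolding e3 using E_sym E_trans by blast
  qed
  show "cond g Z (insert t T)"
    if "cond g (insert s Z) (insert t T)" "cond g Z (insert s T)" "cond g (insert t Z) (insert s T)"
      "both Z t \<Longrightarrow> both Z s \<and> both (insert t Z) s"
  proof -
    let ?w = "both Z t"
    have "?w \<Longrightarrow> both (insert s Z) t" by (auto simp: both_def)
    then have "E ?w Z (insert s Z)" "E ?w (insert t Z) (insert t (insert s Z))"
       "E ?w (insert s Z) (insert t (insert s Z))"
      using that e2 e3 e4 E_mono by blast+
    then show ?thesis unfolding e1 using E_sym E_trans by blast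
  qed
qed

end

text \<open>The varying \<open>t\<close> and the fixed \<open>s\<close> between \<open>t\<close> and
  \<open>u\<close> trade roles. As no other varying label lies between \<open>t\<close> and
  \<open>u\<close>, the label \<open>u\<close> separates both of them from everything beyond it; on
  the far side of \<open>t\<close> the old separators still work.\<close>

lemma sep_exchange:
  assumes sep: "sep Z T" and t: "t \<in> T" and s: "s \<in> Z" and u: "u \<in> Z"
    and bt: "t < s \<and> s < u \<or> u < s \<and> s < t"
    and none: "\<And>t'. t' \<in> T \<Longrightarrow> t' \<noteq> t \<Longrightarrow> \<not> (min t u \<le> t' \<and> t' \<le> max t u)"
  shows "sep (Z - {s}) (insert s (T - {t}))" "sep (Z - {s}) (insert t (T - {t}))"
    "sep (insert t (Z - {s})) (insert s (T - {t}))"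
proof -
  let ?Z = "Z - {s}" and ?T = "T - {t}"
  have uZ: "u \<in> ?Z" using u bt by auto
  have tn: "t \<notin> Z" "s \<notin> T" "s \<noteq> t" using sepD(4)[OF sep] t s by auto
  have fin: "finite Z" "finite T" using sepD[OF sep] by auto
  have btw: "\<exists>z\<in>?Z. min t t' < z \<and> z < max t t' \<and> min s t' < z \<and> z < max s t'" if t': "t' \<in> ?T" for t'
  proof -
    have t'T: "t' \<in> T" "t' \<noteq> t" using t' by auto
    have out: "\<not> (min t u \<le> t' \<and> t' \<le> max t u)" using none t'T by blast
    consider "min t t' < u" "u < max t t'" "min s t' < u" "u < max s t'" | "t < s" "t' < t" | "s < t" "t < t'"
      using out bt t'T by (auto simp: min_def max_def split: if_splits)
    then show ?thesis
    proof cases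
      case 1 then show ?thesis using uZ by blast
    next
      case 2
      then obtain z where "z \<in> Z" "t' < z" "z < t" using sepD(5)[OF sep t'T(1) t] by blast
      then show ?thesis using 2 by (intro bexI[of _ z]) auto
    next
      case 3
      then obtain z where "z \<in> Z" "t < z" "z < t'" using sepD(5)[OF sep t t'T(1)] by blast
      then show ?thesis using 3 by (intro bexI[of _ z]) auto
    qed
  qed
  have pair: "\<exists>z\<in>?Z. t1 < z \<and> z < t2" if "t1 \<in> ?T" "t2 \<in> ?T" "t1 < t2" for t1 t2
  proof -
    obtain z where z: "z \<in> Z" "t1 < z" "z < t2" using sepD(5)[OF sep, of t1 t2] \<open>t1 \<in> ?T\<close> \<open>t2 \<in> ?T\<close> \<open>t1 < t2\<close> by blast
    show ?thesis
    proof (cases "z = s")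
      case False then show ?thesis using z by blast
    next
      case True
      have "\<not> (min t u \<le> t1 \<and> t1 \<le> max t u)" "\<not> (min t u \<le> t2 \<and> t2 \<le> max t u)"
        using none that by blast+
      then have "u < t2" "t1 < u"
        using z True bt by (auto simp: min_def max_def split: if_splits)
      then show ?thesis using uZ by blast
    qed
  qed
  have sepv: "sep ?Z (insert v ?T)" if v: "v = s \<or> v = t" for v
    unfolding sep_def
  proof (intro conjI ballI impI)
    show "finite (?Z \<union> insert v ?T)" "?Z \<noteq> {}" using fin uZ by auto
    show "?Z \<inter> insert v ?T = {}" using v tn sepD(4)[OF sep] by auto
    fix t1 t2 assume "t1 \<in> insert v ?T" "t2 \<in> insert v ?T" "t1 < t2"
    then consider "t1 = v" "t2 \<in> ?T" | "t2 = v" "t1 \<in> ?T" | "t1 \<in> ?T" "t2 \<in> ?T" by auto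
    then show "\<exists>z\<in>?Z. t1 < z \<and> z < t2"
    proof cases
      case 1 then show ?thesis using btw[of t2] \<open>t1 < t2\<close> v by (auto simp: min_def max_def split: if_splits)
    next
      case 2 then show ?thesis using btw[of t1] \<open>t1 < t2\<close> v by (auto simp: min_def max_def split: if_splits; blast)
    next
      case 3 then show ?thesis using pair \<open>t1 < t2\<close> by blast
    qed
  qed
  show "sep ?Z (insert s ?T)" by (rule sepv) simp
  show "sep ?Z (insert t ?T)" by (rule sepv) simp
  from \<open>sep ?Z (insert s ?T)\<close> show "sep (insert t ?Z) (insert s ?T)" using tn unfolding sep_def by (auto; blast)
qed

text \<open>Three sides of the exchange square are available: two avoid \<open>s\<close> or
  \<open>t\<close>, the third is the traded condition \<open>new\<close>. No strength is lost, since
  \<open>u\<close> stays as a neighbour on the side of \<open>s\<close>, and on the other side a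
  neighbour of \<open>t\<close> is also one of \<open>s\<close>.\<close>

lemma (in cube_system) exchange_step:
  assumes sep: "sep Z T" and t: "t \<in> T" and s: "s \<in> Z" and u: "u \<in> Z"
    and bt: "t < s \<and> s < u \<or> u < s \<and> s < t"
    and none: "\<And>t'. t' \<in> T \<Longrightarrow> t' \<noteq> t \<Longrightarrow> \<not> (min t u \<le> t' \<and> t' \<le> max t u)"
    and H: "\<And>Z' T'. sep Z' T' \<Longrightarrow> Z' \<union> T' \<subseteq> Z \<union> T \<Longrightarrow> s \<notin> Z' \<union> T' \<or> t \<notin> Z' \<union> T' \<Longrightarrow> cond g Z' T'"
    and new: "cond g (insert t (Z - {s})) (insert s (T - {t}))"
  shows "cond g Z T"
proof -
  let ?Z = "Z - {s}" and ?T = "T - {t}"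
  have sepv: "sep ?Z (insert s ?T)" by (rule sep_exchange(1)[OF sep t s u bt]) (rule none)
  have sepv': "sep ?Z (insert t ?T)" by (rule sep_exchange(2)[OF sep t s u bt]) (rule none)
  have uZ: "u \<in> ?Z" using u bt by auto
  have tn: "t \<notin> Z" "s \<notin> T" "s \<noteq> t" using sepD(4)[OF sep] t s by auto
  have "cond g (insert s ?Z) (insert t ?T)"
  proof (rule exchange_up)
    show "sep ?Z (insert s ?T)" by (rule sepv)
    show "sep ?Z (insert t ?T)" by (rule sepv')
    show "s \<notin> ?T" "t \<notin> ?T" "s \<noteq> t" using tn by auto
    show "cond g ?Z (insert t ?T)" by (rule H[OF sepv']) (use t tn in auto)
    show "cond g ?Z (insert s ?T)" by (rule H[OF sepv]) (use s tn in auto)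
    show "cond g (insert t ?Z) (insert s ?T)" by (rule new)
    assume "both (insert s ?Z) t"
    then obtain a b where ab: "a \<in> insert s ?Z" "a < t" "b \<in> insert s ?Z" "t < b"
      unfolding both_def by blast
    have w: "both Y v" if "a' \<in> Y" "a' < v" "b' \<in> Y" "v < b'" for Y v a' b'
      using that unfolding both_def by blast
    from bt show "both ?Z t \<and> both ?Z s \<and> both (insert t ?Z) s"
    proof
      assume "t < s \<and> s < u"
      then have "a \<in> ?Z" "a < s" "s < u" "t < u" using ab by auto
      then show ?thesis using w[of a ?Z t u] w[of a ?Z s u] w[of a "insert t ?Z" s u] ab(2) uZ by blast
    next
      assume "u < s \<and> s < t"
      then have "b \<in> ?Z" "s < b" "u < s" "u < t" using ab by auto
      then show ?thesis using w[of u ?Z t b] w[of u ?Z s b] w[of u "insert t ?Z" s b] ab(4) uZ by blast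
    qed
  qed
  moreover have "insert s ?Z = Z" "insert t ?T = T" using s t by auto
  ultimately show ?thesis by simp
qed


context cube_system begin

lemma cond_shrink:
  assumes "cond g Z (T \<union> U)" "sep Z (T \<union> U)" "T \<inter> U = {}"
  shows "cond g (Z \<union> U) T"
proof -
  have "finite U" using sepD(2)[OF assms(2)] by simp
  then show ?thesis using assms
  proof (induction U arbitrary: Z rule: finite_induct)
    case empty
    then show ?case by simp
  next
    case (insert u U)
    have u: "u \<notin> T \<union> U" using insert.prems insert.hyps by auto
    have "cond g (insert u Z) (T \<union> U)"
      using insert.prems u by (intro cond_present) auto
    moreover have "sep (insert u Z) (T \<union> U)"
      using sep_move[of Z u "T \<union> U"] insert.prems u by simp
    ultimately show ?case using insert.IH[of "insert u Z"] insert.prems by auto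
  qed
qed

lemma sep_parity: "n \<ge> 1 \<Longrightarrow> sep {l. l \<le> n \<and> (even l \<longleftrightarrow> \<not> e)} {l. l \<le> n \<and> (even l \<longleftrightarrow> e)}"
  unfolding sep_def
proof (intro conjI ballI impI)
  assume n: "n \<ge> 1"
  show "{l. l \<le> n \<and> (even l \<longleftrightarrow> \<not> e)} \<noteq> {}"
  proof (cases e)
    case True then have "1 \<in> {l. l \<le> n \<and> (even l \<longleftrightarrow> \<not> e)}" using n by auto
    then show ?thesis by blast
  next
    case False then have "0 \<in> {l. l \<le> n \<and> (even l \<longleftrightarrow> \<not> e)}" by auto
    then show ?thesis by blast
  qed
  fix t t' assume "t \<in> {l. l \<le> n \<and> (even l \<longleftrightarrow> e)}" "t' \<in> {l. l \<le> n \<and> (even l \<longleftrightarrow> e)}" "t < t'"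
  then have "Suc t \<noteq> t'" "Suc t < t' \<Longrightarrow> Suc t \<in> {l. l \<le> n \<and> (even l \<longleftrightarrow> \<not> e)}" by auto
  then show "\<exists>z\<in>{l. l \<le> n \<and> (even l \<longleftrightarrow> \<not> e)}. t < z \<and> z < t'"
    using \<open>t < t'\<close> by (intro bexI[of _ "Suc t"]) auto
qed auto

text \<open>Induction on the labels of \<open>T\<close> with the wrong parity, where
  \<open>e\<close> is such that \<open>k\<close> has the same role in the target pattern. The wrong
  label nearest to \<open>k\<close> on its side is traded for its neighbour towards
  \<open>k\<close>; being nearest, it has two places free of \<open>T\<close> next to it in that
  direction. Neither traded label is \<open>k\<close>, so \<open>H\<close> applies.\<close>

lemma cond_full:
  assumes H: "\<And>Z T j. sep Z T \<Longrightarrow> Z \<union> T \<subseteq> {..n} \<Longrightarrow> j \<le> n \<Longrightarrow> j \<noteq> k \<Longrightarrow> j \<notin> Z \<union> T \<Longrightarrow> cond g Z T"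
    and P: "cond g {l. l \<le> n \<and> (even l \<longleftrightarrow> \<not> e)} {l. l \<le> n \<and> (even l \<longleftrightarrow> e)}"
    and sepZT: "sep Z T" and full: "Z \<union> T = {..n}" and e: "e \<longleftrightarrow> (k \<in> T \<longleftrightarrow> even k)" and n: "n \<ge> 1" and k: "k \<le> n"
  shows "cond g Z T"
  using sepZT full e
proof (induction "card {t \<in> T. even t \<longleftrightarrow> \<not> e}" arbitrary: Z T rule: less_induct)
  case less
  let ?W = "\<lambda>T. {t \<in> T. even t \<longleftrightarrow> \<not> e}"
  have finT: "finite T" using sepD[OF less.prems(1)] by simp
  have ZT: "l \<in> Z \<longleftrightarrow> l \<le> n \<and> l \<notin> T" for l using less.prems(2) sepD(4)[OF less.prems(1)] by auto
  have Tn: "t \<in> T \<Longrightarrow> t \<le> n" for t using less.prems(2) by auto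
  have adj: "\<not> (t \<in> T \<and> Suc t \<in> T)" for t
    using sepD(5)[OF less.prems(1), of t "Suc t"] by auto
  show ?case
  proof (cases "?W T = {}")
    case True
    let ?T = "{l. l \<le> n \<and> (even l \<longleftrightarrow> e)}" and ?Z = "{l. l \<le> n \<and> (even l \<longleftrightarrow> \<not> e)}"
    \<comment> \<open>Now \<open>T\<close> lies within the parity class, and the remaining labels of
      the class are made permanently present.\<close>
    have T: "T \<union> (?T - T) = ?T" "Z = ?Z \<union> (?T - T)" using True Tn ZT by auto
    show ?thesis unfolding T(2)
      by (rule cond_shrink) (use P sep_parity[OF n, of e] T(1) in auto)
  next
    case False
    have step: "cond g Z T" if t: "t \<in> ?W T" and s: "s \<in> Z" "s \<noteq> k" and u: "u \<in> Z" and "even s \<longleftrightarrow> e"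
       "t < s \<and> s < u \<or> u < s \<and> s < t" "\<And>t'. t' \<in> T \<Longrightarrow> t' \<noteq> t \<Longrightarrow> \<not> (min t u \<le> t' \<and> t' \<le> max t u)" "t \<noteq> k" for t s u
    proof (rule exchange_step[where t = t and s = s and u = u, OF less.prems(1) _ s(1) u that(6,7)])
      show "t \<in> T" using t by simp
      have sn: "s \<noteq> t" "s \<notin> T" "s \<le> n" "t \<le> n" using that Tn ZT by auto
      show "cond g Z' T'" if "sep Z' T'" "Z' \<union> T' \<subseteq> Z \<union> T" "s \<notin> Z' \<union> T' \<or> t \<notin> Z' \<union> T'" for Z' T'
        using H[of Z' T' s] H[of Z' T' t] that sn less.prems(2) \<open>s \<noteq> k\<close> \<open>t \<noteq> k\<close> by auto
      show "cond g (insert t (Z - {s})) (insert s (T - {t}))"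
      proof (rule less.hyps)
        have "?W (insert s (T - {t})) = ?W T - {t}" using \<open>even s \<longleftrightarrow> e\<close> by auto
        moreover have "finite (?W T)" using finT by simp
        ultimately show "card (?W (insert s (T - {t}))) < card (?W T)" using t by (metis card_Diff1_less)
        show "insert t (Z - {s}) \<union> insert s (T - {t}) = {..n}" using less.prems(2) t s sn by auto
        show "e \<longleftrightarrow> (k \<in> insert s (T - {t}) \<longleftrightarrow> even k)" using less.prems(3) \<open>s \<noteq> k\<close> \<open>t \<noteq> k\<close> by auto
        show "sep (insert t (Z - {s})) (insert s (T - {t}))"
          by (rule sep_exchange(3)[OF less.prems(1) \<open>t \<in> T\<close> s(1) u that(6,7)])
      qed
    qed
    have Wk: "t \<noteq> k" if "t \<in> ?W T" for t using that less.prems(3) by auto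
    show ?thesis
    proof (cases "\<exists>t \<in> ?W T. t < k")
      case True
      define t where "t = Max {t \<in> ?W T. t < k}"
      have fin: "finite {t \<in> ?W T. t < k}" by simp
      have t: "t \<in> ?W T" "t < k" using Max_in[OF fin] True unfolding t_def by blast+
      have mx: "t' \<le> t" if "t' \<in> ?W T" "t' < k" for t'
        using Max_ge[OF fin, of t'] that unfolding t_def by blast
      have et: "even t \<longleftrightarrow> \<not> e" "t \<in> T" using t by auto
      \<comment> \<open>If \<open>Suc t\<close> were \<open>k\<close>, it would have parity
        \<open>e\<close>, so the choice of \<open>e\<close> would put it into \<open>T\<close> right
        next to \<open>t\<close>, against separation.\<close>
      have kn: "Suc t < k"
        using t(2) et adj[of t] less.prems(3) by (metis Suc_lessI even_Suc)
      have sT: "Suc t \<notin> T" using adj et by blast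
      have uT: "Suc (Suc t) \<notin> T"
      proof
        assume u: "Suc (Suc t) \<in> T"
        then have "Suc (Suc t) \<in> ?W T" using et by simp
        then have "\<not> Suc (Suc t) < k" using mx[of "Suc (Suc t)"] by auto
        then have "k = Suc (Suc t)" using kn by simp
        then show False using u et less.prems(3) by auto
      qed
      show ?thesis
      proof (rule step[OF t(1), of "Suc t" "Suc (Suc t)"])
        fix t' assume "t' \<in> T" "t' \<noteq> t"
        then show "\<not> (min t (Suc (Suc t)) \<le> t' \<and> t' \<le> max t (Suc (Suc t)))"
          using sT uT by (auto simp: le_Suc_eq)
      qed (use kn k sT uT et t ZT in auto)
    next
      case False
      define t where "t = Min (?W T)"
      have fin: "finite (?W T)" using finT by simp
      have t: "t \<in> ?W T" using Min_in[OF fin] \<open>?W T \<noteq> {}\<close> unfolding t_def by blast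
      then have tk: "k < t" using False Wk[OF t] by (meson linorder_neqE_nat)
      have mn: "t \<le> t'" if "t' \<in> ?W T" for t'
        using Min_le[OF fin that] unfolding t_def by blast
      have et: "even t \<longleftrightarrow> \<not> e" "t \<in> T" "t \<le> n" using t Tn by auto
      have kn: "Suc k < t"
        using tk et adj[of k] less.prems(3) by (metis Suc_lessI even_Suc)
      then obtain m where m: "t = Suc (Suc m)" "k \<le> m" by (metis Suc_le_D Suc_le_mono less_eq_Suc_le)
      have sT: "Suc m \<notin> T" using adj et m by blast
      have uT: "m \<notin> T"
      proof
        assume u: "m \<in> T"
        then have "m \<in> ?W T" using et m by simp
        then show False using mn[of m] m by simp
      qed
      show ?thesis
      proof (rule step[OF t, of "Suc m" "m"])
        fix t' assume "t' \<in> T" "t' \<noteq> t"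
        then show "\<not> (min t m \<le> t' \<and> t' \<le> max t m)"
          using sT uT m by (auto simp: le_Suc_eq)
      qed (use kn k sT uT et m ZT in auto)
    qed
  qed
qed

text \<open>Patterns on all labels come from \<open>cond_full\<close>, and those avoiding some
  \<open>j \<noteq> k\<close> are given. If exactly \<open>k\<close> is missing, either
  \<open>k\<close> can be added as a varying label and then be made absent, or it touches a varying
  label \<open>t\<close>; in that case the exchange of \<open>k\<close> and \<open>t\<close>
  descends from patterns on all labels.\<close>

lemma good_from_faces:
  assumes H: "\<And>Z T j. sep Z T \<Longrightarrow> Z \<union> T \<subseteq> {..n} \<Longrightarrow> j \<le> n \<Longrightarrow> j \<noteq> k \<Longrightarrow> j \<notin> Z \<union> T \<Longrightarrow> cond g Z T"
    and P: "\<And>e. cond g {l. l \<le> n \<and> (even l \<longleftrightarrow> \<not> e)} {l. l \<le> n \<and> (even l \<longleftrightarrow> e)}"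
    and n: "n \<ge> 1" and k: "k \<le> n"
  shows "good g {..n}"
  unfolding good_def
proof (intro allI impI)
  fix Z T assume sep: "sep Z T" and sub: "Z \<union> T \<subseteq> {..n}"
  have full: "cond g Z T" if "sep Z T" "Z \<union> T = {..n}" for Z T
    using cond_full[OF H P that refl n k] .
  consider "Z \<union> T = {..n}" | j where "j \<le> n" "j \<noteq> k" "j \<notin> Z \<union> T" | "Z \<union> T = {..n} - {k}"
    using sub by blast
  then show "cond g Z T"
  proof cases
    case 1 then show ?thesis using full sep by blast
  next
    case 2 then show ?thesis using H sep sub by blast
  next
    case 3
    have kZ: "k \<notin> Z" "k \<notin> T" using 3 by auto
    have finZ: "finite Z" "finite T" "Z \<noteq> {}" using sepD[OF sep] by auto
    have ZT: "l \<in> Z \<longleftrightarrow> l \<le> n \<and> l \<noteq> k \<and> l \<notin> T" for l using 3 sepD(4)[OF sep] by auto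
    show ?thesis
    proof (cases "sep Z (insert k T)")
      case True
      then have "cond g Z (insert k T)" using 3 k by (intro full) auto
      then show ?thesis using cond_absent kZ finZ by blast
    next
      case False
      have "\<exists>t\<in>T. \<not> (\<exists>z\<in>Z. min t k < z \<and> z < max t k)"
      proof (rule ccontr)
        assume *: "\<not> ?thesis"
        have "\<exists>z\<in>Z. a < z \<and> z < b" if ab: "a \<in> insert k T" "b \<in> insert k T" "a < b" for a b
        proof -
          consider "a = k" "b \<in> T" | "b = k" "a \<in> T" | "a \<in> T" "b \<in> T" using ab by auto
          then show ?thesis
          proof cases
            case 1
            then have "\<exists>z\<in>Z. min b k < z \<and> z < max b k" using * by blast
            then show ?thesis using ab(3) 1 by (simp add: min_def max_def)
          next
            case 2
            then have "\<exists>z\<in>Z. min a k < z \<and> z < max a k" using * by blast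
            then show ?thesis using ab(3) 2 by (simp add: min_def max_def)
          next
            case 3 then show ?thesis using sepD(5)[OF sep _ _ ab(3)] by blast
          qed
        qed
        then show False using False finZ kZ sepD(4)[OF sep] unfolding sep_def by auto
      qed
      then obtain t where t: "t \<in> T" and near: "\<not> (\<exists>z\<in>Z. min t k < z \<and> z < max t k)" by blast
      have tk: "t \<noteq> k" "t \<le> n" using t kZ sub by auto
      \<comment> \<open>A label strictly between \<open>t\<close> and \<open>k\<close> would have to
        vary, and then an element of \<open>Z\<close> would separate it from \<open>t\<close>,
        against \<open>near\<close>.\<close>
      have adj: "t = Suc k \<or> k = Suc t"
      proof (rule ccontr)
        assume *: "\<not> ?thesis"
        define l where "l = Suc (min t k)"
        have l: "min t k < l" "l < max t k" using * tk unfolding l_def by (auto simp: min_def max_def)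
        have "l \<notin> Z" using near l by blast
        then have "l \<in> T" using ZT[of l] l tk k by auto
        then have "\<exists>z\<in>Z. min t l < z \<and> z < max t l" using sepD(5)[OF sep t \<open>l \<in> T\<close>] sepD(5)[OF sep \<open>l \<in> T\<close> t] l
          by (auto simp: min_def max_def split: if_splits)
        then show False using near l by (auto simp: min_def max_def split: if_splits)
      qed
      let ?T = "T - {t}"
      have tT: "insert t ?T = T" using t by auto
      have tZ: "t \<notin> Z" using sepD(4)[OF sep t] .
      have far: "\<exists>z\<in>Z. min t' t < z \<and> z < max t' t \<and> min t' k < z \<and> z < max t' k" if t': "t' \<in> ?T" for t'
      proof -
        have "t' < t \<or> t < t'" using t' by auto
        then obtain z where z: "z \<in> Z" "min t' t < z" "z < max t' t"
          using sepD(5)[OF sep, of t' t] sepD(5)[OF sep, of t t'] t t' by (auto simp: min_def max_def split: if_splits)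
        have "z \<noteq> k" using z kZ by auto
        moreover have "t' \<noteq> k" using t' kZ by auto
        ultimately show ?thesis using z adj by (intro bexI[of _ z]) (auto simp: min_def max_def split: if_splits)
      qed
      have sepk: "sep Z (insert k ?T)" unfolding sep_def
      proof (intro conjI ballI impI)
        fix a b assume ab: "a \<in> insert k ?T" "b \<in> insert k ?T" "a < b"
        then consider "a = k" "b \<in> ?T" | "b = k" "a \<in> ?T" | "a \<in> ?T" "b \<in> ?T" by auto
        then show "\<exists>z\<in>Z. a < z \<and> z < b"
        proof cases
          case 1 then show ?thesis using far[of b] ab(3) by (auto simp: min_def max_def)
        next
          case 2 then show ?thesis using far[of a] ab(3) by (auto simp: min_def max_def)
        next
          case 3 then show ?thesis using sepD(5)[OF sep, of a b] ab(3) by auto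
        qed
      qed (use finZ kZ sepD(4)[OF sep] in auto)
      have "cond g Z (insert t ?T)"
      proof (rule exchange_down[where s = k])
        show "sep Z (insert k ?T)" by (rule sepk)
        show "sep Z (insert t ?T)" "k \<notin> ?T" "t \<notin> ?T" "k \<noteq> t" using sep tT kZ tk by auto
        show "cond g (insert k Z) (insert t ?T)"
        proof (rule full)
          show "sep (insert k Z) (insert t ?T)" unfolding tT using sep kZ unfolding sep_def by auto
          show "insert k Z \<union> insert t ?T = {..n}" using 3 tT k by auto
        qed
        show "cond g Z (insert k ?T)" by (rule H[OF sepk _ \<open>t \<le> n\<close> \<open>t \<noteq> k\<close>]) (use sub k tk tZ in auto)
        show "cond g (insert t Z) (insert k ?T)"
        proof (rule full)
          show "sep (insert t Z) (insert k ?T)" using sepk tk unfolding sep_def by auto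
          show "insert t Z \<union> insert k ?T = {..n}" using 3 t k by auto
        qed
        assume "both Z t"
        \<comment> \<open>Adjacent labels outside \<open>Z\<close> have the same elements of
          \<open>Z\<close> on either side.\<close>
        then show "both Z k \<and> both (insert t Z) k"
          using adj kZ unfolding both_def by (metis insert_iff less_Suc_eq not_less_eq)
      qed
      then show ?thesis unfolding tT .
    qed
  qed
qed

end

section \<open>Filling horns\<close>

text \<open>The parity pattern with economical numbering: coordinate \<open>i\<close> sits between
  the labels \<open>i\<close> and \<open>i + 1\<close> and belongs to the one that varies, so
  \<open>n\<close> coordinates suffice.\<close>

definition lin :: "nat \<Rightarrow> nat set \<Rightarrow> (nat \<Rightarrow> bool) \<Rightarrow> nat set" where
  "lin n T x = {l. l \<le> n \<and> (l \<in> T \<longrightarrow> (0 < l \<longrightarrow> x (l - 1)) \<and> (l < n \<longrightarrow> x l))}"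

abbreviation par :: "nat \<Rightarrow> bool \<Rightarrow> nat set" where
  "par n e \<equiv> {l. l \<le> n \<and> (even l \<longleftrightarrow> e)}"

lemma literals_if: "f \<in> literals \<Longrightarrow> g \<in> literals \<Longrightarrow> (\<lambda>x. if b then f x else g x) \<in> literals"
  by (cases b) simp_all

lemma lin_eqI:
  assumes "\<And>l. l \<in> par n e \<Longrightarrow> P l \<longleftrightarrow> (0 < l \<longrightarrow> x (l - 1)) \<and> (l < n \<longrightarrow> x l)"
  shows "lin n (par n e) x = par n (\<not> e) \<union> {t \<in> par n e. P t}"
  using assms unfolding lin_def by blast

context cube_system begin

lemma cond_parity_iff:
  assumes n: "n \<ge> 1"
  shows "cond g (par n (\<not> e)) (par n e) \<longleftrightarrow> (\<lambda>x. g (lin n (par n e) x)) \<in> Q"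
proof -
  let ?Z = "par n (\<not> e)" and ?T = "par n e"
  have pres: "pres ?Z t x \<longleftrightarrow> (0 < t \<longrightarrow> x (2 * t)) \<and> (t < n \<longrightarrow> x (Suc (2 * t)))" if t: "t \<in> ?T" for t x
  proof -
    have "(\<exists>z\<in>?Z. z < t) \<longleftrightarrow> 0 < t"
    proof
      assume "0 < t" 
      then show "\<exists>z\<in>?Z. z < t" using t by (intro bexI[of _ "t - 1"]) auto
    qed auto
    moreover have "(\<exists>z\<in>?Z. t < z) \<longleftrightarrow> t < n"
    proof
      assume "t < n" 
      then show "\<exists>z\<in>?Z. t < z" using t by (intro bexI[of _ "Suc t"]) auto
    qed auto
    ultimately show ?thesis unfolding pres_def by simp
  qed
  show ?thesis
  proof
    assume c: "cond g ?Z ?T"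
    \<comment> \<open>The left coordinate \<open>2 * t\<close> of \<open>t\<close> is the place
      \<open>t - 1\<close>, the right one \<open>Suc (2 * t)\<close> is the place
      \<open>t\<close>.\<close>
    let ?y = "\<lambda>x m. if even m then x (m div 2 - 1) else x (m div 2)"
    have "lin n ?T x = cfg ?Z ?T (?y x)" for x
      unfolding cfg_def
    proof (rule lin_eqI)
      show "pres ?Z l (?y x) \<longleftrightarrow> (0 < l \<longrightarrow> x (l - 1)) \<and> (l < n \<longrightarrow> x l)" if "l \<in> ?T" for l
        unfolding pres[OF that] by simp
    qed
    then show "(\<lambda>x. g (lin n ?T x)) \<in> Q"
      by (intro subst_eq[OF c[unfolded cond_def], where y = ?y] literals_if) simp_all
  next
    assume c: "(\<lambda>x. g (lin n ?T x)) \<in> Q"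
    \<comment> \<open>The place between \<open>m\<close> and \<open>m + 1\<close> is the right side
      of \<open>m\<close> if \<open>m\<close> varies, and the left side of \<open>m + 1\<close>
      otherwise.\<close>
    let ?y = "\<lambda>x m. if m \<in> ?T then x (Suc (2 * m)) else x (2 * Suc m)"
    have "lin n ?T (?y x) = cfg ?Z ?T x" for x
    proof -
      have "(0 < l \<longrightarrow> ?y x (l - 1)) \<and> (l < n \<longrightarrow> ?y x l) \<longleftrightarrow> pres ?Z l x" if "l \<in> ?T" for l
        unfolding pres[OF that] using that by (cases l) auto
      then show ?thesis unfolding cfg_def by (intro lin_eqI) blast
    qed
    then show "cond g ?Z ?T" unfolding cond_def
      by (intro subst_eq[OF c, where y = ?y] literals_if) simp_all
  qed
qed

text \<open>A filler for the top vertex: presence of \<open>t\<close> is a conjunction of coordinates, so the value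
  at the full set occurs at a single vertex of the cube.\<close>

lemma fill_full:
  assumes n: "n \<ge> 1" and sep: "sep Z T" and full: "Z \<union> T = {..n}" and T: "T \<noteq> {}"
    and H: "\<And>t. t \<in> T \<Longrightarrow> cond g Z (T - {t})"
  shows "\<exists>w. cond (g({..n} := w)) Z T"
proof -
  define J where "J = (\<lambda>t. 2 * t) ` {t \<in> T. \<exists>z\<in>Z. z < t} \<union> (\<lambda>t. Suc (2 * t)) ` {t \<in> T. \<exists>z\<in>Z. t < z}"
  have fin: "finite T" "Z \<noteq> {}" "Z \<inter> T = {}" using sep unfolding sep_def by auto
  have pJ: "pres Z t x = pres Z t y" if "\<forall>i\<in>J. x i = y i" "t \<in> T" for x y t
    using that unfolding pres_def J_def by auto
  have all: "(\<forall>j\<in>J. x j) \<longleftrightarrow> (\<forall>t\<in>T. pres Z t x)" for x unfolding pres_def J_def by auto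
  have "\<exists>p. (\<lambda>x. if \<forall>j\<in>J. x j then p else g (cfg Z T x)) \<in> Q"
  proof (rule corner)
    show "finite J" using fin(1) unfolding J_def by simp
    obtain t z where "t \<in> T" "z \<in> Z" using T fin(2) by blast
    moreover then have "t < z \<or> z < t" using fin(3) by (metis disjoint_iff linorder_neqE_nat)
    ultimately show "J \<noteq> {}" unfolding J_def by auto
    show "g (cfg Z T x) = g (cfg Z T y)" if "\<And>i. i \<in> J \<Longrightarrow> x i = y i" for x y
    proof -
      have "{t \<in> T. pres Z t x} = {t \<in> T. pres Z t y}" using pJ[of x y] that by blast
      then show ?thesis unfolding cfg_def by simp
    qed
    fix j assume "j \<in> J"
    then obtain t where t: "t \<in> T" "j = 2 * t \<and> (\<exists>z\<in>Z. z < t) \<or> j = Suc (2 * t) \<and> (\<exists>z\<in>Z. t < z)"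
      unfolding J_def by blast
    have "cfg Z T (x(j := False)) = cfg Z (T - {t}) x" for x
    proof -
      have "\<not> pres Z t (x(j := False))" using t unfolding pres_def by auto
      moreover have "pres Z t' (x(j := False)) = pres Z t' x" if "t' \<in> T - {t}" for t'
        using t(2) that unfolding pres_def by auto
      ultimately show ?thesis unfolding cfg_def by auto
    qed
    then show "(\<lambda>x. g (cfg Z T (x(j := False)))) \<in> Q" using H[OF t(1)] unfolding cond_def by simp
  qed
  then obtain w where w: "(\<lambda>x. if \<forall>j\<in>J. x j then w else g (cfg Z T x)) \<in> Q" by blast
  have "cfg Z T x = {..n} \<longleftrightarrow> (\<forall>j\<in>J. x j)" for x
    unfolding all cfg_def full[symmetric] using fin(3) by auto
  then have "(\<lambda>x. if \<forall>j\<in>J. x j then w else g (cfg Z T x)) = (\<lambda>x. (g({..n} := w)) (cfg Z T x))"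
    by auto
  then show ?thesis using w unfolding cond_def by auto
qed

lemma cond_cong:
  assumes "cond g Z T" "\<And>B. Z \<subseteq> B \<Longrightarrow> B \<subseteq> Z \<union> T \<Longrightarrow> g B = g' B"
  shows "cond g' Z T"
proof -
  have "g (cfg Z T x) = g' (cfg Z T x)" for x by (rule assms(2)) (auto simp: cfg_def)
  then show ?thesis using assms(1) unfolding cond_def by simp
qed

text \<open>In the pattern in which \<open>k\<close> varies, the unknown value at
  \<open>{..n} - {k}\<close> does not sit at the top. Symmetry of \<open>E\<close> allows the switch
  of \<open>k\<close> to be reversed, so that turning its coordinates on removes \<open>k\<close>.
  Then the unknown value occurs at the top vertex alone and a corner filling provides it.\<close>

lemma fill_flipped:
  assumes sep: "sep Z (insert k T)" and k: "k \<notin> T" and full: "Z \<union> insert k T = {..n}"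
    and H: "\<And>t. t \<in> T \<Longrightarrow> cond g Z (insert k (T - {t}))" and W: "cond g (insert k Z) T"
  shows "\<exists>v. cond (g({..n} - {k} := v)) Z (insert k T)"
proof -
  let ?a = "2 * k" and ?b = "Suc (2 * k)"
  define w where "w = both Z k"
  have fin: "finite T" "Z \<noteq> {}" "Z \<inter> T = {}" "k \<notin> Z" using sep unfolding sep_def by auto
  have ab: "?a \<noteq> ?b" "\<forall>u\<in>T. ?a \<noteq> 2 * u \<and> ?a \<noteq> Suc (2 * u)" "\<forall>u\<in>T. ?b \<noteq> 2 * u \<and> ?b \<noteq> Suc (2 * u)"
    using k by auto presburger+
  have iff: "cond g Z (insert k T') \<longleftrightarrow>
      (\<lambda>x. slot g Z T' (if x ?a \<and> (w \<longrightarrow> x ?b) then Z else insert k Z) x) \<in> Q" if T': "T' \<subseteq> T" for g T'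
  proof -
    have ab': "?a \<noteq> ?b" "\<forall>u\<in>T'. ?a \<noteq> 2 * u \<and> ?a \<noteq> Suc (2 * u)" "\<forall>u\<in>T'. ?b \<noteq> 2 * u \<and> ?b \<noteq> Suc (2 * u)"
      using ab T' by blast+
    interpret square_rel "sq (slot g Z T') ?a ?b"
      using ab' by (intro square_rel_sq indep_slot) auto
    have "cond g Z (insert k T') \<longleftrightarrow> E w Z (insert k Z)" unfolding w_def
      by (rule cond_iff_edge[OF _ _ _ _ ab']) (use fin k T' in auto)
    also have "\<dots> \<longleftrightarrow> E w (insert k Z) Z" using E_sym by blast
    also have "\<dots> \<longleftrightarrow> (\<lambda>x. slot g Z T' (if x ?a \<and> (w \<longrightarrow> x ?b) then Z else insert k Z) x) \<in> Q"
      by (rule E_sq_iff) (use ab' indep_slot in auto)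
    finally show ?thesis .
  qed
  define J' where "J' = (\<lambda>t. 2 * t) ` {t \<in> T. \<exists>z\<in>Z. z < t} \<union> (\<lambda>t. Suc (2 * t)) ` {t \<in> T. \<exists>z\<in>Z. t < z}"
  define J where "J = J' \<union> (if w then {?a, ?b} else {?a})"
  have pJ: "pres Z t x = pres Z t y" if "\<forall>i\<in>J. x i = y i" "t \<in> T" for x y t
    using that unfolding pres_def J_def J'_def by auto
  have all: "(\<forall>j\<in>J'. x j) \<longleftrightarrow> (\<forall>t\<in>T. pres Z t x)" for x unfolding pres_def J'_def by auto
  have allJ: "(\<forall>j\<in>J. x j) \<longleftrightarrow> (\<forall>t\<in>T. pres Z t x) \<and> x ?a \<and> (w \<longrightarrow> x ?b)" for x
    unfolding all[symmetric] J_def by auto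
  let ?c = "\<lambda>x. slot g Z T (if x ?a \<and> (w \<longrightarrow> x ?b) then Z else insert k Z) x"
  have "\<exists>p. (\<lambda>x. if \<forall>j\<in>J. x j then p else ?c x) \<in> Q"
  proof (rule corner)
    show "finite J" using fin(1) unfolding J_def J'_def by simp
    show "J \<noteq> {}" unfolding J_def by auto
    show "?c x = ?c y" if "\<And>i. i \<in> J \<Longrightarrow> x i = y i" for x y
    proof -
      have "{t \<in> T. pres Z t x} = {t \<in> T. pres Z t y}" using pJ[of x y] that by blast
      moreover have "(x ?a \<and> (w \<longrightarrow> x ?b)) = (y ?a \<and> (w \<longrightarrow> y ?b))" using that unfolding J_def by auto
      ultimately show ?thesis unfolding slot_def by simp
    qed
    fix j assume j: "j \<in> J"
    show "(\<lambda>x. ?c (x(j := False))) \<in> Q"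
    proof (cases "j \<in> J'")
      case True
      then obtain t where t: "t \<in> T" "j = 2 * t \<and> (\<exists>z\<in>Z. z < t) \<or> j = Suc (2 * t) \<and> (\<exists>z\<in>Z. t < z)"
        unfolding J'_def by blast
      have jab: "j \<noteq> ?a" "j \<noteq> ?b" using t ab by blast+
      have "?c (x(j := False)) = slot g Z (T - {t}) (if x ?a \<and> (w \<longrightarrow> x ?b) then Z else insert k Z) x" for x
      proof -
        have "\<not> pres Z t (x(j := False))" using t unfolding pres_def by auto
        moreover have "pres Z t' (x(j := False)) = pres Z t' x" if "t' \<in> T - {t}" for t'
          using t(2) that unfolding pres_def by auto
        ultimately have "{t \<in> T. pres Z t (x(j := False))} = {t' \<in> T - {t}. pres Z t' x}" by auto
        then show ?thesis unfolding slot_def using jab by simp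
      qed
      then show ?thesis using H[OF t(1)] unfolding iff[OF Diff_subset] by simp
    next
      case False
      \<comment> \<open>If a coordinate of \<open>k\<close> is 0, the reversed switch leaves
        \<open>k\<close> present; this face is the condition \<open>W\<close>.\<close>
      then have "j = ?a \<or> w \<and> j = ?b" using j unfolding J_def by (auto split: if_splits)
      moreover have "pres Z t (x(j := False)) = pres (insert k Z) t x" if "t \<in> T" for t x
        unfolding pres_insert[OF sep k that] using that ab \<open>j = ?a \<or> w \<and> j = ?b\<close> by (auto simp: pres_def)
      ultimately have "?c (x(j := False)) = g (cfg (insert k Z) T x)" for x
        unfolding slot_def cfg_def by (intro arg_cong[of _ _ g]) auto
      then show ?thesis using W unfolding cond_def by simp
    qed
  qed
  then obtain v where v: "(\<lambda>x. if \<forall>j\<in>J. x j then v else ?c x) \<in> Q" by blast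
  have "(if x ?a \<and> (w \<longrightarrow> x ?b) then Z else insert k Z) \<union> {t \<in> T. pres Z t x} = {..n} - {k} \<longleftrightarrow> (\<forall>j\<in>J. x j)" for x
    unfolding allJ full[symmetric] using fin k by auto
  then have "(\<lambda>x. if \<forall>j\<in>J. x j then v else ?c x) =
      (\<lambda>x. slot (g({..n} - {k} := v)) Z T (if x ?a \<and> (w \<longrightarrow> x ?b) then Z else insert k Z) x)"
    unfolding slot_def by auto
  then show ?thesis using v iff[OF order_refl] by auto
qed

text \<open>The two missing values of a horn are filled one after the other; the first filler has to avoid
  the label \<open>k\<close>, and the value at \<open>{..n} - {k}\<close> is then the top of a pair of opposite cubes.\<close>

lemma horn_extension:
  assumes n: "n \<ge> 1" and k: "k \<le> n"
    and H: "\<And>Z T j. sep Z T \<Longrightarrow> Z \<union> T \<subseteq> {..n} \<Longrightarrow> j \<le> n \<Longrightarrow> j \<noteq> k \<Longrightarrow> j \<notin> Z \<union> T \<Longrightarrow> cond g Z T"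
  shows "\<exists>g'. good g' {..n} \<and> (\<forall>B j. B \<subseteq> {..n} \<longrightarrow> j \<le> n \<longrightarrow> j \<noteq> k \<longrightarrow> j \<notin> B \<longrightarrow> g' B = g B)"
proof -
  \<comment> \<open>The parity opposite to that of \<open>k\<close>: in the first pattern
    \<open>k\<close> is fixed, so dropping any varying label leaves a pattern of the horn.\<close>
  define e where "e = odd k"
  let ?Z = "par n (\<not> e)" and ?T = "par n e"
  note sp = sep_parity[OF n]
  have kZ: "k \<in> ?Z" "k \<notin> ?T" using k by (auto simp: e_def)
  have TZ: "?Z \<union> ?T = {..n}" "?T \<union> ?Z = {..n}" by auto
  have T0: "?T \<noteq> {}" "?Z \<noteq> {}" using sp[of "\<not> e"] sp[of e] unfolding sep_def by auto
  have "\<exists>w. cond (g({..n} := w)) ?Z ?T"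
  proof (rule fill_full[OF n sp TZ(1) T0(1)])
    fix t assume t: "t \<in> ?T"
    then have "t \<noteq> k" "t \<le> n" using kZ by auto
    with t show "cond g ?Z (?T - {t})"
      by (intro H[of _ _ t] sep_subset[OF sp]) auto
  qed
  then obtain w where w: "cond (g({..n} := w)) ?Z ?T" by blast
  define g1 where "g1 = g({..n} := w)"
  have H1: "cond g1 Z T" if "sep Z T" "Z \<union> T \<subseteq> {..n}" "j \<le> n" "j \<noteq> k" "j \<notin> Z \<union> T" for Z T j
  proof (rule cond_cong[OF H[OF that]])
    show "g B = g1 B" if "B \<subseteq> Z \<union> T" for B using that \<open>j \<le> n\<close> \<open>j \<notin> Z \<union> T\<close> unfolding g1_def by auto
  qed
  \<comment> \<open>Once \<open>w\<close> is chosen, all patterns on the full set in which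
    \<open>k\<close> is fixed hold. One of them is the face with \<open>k\<close> present in the
    second filling.\<close>
  have full1: "cond g1 Z T" if "sep Z T" "Z \<union> T = {..n}" "k \<notin> T" for Z T
    by (rule cond_full[OF H1 _ that(1,2) _ n k, where e = e])
      (use w that in \<open>auto simp: g1_def e_def\<close>)
  let ?T' = "?Z - {k}"
  have sT': "sep ?T (insert k ?T')" "insert k ?T' = ?Z" "k \<notin> ?T'" using sp[of "\<not> e"] kZ by (auto simp: insert_absorb)
  have wt: "cond g1 (insert k ?T) ?T'"
    by (rule full1) (use sep_move[OF sT'(1)] sT'(3) kZ in auto)
  have "\<exists>v. cond (g1({..n} - {k} := v)) ?T (insert k ?T')"
  proof (rule fill_flipped[OF sT'(1,3) _ _ wt])
    show "?T \<union> insert k ?T' = {..n}" using sT'(2) TZ by simp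
    fix t assume t: "t \<in> ?T'"
    then have "t \<noteq> k" "t \<le> n" by auto
    with t k show "cond g1 ?T (insert k (?T' - {t}))"
      by (intro H1[of _ _ t] sep_subset[OF sT'(1)]) auto
  qed
  then obtain v where v: "cond (g1({..n} - {k} := v)) ?T ?Z" unfolding sT'(2) by blast
  define g2 where "g2 = g1({..n} - {k} := v)"
  have H2: "cond g2 Z T" if "sep Z T" "Z \<union> T \<subseteq> {..n}" "j \<le> n" "j \<noteq> k" "j \<notin> Z \<union> T" for Z T j
  proof (rule cond_cong[OF H1[OF that]])
    show "g1 B = g2 B" if "B \<subseteq> Z \<union> T" for B using that \<open>j \<le> n\<close> \<open>j \<noteq> k\<close> \<open>j \<notin> Z \<union> T\<close> unfolding g2_def by auto
  qed
  have P: "cond g2 (par n (\<not> e')) (par n e')" for e'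
  proof (cases "e' = e")
    case True
    have "cond g2 ?Z ?T"
    proof (rule cond_cong[OF w])
      \<comment> \<open>All label sets of the first pattern contain \<open>k\<close>, so the second
        choice does not disturb it.\<close>
      show "(g({..n} := w)) B = g2 B" if "?Z \<subseteq> B" for B
        using that kZ unfolding g2_def g1_def by auto
    qed
    then show ?thesis using True by simp
  next
    case False
    then show ?thesis using v unfolding g2_def by simp
  qed
  have "good g2 {..n}" by (rule good_from_faces[OF H2 P n k])
  moreover have "g2 B = g B" if "B \<subseteq> {..n}" "j \<le> n" "j \<noteq> k" "j \<notin> B" for B j
    using that unfolding g2_def g1_def by auto
  ultimately show ?thesis by blast
qed

end

section \<open>From test cubes to arbitrary cubes between fixed labels\<close>

context square_rel begin

text \<open>\<open>E w\<close> is symmetric and transitive, so it spreads over everything connected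
  by \<open>R\<close>. The strong form then fills every square, the weak form those that are
  constant in the second direction.\<close>

lemma arbitrary_if_connected:
  assumes conn: "\<And>u v. u \<in> V \<Longrightarrow> v \<in> V \<Longrightarrow> (u, v) \<in> (R \<union> R\<inverse>)\<^sup>*"
    and refl: "\<And>u. u \<in> V \<Longrightarrow> (u, u) \<in> R"
    and E: "\<And>u v. (u, v) \<in> R \<Longrightarrow> E w u v"
    and V: "\<And>p q. \<beta> p q \<in> V" and w: "\<not> w \<Longrightarrow> (\<And>p. \<beta> p False = \<beta> p True)"
  shows "S (\<beta> False False) (\<beta> False True) (\<beta> True False) (\<beta> True True)"
proof -
  have all: "E w u v" if "u \<in> V" "v \<in> V" for u v
    using conn[OF that]
  proof (induction rule: rtrancl_induct)
    case base
    then show ?case using E refl that by blast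
  next
    case (step y z)
    then have "E w y z" using E E_sym by blast
    with step.IH show ?case by (rule E_trans)
  qed
  show ?thesis
  proof (cases w)
    case True
    then show ?thesis using all V unfolding E_def by (intro E2_arbitrary) auto
  next
    case False
    then show ?thesis using all[OF V V] w[OF False] unfolding E_def E1_def by simp
  qed
qed

end

context cube_system begin

text \<open>\<open>U\<close> is the set of slots that depend on one coordinate only.\<close>

lemma multi_slot:
  fixes G :: "(nat \<Rightarrow> 'v) \<Rightarrow> 'p"
  assumes "finite I"
    and conn: "\<And>i u v. i \<in> I \<Longrightarrow> u \<in> V i \<Longrightarrow> v \<in> V i \<Longrightarrow> (u, v) \<in> (R i \<union> (R i)\<inverse>)\<^sup>*"
    and refl: "\<And>i u. i \<in> I \<Longrightarrow> u \<in> V i \<Longrightarrow> (u, u) \<in> R i"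
    and std: "\<And>e. (\<And>i. i \<in> I \<Longrightarrow> e i \<in> R i) \<Longrightarrow>
      (\<lambda>x. G (\<lambda>i\<in>I. if x (2 * i) \<and> (i \<notin> U \<longrightarrow> x (Suc (2 * i))) then snd (e i) else fst (e i))) \<in> Q"
    and V: "\<And>i p q. i \<in> I \<Longrightarrow> \<beta> i p q \<in> V i"
    and one: "\<And>i p. i \<in> U \<Longrightarrow> \<beta> i p False = \<beta> i p True"
  shows "(\<lambda>x. G (\<lambda>i\<in>I. \<beta> i (x (2 * i)) (x (Suc (2 * i))))) \<in> Q"
proof -
  define act where "act i x \<longleftrightarrow> x (2 * i) \<and> (i \<notin> U \<longrightarrow> x (Suc (2 * i)))" for i and x :: "nat \<Rightarrow> bool"
  \<comment> \<open>Slots in \<open>J\<close> already carry an arbitrary square, the others a single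
    step of \<open>R\<close>. Keeping \<open>e\<close> arbitrary lets the next slot range over all
    its steps.\<close>
  have "J \<subseteq> I \<Longrightarrow> \<forall>e. (\<forall>i\<in>I. e i \<in> R i) \<longrightarrow>
      (\<lambda>x. G (\<lambda>i\<in>I. if i \<in> J then \<beta> i (x (2 * i)) (x (Suc (2 * i)))
         else if act i x then snd (e i) else fst (e i))) \<in> Q"
    if "finite J" for J
    using that
  proof (induction J rule: finite_induct)
    case empty
    then show ?case using std unfolding act_def by (simp only: empty_iff if_False) blast
  next
    case (insert j J)
    have jI: "j \<in> I" using insert.prems by simp
    show ?case
    proof (intro allI impI)
      fix e assume e: "\<forall>i\<in>I. e i \<in> R i"
      define c where "c v x = G (\<lambda>i\<in>I. if i = j then v else if i \<in> J then \<beta> i (x (2 * i)) (x (Suc (2 * i)))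
         else if act i x then snd (e i) else fst (e i))" for v and x :: "nat \<Rightarrow> bool"
      let ?a = "2 * j" and ?b = "Suc (2 * j)"
      have ab: "?a \<noteq> ?b" by simp
      have ind: "indep (c v) ?a" "indep (c v) ?b" for v
        unfolding indep_def c_def act_def
        by (intro allI arg_cong[of _ _ G] restrict_ext; auto; presburger)+
      interpret square_rel "sq c ?a ?b" by (rule square_rel_sq[OF ab ind])
      have "sq c ?a ?b (\<beta> j False False) (\<beta> j False True) (\<beta> j True False) (\<beta> j True True)"
      proof (rule arbitrary_if_connected[where w = "j \<notin> U", OF conn[OF jI] refl[OF jI]])
        show "\<beta> j p q \<in> V j" for p q by (rule V[OF jI])
        show "\<beta> j p False = \<beta> j p True" if "\<not> j \<notin> U" for p using one that by blast
        fix u v assume uv: "(u, v) \<in> R j"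
        have "(\<lambda>x. c (if x ?a \<and> (j \<notin> U \<longrightarrow> x ?b) then v else u) x) = 
          (\<lambda>x. G (\<lambda>i\<in>I. if i \<in> J then \<beta> i (x (2 * i)) (x (Suc (2 * i)))
             else if act i x then snd ((e(j := (u, v))) i) else fst ((e(j := (u, v))) i)))"
          unfolding c_def using insert.hyps(2)
          by (intro ext arg_cong[of _ _ G] restrict_ext) (auto simp: act_def)
        also have "\<dots> \<in> Q"
        proof -
          have "\<forall>i\<in>I. (e(j := (u, v))) i \<in> R i" using e uv by simp
          then show ?thesis using insert.IH insert.prems by blast
        qed
        finally show "E (j \<notin> U) u v" by (subst E_sq_iff[OF ab ind])
      qed
      moreover have "c (if x ?a then if x ?b then \<beta> j True True else \<beta> j True False
          else if x ?b then \<beta> j False True else \<beta> j False False) x =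
        G (\<lambda>i\<in>I. if i \<in> insert j J then \<beta> i (x (2 * i)) (x (Suc (2 * i)))
         else if act i x then snd (e i) else fst (e i))" for x
        unfolding c_def by (intro arg_cong[of _ _ G] restrict_ext) auto
      ultimately show "(\<lambda>x. G (\<lambda>i\<in>I. if i \<in> insert j J then \<beta> i (x (2 * i)) (x (Suc (2 * i)))
         else if act i x then snd (e i) else fst (e i))) \<in> Q"
        unfolding sq_def by simp
    qed
  qed
  from this[OF \<open>finite I\<close> order_refl]
  have *: "(\<lambda>x. G (\<lambda>i\<in>I. if i \<in> I then \<beta> i (x (2 * i)) (x (Suc (2 * i)))
         else if act i x then snd (e i) else fst (e i))) \<in> Q" if "\<forall>i\<in>I. e i \<in> R i" for e using that by blast
  have "(\<beta> i p q, \<beta> i p q) \<in> R i" if "i \<in> I" for i p q using that V refl by blast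
  then show ?thesis using *[of "\<lambda>i. (\<beta> i False False, \<beta> i False False)"] by (simp cong: restrict_cong)
qed

definition gap :: "nat \<Rightarrow> nat set \<Rightarrow> nat \<Rightarrow> nat set" where
  "gap n Z i = {l. l \<le> n \<and> l \<notin> Z \<and> i \<le> l \<and> (\<forall>z\<in>Z. \<not> (i \<le> z \<and> z \<le> l))}"

text \<open>The gap after \<open>z\<close> is indexed by \<open>Suc z\<close>, the gap before the first element of \<open>Z\<close> by \<open>0\<close>.\<close>

definition gaps :: "nat set \<Rightarrow> nat set" where
  "gaps Z = insert 0 (Suc ` Z)"

lemma gap_unique: "i \<in> gaps Z \<Longrightarrow> j \<in> gaps Z \<Longrightarrow> l \<in> gap n Z i \<Longrightarrow> l \<in> gap n Z j \<Longrightarrow> i = j"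
proof (rule ccontr)
  assume *: "i \<in> gaps Z" "j \<in> gaps Z" "l \<in> gap n Z i" "l \<in> gap n Z j" "i \<noteq> j"
  have False if ij: "i < j" "j \<in> gaps Z" "l \<in> gap n Z i" "l \<in> gap n Z j" for i j
  proof -
    obtain z where z: "z \<in> Z" "j = Suc z" using ij(1,2) unfolding gaps_def by auto
    then have "i \<le> z" "z \<le> l" using ij unfolding gap_def by auto
    then show False using ij z unfolding gap_def by blast
  qed
  then show False using * by (meson linorder_neqE_nat)
qed

lemma gap_exists:
  assumes "finite Z" "l \<le> n" "l \<notin> Z" shows "\<exists>i\<in>gaps Z. l \<in> gap n Z i"
proof (cases "{z \<in> Z. z < l} = {}")
  case True
  then have "l \<in> gap n Z 0" using assms unfolding gap_def by (auto simp: nat_less_le)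
  then show ?thesis unfolding gaps_def by blast
next
  case False
  have fin: "finite {z \<in> Z. z < l}" using assms(1) by simp
  define z where "z = Max {z \<in> Z. z < l}"
  have z: "z \<in> Z" "z < l" using Max_in[OF fin False] unfolding z_def by blast+
  have "z' \<le> z" if "z' \<in> Z" "z' \<le> l" for z'
    unfolding z_def by (rule Max_ge[OF fin]) (use that assms(3) in \<open>auto simp: nat_less_le\<close>)
  then have "l \<in> gap n Z (Suc z)" using z assms unfolding gap_def by fastforce
  then show ?thesis using z unfolding gaps_def by blast
qed

lemma gap_between:
  assumes "i \<in> gaps Z" "j \<in> gaps Z" "i \<noteq> j" "t \<in> gap n Z i" "t' \<in> gap n Z j" "t < t'"
  shows "\<exists>z\<in>Z. t < z \<and> z < t'"
proof (rule ccontr)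
  assume no: "\<not> ?thesis"
  have tt: "t \<notin> Z" "t' \<notin> Z" "i \<le> t" "t \<le> n" using assms unfolding gap_def by auto
  have "t' \<notin> gap n Z i" using assms gap_unique by blast
  then obtain z where "z \<in> Z" "i \<le> z" "z \<le> t'" using assms(5) tt assms(6) unfolding gap_def by auto
  then have "z \<le> t" using no tt by (metis not_le nat_less_le)
  then show False using \<open>z \<in> Z\<close> \<open>i \<le> z\<close> assms(4) unfolding gap_def by blast
qed

text \<open>The subsets of a gap are connected by adding one label at a time, and varying at most
  one label in each gap gives a separated pattern, to which \<open>good\<close> applies. So
  \<open>multi_slot\<close> admits an arbitrary square of subsets in every gap; an outermost gap has
  fixed labels on one side only and gets a single coordinate.\<close>

lemma gap_cubes:
  assumes good: "good g {..n}" and Z: "Z \<subseteq> {..n}" "Z \<noteq> {}"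
    and \<beta>: "\<And>i p q. i \<in> gaps Z \<Longrightarrow> \<beta> i p q \<subseteq> gap n Z i"
    and one: "\<And>i p. i = 0 \<or> \<not> (\<exists>z\<in>Z. i \<le> z) \<Longrightarrow> \<beta> i p False = \<beta> i p True"
  shows "(\<lambda>x. g (Z \<union> (\<Union>i\<in>gaps Z. \<beta> i (x (2 * i)) (x (Suc (2 * i)))))) \<in> Q"
proof -
  define U where "U = {i. i = 0 \<or> \<not> (\<exists>z\<in>Z. i \<le> z)}"
  define R where "R i = {(B, B'). B \<subseteq> gap n Z i \<and> B' \<subseteq> gap n Z i \<and> (\<exists>t. B' = insert t B \<or> B' = B)}" for i
  have finZ: "finite Z" using Z(1) finite_subset by blast
  have fing: "finite (gap n Z i)" for i unfolding gap_def by simp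
  have "(\<lambda>x. g (Z \<union> \<Union>((\<lambda>i\<in>gaps Z. \<beta> i (x (2 * i)) (x (Suc (2 * i)))) ` gaps Z))) \<in> Q"
  proof (rule multi_slot[where V = "\<lambda>i. Pow (gap n Z i)" and R = R and U = U and G = "\<lambda>v. g (Z \<union> \<Union>(v ` gaps Z))"])
    show "finite (gaps Z)" using finZ unfolding gaps_def by simp
    show "\<beta> i p q \<in> Pow (gap n Z i)" if "i \<in> gaps Z" for i p q using \<beta>[OF that] by blast
    show "\<beta> i p False = \<beta> i p True" if "i \<in> U" for i p using one that unfolding U_def by blast
    show "(u, u) \<in> R i" if "u \<in> Pow (gap n Z i)" for i u using that unfolding R_def by blast
    show "(u, v) \<in> (R i \<union> (R i)\<inverse>)\<^sup>*" if uv: "u \<in> Pow (gap n Z i)" "v \<in> Pow (gap n Z i)" for i u v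
    proof -
      have e: "({}, B) \<in> (R i \<union> (R i)\<inverse>)\<^sup>*" if "B \<subseteq> gap n Z i" for B
      proof -
        have "finite B" using that fing finite_subset by blast
        then show ?thesis using that
        proof (induction B rule: finite_induct)
          case (insert t B)
          then have "(B, insert t B) \<in> R i \<union> (R i)\<inverse>" unfolding R_def by blast
          with insert show ?case by (meson rtrancl.rtrancl_into_rtrancl insert_subset)
        qed simp
      qed
      have "sym (R i \<union> (R i)\<inverse>)" by (simp add: sym_Un_converse)
      then have "sym ((R i \<union> (R i)\<inverse>)\<^sup>*)" by (rule sym_rtrancl)
      then show ?thesis using e[of u] e[of v] uv by (meson PowD rtrancl_trans symD)
    qed
    fix e assume e: "\<And>i. i \<in> gaps Z \<Longrightarrow> e i \<in> R i"
    let ?act = "\<lambda>i x. x (2 * i) \<and> (i \<notin> U \<longrightarrow> x (Suc (2 * i)))"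
    define Z' where "Z' = Z \<union> (\<Union>i\<in>gaps Z. fst (e i))"
    define T where "T i = snd (e i) - fst (e i)" for i
    define T' where "T' = (\<Union>i\<in>gaps Z. T i)"
    have eg: "fst (e i) \<subseteq> gap n Z i" "snd (e i) = fst (e i) \<union> T i" "T i \<subseteq> gap n Z i" 
       "t \<in> T i \<Longrightarrow> t' \<in> T i \<Longrightarrow> t = t'" if "i \<in> gaps Z" for i t t'
      using e[OF that] unfolding R_def T_def by auto
    have Tn: "t \<notin> Z'" if "t \<in> T i" "i \<in> gaps Z" for t i
    proof
      assume "t \<in> Z'"
      moreover have tg: "t \<in> gap n Z i" using that eg(3) by blast
      then have "t \<notin> Z" unfolding gap_def by auto
      ultimately obtain j where "j \<in> gaps Z" "t \<in> fst (e j)" unfolding Z'_def by blast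
      then have "j = i" using gap_unique[OF _ that(2) _ tg] eg(1) by blast
      then show False using \<open>t \<in> fst (e j)\<close> that(1) unfolding T_def by blast
    qed
    have sepZT: "sep Z' T'" unfolding sep_def
    proof (intro conjI ballI impI)
      have "Z' \<union> T' \<subseteq> {..n}" using Z(1) eg(1,3) unfolding Z'_def T'_def gap_def by auto blast+
      then show "finite (Z' \<union> T')" by (rule finite_subset) simp
      show "Z' \<noteq> {}" using Z(2) unfolding Z'_def by blast
      show "Z' \<inter> T' = {}" using Tn unfolding T'_def by blast
      fix t t' assume "t \<in> T'" "t' \<in> T'" "t < t'"
      then obtain i j where ij: "i \<in> gaps Z" "j \<in> gaps Z" "t \<in> T i" "t' \<in> T j" unfolding T'_def by blast
      then have "i \<noteq> j" using eg(4) \<open>t < t'\<close> by blast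
      then have "\<exists>z\<in>Z. t < z \<and> z < t'" using gap_between ij eg(3) \<open>t < t'\<close> by (meson subsetD)
      then show "\<exists>z\<in>Z'. t < z \<and> z < t'" unfolding Z'_def by blast
    qed
    have sub: "Z' \<union> T' \<subseteq> {..n}" using Z(1) eg(1,3) unfolding Z'_def T'_def gap_def by auto blast+
    define idx where "idx t = (THE i. i \<in> gaps Z \<and> t \<in> gap n Z i)" for t
    have idx: "idx t = i" if "i \<in> gaps Z" "t \<in> gap n Z i" for i t
      unfolding idx_def using that gap_unique by (intro the_equality) blast+
    \<comment> \<open>A varying label reads the coordinates of the gap containing it; in an
      outermost gap both of its places read the same coordinate.\<close>
    let ?y = "\<lambda>x m. if even m then x (2 * idx (m div 2)) else
       if idx (m div 2) \<in> U then x (2 * idx (m div 2)) else x (Suc (2 * idx (m div 2)))"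
    have pres: "pres Z' t (?y x) \<longleftrightarrow> ?act i x" if i: "i \<in> gaps Z" and t: "t \<in> T i" for i t x
    proof -
      have tg: "t \<in> gap n Z i" using eg(3)[OF i] t by blast
      have yt: "?y x (2 * t) = x (2 * i)" "?y x (Suc (2 * t)) = (if i \<in> U then x (2 * i) else x (Suc (2 * i)))"
        using idx[OF i tg] by simp_all
      have "t \<notin> Z'" using Tn t i by blast
      moreover have "Z' \<noteq> {}" using sepZT unfolding sep_def by blast
      ultimately have side: "(\<exists>z\<in>Z'. z < t) \<or> (\<exists>z\<in>Z'. t < z)" by (metis all_not_in_conv linorder_neqE_nat)
      show ?thesis
      proof (cases "i \<in> U")
        case True
        then show ?thesis unfolding pres_def yt using side by auto
      next
        case False
        then obtain z z' where "z \<in> Z" "i = Suc z" "z' \<in> Z" "i \<le> z'" using i unfolding U_def gaps_def by auto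
        then have "z < t" "t < z'" using tg unfolding gap_def by (auto simp: not_le[symmetric])
        then have "\<exists>z\<in>Z'. z < t" "\<exists>z\<in>Z'. t < z" using \<open>z \<in> Z\<close> \<open>z' \<in> Z\<close> unfolding Z'_def by blast+
        then show ?thesis unfolding pres_def yt using False by simp
      qed
    qed
    have "Z \<union> \<Union>((\<lambda>i\<in>gaps Z. if ?act i x then snd (e i) else fst (e i)) ` gaps Z) = cfg Z' T' (?y x)" for x
    proof -
      have "cfg Z' T' (?y x) = Z' \<union> (\<Union>i\<in>gaps Z. {t \<in> T i. ?act i x})"
        unfolding cfg_def T'_def using pres by blast
      also have "\<dots> = Z \<union> (\<Union>i\<in>gaps Z. fst (e i) \<union> {t \<in> T i. ?act i x})" unfolding Z'_def by blast
      also have "(\<Union>i\<in>gaps Z. fst (e i) \<union> {t \<in> T i. ?act i x}) = (\<Union>i\<in>gaps Z. if ?act i x then snd (e i) else fst (e i))"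
        using eg(2) by (intro SUP_cong) auto
      finally show ?thesis by simp
    qed
    note eq = this
    have c: "(\<lambda>x. g (cfg Z' T' x)) \<in> Q" using good sepZT sub unfolding good_def cond_def by blast
    show "(\<lambda>x. g (Z \<union> \<Union>((\<lambda>i\<in>gaps Z. if ?act i x then snd (e i) else fst (e i)) ` gaps Z))) \<in> Q"
    proof (rule subst_eq[where y = ?y, OF c])
      show "(\<lambda>x. ?y x i) \<in> literals" for i by (intro literals_if literals_var)
    qed (rule arg_cong[of _ _ g, OF eq])
  qed
  then show ?thesis by simp
qed

end

section \<open>Degenerable cubes of labels\<close>

text \<open>\<open>degenerable\<close> in boolean coordinates, with the pushforward expressed
  through label functions; see \<open>degenerable_imp_degen\<close> and
  \<open>degen_imp_degenerable\<close>.\<close>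

definition degen :: "nat \<Rightarrow> ((nat \<Rightarrow> bool) \<Rightarrow> nat set) \<Rightarrow> bool" where
  "degen k A \<longleftrightarrow> (\<forall>x. A x \<subseteq> {..k} \<and> A x \<noteq> {}) \<and> (\<forall>x y. (\<forall>i<k. x i = y i) \<longrightarrow> A x = A y) \<and>
     (\<forall>i<k. \<forall>x b. (\<forall>j. j \<noteq> i \<longrightarrow> j \<noteq> Suc i \<longrightarrow> (j \<in> A (x(i := b)) \<longleftrightarrow> j \<in> A x)) \<and>
        (i \<in> A (x(i := b)) \<or> Suc i \<in> A (x(i := b)) \<longleftrightarrow> i \<in> A x \<or> Suc i \<in> A x))"

lemma degenD:
  assumes "degen k A"
  shows "A x \<subseteq> {..k}" "A x \<noteq> {}" "(\<And>i. i < k \<Longrightarrow> x i = y i) \<Longrightarrow> A x = A y"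
    "i < k \<Longrightarrow> j \<noteq> i \<Longrightarrow> j \<noteq> Suc i \<Longrightarrow> j \<in> A (x(i := b)) \<longleftrightarrow> j \<in> A x"
    "i < k \<Longrightarrow> i \<in> A (x(i := b)) \<or> Suc i \<in> A (x(i := b)) \<longleftrightarrow> i \<in> A x \<or> Suc i \<in> A x"
  using assms unfolding degen_def by simp_all

lemma degen_insert:
  assumes "degen k A" "l \<le> k" shows "degen k (\<lambda>x. insert l (A x))"
proof -
  show ?thesis unfolding degen_def
  proof (intro conjI allI impI)
    show "insert l (A x) = insert l (A y)" if "\<forall>i<k. x i = y i" for x y
      using degenD(3)[OF assms(1), of x y] that by simp
    fix i j x b
    assume i: "i < k"
    show "j \<in> insert l (A (x(i := b))) \<longleftrightarrow> j \<in> insert l (A x)" if "j \<noteq> i" "j \<noteq> Suc i"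
      using degenD(4)[OF assms(1) i that] by simp
    show "i \<in> insert l (A (x(i := b))) \<or> Suc i \<in> insert l (A (x(i := b))) \<longleftrightarrow>
        i \<in> insert l (A x) \<or> Suc i \<in> insert l (A x)"
      using degenD(5)[OF assms(1) i, of x b] by (cases "i = l"; cases "Suc i = l") simp_all
  qed (use degenD(1)[OF assms(1)] assms(2) in auto)
qed

lemma degen_label:
  assumes "degen k A" "\<And>i. i < k \<Longrightarrow> i = j \<or> Suc i = j \<Longrightarrow> x i = y i"
  shows "j \<in> A x \<longleftrightarrow> j \<in> A y"
proof (rule depends_only_on[where k = k and D = "{i. i = j \<or> Suc i = j}" and f = "\<lambda>x. j \<in> A x"])
  show "(j \<in> A (x(i := b))) = (j \<in> A x)" if "i < k" "i \<notin> {i. i = j \<or> Suc i = j}" for i x b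
    using degenD(4)[OF assms(1) that(1)] that(2) by auto
  show "(j \<in> A x) = (j \<in> A y)" if "\<And>i. i < k \<Longrightarrow> x i = y i" for x y
    using degenD(3)[OF assms(1), of x y] that by simp
qed (use assms(2) in blast)

text \<open>Label \<open>i\<close> looks at the coordinates \<open>i - 1\<close> and
  \<open>i\<close>, label \<open>i + 1\<close> at \<open>i\<close> and \<open>i + 1\<close>. So a
  point can be assembled from \<open>x\<close> below \<open>i\<close> and \<open>y\<close> from
  \<open>i\<close> on. There label \<open>i\<close> is absent but appears when coordinate
  \<open>i\<close> is switched; as presence of at least one of the two labels does not depend on
  that coordinate, \<open>i + 1\<close> is present.\<close>

lemma degen_present_right:
  assumes d: "degen k A" and i: "i < k" "i \<notin> A (x(i := e))" "i \<in> A (x(i := \<not> e))" and y: "y i = e"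
  shows "Suc i \<in> A y"
proof -
  define m where "m l = (if l < i then x l else y l)" for l
  have "i \<in> A m \<longleftrightarrow> i \<in> A (x(i := e))" by (rule degen_label[OF d]) (use y in \<open>auto simp: m_def\<close>)
  moreover have "i \<in> A (m(i := \<not> e)) \<longleftrightarrow> i \<in> A (x(i := \<not> e))" by (rule degen_label[OF d]) (auto simp: m_def)
  ultimately have "Suc i \<in> A m" using degenD(5)[OF d i(1), of m "\<not> e"] i by blast
  moreover have "Suc i \<in> A m \<longleftrightarrow> Suc i \<in> A y" by (rule degen_label[OF d]) (auto simp: m_def)
  ultimately show ?thesis by blast
qed

lemma degen_present_left:
  assumes d: "degen k A" and i: "i < k" "Suc i \<notin> A (x(i := e))" "Suc i \<in> A (x(i := \<not> e))" and y: "y i = e"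
  shows "i \<in> A y"
proof -
  define m where "m l = (if l > i then x l else y l)" for l
  have "Suc i \<in> A m \<longleftrightarrow> Suc i \<in> A (x(i := e))" by (rule degen_label[OF d]) (use y in \<open>auto simp: m_def\<close>)
  moreover have "Suc i \<in> A (m(i := \<not> e)) \<longleftrightarrow> Suc i \<in> A (x(i := \<not> e))" by (rule degen_label[OF d]) (auto simp: m_def)
  ultimately have "i \<in> A m" using degenD(5)[OF d i(1), of m "\<not> e"] i by blast
  moreover have "i \<in> A m \<longleftrightarrow> i \<in> A y" by (rule degen_label[OF d]) (auto simp: m_def)
  ultimately show ?thesis by blast
qed

lemma influence_values:
  fixes A :: "(nat \<Rightarrow> bool) \<Rightarrow> 'b set"
  assumes "(j \<in> A (x(i := b))) \<noteq> (j \<in> A x)"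
  obtains e where "j \<notin> A (x(i := e))" "j \<in> A (x(i := \<not> e))"
proof -
  have "x i \<noteq> b"
  proof
    assume "x i = b"
    then have "x(i := b) = x" by auto
    then show False using assms by simp
  qed
  then have "x i = (\<not> b)" by simp
  then have "x(i := \<not> b) = x" by (rule fun_upd_idem)
  then show thesis using that[of b] that[of "\<not> b"] assms by auto
qed

context cube_system begin

text \<open>If no coordinate \<open>i\<close> influences both labels \<open>i\<close> and \<open>i + 1\<close>, then a label influenced by a
  coordinate has an omnipresent neighbour on the other side of it, so the cube is a cube of gaps
  between omnipresent labels.\<close>

lemma good_imp_simple_degen:
  assumes good: "good g {..k}" and d: "degen k A"
    and simple: "\<And>i. i < k \<Longrightarrow> (\<forall>x b. i \<in> A (x(i := b)) \<longleftrightarrow> i \<in> A x) \<or> (\<forall>x b. Suc i \<in> A (x(i := b)) \<longleftrightarrow> Suc i \<in> A x)"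
  shows "(\<lambda>x. g (A x)) \<in> Q"
proof -
  define Z where "Z = {l. \<forall>x. l \<in> A x}"
  have Zk: "Z \<subseteq> {..k}" using degenD(1)[OF d] unfolding Z_def by blast
  have right: "Suc i \<in> Z" if i: "i < k" "(i \<in> A (x(i := b))) \<noteq> (i \<in> A x)" for i x b
  proof -
    obtain e where "i \<notin> A (x(i := e))" "i \<in> A (x(i := \<not> e))" using influence_values i(2) .
    then have r: "Suc i \<in> A y" if "y i = e" for y using degen_present_right[OF d i(1)] that by blast
    have "\<forall>x b. Suc i \<in> A (x(i := b)) \<longleftrightarrow> Suc i \<in> A x" using simple[OF i(1)] i(2) by blast
    then have "Suc i \<in> A y" for y using r[of "y(i := e)"] by simp
    then show ?thesis unfolding Z_def by blast
  qed
  have left: "i \<in> Z" if i: "i < k" "(Suc i \<in> A (x(i := b))) \<noteq> (Suc i \<in> A x)" for i x b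
  proof -
    obtain e where "Suc i \<notin> A (x(i := e))" "Suc i \<in> A (x(i := \<not> e))" using influence_values i(2) .
    then have r: "i \<in> A y" if "y i = e" for y using degen_present_left[OF d i(1)] that by blast
    have "\<forall>x b. i \<in> A (x(i := b)) \<longleftrightarrow> i \<in> A x" using simple[OF i(1)] i(2) by blast
    then have "i \<in> A y" for y using r[of "y(i := e)"] by simp
    then show ?thesis unfolding Z_def by blast
  qed
  have dep: "l \<in> A x \<longleftrightarrow> l \<in> A y"
    if "\<And>i. i < k \<Longrightarrow> Suc i = l \<Longrightarrow> i \<in> Z \<Longrightarrow> x i = y i" "l < k \<Longrightarrow> Suc l \<in> Z \<Longrightarrow> x l = y l" for l x y
  proof (rule depends_only_on[where k = k and D = "{i. Suc i = l \<and> i \<in> Z \<or> i = l \<and> Suc l \<in> Z}" and f = "\<lambda>x. l \<in> A x"])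
    show "(l \<in> A (x(i := b))) = (l \<in> A x)" if "i < k" "i \<notin> {i. Suc i = l \<and> i \<in> Z \<or> i = l \<and> Suc l \<in> Z}" for i x b
      using degenD(4)[OF d that(1), of l x b] left[OF that(1), of x b] right[OF that(1), of x b] that(2) by auto
    show "(l \<in> A x) = (l \<in> A y)" if "\<And>i. i < k \<Longrightarrow> x i = y i" for x y
      using degenD(3)[OF d, of x y] that by simp
  qed (use that in blast)
  show ?thesis
  proof (cases "Z = {}")
    case True
    have const: "A x = A y" for x y using dep[of _ x y] True by blast
    let ?B = "A (\<lambda>_. False)"
    have "sep ?B {}" unfolding sep_def using degenD(1,2)[OF d] by (auto intro: finite_subset)
    then have "cond g ?B {}" using good degenD(1)[OF d] unfolding good_def by blast
    then have "(\<lambda>x. g ?B) \<in> Q" unfolding cond_def cfg_def by simp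
    moreover have "(\<lambda>x. g ?B) = (\<lambda>x. g (A x))" by (intro ext arg_cong[of _ _ g] const)
    ultimately show ?thesis by (simp only:)
  next
    case False
    \<comment> \<open>The gap from \<open>i\<close> to \<open>hi i - 1\<close> sees only the
      coordinates \<open>i - 1\<close> and \<open>hi i - 1\<close>, next to its bounding labels.
      \<open>pt\<close> puts \<open>p\<close> at the first of these and \<open>q\<close> elsewhere;
      an outermost gap sees one coordinate, and there \<open>p\<close> is put everywhere.\<close>
    define hi where "hi i = (LEAST z. z \<in> Z \<and> i \<le> z)" for i
    define pt where "pt i p q = (\<lambda>c. if i = 0 then p else if (\<exists>z\<in>Z. i \<le> z) \<and> c \<noteq> i - 1 then q else p)" for i :: nat and p q :: bool
    define \<beta> where "\<beta> i p q = A (pt i p q) \<inter> gap k Z i" for i p q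
    \<comment> \<open>Slot coordinate \<open>2 * i\<close> stands for \<open>i - 1\<close> and
      \<open>Suc (2 * i)\<close> for \<open>hi i - 1\<close>. The first gap has no coordinate to its
      left and uses \<open>hi 0 - 1\<close> instead.\<close>
    define y where "y x m = (if even m then if m = 0 then x (hi 0 - 1) else x (m div 2 - 1) else x (hi (m div 2) - 1))"
      for x :: "nat \<Rightarrow> bool" and m
    have c: "(\<lambda>x. g (Z \<union> (\<Union>i\<in>gaps Z. \<beta> i (x (2 * i)) (x (Suc (2 * i)))))) \<in> Q"
      by (rule gap_cubes[OF good Zk False]) (auto simp: \<beta>_def pt_def)
    have eq: "l \<in> A (pt i (y x (2 * i)) (y x (Suc (2 * i)))) \<longleftrightarrow> l \<in> A x" if l: "l \<in> gap k Z i" for l i x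
    proof (rule dep)
      have li: "i \<le> l" "l \<notin> Z" "\<And>z. z \<in> Z \<Longrightarrow> i \<le> z \<Longrightarrow> l < z" using l unfolding gap_def by (auto simp: not_le[symmetric])
      show "pt i (y x (2 * i)) (y x (Suc (2 * i))) j = x j" if "Suc j = l" "j \<in> Z" for j
      proof -
        have "\<not> i \<le> j" using li(3)[OF \<open>j \<in> Z\<close>] that(1) by auto
        then have "i = l" using li(1) that(1) by simp
        then show ?thesis using that unfolding pt_def y_def by auto
      qed
      show "pt i (y x (2 * i)) (y x (Suc (2 * i))) l = x l" if "Suc l \<in> Z"
      proof -
        have "hi i = Suc l" unfolding hi_def
        proof (rule Least_equality)
          show "Suc l \<in> Z \<and> i \<le> Suc l" using that li(1) by simp
          show "Suc l \<le> z" if "z \<in> Z \<and> i \<le> z" for z using li(3)[of z] that by simp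
        qed
        moreover have "\<exists>z\<in>Z. i \<le> z" using that li(1) by (intro bexI[of _ "Suc l"]) auto
        ultimately show ?thesis using li(1) unfolding pt_def y_def by auto
      qed
    qed
    have "A x = Z \<union> (\<Union>i\<in>gaps Z. \<beta> i (y x (2 * i)) (y x (Suc (2 * i))))" for x
    proof -
      have ZA: "Z \<subseteq> A x" unfolding Z_def by blast
      have "l \<in> \<beta> i (y x (2 * i)) (y x (Suc (2 * i))) \<longleftrightarrow> l \<in> A x \<inter> gap k Z i" for l i
        using eq[of l i x] unfolding \<beta>_def by auto
      then have "\<beta> i (y x (2 * i)) (y x (Suc (2 * i))) = A x \<inter> gap k Z i" for i by blast
      moreover have "A x \<subseteq> Z \<union> (\<Union>i\<in>gaps Z. gap k Z i)"
        using gap_exists[OF finite_subset[OF Zk], of _ k] degenD(1)[OF d, of x] by blast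
      ultimately show ?thesis using ZA by auto
    qed
    note eq' = this
    show ?thesis
    proof (rule subst_eq[where y = y, OF c])
      show "(\<lambda>x. y x i) \<in> literals" for i unfolding y_def by (intro literals_if literals_var)
      show "g (A x) = g (Z \<union> (\<Union>i\<in>gaps Z. \<beta> i (y x (2 * i)) (y x (Suc (2 * i)))))" for x
        by (rule arg_cong[of _ _ g, OF eq'])
    qed
  qed
qed

text \<open>A coordinate \<open>i\<close> that influences both labels is removed by inserting, half way, the cube in
  which both labels are present.\<close>

lemma good_imp_degen:
  assumes good: "good g {..k}" and d: "degen k A"
  shows "(\<lambda>x. g (A x)) \<in> Q"
  using d
proof (induction "card {l. l \<le> k \<and> (\<exists>x. l \<notin> A x)}" arbitrary: A rule: less_induct)
  case less
  note d = less.prems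
  let ?N = "\<lambda>A. {l. l \<le> k \<and> (\<exists>x::nat \<Rightarrow> bool. l \<notin> A x)}"
  show ?case
  proof (cases "\<forall>i<k. (\<forall>x b. i \<in> A (x(i := b)) \<longleftrightarrow> i \<in> A x) \<or> (\<forall>x b. Suc i \<in> A (x(i := b)) \<longleftrightarrow> Suc i \<in> A x)")
    case True
    then show ?thesis by (intro good_imp_simple_degen[OF good d]) blast
  next
    case False
    then obtain i x b y b' where i: "i < k" "(i \<in> A (x(i := b))) \<noteq> (i \<in> A x)"
      "(Suc i \<in> A (y(i := b'))) \<noteq> (Suc i \<in> A y)" by blast
    obtain e where e: "i \<notin> A (x(i := e))" "i \<in> A (x(i := \<not> e))" using influence_values i(2) .
    obtain f where f: "Suc i \<notin> A (y(i := f))" "Suc i \<in> A (y(i := \<not> f))" using influence_values i(3) .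
    have r: "Suc i \<in> A z" if "z i = e" for z by (rule degen_present_right[where A = A and i = i and y = z and x = x and e = e, OF d i(1) e that])
    \<comment> \<open>The two labels are absent on opposite faces: \<open>i\<close> only where the
      coordinate is \<open>e\<close>, \<open>i + 1\<close> only where it is not.\<close>
    have "f = (\<not> e)" using r[of "y(i := f)"] f(1) by (cases e; cases f) simp_all
    then have f': "Suc i \<notin> A (y(i := \<not> e))" "Suc i \<in> A (y(i := \<not> \<not> e))" using f by simp_all
    have l: "i \<in> A z" if "z i = (\<not> e)" for z by (rule degen_present_left[where A = A and i = i and y = z and x = y and e = "\<not> e", OF d i(1) f' that])
    have IH: "(\<lambda>x. g (insert j (A x))) \<in> Q" if j: "j \<le> k" "j \<notin> A z" for j z
    proof (rule less.hyps)
      show "degen k (\<lambda>x. insert j (A x))" by (rule degen_insert[OF d j(1)])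
      show "card (?N (\<lambda>x. insert j (A x))) < card (?N A)"
        by (rule psubset_card_mono) (use j in auto)
    qed
    let ?c0 = "\<lambda>z. g (A (z(i := \<not> e)))" and ?c1 = "\<lambda>z. g (insert i (insert (Suc i) (A z)))" and ?c2 = "\<lambda>z. g (A (z(i := e)))"
    have upd: "insert i (insert (Suc i) (A (z(i := b)))) = insert i (insert (Suc i) (A z))" for z b
      using degenD(4)[OF d i(1), of _ z b] by blast
    \<comment> \<open>Adding label \<open>i\<close> changes the cube on the face \<open>e\<close>
      only, adding \<open>i + 1\<close> changes it on the opposite face only. The two results share
      the face \<open>?c1\<close> with both labels present and glue back to
      \<open>A\<close>.\<close>
    have A1: "g (insert i (A z)) = (if z i = e then ?c1 z else ?c0 z)" for z
    proof (cases "z i = e")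
      case True then show ?thesis using r[of z] by (simp add: insert_absorb)
    next
      case False
      then have "z(i := \<not> e) = z" by (intro fun_upd_idem) simp
      then show ?thesis using False l[of z] by (simp add: insert_absorb)
    qed
    have A2: "g (insert (Suc i) (A z)) = (if z i = e then ?c2 z else ?c1 z)" for z
    proof (cases "z i = e")
      case True 
      then have "z(i := e) = z" by (rule fun_upd_idem)
      then show ?thesis using True r[of z] by (simp add: insert_absorb)
    next
      case False
      then show ?thesis using l[of z] by (simp add: insert_absorb insert_commute[of i])
    qed
    have A: "g (A z) = (if z i = e then ?c2 z else ?c0 z)" for z
    proof (cases "z i = e")
      case True 
      then have "z(i := e) = z" by (rule fun_upd_idem)
      then show ?thesis using True by simp
    next
      case False
      then have "z(i := \<not> e) = z" by (intro fun_upd_idem) simp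
      then show ?thesis using False by simp
    qed
    have Q1: "(\<lambda>z. if z i = e then ?c1 z else ?c0 z) \<in> Q"
      using IH[of i, OF _ e(1)] i(1) unfolding A1 by simp
    have Q2: "(\<lambda>z. if z i = e then ?c2 z else ?c1 z) \<in> Q"
      using IH[of "Suc i", OF _ f(1)] i(1) unfolding A2 by simp
    have ind: "indep ?c0 i" "indep ?c1 i" "indep ?c2 i" unfolding indep_def by (simp_all add: upd)
    have "(\<lambda>z. if z i = e then ?c2 z else ?c0 z) \<in> Q"
    proof (cases e)
      case True
      then show ?thesis using glue[OF _ _ ind] Q1 Q2 by simp
    next
      case False
      have "(\<lambda>z. if z i = e then ?c1 z else ?c0 z) = (\<lambda>z. if z i then ?c0 z else ?c1 z)"
        "(\<lambda>z. if z i = e then ?c2 z else ?c1 z) = (\<lambda>z. if z i then ?c1 z else ?c2 z)"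
        using False by auto
      then have "(\<lambda>z. if z i then ?c0 z else ?c1 z) \<in> Q" "(\<lambda>z. if z i then ?c1 z else ?c2 z) \<in> Q"
        using Q1 Q2 by (simp_all only:)
      then have "(\<lambda>z. if z i then ?c0 z else ?c2 z) \<in> Q" using glue[OF _ _ ind(3,2,1)] by blast
      moreover have "(\<lambda>z. if z i then ?c0 z else ?c2 z) = (\<lambda>z. if z i = e then ?c2 z else ?c0 z)" using False by auto
      ultimately show ?thesis by simp
    qed
    moreover have "(\<lambda>z. g (A z)) = (\<lambda>z. if z i = e then ?c2 z else ?c0 z)" by (rule ext) (rule A)
    ultimately show ?thesis by (simp only:)
  qed
qed

text \<open>Varying labels whose image meets that of \<open>Z\<close> become permanently present. On
  the others the map is injective: a fixed label between two labels with the same image would have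
  that image as well. So a pushed test cube is again a test cube, up to renaming of
  coordinates.\<close>

lemma good_push:
  assumes good: "good g {..n}" and mono: "mono_on {..k} \<sigma>" and im: "\<sigma> ` {..k} \<subseteq> {..n}"
  shows "good (\<lambda>B. g (\<sigma> ` B)) {..k}"
  unfolding good_def
proof (intro allI impI)
  fix Z T assume sep: "sep Z T" and sub: "Z \<union> T \<subseteq> {..k}"
  define T1 where "T1 = {t \<in> T. \<sigma> t \<notin> \<sigma> ` Z}"
  have lt: "a < b" if "\<sigma> a < \<sigma> b" "a \<le> k" "b \<le> k" for a b
    using mono that unfolding mono_on_def by (metis atMost_iff leD not_le)
  have le: "\<sigma> a \<le> \<sigma> b" if "a \<le> b" "b \<le> k" for a b
    using mono that unfolding mono_on_def by simp
  have in_k: "t \<in> T \<Longrightarrow> t \<le> k" "z \<in> Z \<Longrightarrow> z \<le> k" for t z using sub by auto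
  have T1D: "t \<in> T" "\<sigma> t \<notin> \<sigma> ` Z" if "t \<in> T1" for t using that unfolding T1_def by auto
  have inj: "t = t'" if "t \<in> T1" "t' \<in> T" "\<sigma> t = \<sigma> t'" for t t'
  proof (rule ccontr)
    assume "t \<noteq> t'"
    have tT: "t \<in> T" using that T1D by blast
    have "\<exists>z\<in>Z. min t t' < z \<and> z < max t t'"
    proof (cases "t < t'")
      case True
      then show ?thesis using sepD(5)[OF sep tT that(2)] by simp
    next
      case False
      then show ?thesis using sepD(5)[OF sep that(2) tT] \<open>t \<noteq> t'\<close> by simp
    qed
    then obtain z where z: "z \<in> Z" "min t t' < z" "z < max t t'" by blast
    have "\<sigma> (min t t') \<le> \<sigma> z" "\<sigma> z \<le> \<sigma> (max t t')"
      using le[of "min t t'" z] le[of z "max t t'"] in_k[of t] in_k[of t'] in_k(2)[of z] z tT that(2) by auto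
    then have "\<sigma> z = \<sigma> t" using that(3) by (auto simp: min_def max_def split: if_splits)
    then have "\<sigma> t \<in> \<sigma> ` Z" using z(1) by (metis imageI)
    then show False using T1D[OF that(1)] by blast
  qed
  have sep1: "sep (\<sigma> ` Z) (\<sigma> ` T1)" unfolding sep_def
  proof (intro conjI ballI impI)
    show "finite (\<sigma> ` Z \<union> \<sigma> ` T1)" using sepD(1,2)[OF sep] unfolding T1_def by simp
    show "\<sigma> ` Z \<noteq> {}" using sepD(3)[OF sep] by simp
    show "\<sigma> ` Z \<inter> \<sigma> ` T1 = {}"
    proof (rule equals0I)
      fix s assume s: "s \<in> \<sigma> ` Z \<inter> \<sigma> ` T1"
      then obtain t where "t \<in> T1" "s = \<sigma> t" by (elim IntE imageE)
      then show False using T1D(2) s by simp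
    qed
    fix a b assume "a \<in> \<sigma> ` T1" "b \<in> \<sigma> ` T1" "a < b"
    then obtain t t' where t: "t \<in> T1" "t' \<in> T1" "a = \<sigma> t" "b = \<sigma> t'" by (elim imageE)
    have tk: "t \<in> T" "t' \<in> T" "t \<le> k" "t' \<le> k" using T1D(1)[OF t(1)] T1D(1)[OF t(2)] in_k(1) by simp_all
    then have "t < t'" using lt[of t t'] \<open>a < b\<close> t(3,4) by simp
    then obtain z where z: "z \<in> Z" "t < z" "z < t'" using sepD(5)[OF sep tk(1,2)] by blast
    then have "a \<le> \<sigma> z" "\<sigma> z \<le> b" using le[of t z] le[of z t'] t(3,4) tk by simp_all
    moreover have "\<sigma> z \<in> \<sigma> ` Z" using z(1) by (rule imageI)
    then have "a \<noteq> \<sigma> z" "\<sigma> z \<noteq> b" using t T1D(2) by metis+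
    ultimately show "\<exists>z\<in>\<sigma> ` Z. a < z \<and> z < b" using z(1) by (intro bexI[of _ "\<sigma> z"]) auto
  qed
  define \<tau> where "\<tau> s = (THE t. t \<in> T1 \<and> \<sigma> t = s)" for s
  have \<tau>: "\<tau> (\<sigma> t) = t" if "t \<in> T1" for t
    unfolding \<tau>_def by (rule the_equality) (use that inj[OF _ T1D(1)[OF that]] in auto)
  define y where "y x m = (if even m then x (2 * \<tau> (m div 2)) else x (Suc (2 * \<tau> (m div 2))))"
    for x :: "nat \<Rightarrow> bool" and m
  have pres: "pres (\<sigma> ` Z) (\<sigma> t) (y x) \<longleftrightarrow> pres Z t x" if t: "t \<in> T1" for t x
  proof -
    have neq: "\<sigma> z \<noteq> \<sigma> t" if "z \<in> Z" for z using T1D(2)[OF t] that by (metis imageI)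
    have tk: "t \<le> k" using in_k(1)[OF T1D(1)[OF t]] .
    have "\<sigma> z < \<sigma> t \<longleftrightarrow> z < t" "\<sigma> t < \<sigma> z \<longleftrightarrow> t < z" if "z \<in> Z" for z
      using le[of z t] le[of t z] lt[of z t] lt[of t z] neq[OF that] in_k(2)[OF that] tk
      by linarith+
    then have "(\<exists>z\<in>\<sigma> ` Z. z < \<sigma> t) \<longleftrightarrow> (\<exists>z\<in>Z. z < t)" "(\<exists>z\<in>\<sigma> ` Z. \<sigma> t < z) \<longleftrightarrow> (\<exists>z\<in>Z. t < z)" by auto
    then show ?thesis unfolding pres_def y_def using \<tau>[OF t] by simp
  qed
  have eq: "cfg (\<sigma> ` Z) (\<sigma> ` T1) (y x) = \<sigma> ` cfg Z T x" for x
  proof -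
    have "{s \<in> \<sigma> ` T1. pres (\<sigma> ` Z) s (y x)} = \<sigma> ` {t \<in> T1. pres Z t x}"
      using pres[of _ x] by auto
    then have "cfg (\<sigma> ` Z) (\<sigma> ` T1) (y x) = \<sigma> ` Z \<union> \<sigma> ` {t \<in> T1. pres Z t x}"
      unfolding cfg_def by simp
    also have "\<dots> = \<sigma> ` cfg Z T x" unfolding cfg_def T1_def by auto
    finally show ?thesis .
  qed
  have "\<sigma> ` Z \<union> \<sigma> ` T1 \<subseteq> {..n}" using im sub unfolding T1_def by auto
  then have "cond g (\<sigma> ` Z) (\<sigma> ` T1)" using good sep1 unfolding good_def by blast
  then show "cond (\<lambda>B. g (\<sigma> ` B)) Z T" unfolding cond_def
  proof (rule subst_eq[where y = y])
    show "(\<lambda>x. y x i) \<in> literals" for i unfolding y_def by (intro literals_if literals_var)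
    show "g (\<sigma> ` cfg Z T x) = g (cfg (\<sigma> ` Z) (\<sigma> ` T1) (y x))" for x
      by (rule arg_cong[of _ _ g, OF eq[symmetric]])
  qed
qed

end

section \<open>Homotopy groups in terms of top vertices\<close>

text \<open>\<open>\<sigma>\<close> enumerates \<open>Z \<union> T\<close>. By separation, one of
  any two consecutive labels is fixed, and this makes the cube on the positions degenerable. Hence
  test cubes belong to \<open>K\<close>, and goodness is necessary for a simplex.\<close>

lemma cfg_eq_degen:
  assumes sep: "sep Z T" and sub: "Z \<union> T \<subseteq> {..n}"
  obtains k \<sigma> A y where "mono_on {..k} \<sigma>" "\<sigma> ` {..k} \<subseteq> {..n}" "degen k A"
    "\<And>i. (\<lambda>x. y x i) \<in> literals" "\<And>x. cfg Z T x = \<sigma> ` A (y x)"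
proof -
  let ?S = "Z \<union> T"
  have fin: "finite ?S" "?S \<noteq> {}" using sepD[OF sep] by auto
  define k where "k = card ?S - 1"
  have ck: "card ?S = Suc k" using fin unfolding k_def by (simp add: card_gt_0_iff)
  define \<sigma> where "\<sigma> i = sorted_list_of_set ?S ! i" for i
  have mono: "\<sigma> i < \<sigma> j" if "i < j" "j \<le> k" for i j
    using that ck fin unfolding \<sigma>_def by (intro sorted_wrt_nth_less[OF strict_sorted_list_of_set]) auto
  have im: "\<sigma> ` {..k} = ?S"
  proof -
    have "\<sigma> ` {..k} = set (sorted_list_of_set ?S)"
      unfolding \<sigma>_def set_conv_nth using ck by (auto simp: less_Suc_eq_le)
    then show ?thesis using fin by simp
  qed
  have \<sigma>S: "\<sigma> i \<in> Z \<or> \<sigma> i \<in> T" if "i \<le> k" for i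
  proof -
    have "\<sigma> i \<in> \<sigma> ` {..k}" using that by simp
    then show ?thesis unfolding im by simp
  qed
  have disj: "\<sigma> i \<notin> Z" if "\<sigma> i \<in> T" for i using sepD(4)[OF sep that] .
  have lt_iff: "\<sigma> i < \<sigma> j \<longleftrightarrow> i < j" if "i \<le> k" "j \<le> k" for i j
    using mono[of i j] mono[of j i] that by (metis linorder_neqE_nat less_asym less_irrefl)
  have adj: "\<sigma> i \<in> Z \<or> \<sigma> (Suc i) \<in> Z" if ik: "i < k" for i
  proof (rule ccontr)
    assume "\<not> ?thesis"
    then have "\<sigma> i \<in> T" "\<sigma> (Suc i) \<in> T" using \<sigma>S[of i] \<sigma>S[of "Suc i"] ik by auto
    then obtain z where z: "z \<in> Z" "\<sigma> i < z" "z < \<sigma> (Suc i)"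
      using sepD(5)[OF sep _ _ mono[of i "Suc i"]] ik by auto
    then have "z \<in> \<sigma> ` {..k}" unfolding im by simp
    then obtain j where "j \<le> k" "z = \<sigma> j" by auto
    then show False using z(2,3) lt_iff[of i j] lt_iff[of j "Suc i"] ik by auto
  qed
  define A where "A w = {i. i \<le> k \<and> (\<sigma> i \<in> Z \<or> (0 < i \<longrightarrow> w (i - 1)) \<and> (i < k \<longrightarrow> w i))}" for w :: "nat \<Rightarrow> bool"
  \<comment> \<open>The coordinate between the positions \<open>i\<close> and \<open>i + 1\<close>
    belongs to whichever of the two labels varies, as its right or its left side.\<close>
  define y where "y x i = (if \<sigma> i \<in> T then x (Suc (2 * \<sigma> i)) else x (2 * \<sigma> (Suc i)))" for x :: "nat \<Rightarrow> bool" and i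
  show thesis
  proof (rule that)
    show "mono_on {..k} \<sigma>" unfolding mono_on_def using mono by (metis atMost_iff le_neq_implies_less less_imp_le order_refl)
    show "\<sigma> ` {..k} \<subseteq> {..n}" using im sub by simp
    show "(\<lambda>x. y x i) \<in> literals" for i unfolding y_def by (intro literals_if literals_var)
    show "degen k A" unfolding degen_def
    proof (intro conjI allI impI)
      obtain z where "z \<in> Z" using sepD(3)[OF sep] by blast
      then have "z \<in> \<sigma> ` {..k}" unfolding im by simp
      then obtain i where "i \<le> k" "\<sigma> i = z" by auto
      then have "i \<in> A x" for x using \<open>z \<in> Z\<close> unfolding A_def by simp
      then show "A x \<noteq> {}" for x by blast
      show "A x = A x'" if "\<forall>i<k. x i = x' i" for x x' using that unfolding A_def by auto
      fix i x b assume i: "i < k"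
      show "j \<in> A (x(i := b)) \<longleftrightarrow> j \<in> A x" if "j \<noteq> i" "j \<noteq> Suc i" for j
        using that unfolding A_def by auto
      have "i \<in> A x \<or> Suc i \<in> A x" for x using adj[OF i] i unfolding A_def by auto
      then show "i \<in> A (x(i := b)) \<or> Suc i \<in> A (x(i := b)) \<longleftrightarrow> i \<in> A x \<or> Suc i \<in> A x" by blast
    qed (auto simp: A_def)
    fix x
    have pres: "pres Z (\<sigma> i) x \<longleftrightarrow> (0 < i \<longrightarrow> y x (i - 1)) \<and> (i < k \<longrightarrow> y x i)" if i: "i \<le> k" "\<sigma> i \<in> T" for i
    proof -
      have lower: "(\<exists>z\<in>Z. z < \<sigma> i) \<longleftrightarrow> 0 < i"
      proof
        assume "\<exists>z\<in>Z. z < \<sigma> i"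
        then obtain z where z: "z \<in> Z" "z < \<sigma> i" by blast
        then have "z \<in> \<sigma> ` {..k}" unfolding im by simp
        then obtain j where "j \<le> k" "z = \<sigma> j" by auto
        then show "0 < i" using z lt_iff[of j i] i by simp
      next
        assume "0 < i"
        then have "\<sigma> (i - 1) \<in> Z" using adj[of "i - 1"] disj[OF i(2)] i by simp
        moreover have "\<sigma> (i - 1) < \<sigma> i" using mono[of "i - 1" i] i \<open>0 < i\<close> by simp
        ultimately show "\<exists>z\<in>Z. z < \<sigma> i" by blast
      qed
      have upper: "(\<exists>z\<in>Z. \<sigma> i < z) \<longleftrightarrow> i < k"
      proof
        assume "\<exists>z\<in>Z. \<sigma> i < z"
        then obtain z where z: "z \<in> Z" "\<sigma> i < z" by blast
        then have "z \<in> \<sigma> ` {..k}" unfolding im by simp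
        then obtain j where "j \<le> k" "z = \<sigma> j" by auto
        then show "i < k" using z lt_iff[of i j] i by simp
      next
        assume "i < k"
        then have "\<sigma> (Suc i) \<in> Z" using adj[of i] disj[OF i(2)] by simp
        moreover have "\<sigma> i < \<sigma> (Suc i)" using mono[of i "Suc i"] \<open>i < k\<close> by simp
        ultimately show "\<exists>z\<in>Z. \<sigma> i < z" by blast
      qed
      have "y x (i - 1) = x (2 * \<sigma> i)" if "0 < i"
      proof -
        have "\<sigma> (i - 1) \<in> Z" using adj[of "i - 1"] disj[OF i(2)] i that by simp
        then show ?thesis using disj[of "i - 1"] that unfolding y_def by auto
      qed
      moreover have "y x i = x (Suc (2 * \<sigma> i))" using i unfolding y_def by simp
      ultimately show ?thesis unfolding pres_def lower upper by simp
    qed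
    have "\<sigma> ` A (y x) = {s \<in> \<sigma> ` {..k}. s \<in> Z \<or> s \<in> T \<and> pres Z s x}"
    proof -
      have "A (y x) = {i \<in> {..k}. \<sigma> i \<in> Z \<or> \<sigma> i \<in> T \<and> pres Z (\<sigma> i) x}"
        unfolding A_def using pres \<sigma>S disj by fastforce
      then show ?thesis by auto
    qed
    also have "\<dots> = cfg Z T x" unfolding im cfg_def by auto
    finally show "cfg Z T x = \<sigma> ` A (y x)" by simp
  qed
qed

lemma (in cube_system) goodI_degen:
  assumes "\<And>k \<sigma> A. mono_on {..k} \<sigma> \<Longrightarrow> \<sigma> ` {..k} \<subseteq> {..n} \<Longrightarrow> degen k A \<Longrightarrow> (\<lambda>x. g (\<sigma> ` A x)) \<in> Q"
  shows "good g {..n}"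
  unfolding good_def
proof (intro allI impI)
  fix Z T assume "sep Z T" "Z \<union> T \<subseteq> {..n}"
  then obtain k \<sigma> A y where *: "mono_on {..k} \<sigma>" "\<sigma> ` {..k} \<subseteq> {..n}" "degen k A"
    "\<And>i. (\<lambda>x. y x i) \<in> literals" "\<And>x. cfg Z T x = \<sigma> ` A (y x)" by (rule cfg_eq_degen) blast
  show "cond g Z T" unfolding cond_def
    by (rule subst_eq[where y = y, OF assms[OF *(1-3)] *(4)]) (rule arg_cong[of _ _ g, OF *(5)])
qed

context cube_system begin

text \<open>The coordinates on which a cube of labels depends inject into the labels other than the
  smallest one.\<close>

lemma card_coords:
  assumes sep: "sep Z T"
  defines "W \<equiv> (\<lambda>t. 2 * t) ` {t \<in> T. \<exists>z\<in>Z. z < t} \<union> (\<lambda>t. Suc (2 * t)) ` {t \<in> T. \<exists>z\<in>Z. t < z}"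
  shows "finite W" "Suc (card W) \<le> card (Z \<union> T)"
proof -
  have fin: "finite Z" "finite T" "Z \<noteq> {}" using sepD[OF sep] by auto
  show finW: "finite W" unfolding W_def using fin by simp
  define nxt where "nxt t = Min {z \<in> Z. t < z}" for t
  have nx: "nxt t \<in> Z" "t < nxt t" "\<And>z'. z' \<in> Z \<Longrightarrow> t < z' \<Longrightarrow> nxt t \<le> z'" if "\<exists>z\<in>Z. t < z" for t
  proof -
    have f: "finite {z \<in> Z. t < z}" "{z \<in> Z. t < z} \<noteq> {}" using fin that by auto
    show "nxt t \<in> Z" "t < nxt t" using Min_in[OF f] unfolding nxt_def by auto
    show "nxt t \<le> z'" if "z' \<in> Z" "t < z'" for z' unfolding nxt_def using f(1) that by (intro Min_le) auto
  qed
  \<comment> \<open>A left coordinate is sent to its own label, a right one to the next fixed label.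
    Distinct varying labels have distinct next fixed labels because they are separated, and every
    value has a smaller label below it.\<close>
  define f where "f w = (if even w then w div 2 else nxt (w div 2))" for w
  let ?m = "Min (Z \<union> T)"
  have m: "?m \<le> a" if "a \<in> Z \<union> T" for a by (rule Min_le) (use fin that in auto)
  have "inj_on f W"
  proof (rule inj_onI)
    fix v w assume v: "v \<in> W" and w: "w \<in> W" and eq: "f v = f w"
    have cases: "(\<exists>t\<in>T. u = 2 * t \<and> f u = t) \<or> (\<exists>t\<in>T. u = Suc (2 * t) \<and> (\<exists>z\<in>Z. t < z) \<and> f u = nxt t)" if "u \<in> W" for u
      using that unfolding W_def f_def by auto
    have ne: "t \<noteq> nxt s" if "t \<in> T" "\<exists>z\<in>Z. s < z" for t s
      using nx(1)[of s] sepD(4)[OF sep that(1)] that(2) by auto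
    have nlt: "nxt t < nxt s" if ts: "t \<in> T" "s \<in> T" "t < s" "\<exists>z\<in>Z. s < z" for s t
    proof -
      obtain z where "z \<in> Z" "t < z" "z < s" using sepD(5)[OF sep ts(1-3)] by blast
      then have "nxt t \<le> z" using nx(3)[of t z] by blast
      then show ?thesis using \<open>z < s\<close> nx(2)[OF ts(4)] by simp
    qed
    from cases[OF v] cases[OF w] show "v = w"
    proof (elim disjE bexE conjE, goal_cases)
      case (4 t s z' z)
      then show ?case using nlt[of t s] nlt[of s t] eq by (cases t s rule: linorder_cases) auto
    qed (use eq ne in metis)+
  qed
  moreover have "f ` W \<subseteq> (Z \<union> T) - {?m}"
  proof
    fix a assume "a \<in> f ` W"
    then have "(\<exists>t\<in>T. \<exists>z\<in>Z. z < t \<and> a = t) \<or> (\<exists>t\<in>T. (\<exists>z\<in>Z. t < z) \<and> a = nxt t)"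
      unfolding W_def f_def by auto
    then consider t z where "t \<in> T" "z \<in> Z" "z < t" "a = t" | t where "t \<in> T" "\<exists>z\<in>Z. t < z" "a = nxt t"
      by blast
    then show "a \<in> (Z \<union> T) - {?m}"
    proof cases
      case 1
      then show ?thesis using m[of z] by auto
    next
      case 2
      then show ?thesis using m[of t] nx(1,2)[of t] by auto
    qed
  qed
  ultimately have "card W \<le> card ((Z \<union> T) - {?m})" using fin by (intro card_inj_on_le) auto
  also have "\<dots> = card (Z \<union> T) - 1" using Min_in[of "Z \<union> T"] fin by (subst card_Diff_singleton) auto
  finally show "Suc (card W) \<le> card (Z \<union> T)" using fin by (simp add: card_gt_0_iff Suc_le_eq) (metis Suc_pred card_gt_0_iff finite_UnI Un_empty le_imp_less_Suc)
qed

lemma lin_missing: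
  assumes "i < n" "\<not> x i"
  obtains l where "l = i \<or> l = Suc i" "l \<in> par n e" "l \<notin> lin n (par n e) x"
proof (cases "even i \<longleftrightarrow> e")
  case True
  then show thesis using assms that[of i] unfolding lin_def by simp
next
  case False
  then show thesis using assms that[of "Suc i"] unfolding lin_def by simp
qed

section \<open>Pointed cubes and their products in terms of top vertices\<close>

context
  fixes b :: 'p
begin

text \<open>In dimension \<open>n = m + 1\<close>: \<open>pt m p\<close> says that \<open>p\<close> is the top vertex of a cube with all other vertices
  \<open>b\<close>, \<open>peq\<close> that two such cubes are related, and \<open>prd\<close> that the third is a product of the first two.\<close>

definition top_slot :: "nat \<Rightarrow> 'p \<Rightarrow> (nat \<Rightarrow> bool) \<Rightarrow> 'p" where
  "top_slot m v x = (if \<forall>i<m. x i then v else b)"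

definition pt :: "nat \<Rightarrow> 'p \<Rightarrow> bool" where
  "pt m p \<longleftrightarrow> sq (top_slot m) m (Suc m) b b p p"

definition peq :: "nat \<Rightarrow> 'p \<Rightarrow> 'p \<Rightarrow> bool" where
  "peq m p q \<longleftrightarrow> sq (top_slot m) m (Suc m) b b p q"

definition prd :: "nat \<Rightarrow> 'p \<Rightarrow> 'p \<Rightarrow> 'p \<Rightarrow> bool" where
  "prd m p q r \<longleftrightarrow> sq (top_slot m) m (Suc m) b q p r"

lemma square_rel_top: "square_rel (sq (top_slot m) m (Suc m))"
  by (rule square_rel_sq) (auto simp: indep_def top_slot_def)

lemma pt_iff: "pt m p \<longleftrightarrow> (\<lambda>x. if \<forall>i<Suc m. x i then p else b) \<in> Q"
proof -
  have "(\<lambda>x. top_slot m (if x m then if x (Suc m) then p else p else if x (Suc m) then b else b) x) =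
    (\<lambda>x. if \<forall>i<Suc m. x i then p else b)"
    by (rule ext) (auto simp: top_slot_def All_less_Suc)
  then show ?thesis unfolding pt_def sq_def by simp
qed

lemma base_in_Q:
  assumes "pt m p" shows "(\<lambda>_. b) \<in> Q"
proof -
  have "(\<lambda>_. if \<forall>i<Suc m. (\<lambda>_. False) i then p else b) \<in> Q"
    using const_in_Q[OF assms[unfolded pt_iff]] .
  moreover have "\<not> (\<forall>i<Suc m. (\<lambda>_. False) i)" by auto
  ultimately show ?thesis by (simp only: if_False)
qed

lemma pt_base: "pt m p \<Longrightarrow> pt m b"
  unfolding pt_iff[of m b] using base_in_Q by simp

lemma peq_refl: "pt m p \<Longrightarrow> peq m p p"
  unfolding pt_def peq_def .

lemma prd_base: "prd m p b r \<longleftrightarrow> peq m p r"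
  unfolding prd_def peq_def ..

lemma peq_sym: "peq m p q \<Longrightarrow> peq m q p"
  unfolding peq_def by (rule square_rel.flip'[OF square_rel_top])

lemma peq_trans: "peq m p q \<Longrightarrow> peq m q r \<Longrightarrow> peq m p r"
  unfolding peq_def by (rule square_rel.glue'[OF square_rel_top])

lemma prd_commute: "prd m p q r \<Longrightarrow> prd m q p r"
  unfolding prd_def by (rule square_rel.swap[OF square_rel_top])

text \<open>On the diagonal of the square with corners \<open>b\<close>, \<open>q\<close>,
  \<open>p\<close>, \<open>r\<close>, only the far corner \<open>r\<close> is left besides
  \<open>b\<close>.\<close>

lemma prd_pt:
  assumes "prd m p q r" shows "pt m r"
  unfolding pt_iff
proof (rule subst_eq[OF assms[unfolded prd_def sq_def], where y = "\<lambda>x. x(Suc m := x m)"])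
  show "(\<lambda>x. (x(Suc m := x m)) i) \<in> literals" for i by (cases "i = Suc m") simp_all
qed (auto simp: top_slot_def All_less_Suc)

text \<open>The cubes of \<open>p\<close> and \<open>q\<close> are two faces of a corner of
  dimension \<open>m + 2\<close> whose other faces are constant; the filler supplies
  \<open>r\<close>.\<close>

lemma prd_exists:
  assumes "pt m p" "pt m q" shows "\<exists>r. prd m p q r"
proof -
  let ?c = "\<lambda>x. top_slot m (if x m then p else if x (Suc m) then q else b) x"
  have "\<exists>r. (\<lambda>x. if \<forall>j\<in>{..Suc m}. x j then r else ?c x) \<in> Q"
  proof (rule corner)
    show "?c x = ?c y" if "\<And>i. i \<in> {..Suc m} \<Longrightarrow> x i = y i" for x y
    proof -
      have "x m = y m" "x (Suc m) = y (Suc m)" "(\<forall>i<m. x i) \<longleftrightarrow> (\<forall>i<m. y i)" using that by auto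
      then show ?thesis unfolding top_slot_def by (simp only:)
    qed
    fix j assume j: "j \<in> {..Suc m}"
    have lit: "(\<lambda>x. (x(m := x (Suc m))) i) \<in> literals" for i by (cases "i = m") simp_all
    consider "j < m" | "j = m" | "j = Suc m" using j by fastforce
    then show "(\<lambda>x. ?c (x(j := False))) \<in> Q"
    proof cases
      case 1
      have "(\<lambda>x. ?c (x(j := False))) = (\<lambda>x. b)"
      proof (rule ext)
        fix x :: "nat \<Rightarrow> bool"
        have "\<not> (\<forall>i<m. (x(j := False)) i)" using 1 by auto
        then show "?c (x(j := False)) = b" unfolding top_slot_def by (simp only: if_False)
      qed
      then show ?thesis using base_in_Q[OF assms(1)] by simp
    next
      case 2
      show ?thesis
        by (rule subst_eq[where y = "\<lambda>x. x(m := x (Suc m))", OF assms(2)[unfolded pt_iff] lit]) (auto simp: 2 top_slot_def All_less_Suc)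
    next
      case 3
      have "(\<lambda>x. ?c (x(j := False))) = (\<lambda>x. if \<forall>i<Suc m. x i then p else b)"
        by (rule ext) (auto simp: 3 top_slot_def All_less_Suc)
      then show ?thesis using assms(1) unfolding pt_iff by simp
    qed
  qed auto
  then obtain r where r: "(\<lambda>x. if \<forall>j\<in>{..Suc m}. x j then r else ?c x) \<in> Q" by blast
  have all: "(\<forall>j\<in>{..Suc m}. x j) \<longleftrightarrow> (\<forall>i<m. x i) \<and> x m \<and> x (Suc m)" for x :: "nat \<Rightarrow> bool"
    by (metis atMost_iff le_Suc_eq less_Suc_eq_le order_refl less_imp_le nat_less_le)
  have "(\<lambda>x. if \<forall>j\<in>{..Suc m}. x j then r else ?c x) =
      (\<lambda>x. top_slot m (if x m then if x (Suc m) then r else p else if x (Suc m) then q else b) x)"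
  proof (rule ext)
    fix x
    show "(if \<forall>j\<in>{..Suc m}. x j then r else ?c x) =
      top_slot m (if x m then if x (Suc m) then r else p else if x (Suc m) then q else b) x"
      unfolding all top_slot_def by (cases "\<forall>i<m. x i"; cases "x m"; cases "x (Suc m)"; auto)
  qed
  then show ?thesis using r unfolding prd_def sq_def by auto
qed

text \<open>Gluing the two product squares along the square of \<open>q\<close> and
  \<open>q'\<close> leaves a square with rows \<open>p, r\<close> and \<open>p', r'\<close>. Its
  transpose, glued to the square of \<open>p\<close> and \<open>p'\<close>, relates \<open>r\<close>
  to \<open>r'\<close>.\<close>

lemma prd_unique:
  assumes "prd m p q r" "prd m p' q' r'" "peq m p p'" "peq m q q'"
  shows "peq m r r'"
proof -
  interpret square_rel "sq (top_slot m) m (Suc m)" by (rule square_rel_top)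
  let ?S = "sq (top_slot m) m (Suc m)"
  have "?S b q b q'" using assms(4) swap unfolding peq_def by blast
  moreover have "?S b q p r" "?S b q' p' r'" using assms(1,2) unfolding prd_def .
  ultimately have "?S p r p' r'" using glue flip by blast
  then have "?S p p' r r'" by (rule swap)
  with assms(3) show ?thesis unfolding peq_def by (rule glue)
qed

text \<open>If only the full set has a value other than \<open>b\<close>, the pattern is a pointed
  cube in its own coordinates. By \<open>card_coords\<close> there are at most \<open>m + 1\<close>
  of these, so it is obtained from the cube of \<open>pt\<close> by identifying coordinates.\<close>

lemma cond_of_pt:
  assumes p: "pt m (g (Z \<union> T))" and sep: "sep Z T" and card: "card (Z \<union> T) \<le> Suc (Suc m)"
    and rest: "\<And>B. Z \<subseteq> B \<Longrightarrow> B \<subset> Z \<union> T \<Longrightarrow> g B = b"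
  shows "cond g Z T"
proof -
  define W where "W = (\<lambda>t. 2 * t) ` {t \<in> T. \<exists>z\<in>Z. z < t} \<union> (\<lambda>t. Suc (2 * t)) ` {t \<in> T. \<exists>z\<in>Z. t < z}"
  have finW: "finite W" and cW: "card W \<le> Suc m" using card_coords[OF sep] card unfolding W_def by auto
  have all: "(\<forall>w\<in>W. x w) \<longleftrightarrow> (\<forall>t\<in>T. pres Z t x)" for x unfolding pres_def W_def by auto
  have disj: "Z \<inter> T = {}" using sep unfolding sep_def by blast
  have val: "g (cfg Z T x) = (if \<forall>w\<in>W. x w then g (Z \<union> T) else b)" for x
  proof (cases "\<forall>t\<in>T. pres Z t x")
    case True
    then have "cfg Z T x = Z \<union> T" unfolding cfg_def by auto
    then show ?thesis using True all by simp
  next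
    case False
    then obtain t where t: "t \<in> T" "\<not> pres Z t x" by blast
    then have "t \<notin> cfg Z T x" unfolding cfg_def using disj by auto
    moreover have "cfg Z T x \<subseteq> Z \<union> T" "Z \<subseteq> cfg Z T x" unfolding cfg_def by auto
    ultimately have "g (cfg Z T x) = b" using t(1) by (intro rest) auto
    moreover have "\<not> (\<forall>w\<in>W. x w)" using False all by blast
    ultimately show ?thesis by (simp only: if_False)
  qed
  obtain e where e: "bij_betw e {0..<card W} W" using ex_bij_betw_nat_finite[OF finW] by blast
  \<comment> \<open>Surplus coordinates repeat the first one; if there is none at all, the pattern
    is constant at the top vertex.\<close>
  define y where "y x i = (if W = {} then True else x (e (if i < card W then i else 0)))"
    for x :: "nat \<Rightarrow> bool" and i :: nat
  have "(\<forall>i<Suc m. y x i) \<longleftrightarrow> (\<forall>w\<in>W. x w)" for x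
  proof (cases "W = {}")
    case True then show ?thesis unfolding y_def by simp
  next
    case False
    then have c0: "0 < card W" using finW by (simp add: card_gt_0_iff)
    have W: "W = e ` {0..<card W}" using e unfolding bij_betw_def by simp
    show ?thesis
    proof
      assume *: "\<forall>i<Suc m. y x i"
      show "\<forall>w\<in>W. x w"
      proof
        fix w assume "w \<in> W"
        then have "w \<in> e ` {0..<card W}" using W by simp
        then obtain i where "i < card W" "w = e i" by auto
        then show "x w" using *[rule_format, of i] cW False unfolding y_def by simp
      qed
    next
      assume *: "\<forall>w\<in>W. x w"
      have "e (if i < card W then i else 0) \<in> W" for i using c0 by (subst W) auto
      then show "\<forall>i<Suc m. y x i" using * unfolding y_def by simp
    qed
  qed
  note yW = this
  show ?thesis unfolding cond_def val
  proof (rule subst_eq[where y = y, OF p[unfolded pt_iff]])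
    show "(\<lambda>x. y x i) \<in> literals" for i
      unfolding y_def by (intro literals_if literals_const literals_var)
  qed (simp only: yW)
qed

text \<open>Every pattern has the value \<open>b\<close> below its top vertex, so
  \<open>cond_of_pt\<close> applies to it. Conversely, one parity pattern already is the pointed
  cube: it uses each of the \<open>m + 1\<close> coordinates, and a label disappears as soon as one
  of them is 0.\<close>

lemma good_top_iff:
  assumes g: "g {..Suc m} = p" "\<And>B. B \<noteq> {} \<Longrightarrow> B \<subset> {..Suc m} \<Longrightarrow> g B = b"
  shows "good g {..Suc m} \<longleftrightarrow> pt m p"
proof
  assume p: "pt m p"
  show "good g {..Suc m}" unfolding good_def
  proof (intro allI impI)
    fix Z T assume s: "sep Z T" and sub: "Z \<union> T \<subseteq> {..Suc m}"
    have Z: "Z \<noteq> {}" using s unfolding sep_def by blast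
    show "cond g Z T"
    proof (rule cond_of_pt[OF _ s])
      show "pt m (g (Z \<union> T))"
      proof (cases "Z \<union> T = {..Suc m}")
        case False
        then have "g (Z \<union> T) = b" using sub Z by (intro g(2)) auto
        then show ?thesis using pt_base[OF p] by simp
      qed (simp add: p g(1))
      show "card (Z \<union> T) \<le> Suc (Suc m)" using card_mono[OF _ sub] by simp
      show "g B = b" if "Z \<subseteq> B" "B \<subset> Z \<union> T" for B using that sub Z by (intro g(2)) auto
    qed
  qed
next
  assume "good g {..Suc m}"
  then have "cond g (par (Suc m) (\<not> True)) (par (Suc m) True)"
    using sep_parity[of "Suc m" True] unfolding good_def by auto
  then have q: "(\<lambda>x. g (lin (Suc m) (par (Suc m) True) x)) \<in> Q" by (subst (asm) cond_parity_iff) simp_all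
  have "g (lin (Suc m) (par (Suc m) True) x) = (if \<forall>i<Suc m. x i then p else b)" for x
  proof (cases "\<forall>i<Suc m. x i")
    case True
    then have "lin (Suc m) (par (Suc m) True) x = {..Suc m}" unfolding lin_def by auto
    then show ?thesis using True g(1) by simp
  next
    case False
    then obtain i where "i < Suc m" "\<not> x i" by blast
    then obtain l where l: "l \<in> par (Suc m) True" "l \<notin> lin (Suc m) (par (Suc m) True) x" by (rule lin_missing)
    \<comment> \<open>While the even labels vary, the label 1 stays present, so the sets that occur
      are nonempty.\<close>
    have "1 \<in> lin (Suc m) (par (Suc m) True) x" unfolding lin_def by simp
    then have "g (lin (Suc m) (par (Suc m) True) x) = b" using l by (intro g(2)) (auto simp: lin_def)
    then show ?thesis using False by (simp only: if_False)
  qed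
  then show "pt m p" using q unfolding pt_iff by simp
qed

text \<open>The rows \<open>r, r\<close> and \<open>b, b\<close> are interchanged by gluing with the
  square that \<open>pt m r\<close> provides.\<close>

lemma E2_iff_peq:
  assumes "pt m r"
  shows "sq (top_slot m) m (Suc m) r r r u \<longleftrightarrow> peq m r u"
proof -
  interpret square_rel "sq (top_slot m) m (Suc m)" by (rule square_rel_top)
  show ?thesis using assms glue flip unfolding pt_def peq_def by blast
qed

text \<open>In the parity pattern two coordinates control a label where the product square has one
  direction. With the edge in direction \<open>m + 2\<close> read as a single value, the pattern is
  the square \<open>?S ?S ?S ?U\<close> and the product is \<open>?B ?B ?S ?U\<close>. They differ
  by \<open>?B ?B ?S ?S\<close>, which comes from the pointed cube of \<open>p\<close>.\<close>

lemma split_iff_prd: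
  assumes "pt (Suc m) p"
  shows "(\<lambda>x. if \<forall>i<m. x i then
       (if x m \<and> x (Suc m) then if x (Suc (Suc m)) then u else q else if x (Suc (Suc m)) then p else b)
       else b) \<in> Q \<longleftrightarrow> prd (Suc m) q p u"
proof -
  define c where "c v x = (if \<forall>i<m. x i then if x (Suc (Suc m)) then snd v else fst v else b)"
    for v :: "'p \<times> 'p" and x :: "nat \<Rightarrow> bool"
  interpret square_rel "sq c m (Suc m)"
    by (rule square_rel_sq) (auto simp: indep_def c_def)
  let ?B = "(b, b)" and ?S = "(b, p)" and ?U = "(q, u)"
  have "(\<lambda>x. if \<forall>i<m. x i then
       (if x m \<and> x (Suc m) then if x (Suc (Suc m)) then u else q else if x (Suc (Suc m)) then p else b)
       else b) = (\<lambda>x. c (if x m then if x (Suc m) then ?U else ?S else if x (Suc m) then ?S else ?S) x)"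
    unfolding c_def by (rule ext) auto
  then have 1: "(\<lambda>x. if \<forall>i<m. x i then
       (if x m \<and> x (Suc m) then if x (Suc (Suc m)) then u else q else if x (Suc (Suc m)) then p else b)
       else b) \<in> Q \<longleftrightarrow> sq c m (Suc m) ?S ?S ?S ?U" unfolding sq_def by simp
  have "(\<lambda>x. top_slot (Suc m) (if x (Suc m) then if x (Suc (Suc m)) then u else q else if x (Suc (Suc m)) then p else b) x) =
     (\<lambda>x. c (if x m then if x (Suc m) then ?U else ?S else if x (Suc m) then ?B else ?B) x)"
    unfolding c_def top_slot_def by (rule ext) (auto simp: All_less_Suc)
  then have 2: "prd (Suc m) q p u \<longleftrightarrow> sq c m (Suc m) ?B ?B ?S ?U" unfolding prd_def sq_def by simp
  have "sq c m (Suc m) ?B ?B ?S ?S" unfolding sq_def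
  proof (rule subst_eq[OF assms[unfolded pt_iff], where y = "\<lambda>x. x(Suc m := x (Suc (Suc m)))"])
    show "(\<lambda>x. (x(Suc m := x (Suc (Suc m)))) i) \<in> literals" for i by (cases "i = Suc m") simp_all
  qed (auto simp: c_def All_less_Suc)
  then show ?thesis unfolding 1 2 using glue flip by blast
qed

text \<open>Of the two parity patterns, the one in which \<open>m + 1\<close> varies compares
  \<open>r\<close> with \<open>u\<close>; the one in which \<open>m\<close> and \<open>m + 2\<close>
  vary is the product square of \<open>p\<close> and \<open>q\<close> with far corner
  \<open>u\<close>. Patterns that avoid some label other than \<open>m + 1\<close> have at most one
  value other than \<open>b\<close>, at the top, and are covered by \<open>cond_of_pt\<close>. So
  the exact product is \<open>u\<close>, while the face \<open>r\<close> is a product up to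
  \<open>peq\<close>.\<close>

lemma good_product_iff:
  assumes pts: "pt m p" "pt m q" "pt m r"
    and top: "g {..Suc (Suc m)} = u" "g ({..Suc (Suc m)} - {m}) = p"
      "g ({..Suc (Suc m)} - {Suc m}) = r" "g ({..Suc (Suc m)} - {Suc (Suc m)}) = q"
    and rest: "\<And>B. B \<noteq> {} \<Longrightarrow> B \<subset> {..Suc (Suc m)} \<Longrightarrow> B \<noteq> {..Suc (Suc m)} - {m} \<Longrightarrow>
      B \<noteq> {..Suc (Suc m)} - {Suc m} \<Longrightarrow> B \<noteq> {..Suc (Suc m)} - {Suc (Suc m)} \<Longrightarrow> g B = b"
  shows "good g {..Suc (Suc m)} \<longleftrightarrow> peq m r u \<and> prd m p q u"
proof -
  let ?N = "Suc (Suc m)"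
  have miss: "g B = b" if B: "B \<noteq> {}" "B \<subseteq> {..?N}" and l: "l \<le> ?N" "l \<notin> B" "l < m \<or> (\<exists>l'\<le>?N. l' \<noteq> l \<and> l' \<notin> B)" for B l
  proof -
    have ne: "B \<noteq> {..?N} - {x}" if x: "m \<le> x" for x
    proof
      assume eq: "B = {..?N} - {x}"
      then have "l = x" using l by auto
      then obtain l' where "l' \<le> ?N" "l' \<noteq> x" "l' \<notin> B" using l(3) x by auto
      then show False using eq by simp
    qed
    have "l \<in> {..?N}" using l(1) by simp
    then have "B \<subset> {..?N}" using B(2) l(2) by blast
    then show ?thesis using ne[of m] ne[of "Suc m"] ne[of ?N] B(1) by (intro rest) simp_all
  qed
  have e1: "cond g (par ?N (\<not> even (Suc m))) (par ?N (even (Suc m))) \<longleftrightarrow> peq m r u"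
  proof -
    let ?L = "lin ?N (par ?N (even (Suc m)))"
    have "g (?L x) = top_slot m (if x m then if x (Suc m) then u else r else if x (Suc m) then r else r) x" for x
    proof (cases "\<forall>i<m. x i")
      case True
      have "?L x = (if x m \<and> x (Suc m) then {..?N} else {..?N} - {Suc m})"
      proof -
        have "l \<in> ?L x \<longleftrightarrow> l \<le> ?N \<and> (l = Suc m \<longrightarrow> x m \<and> x (Suc m))" for l
        proof (cases "l = Suc m")
          case True then show ?thesis unfolding lin_def by simp
        next
          case False
          show ?thesis
          proof (cases "l < m")
            case True then show ?thesis using \<open>\<forall>i<m. x i\<close> unfolding lin_def by auto
          next
            case f2: False
            then have "l \<le> ?N \<Longrightarrow> l = m \<or> l = ?N" using False by auto
            then show ?thesis using False unfolding lin_def by auto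
          qed
        qed
        then show ?thesis by auto
      qed
      then show ?thesis using True top unfolding top_slot_def by simp
    next
      case False
      then obtain i where i: "i < m" "\<not> x i" by blast
      then have iN: "i < ?N" by simp
      obtain l where l: "l = i \<or> l = Suc i" "l \<in> par ?N (even (Suc m))" "l \<notin> ?L x"
        using lin_missing[where e = "even (Suc m)" and x = x and i = i, OF iN i(2)] .
      have "l \<noteq> m" using l(2) by auto
      moreover have "l \<le> m" using i l(1) by auto
      ultimately have "l < m" by simp
      moreover have "?N \<in> ?L x" unfolding lin_def by simp
      ultimately have "g (?L x) = b" using l by (intro miss[of _ l]) (auto simp: lin_def)
      then show ?thesis using False unfolding top_slot_def by auto
    qed
    then show ?thesis unfolding E2_iff_peq[OF pts(3), symmetric] sq_def by (subst cond_parity_iff) simp_all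
  qed
  have e2: "cond g (par ?N (\<not> even m)) (par ?N (even m)) \<longleftrightarrow> prd m p q u"
  proof -
    let ?L = "lin ?N (par ?N (even m))"
    have lm: "(\<lambda>x. g (?L x)) \<in> Q \<longleftrightarrow> cond g (par ?N (\<not> even m)) (par ?N (even m))"
      by (rule cond_parity_iff[symmetric]) simp
    have in1: "Suc m \<in> ?L x" for x unfolding lin_def by simp
    have gL: "g (?L x) = (if m \<in> ?L x then if ?N \<in> ?L x then u else q else if ?N \<in> ?L x then p else b)"
      if "\<forall>l<m. l \<in> ?L x" for x
    proof -
      have sub: "?L x \<subseteq> {..?N}" by (auto simp: lin_def)
      have "l \<in> ?L x \<longleftrightarrow> l \<in> {..?N} - {l. l = m \<and> m \<notin> ?L x \<or> l = ?N \<and> ?N \<notin> ?L x}" for l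
      proof -
        consider "l < m" | "l = m" | "l = Suc m" | "l = ?N" | "l > ?N" by linarith
        then show ?thesis
        proof cases
          case 1 then show ?thesis using that by auto
        next
          case 2 then show ?thesis by auto
        next
          case 3 then show ?thesis using in1[of x] by auto
        next
          case 4 then show ?thesis by auto
        next
          case 5 then show ?thesis using sub by auto
        qed
      qed
      note mem = this
      consider "m \<in> ?L x" "?N \<in> ?L x" | "m \<in> ?L x" "?N \<notin> ?L x" | "m \<notin> ?L x" "?N \<in> ?L x" | "m \<notin> ?L x" "?N \<notin> ?L x"
        by blast
      then show ?thesis
      proof cases
        case 1
        then have "?L x = {..?N}" using mem by blast
        then have "g (?L x) = u" using top(1) by (simp only:)
        then show ?thesis by (simp only: 1 if_True)
      next
        case 2
        then have "?L x = {..?N} - {?N}" using mem by blast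
        then have "g (?L x) = q" using top(4) by (simp only:)
        then show ?thesis by (simp only: 2 if_True if_False)
      next
        case 3
        then have "?L x = {..?N} - {m}" using mem by blast
        then have "g (?L x) = p" using top(2) by (simp only:)
        then show ?thesis by (simp only: 3 if_True if_False)
      next
        case 4
        have "g (?L x) = b"
        proof (rule miss[of "?L x" m])
          show "?L x \<noteq> {}" using in1[of x] by blast
          show "m < m \<or> (\<exists>l'\<le>?N. l' \<noteq> m \<and> l' \<notin> ?L x)" using 4(2) by (intro disjI2 exI[of _ ?N]) simp
        qed (use sub 4(1) in simp_all)
        then show ?thesis by (simp only: 4 if_False)
      qed
    qed
    have N: "?N \<in> ?L x \<longleftrightarrow> x (Suc m)" for x unfolding lin_def by auto
    show ?thesis
    \<comment> \<open>For \<open>m = 0\<close> this label is the first and has a coordinate on its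
      right only. Otherwise it has two, and \<open>split_iff_prd\<close> reduces them to
      one.\<close>
    proof (cases m)
      case 0
      have "m \<in> ?L x \<longleftrightarrow> x m" for x unfolding lin_def 0 by auto
      then have "g (?L x) = top_slot m (if x m then if x (Suc m) then u else q else if x (Suc m) then p else b) x" for x
        using gL[of x] N[of x] 0 unfolding top_slot_def by simp
      then have "cond g (par ?N (\<not> even m)) (par ?N (even m)) \<longleftrightarrow> prd m q p u"
        unfolding lm[symmetric] prd_def sq_def by simp
      then show ?thesis using prd_commute by blast
    next
      case (Suc k)
      have mL: "m \<in> ?L x \<longleftrightarrow> x k \<and> x m" for x unfolding lin_def Suc by auto
      have "g (?L x) = (if \<forall>i<k. x i then (if x k \<and> x (Suc k) then if x (Suc (Suc k)) then u else q else if x (Suc (Suc k)) then p else b) else b)" for x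
      proof (cases "\<forall>i<k. x i")
        case True
        have "l \<in> ?L x" if "l < m" for l using True that Suc unfolding lin_def by (auto simp: less_Suc_eq)
        then show ?thesis using gL[of x] N[of x] mL[of x] True Suc by simp
      next
        case False
        then obtain i where i: "i < k" "\<not> x i" by blast
        then have iN: "i < ?N" using Suc by simp
        obtain l where l: "l = i \<or> l = Suc i" "l \<in> par ?N (even m)" "l \<notin> ?L x"
          using lin_missing[where e = "even m" and x = x and i = i, OF iN i(2)] .
        then have "l < m" using i Suc by auto
        then have "g (?L x) = b" using l in1[of x] by (intro miss[of _ l]) (auto simp: lin_def)
        then show ?thesis using False by auto
      qed
      then have "cond g (par ?N (\<not> even m)) (par ?N (even m)) \<longleftrightarrow> prd m q p u"
        using split_iff_prd[of k p u q] pts(1) Suc unfolding lm[symmetric] by simp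
      then show ?thesis using prd_commute by blast
    qed
  qed
  show ?thesis
  proof
    assume "good g {..?N}"
    then have "cond g (par ?N (\<not> e)) (par ?N e)" for e
      using sep_parity[of ?N e] unfolding good_def by auto
    then show "peq m r u \<and> prd m p q u" using e1 e2 by blast
  next
    assume *: "peq m r u \<and> prd m p q u"
    show "good g {..?N}"
    proof (rule good_from_faces[where k = "Suc m"])
      show "cond g (par ?N (\<not> e)) (par ?N e)" for e
      proof (cases "e = even m")
        case True then show ?thesis using e2 * by simp
      next
        case False
        then have "e = even (Suc m)" by simp
        then show ?thesis using e1 * by simp
      qed
      fix Z T j assume s: "sep Z T" and sub: "Z \<union> T \<subseteq> {..?N}" and j: "j \<le> ?N" "j \<noteq> Suc m" "j \<notin> Z \<union> T"
      have Z: "Z \<noteq> {}" using s unfolding sep_def by blast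
      show "cond g Z T"
      proof (rule cond_of_pt[OF _ s])
        show "pt m (g (Z \<union> T))"
        proof -
          consider "Z \<union> T = {..?N} - {m}" | "Z \<union> T = {..?N} - {?N}" |
            "Z \<union> T \<noteq> {..?N} - {m}" "Z \<union> T \<noteq> {..?N} - {?N}" by blast
          then show ?thesis
          proof cases
            case 1
            then show ?thesis using top(2) pts(1) by (simp only:)
          next
            case 2
            then show ?thesis using top(4) pts(2) by (simp only:)
          next
            case 3
            have "j \<in> {..?N} - {Suc m}" "j \<in> {..?N}" using j by auto
            then have "Z \<union> T \<noteq> {..?N} - {Suc m}" "Z \<union> T \<subset> {..?N}" using j(3) sub by blast+
            then have "g (Z \<union> T) = b" using 3 Z by (intro rest) blast+
            then show ?thesis using pt_base[OF pts(1)] by (simp only:)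
          qed
        qed
        have "Z \<union> T \<subseteq> {..?N} - {j}" using sub j by auto
        then have "card (Z \<union> T) \<le> card ({..?N} - {j})" by (intro card_mono) auto
        then show "card (Z \<union> T) \<le> Suc (Suc m)" using j by simp
        fix B assume B: "Z \<subseteq> B" "B \<subset> Z \<union> T"
        then obtain l where l: "l \<in> Z \<union> T" "l \<notin> B" by blast
        then have "l \<in> {..?N}" "l \<noteq> j" using sub j(3) by blast+
        then have "l \<le> ?N" by simp
        then have "j < m \<or> (\<exists>l'\<le>?N. l' \<noteq> j \<and> l' \<notin> B)" using l(2) \<open>l \<noteq> j\<close> by blast
        moreover have "B \<noteq> {}" "B \<subseteq> {..?N}" "j \<notin> B" using B Z sub j(3) by blast+
        ultimately show "g B = b" using j(1) by (intro miss[of B j])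
      qed
    qed simp_all
  qed
qed

end
end

section \<open>Cubesets as systems of cubes\<close>

definition pnt :: "nat \<Rightarrow> (nat \<Rightarrow> bool) \<Rightarrow> nat \<Rightarrow> int" where
  "pnt m x = (\<lambda>i\<in>{..<m}. if x i then 1 else 0)"

text \<open>Entries from \<open>m\<close> on read as False, so that every vertex gives a full
  sequence.\<close>

definition bits :: "nat \<Rightarrow> (nat \<Rightarrow> int) \<Rightarrow> nat \<Rightarrow> bool" where
  "bits m v i \<longleftrightarrow> i < m \<and> v i = 1"

lemma pnt_in_cube [simp]: "pnt m x \<in> cube m"
  unfolding pnt_def cube_def by auto

lemma cube_eqI: "u \<in> cube m \<Longrightarrow> v \<in> cube m \<Longrightarrow> (\<And>i. i < m \<Longrightarrow> u i = v i) \<Longrightarrow> u = v"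
  unfolding cube_def by (rule PiE_ext) auto

lemma cube_coord: "v \<in> cube m \<Longrightarrow> i < m \<Longrightarrow> v i = 0 \<or> v i = 1"
  unfolding cube_def by (auto dest!: PiE_mem[where x = i])

lemma pnt_bits [simp]: "v \<in> cube m \<Longrightarrow> pnt m (bits m v) = v"
  by (rule cube_eqI[OF pnt_in_cube]) (auto simp: pnt_def bits_def dest: cube_coord)

lemma bits_pnt: "i < m \<Longrightarrow> bits m (pnt m x) i = x i"
  unfolding pnt_def bits_def by simp

lemma pnt_cong: "(\<And>i. i < m \<Longrightarrow> x i = y i) \<Longrightarrow> pnt m x = pnt m y"
  unfolding pnt_def by (rule restrict_ext) simp

lemma cube_0: "cube 0 = {\<lambda>_. undefined}"
  unfolding cube_def by simp

lemma Obj_Box [simp]: "x \<in> Obj Box"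
  unfolding Box_def by simp

lemma Arr_BoxD:
  assumes "\<phi> \<in> Arr Box n m"
  shows "\<phi> \<in> cube n \<rightarrow>\<^sub>E cube m" "v \<in> cube n \<Longrightarrow> \<phi> v \<in> cube m"
  using assms unfolding Box_def by auto

lemma Cmp_Box: "Cmp Box l m n g f = compose (cube l) g f"
  unfolding Box_def by simp

text \<open>Test on vertices with at most two entries 1. If \<open>a j\<close> is not 0, then
  \<open>b\<close> and \<open>b + a j\<close> are 0 and 1 in some order, and a second nonzero
  coefficient would lead out of {0, 1}. So at most one variable occurs.\<close>

lemma affine_literal:
  fixes a :: "nat \<Rightarrow> int"
  assumes "\<And>v. v \<in> cube m \<Longrightarrow> b + (\<Sum>j<m. a j * v j) \<in> {0, 1}"
  shows "\<exists>s\<in>literals. \<forall>v\<in>cube m. b + (\<Sum>j<m. a j * v j) = 1 \<longleftrightarrow> s (\<lambda>j. v j = 1)"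
proof -
  have val: "b + (\<Sum>j\<in>{j. j < m \<and> x j}. a j) \<in> {0, 1}" for x
  proof -
    have "(\<Sum>j<m. a j * pnt m x j) = (\<Sum>j<m. if x j then a j else 0)"
      by (rule sum.cong) (auto simp: pnt_def)
    also have "\<dots> = (\<Sum>j\<in>{j\<in>{..<m}. x j}. a j)" by (rule sum.inter_filter[symmetric]) simp
    finally show ?thesis using assms[of "pnt m x"] by simp
  qed
  have b: "b \<in> {0, 1}" using val[of "\<lambda>_. False"] by simp
  show ?thesis
  proof (cases "\<exists>j<m. a j \<noteq> 0")
    case False
    then have "b + (\<Sum>j<m. a j * v j) = b" for v by simp
    then show ?thesis by (intro bexI[of _ "\<lambda>_. b = 1"]) auto
  next
    case True
    then obtain j where j: "j < m" "a j \<noteq> 0" by blast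
    have aj: "b + a j \<in> {0, 1}"
    proof -
      have "{i. i < m \<and> i = j} = {j}" using j by auto
      then show ?thesis using val[of "\<lambda>i. i = j"] by simp
    qed
    have ak: "a k = 0" if k: "k < m" "k \<noteq> j" for k
    proof -
      have "{i. i < m \<and> i = k} = {k}" "{i. i < m \<and> (i = k \<or> i = j)} = {k, j}" using j k by auto
      then have "b + a k \<in> {0, 1}" "b + (a k + a j) \<in> {0, 1}"
        using val[of "\<lambda>i. i = k"] val[of "\<lambda>i. i = k \<or> i = j"] k by simp_all
      then show ?thesis using aj b j(2) by auto
    qed
    have sum: "(\<Sum>i<m. a i * v i) = a j * v j" for v
    proof -
      have "(\<Sum>i<m. a i * v i) = (\<Sum>i<m. if i = j then a j * v j else 0)"
        by (rule sum.cong) (auto simp: ak)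
      then show ?thesis using j(1) by simp
    qed
    show ?thesis
    proof (cases "b = 0")
      case True
      then have "a j = 1" using aj j(2) by auto
      then show ?thesis using True sum by (intro bexI[of _ "\<lambda>x. x j"]) auto
    next
      case False
      then have "b = 1" "a j = -1" using aj j(2) b by auto
      moreover have "v j \<in> {0, 1}" if "v \<in> cube m" for v using cube_coord[OF that j(1)] by auto
      ultimately show ?thesis using sum by (intro bexI[of _ "\<lambda>x. \<not> x j"]) auto
    qed
  qed
qed

lemma Arr_Box_literal:
  assumes "\<phi> \<in> Arr Box m n"
  shows "(\<lambda>x. bits n (\<phi> (pnt m x)) i) \<in> literals"
proof (cases "i < n")
  case False
  then have "(\<lambda>x. bits n (\<phi> (pnt m x)) i) = (\<lambda>_. False)" unfolding bits_def by simp
  then show ?thesis by simp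
next
  case True
  obtain a b where ab: "\<And>v. v \<in> cube m \<Longrightarrow> \<phi> v i = b i + (\<Sum>j<m. a i j * v j)"
    using assms True unfolding Box_def by auto
  have "b i + (\<Sum>j<m. a i j * v j) \<in> {0, 1}" if "v \<in> cube m" for v
    using cube_coord[OF Arr_BoxD(2)[OF assms that] True] ab[OF that] by auto
  then obtain s where s: "s \<in> literals" "\<And>v. v \<in> cube m \<Longrightarrow> b i + (\<Sum>j<m. a i j * v j) = 1 \<longleftrightarrow> s (\<lambda>j. v j = 1)"
    using affine_literal[of m "b i" "a i"] by auto
  have *: "(\<lambda>x. bits n (\<phi> (pnt m x)) i) = (\<lambda>x. s (\<lambda>j. pnt m x j = 1))"
    using s(2) ab True unfolding bits_def by (intro ext) simp
  obtain s' where s': "s = (\<lambda>_. s') \<or> (\<exists>j. s = (\<lambda>x. x j = s'))" using s(1) unfolding literals_def by auto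
  show ?thesis unfolding *
  proof (cases "s = (\<lambda>_. s')")
    case True
    then show "(\<lambda>x. s (\<lambda>j. pnt m x j = 1)) \<in> literals" by simp
  next
    case False
    then obtain j where j: "s = (\<lambda>x. x j = s')" using s' by blast
    show "(\<lambda>x. s (\<lambda>j. pnt m x j = 1)) \<in> literals"
    proof (cases "j < m")
      case True
      then have "(\<lambda>x. s (\<lambda>j. pnt m x j = 1)) = (\<lambda>x. x j = s')" unfolding j pnt_def by auto
      then show ?thesis by simp
    next
      case False
      \<comment> \<open>An entry outside the domain is the fixed integer \<open>undefined\<close>,
        so this literal is constant on the cube.\<close>
      then have "(\<lambda>x. s (\<lambda>j. pnt m x j = 1)) = (\<lambda>x. ((undefined :: int) = 1) = s')" unfolding j pnt_def by auto
      then show ?thesis by simp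
    qed
  qed
qed

lemma literal_Arr_Box:
  assumes s: "\<And>i. i < n \<Longrightarrow> s i \<in> literals"
    and m: "\<And>i x y. i < n \<Longrightarrow> (\<And>j. j < m \<Longrightarrow> x j = y j) \<Longrightarrow> s i x = s i y"
  shows "(\<lambda>v\<in>cube m. pnt n (\<lambda>i. s i (bits m v))) \<in> Arr Box m n"
proof -
  have "\<exists>(a :: nat \<Rightarrow> int) b. \<forall>v\<in>cube m. (if s i (bits m v) then 1 else 0) = b + (\<Sum>j<m. a j * v j)" if i: "i < n" for i
  proof -
    consider e where "s i = (\<lambda>_. e)" | j e where "s i = (\<lambda>x. x j = e)" using s[OF i] unfolding literals_def by auto
    then show ?thesis
    proof cases
      case 1
      then show ?thesis by (intro exI[of _ "\<lambda>_. 0"] exI[of _ "if e then 1 else 0"]) simp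
    next
      case 2
      have jm: "j < m"
      proof (rule ccontr)
        assume "\<not> j < m"
        then have "s i (\<lambda>_. True) = s i ((\<lambda>_. True)(j := False))" by (intro m[OF i]) auto
        then show False unfolding 2 by simp
      qed
      have sum: "(\<Sum>l<m. (if l = j then c else 0) * v l) = c * v j" for c :: int and v
      proof -
        have "(\<Sum>l<m. (if l = j then c else 0) * v l) = (\<Sum>l<m. if l = j then c * v j else 0)"
          by (rule sum.cong) auto
        then show ?thesis using jm by simp
      qed
      have v: "v j = 0 \<or> v j = 1" if "v \<in> cube m" for v using cube_coord[OF that jm] .
      show ?thesis
      proof (cases e)
        case True
        have "\<forall>v\<in>cube m. (if s i (bits m v) then 1 else 0) = 0 + (\<Sum>l<m. (if l = j then 1 else 0) * v l)"
          unfolding sum 2 using v True jm by (auto simp: bits_def)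
        then show ?thesis by (intro exI[of _ "\<lambda>l. if l = j then 1 else 0"] exI[of _ 0])
      next
        case False
        have "\<forall>v\<in>cube m. (if s i (bits m v) then 1 else 0) = 1 + (\<Sum>l<m. (if l = j then -1 else 0) * v l)"
          unfolding sum 2 using v False jm by (auto simp: bits_def)
        then show ?thesis by (intro exI[of _ "\<lambda>l. if l = j then -1 else 0"] exI[of _ 1])
      qed
    qed
  qed
  then obtain a b where "\<And>i. i < n \<Longrightarrow> \<forall>v\<in>cube m. (if s i (bits m v) then 1 else 0) = b i + (\<Sum>j<m. (a i j :: int) * v j)"
    by metis
  then show ?thesis unfolding Box_def by (auto simp: pnt_def intro!: exI[of _ a] exI[of _ b] restrict_PiE_iff[THEN iffD2] pnt_in_cube[unfolded pnt_def])
qed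

lemma const_Arr_Box: "v \<in> cube n \<Longrightarrow> (\<lambda>_\<in>cube m. v) \<in> Arr Box m n"
  using literal_Arr_Box[of n "\<lambda>i _. bits n v i" m] by simp

lemma id_Arr_Box: "(\<lambda>v\<in>cube n. v) \<in> Arr Box n n"
proof -
  have "(\<lambda>v\<in>cube n. pnt n (\<lambda>i. bits n v i)) \<in> Arr Box n n"
    by (rule literal_Arr_Box[where s = "\<lambda>i x. x i"]) auto
  moreover have "(\<lambda>v\<in>cube n. pnt n (\<lambda>i. bits n v i)) = (\<lambda>v\<in>cube n. v)" by (rule restrict_ext) simp
  ultimately show ?thesis by simp
qed

lemma literals_comp:
  assumes "s \<in> literals" "\<And>i. (\<lambda>x. y x i) \<in> literals"
  shows "(\<lambda>x. s (y x)) \<in> literals"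
proof -
  consider e where "s = (\<lambda>_. e)" | j e where "s = (\<lambda>x. x j = e)" using assms(1) unfolding literals_def by auto
  then show ?thesis
  proof cases
    case 2
    consider e' where "(\<lambda>x. y x j) = (\<lambda>_. e')" | k e' where "(\<lambda>x. y x j) = (\<lambda>x. x k = e')"
      using assms(2)[of j] unfolding literals_def by auto
    then show ?thesis
    proof cases
      case 1
      then have "(\<lambda>x. s (y x)) = (\<lambda>_. e' = e)" unfolding 2 by (metis (full_types))
      then show ?thesis by simp
    next
      case (2 k e')
      then have "y x j \<longleftrightarrow> (x k = e')" for x by metis
      then have "(\<lambda>x. s (y x)) = (\<lambda>x. x k = (e' = e))" unfolding \<open>s = (\<lambda>x. x j = e)\<close> by auto
      then show ?thesis by simp
    qed
  qed simp
qed

lemma comp_Arr_Box: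
  assumes f: "f \<in> Arr Box l m" and g: "g \<in> Arr Box m n"
  shows "compose (cube l) g f \<in> Arr Box l n"
proof -
  have "(\<lambda>v\<in>cube l. pnt n (\<lambda>i. bits n (g (f (pnt l (bits l v)))) i)) \<in> Arr Box l n"
  proof (rule literal_Arr_Box[where s = "\<lambda>i x. bits n (g (f (pnt l x))) i"])
    show "(\<lambda>x. bits n (g (f (pnt l x))) i) \<in> literals" for i
    proof -
      have "(\<lambda>x. bits n (g (pnt m (bits m (f (pnt l x))))) i) \<in> literals"
        by (rule literals_comp[where s = "\<lambda>x. bits n (g (pnt m x)) i" and y = "\<lambda>x. bits m (f (pnt l x))"])
          (rule Arr_Box_literal[OF g], rule Arr_Box_literal[OF f])
      then show ?thesis using Arr_BoxD(2)[OF f] by simp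
    qed
    show "bits n (g (f (pnt l x))) i = bits n (g (f (pnt l y))) i" if "\<And>j. j < l \<Longrightarrow> x j = y j" for i x y
      using pnt_cong[of l x y] that by simp
  qed
  moreover have "(\<lambda>v\<in>cube l. pnt n (\<lambda>i. bits n (g (f (pnt l (bits l v)))) i)) = compose (cube l) g f"
    unfolding compose_def using Arr_BoxD(2)[OF f] Arr_BoxD(2)[OF g] by (intro restrict_ext) simp
  ultimately show ?thesis by simp
qed

text \<open>Cubes of all dimensions at once, recorded by their vertices. A concrete cubeset loses
  nothing by this.\<close>

definition cubes :: "'a cubeset \<Rightarrow> ((nat \<Rightarrow> bool) \<Rightarrow> 'a) set" where
  "cubes X = {c. \<exists>m. \<exists>q\<in>Val X m. \<forall>x. c x = vertex X m q (pnt m x)}"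

lemma is_presheafD:
  assumes "is_presheaf B P" "x \<in> Obj B" "y \<in> Obj B" "f \<in> Arr B x y"
  shows "a \<in> Val P y \<Longrightarrow> Act P x y f a \<in> Val P x"
    and "a \<in> Val P x \<Longrightarrow> Act P x x (Idn B x) a = a"
    and "z \<in> Obj B \<Longrightarrow> g \<in> Arr B y z \<Longrightarrow> a' \<in> Val P z \<Longrightarrow> Act P x z (Cmp B x y z g f) a' = Act P x y f (Act P y z g a')"
  using assms unfolding is_presheaf_def by blast+

lemma vertex_Act:
  assumes X: "is_presheaf Box X" and \<phi>: "\<phi> \<in> Arr Box m n" and c: "c \<in> Val X n" and v: "v \<in> cube m"
  shows "vertex X m (Act X m n \<phi> c) v = vertex X n c (\<phi> v)"
proof -
  have "vertex X m (Act X m n \<phi> c) v = Act X 0 n (Cmp Box 0 m n \<phi> (\<lambda>_\<in>cube 0. v)) c"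
    unfolding vertex_def using is_presheafD(3)[OF X _ _ const_Arr_Box[OF v] _ \<phi> c] by simp
  also have "Cmp Box 0 m n \<phi> (\<lambda>_\<in>cube 0. v) = (\<lambda>_\<in>cube 0. \<phi> v)"
    unfolding Cmp_Box compose_def by (rule restrict_ext) simp
  finally show ?thesis unfolding vertex_def .
qed

lemma vertex_in_Val:
  "is_presheaf Box X \<Longrightarrow> c \<in> Val X n \<Longrightarrow> v \<in> cube n \<Longrightarrow> vertex X n c v \<in> Val X 0"
  unfolding vertex_def by (rule is_presheafD(1)[OF _ _ _ const_Arr_Box]) auto

lemma vertex_0:
  assumes "is_presheaf Box X" "c \<in> Val X 0" "v \<in> cube 0" shows "vertex X 0 c v = c"
proof -
  have "v = (\<lambda>_. undefined)" using assms(3) unfolding cube_0 by simp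
  moreover have "Idn Box 0 = (\<lambda>v\<in>cube 0. v)" by (simp add: Box_def)
  ultimately have "(\<lambda>_\<in>cube 0. v) = Idn Box 0" unfolding cube_0 by (auto simp: fun_eq_iff)
  then show ?thesis unfolding vertex_def
    using is_presheafD(2)[OF assms(1) _ _ _ assms(2), of 0 "\<lambda>_\<in>cube 0. v"] const_Arr_Box[OF assms(3), of 0] by simp
qed

lemma concrete_eqI:
  assumes "concrete_cubeset X" "c \<in> Val X n" "d \<in> Val X n" "\<And>v. v \<in> cube n \<Longrightarrow> vertex X n c v = vertex X n d v"
  shows "c = d"
proof -
  have "(\<lambda>v\<in>cube n. vertex X n c v) = (\<lambda>v\<in>cube n. vertex X n d v)" using assms(4) by (rule restrict_ext)
  then show ?thesis using assms(1-3) unfolding concrete_cubeset_def inj_on_def by blast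
qed

locale presheaf_on_Box =
  fixes X :: "'a cubeset"
  assumes presheaf: "is_presheaf Box X"
begin

lemma cubes_subst:
  assumes "c \<in> cubes X" "\<And>i. s i \<in> literals" shows "(\<lambda>x. c (\<lambda>i. s i x)) \<in> cubes X"
proof -
  obtain n q where q: "q \<in> Val X n" "\<And>x. c x = vertex X n q (pnt n x)" using assms(1) unfolding cubes_def by blast
  have "\<exists>m. \<forall>x y. (\<forall>j<m. x j = y j) \<longrightarrow> s i x = s i y" for i
  proof -
    consider e where "s i = (\<lambda>_. e)" | j e where "s i = (\<lambda>x. x j = e)" using assms(2)[of i] unfolding literals_def by auto
    then show ?thesis
    proof cases
      case 2
      then show ?thesis by (intro exI[of _ "Suc j"]) simp
    qed simp
  qed
  then obtain b where b: "\<And>i x y. (\<forall>j<b i. x j = y j) \<Longrightarrow> s i x = s i y" by metis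
  \<comment> \<open>Enough coordinates for all the literals that feed the \<open>n\<close>
    coordinates of \<open>q\<close>.\<close>
  define m where "m = (\<Sum>i<n. b i)"
  have bm: "b i \<le> m" if "i < n" for i unfolding m_def using that by (intro member_le_sum) auto
  have sm: "s i x = s i y" if "i < n" "\<And>j. j < m \<Longrightarrow> x j = y j" for i x y
    by (rule b) (use bm[OF that(1)] that(2) in auto)
  define \<phi> where "\<phi> = (\<lambda>v\<in>cube m. pnt n (\<lambda>i. s i (bits m v)))"
  have \<phi>: "\<phi> \<in> Arr Box m n" unfolding \<phi>_def
  proof (rule literal_Arr_Box)
    show "s i \<in> literals" for i by (rule assms(2))
    show "s i x = s i y" if "i < n" "\<And>j. j < m \<Longrightarrow> x j = y j" for i x y by (rule sm) (rule that(1), rule that(2))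
  qed
  have "vertex X m (Act X m n \<phi> q) (pnt m x) = c (\<lambda>i. s i x)" for x
  proof -
    have "\<phi> (pnt m x) = pnt n (\<lambda>i. s i (bits m (pnt m x)))" unfolding \<phi>_def by simp
    also have "\<dots> = pnt n (\<lambda>i. s i x)"
      by (rule pnt_cong, rule sm) (assumption, rule bits_pnt)
    finally have "\<phi> (pnt m x) = pnt n (\<lambda>i. s i x)" .
    then show "vertex X m (Act X m n \<phi> q) (pnt m x) = c (\<lambda>i. s i x)"
      by (simp add: vertex_Act[OF presheaf \<phi> q(1)] q(2))
  qed
  moreover have "Act X m n \<phi> q \<in> Val X m" using is_presheafD(1)[OF presheaf _ _ \<phi> q(1)] by simp
  ultimately show ?thesis unfolding cubes_def
    by (intro CollectI exI[of _ m] bexI[of _ "Act X m n \<phi> q"] allI) simp_all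
qed

text \<open>The dimension \<open>m\<close> need not be that of a cube behind \<open>c\<close>:
  surplus coordinates of \<open>c\<close> are set to 0, and missing ones become degenerate
  directions.\<close>

lemma cubes_realize:
  assumes "c \<in> cubes X" shows "\<exists>q\<in>Val X m. \<forall>v\<in>cube m. vertex X m q v = c (bits m v)"
proof -
  obtain n q where q: "q \<in> Val X n" "\<And>x. c x = vertex X n q (pnt n x)" using assms unfolding cubes_def by blast
  define \<phi> where "\<phi> = (\<lambda>v\<in>cube m. pnt n (\<lambda>i. (if i < m then (\<lambda>x. x i) else (\<lambda>_. False)) (bits m v)))"
  have \<phi>: "\<phi> \<in> Arr Box m n" unfolding \<phi>_def by (rule literal_Arr_Box) auto
  have "vertex X m (Act X m n \<phi> q) v = c (bits m v)" if "v \<in> cube m" for v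
  proof -
    have "\<phi> v = pnt n (bits m v)" unfolding \<phi>_def using that by (auto simp: bits_def intro!: pnt_cong)
    then show ?thesis using vertex_Act[OF presheaf \<phi> q(1) that] q(2) by simp
  qed
  moreover have "Act X m n \<phi> q \<in> Val X m" using is_presheafD(1)[OF presheaf _ _ \<phi> q(1)] by simp
  ultimately show ?thesis by blast
qed

lemma vertex_in_cubes: "q \<in> Val X m \<Longrightarrow> (\<lambda>x. vertex X m q (pnt m x)) \<in> cubes X"
  unfolding cubes_def by blast

lemma cubes_finitary:
  assumes "c \<in> cubes X" shows "\<exists>m. \<forall>x y. (\<forall>i<m. x i = y i) \<longrightarrow> c x = c y"
proof -
  obtain n q where "q \<in> Val X n" "\<And>x. c x = vertex X n q (pnt n x)" using assms unfolding cubes_def by blast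
  then show ?thesis using pnt_cong by (intro exI[of _ n]) metis
qed

end

locale concrete_presheaf = presheaf_on_Box +
  assumes concrete: "concrete_cubeset X"
begin

definition cell :: "nat \<Rightarrow> ((nat \<Rightarrow> int) \<Rightarrow> 'a) \<Rightarrow> 'a" where
  "cell m f = (THE q. q \<in> Val X m \<and> (\<forall>v\<in>cube m. vertex X m q v = f v))"

lemma cell:
  assumes "\<exists>q\<in>Val X m. \<forall>v\<in>cube m. vertex X m q v = f v"
  shows "cell m f \<in> Val X m" "v \<in> cube m \<Longrightarrow> vertex X m (cell m f) v = f v"
proof -
  have "\<exists>!q. q \<in> Val X m \<and> (\<forall>v\<in>cube m. vertex X m q v = f v)"
    using assms concrete_eqI[OF concrete] by metis
  from theI'[OF this] show "cell m f \<in> Val X m" "v \<in> cube m \<Longrightarrow> vertex X m (cell m f) v = f v"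
    unfolding cell_def by auto
qed

text \<open>A map on the corner must be given on all of its cubes. Each of them factors through a
  face with \<open>j\<close>-th coordinate 0, where \<open>c\<close> is a cube by hypothesis, and
  concreteness makes these choices compatible with restriction.\<close>

lemma corner_fill:
  assumes fib: "fibrant_cubeset X" and n: "n \<ge> 1"
    and dep: "\<And>x y. (\<And>i. i < n \<Longrightarrow> x i = y i) \<Longrightarrow> c x = c y"
    and faces: "\<And>j. j < n \<Longrightarrow> (\<lambda>x. c (x(j := False))) \<in> cubes X"
  shows "\<exists>p. (\<lambda>x. if \<forall>j<n. x j then p else c x) \<in> cubes X"
proof -
  define \<theta> where "\<theta> m = (\<lambda>\<phi>\<in>Val (corner n) m. cell m (\<lambda>v. c (bits n (\<phi> v))))" for m
  have corner: "\<phi> \<in> Val (corner n) m \<longleftrightarrow> \<phi> \<in> Arr Box m n \<and> (\<exists>j<n. \<forall>v\<in>cube m. \<phi> v j = 0)" for \<phi> m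
    unfolding corner_def by simp
  have ex: "\<exists>q\<in>Val X m. \<forall>v\<in>cube m. vertex X m q v = c (bits n (\<phi> v))" if \<phi>: "\<phi> \<in> Val (corner n) m" for m \<phi>
  proof -
    obtain j where j: "\<phi> \<in> Arr Box m n" "j < n" "\<And>v. v \<in> cube m \<Longrightarrow> \<phi> v j = 0" using \<phi> corner by blast
    have "(\<lambda>x. c ((\<lambda>i. bits n (\<phi> (pnt m x)) i)(j := False))) \<in> cubes X"
      by (rule cubes_subst[OF faces[OF j(2)], of "\<lambda>i x. bits n (\<phi> (pnt m x)) i"]) (rule Arr_Box_literal[OF j(1)])
    moreover have "(bits n (\<phi> (pnt m x)))(j := False) = bits n (\<phi> (pnt m x))" for x
      using j(3)[of "pnt m x"] by (intro fun_upd_idem) (simp add: bits_def)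
    ultimately have "(\<lambda>x. c (bits n (\<phi> (pnt m x)))) \<in> cubes X" by simp
    from cubes_realize[OF this, of m] show ?thesis by simp
  qed
  have comp: "compose (cube l) \<phi> f \<in> Val (corner n) l" if f: "f \<in> Arr Box l m" and \<phi>: "\<phi> \<in> Val (corner n) m" for l m f \<phi>
  proof -
    obtain j where "j < n" "\<And>v. v \<in> cube m \<Longrightarrow> \<phi> v j = 0" using \<phi> corner by blast
    then have "\<exists>j<n. \<forall>v\<in>cube l. compose (cube l) \<phi> f v j = 0"
      using Arr_BoxD(2)[OF f] by (intro exI[of _ j]) (auto simp: compose_def)
    then show ?thesis using comp_Arr_Box[OF f] \<phi> corner by blast
  qed
  have "\<theta> \<in> presheaf_hom Box (corner n) X" unfolding presheaf_hom_def
  proof (intro CollectI conjI ballI)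
    have "\<theta> m \<in> Val (corner n) m \<rightarrow>\<^sub>E Val X m" for m
      unfolding \<theta>_def using cell(1)[OF ex] by auto
    then show "\<theta> \<in> (\<Pi>\<^sub>E m\<in>Obj Box. Val (corner n) m \<rightarrow>\<^sub>E Val X m)" by (auto simp: PiE_iff extensional_def)
    fix l m f \<phi> assume f: "f \<in> Arr Box l m" and \<phi>: "\<phi> \<in> Val (corner n) m"
    have act: "Act (corner n) l m f \<phi> = compose (cube l) \<phi> f"
      unfolding corner_def representable_def Cmp_Box by simp
    note c' = comp[OF f \<phi>]
    show "\<theta> l (Act (corner n) l m f \<phi>) = Act X l m f (\<theta> m \<phi>)"
    proof (rule concrete_eqI[OF concrete])
      show "\<theta> l (Act (corner n) l m f \<phi>) \<in> Val X l" unfolding act \<theta>_def using cell(1)[OF ex[OF c']] c' by simp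
      have q: "\<theta> m \<phi> \<in> Val X m" unfolding \<theta>_def using cell(1)[OF ex[OF \<phi>]] \<phi> by simp
      show "Act X l m f (\<theta> m \<phi>) \<in> Val X l" using is_presheafD(1)[OF presheaf _ _ f q] by simp
      fix v assume v: "v \<in> cube l"
      have "vertex X l (\<theta> l (Act (corner n) l m f \<phi>)) v = c (bits n (\<phi> (f v)))"
        unfolding act \<theta>_def using cell(2)[OF ex[OF c'] v] c' v by (simp add: compose_def)
      also have "\<dots> = vertex X m (\<theta> m \<phi>) (f v)"
        unfolding \<theta>_def using cell(2)[OF ex[OF \<phi>] Arr_BoxD(2)[OF f v]] \<phi> by simp
      finally show "vertex X l (\<theta> l (Act (corner n) l m f \<phi>)) v = vertex X l (Act X l m f (\<theta> m \<phi>)) v"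
        using vertex_Act[OF presheaf f q v] by simp
    qed
  qed
  then obtain \<eta> where \<eta>: "\<eta> \<in> presheaf_hom Box (representable Box n) X"
      "\<And>m a. a \<in> Val (corner n) m \<Longrightarrow> \<eta> m a = \<theta> m a"
    using fib n unfolding fibrant_cubeset_def extends_from_def by (metis Obj_Box)
  let ?id = "\<lambda>v\<in>cube n. v"
  have idV: "?id \<in> Val (representable Box n) n" unfolding representable_def using id_Arr_Box by simp
  \<comment> \<open>The extended map is determined by the image of the identity cube. Vertices of it
    with a zero entry lie in the corner, so their values are prescribed.\<close>
  define q where "q = \<eta> n ?id"
  have q: "q \<in> Val X n" using \<eta>(1) idV unfolding q_def presheaf_hom_def by (auto simp: PiE_iff)
  have vq: "vertex X n q v = c (bits n v)" if v: "v \<in> cube n" "j < n" "v j = 0" for v j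
  proof -
    let ?v = "\<lambda>_\<in>cube 0. v"
    have "vertex X n q v = \<eta> 0 (Act (representable Box n) 0 n ?v ?id)"
      unfolding vertex_def q_def using \<eta>(1) idV const_Arr_Box[OF v(1), of 0] unfolding presheaf_hom_def by auto
    also have "Act (representable Box n) 0 n ?v ?id = ?v"
      unfolding representable_def using v(1) by (auto simp: Cmp_Box compose_def)
    finally have *: "vertex X n q v = \<eta> 0 ?v" .
    have cv: "?v \<in> Val (corner n) 0" using corner const_Arr_Box[OF v(1)] v by auto
    have u: "(\<lambda>_. undefined) \<in> cube 0" by (simp add: cube_0)
    have "\<eta> 0 ?v = vertex X 0 (cell 0 (\<lambda>u. c (bits n (?v u)))) (\<lambda>_. undefined)"
      using vertex_0[OF presheaf cell(1)[OF ex[OF cv]] u] \<eta>(2)[OF cv] cv unfolding \<theta>_def by simp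
    also have "\<dots> = c (bits n v)" using cell(2)[OF ex[OF cv] u] u by simp
    finally show ?thesis using * by simp
  qed
  define p where "p = vertex X n q (pnt n (\<lambda>_. True))"
  have "(if \<forall>j<n. x j then p else c x) = vertex X n q (pnt n x)" for x
  proof (cases "\<forall>j<n. x j")
    case True
    then have "pnt n x = pnt n (\<lambda>_. True)" by (intro pnt_cong) simp
    then show ?thesis using True unfolding p_def by simp
  next
    case False
    then obtain j where "j < n" "\<not> x j" by blast
    then have "vertex X n q (pnt n x) = c (bits n (pnt n x))" by (intro vq[of _ j]) (auto simp: pnt_def intro!: pnt_in_cube[unfolded pnt_def])
    also have "\<dots> = c x" by (rule dep) (simp add: bits_pnt)
    finally show ?thesis using False by auto
  qed
  then have "(\<lambda>x. if \<forall>j<n. x j then p else c x) = (\<lambda>x. vertex X n q (pnt n x))" by (rule ext)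
  then show ?thesis using vertex_in_cubes[OF q] by (intro exI[of _ p]) (simp only:)
qed

lemma cube_system_cubes:
  assumes fib: "fibrant_cubeset X"
  shows "cube_system (cubes X)"
proof
  show "\<exists>m. \<forall>x y. (\<forall>i<m. x i = y i) \<longrightarrow> c x = c y" if "c \<in> cubes X" for c by (rule cubes_finitary[OF that])
  show "(\<lambda>x. c (\<lambda>i. s i x)) \<in> cubes X" if "c \<in> cubes X" "\<And>i. s i \<in> literals" for c s
    by (rule cubes_subst[OF that])
  fix J :: "nat set" and c :: "(nat \<Rightarrow> bool) \<Rightarrow> 'a"
  assume J: "finite J" "J \<noteq> {}" and dep: "\<And>x y. (\<And>i. i \<in> J \<Longrightarrow> x i = y i) \<Longrightarrow> c x = c y"
    and faces: "\<And>j. j \<in> J \<Longrightarrow> (\<lambda>x. c (x(j := False))) \<in> cubes X"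
  let ?n = "card J"
  obtain e where e: "bij_betw e {0..<?n} J" using ex_bij_betw_nat_finite[OF J(1)] by blast
  define e' where "e' = the_inv_into {0..<?n} e"
  have e'n: "e' i < ?n" "e (e' i) = i" if "i \<in> J" for i
    using that e f_the_inv_into_f_bij_betw[OF e] bij_betwE[OF bij_betw_the_inv_into[OF e]] unfolding e'_def by auto
  have e'e: "e' (e j) = j" "e j \<in> J" if "j < ?n" for j
    using that e the_inv_into_f_f[of e "{0..<?n}" j] unfolding e'_def bij_betw_def by auto
  define c' where "c' x = c (\<lambda>i. x (e' i))" for x
  have "\<exists>p. (\<lambda>x. if \<forall>j<?n. x j then p else c' x) \<in> cubes X"
  proof (rule corner_fill[OF fib])
    show "1 \<le> ?n" using J by (simp add: Suc_le_eq card_gt_0_iff)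
    show "c' x = c' y" if "\<And>i. i < ?n \<Longrightarrow> x i = y i" for x y unfolding c'_def by (rule dep) (use that e'n in auto)
    fix j assume j: "j < ?n"
    have "(\<lambda>x. c ((\<lambda>i. x (e' i))(e j := False))) \<in> cubes X"
      by (rule cubes_subst[OF faces[OF e'e(2)[OF j]], of "\<lambda>i x. x (e' i)"]) simp
    moreover have "c ((\<lambda>i. x (e' i))(e j := False)) = c' (x(j := False))" for x
      unfolding c'_def by (rule dep) (use e'n e'e[OF j] in auto)
    ultimately show "(\<lambda>x. c' (x(j := False))) \<in> cubes X" by simp
  qed
  then obtain p where p: "(\<lambda>x. if \<forall>j<?n. x j then p else c' x) \<in> cubes X" by blast
  have "(\<lambda>x. if \<forall>j<?n. x (e j) then p else c' (\<lambda>j. x (e j))) \<in> cubes X"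
    using cubes_subst[OF p, of "\<lambda>j x. x (e j)"] by simp
  moreover have "(\<lambda>x. if \<forall>j<?n. x (e j) then p else c' (\<lambda>j. x (e j))) = (\<lambda>x. if \<forall>j\<in>J. x j then p else c x)"
  proof (rule ext)
    fix x :: "nat \<Rightarrow> bool"
    have "(\<forall>j<?n. x (e j)) \<longleftrightarrow> (\<forall>j\<in>J. x j)" using e'n e'e(2) by metis
    moreover have "c' (\<lambda>j. x (e j)) = c x" unfolding c'_def by (rule dep) (use e'n in auto)
    ultimately show "(if \<forall>j<?n. x (e j) then p else c' (\<lambda>j. x (e j))) = (if \<forall>j\<in>J. x j then p else c x)" by simp
  qed
  ultimately show "\<exists>p. (\<lambda>x. if \<forall>j\<in>J. x j then p else c x) \<in> cubes X" by (intro exI[of _ p]) simp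
qed

end

section \<open>Simplices of \<open>K\<^sup>* X\<close> and the Kan condition\<close>

lemma codegeneracy_image_iff:
  "j \<noteq> i \<Longrightarrow> j \<noteq> Suc i \<Longrightarrow> codegeneracy i j \<in> codegeneracy i ` B \<longleftrightarrow> j \<in> B"
  "i \<in> codegeneracy i ` B \<longleftrightarrow> i \<in> B \<or> Suc i \<in> B"
proof -
  assume j: "j \<noteq> i" "j \<noteq> Suc i"
  have "j' = j" if "codegeneracy i j = codegeneracy i j'" for j'
    using that j unfolding codegeneracy_def by (auto split: if_splits)
  then show "codegeneracy i j \<in> codegeneracy i ` B \<longleftrightarrow> j \<in> B" by auto
next
  have "i = codegeneracy i j' \<longleftrightarrow> j' = i \<or> j' = Suc i" for j'
    unfolding codegeneracy_def by auto
  then show "i \<in> codegeneracy i ` B \<longleftrightarrow> i \<in> B \<or> Suc i \<in> B" unfolding image_iff by auto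
qed

lemma codegeneracy_image_eqI:
  assumes "\<And>j. j \<noteq> i \<Longrightarrow> j \<noteq> Suc i \<Longrightarrow> j \<in> B \<longleftrightarrow> j \<in> B'" "i \<in> B \<or> Suc i \<in> B \<longleftrightarrow> i \<in> B' \<or> Suc i \<in> B'"
  shows "codegeneracy i ` B = codegeneracy i ` B'"
proof -
  have img: "codegeneracy i ` B = codegeneracy i ` (B - {i, Suc i}) \<union> (if i \<in> B \<or> Suc i \<in> B then {i} else {})" for B
  proof -
    have "B = (B - {i, Suc i}) \<union> (B \<inter> {i, Suc i})" by blast
    then have "codegeneracy i ` B = codegeneracy i ` (B - {i, Suc i}) \<union> codegeneracy i ` (B \<inter> {i, Suc i})"
      using image_Un[of "codegeneracy i" "B - {i, Suc i}" "B \<inter> {i, Suc i}"] by (simp only:)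
    moreover have "codegeneracy i ` (B \<inter> {i, Suc i}) = (\<lambda>_. i) ` (B \<inter> {i, Suc i})"
      by (intro image_cong) (auto simp: codegeneracy_def)
    then have "codegeneracy i ` (B \<inter> {i, Suc i}) = (if i \<in> B \<or> Suc i \<in> B then {i} else {})" by auto
    ultimately show ?thesis by simp
  qed
  have "codegeneracy i ` B = codegeneracy i ` (B - {i, Suc i}) \<union> (if i \<in> B \<or> Suc i \<in> B then {i} else {})"
    by (rule img)
  also have "B - {i, Suc i} = B' - {i, Suc i}" using assms(1) by blast
  also have "(i \<in> B \<or> Suc i \<in> B) = (i \<in> B' \<or> Suc i \<in> B')" by (rule assms(2))
  also have "codegeneracy i ` (B' - {i, Suc i}) \<union> (if i \<in> B' \<or> Suc i \<in> B' then {i} else {}) = codegeneracy i ` B'"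
    by (rule img[symmetric])
  finally show ?thesis .
qed

lemma degenerable_imp_degen:
  assumes "degenerable k A" shows "degen k (\<lambda>x. A (pnt k x))"
  unfolding degen_def
proof (intro conjI allI impI)
  have A: "A v \<in> Sub k" if "v \<in> cube k" for v using assms that unfolding degenerable_def by auto
  show "A (pnt k x) \<subseteq> {..k}" "A (pnt k x) \<noteq> {}" for x using A[of "pnt k x"] unfolding Sub_def by auto
  show "A (pnt k x) = A (pnt k y)" if "\<forall>i<k. x i = y i" for x y using pnt_cong[of k x y] that by simp
  fix i x b assume i: "i < k"
  have eq: "codegeneracy i ` A (pnt k (x(i := b))) = codegeneracy i ` A (pnt k x)"
  proof -
    have "pnt k (x(i := b)) j = pnt k x j" if "j \<noteq> i" for j using that unfolding pnt_def by simp
    then show ?thesis using assms i unfolding degenerable_def by simp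
  qed
  show "j \<in> A (pnt k (x(i := b))) \<longleftrightarrow> j \<in> A (pnt k x)" if "j \<noteq> i" "j \<noteq> Suc i" for j
    using codegeneracy_image_iff(1)[OF that, of "A (pnt k (x(i := b)))"] codegeneracy_image_iff(1)[OF that, of "A (pnt k x)"] eq
    by simp
  show "i \<in> A (pnt k (x(i := b))) \<or> Suc i \<in> A (pnt k (x(i := b))) \<longleftrightarrow> i \<in> A (pnt k x) \<or> Suc i \<in> A (pnt k x)"
    using codegeneracy_image_iff(2)[of i "A (pnt k (x(i := b)))"] codegeneracy_image_iff(2)[of i "A (pnt k x)"] eq
    by simp
qed

lemma degen_imp_degenerable:
  assumes "degen k A" shows "degenerable k (\<lambda>v\<in>cube k. A (bits k v))"
  unfolding degenerable_def
proof (intro conjI allI impI ballI)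
  show "(\<lambda>v\<in>cube k. A (bits k v)) \<in> cube k \<rightarrow>\<^sub>E Sub k"
    using degenD(1,2)[OF assms] unfolding Sub_def by auto
  fix i u v assume i: "i < k" and uv: "u \<in> cube k" "v \<in> cube k" "\<forall>j. j \<noteq> i \<longrightarrow> u j = v j"
  have "bits k u = (bits k v)(i := bits k u i)"
  proof (rule ext)
    show "bits k u j = ((bits k v)(i := bits k u i)) j" for j using uv(3) by (simp add: bits_def)
  qed
  then obtain b where b: "bits k u = (bits k v)(i := b)" by blast
  show "codegeneracy i ` (\<lambda>v\<in>cube k. A (bits k v)) u = codegeneracy i ` (\<lambda>v\<in>cube k. A (bits k v)) v"
    using uv(1,2) degenD(4,5)[OF assms i] unfolding b by (simp add: b) (rule codegeneracy_image_eqI)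
qed

lemma Arr_Simplex_iff: "\<sigma> \<in> Arr Simplex k n \<longleftrightarrow> \<sigma> \<in> {..k} \<rightarrow>\<^sub>E {..n} \<and> mono_on {..k} \<sigma>"
  unfolding Simplex_def by simp

lemma K_Val_I:
  assumes "\<phi> \<in> Arr Box m k" "mono_on {..k} \<sigma>" "\<sigma> ` {..k} \<subseteq> {..n}" "degen k A"
  shows "(\<lambda>v\<in>cube m. \<sigma> ` A (bits k (\<phi> v))) \<in> Val (K n) m"
proof -
  have "restrict \<sigma> {..k} \<in> Arr Simplex k n" using assms(2,3) unfolding Arr_Simplex_iff mono_on_def by auto
  then have "(\<lambda>v\<in>cube m. restrict \<sigma> {..k} ` (\<lambda>v\<in>cube k. A (bits k v)) (\<phi> v)) \<in> Val (K n) m"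
    unfolding K_def presheaf.select_convs mem_Collect_eq using assms(1) degen_imp_degenerable[OF assms(4)]
    by (intro exI[of _ "restrict \<sigma> {..k}"] exI[of _ "\<lambda>v\<in>cube k. A (bits k v)"] exI[of _ \<phi>] exI[of _ k] conjI refl)
  moreover have "restrict \<sigma> {..k} ` A x = \<sigma> ` A x" for x
    by (rule image_cong) (use degenD(1)[OF assms(4), of x] in auto)
  then have "(\<lambda>v\<in>cube m. restrict \<sigma> {..k} ` (\<lambda>v\<in>cube k. A (bits k v)) (\<phi> v)) = (\<lambda>v\<in>cube m. \<sigma> ` A (bits k (\<phi> v)))"
    using Arr_BoxD(2)[OF assms(1)] by (intro restrict_ext) (simp del: restrict_apply add: restrict_apply'[of _ "cube k"])
  ultimately show ?thesis by simp
qed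

lemma K_Val_E:
  assumes "a \<in> Val (K n) m"
  obtains k \<phi> \<sigma> A where "\<phi> \<in> Arr Box m k" "mono_on {..k} \<sigma>" "\<sigma> ` {..k} \<subseteq> {..n}" "degen k A"
    "a = (\<lambda>v\<in>cube m. \<sigma> ` A (bits k (\<phi> v)))"
proof -
  obtain k \<phi> \<sigma> A where *: "\<phi> \<in> Arr Box m k" "degenerable k A" "\<sigma> \<in> Arr Simplex k n" "a = (\<lambda>v\<in>cube m. \<sigma> ` A (\<phi> v))"
    using assms unfolding K_def by auto
  show thesis
  proof (rule that[OF *(1) _ _ degenerable_imp_degen[OF *(2)]])
    show "mono_on {..k} \<sigma>" "\<sigma> ` {..k} \<subseteq> {..n}" using *(3) unfolding Arr_Simplex_iff by auto
    show "a = (\<lambda>v\<in>cube m. \<sigma> ` A (pnt k (bits k (\<phi> v))))"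
      unfolding *(4) using Arr_BoxD(2)[OF *(1)] by (intro restrict_ext) simp
  qed
qed

lemma K_Val_Sub:
  assumes "a \<in> Val (K n) m" "v \<in> cube m" shows "a v \<in> Sub n"
  using assms(1)
proof (rule K_Val_E)
  fix k \<phi> \<sigma> A assume *: "mono_on {..k} \<sigma>" "\<sigma> ` {..k} \<subseteq> {..n}" "degen k A" "a = (\<lambda>v\<in>cube m. \<sigma> ` A (bits k (\<phi> v)))"
  have "a v = \<sigma> ` A (bits k (\<phi> v))" using *(4) assms(2) by simp
  then show ?thesis using degenD(1,2)[OF *(3), of "bits k (\<phi> v)"] *(2) unfolding Sub_def by blast
qed

lemma K_Val_ext: "a \<in> Val (K n) m \<Longrightarrow> (\<lambda>v\<in>cube m. a v) = a"
  by (erule K_Val_E) (auto simp: fun_eq_iff)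

lemma K_Val_comp:
  assumes "a \<in> Val (K n) m" "f \<in> Arr Box l m" shows "compose (cube l) a f \<in> Val (K n) l"
  using assms(1)
proof (rule K_Val_E)
  fix k \<phi> \<sigma> A assume *: "\<phi> \<in> Arr Box m k" "mono_on {..k} \<sigma>" "\<sigma> ` {..k} \<subseteq> {..n}" "degen k A" "a = (\<lambda>v\<in>cube m. \<sigma> ` A (bits k (\<phi> v)))"
  have "compose (cube l) a f = (\<lambda>v\<in>cube l. \<sigma> ` A (bits k (compose (cube l) \<phi> f v)))"
    unfolding *(5) compose_def using Arr_BoxD(2)[OF assms(2)] by (intro restrict_ext) simp
  then show ?thesis using K_Val_I[OF comp_Arr_Box[OF assms(2) *(1)] *(2-4)] by simp
qed

lemma K_Val_push:
  assumes "a \<in> Val (K m) p" "\<tau> \<in> Arr Simplex m n" shows "(\<lambda>v\<in>cube p. \<tau> ` a v) \<in> Val (K n) p"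
  using assms(1)
proof (rule K_Val_E)
  fix k \<phi> \<sigma> A assume *: "\<phi> \<in> Arr Box p k" "mono_on {..k} \<sigma>" "\<sigma> ` {..k} \<subseteq> {..m}" "degen k A" "a = (\<lambda>v\<in>cube p. \<sigma> ` A (bits k (\<phi> v)))"
  have "(\<lambda>v\<in>cube p. \<tau> ` a v) = (\<lambda>v\<in>cube p. (\<tau> \<circ> \<sigma>) ` A (bits k (\<phi> v)))"
    unfolding *(5) by (intro restrict_ext) (simp add: image_comp)
  moreover have "(\<tau> \<circ> \<sigma>) ` {..k} \<subseteq> {..n}" using *(3) assms(2) unfolding Arr_Simplex_iff by auto
  moreover have "mono_on {..k} (\<tau> \<circ> \<sigma>)"
  proof (rule mono_onI)
    fix r s assume "r \<in> {..k}" "s \<in> {..k}" "r \<le> s"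
    then have "\<sigma> r \<le> \<sigma> s" "\<sigma> r \<in> {..m}" "\<sigma> s \<in> {..m}" using *(2,3) unfolding mono_on_def by blast+
    then show "(\<tau> \<circ> \<sigma>) r \<le> (\<tau> \<circ> \<sigma>) s" using assms(2) unfolding Arr_Simplex_iff mono_on_def by simp
  qed
  ultimately show ?thesis using K_Val_I[OF *(1) _ _ *(4)] by metis
qed

text \<open>The pattern in which nothing varies. In particular every label set is a point of
  \<open>K n\<close>.\<close>

lemma K_Val_const:
  assumes "B \<in> Sub n" shows "(\<lambda>_\<in>cube m. B) \<in> Val (K n) m"
proof -
  have B: "sep B {}" "B \<union> {} \<subseteq> {..n}" using assms unfolding Sub_def sep_def by (auto intro: finite_subset)
  obtain k \<sigma> A y where *: "mono_on {..k} \<sigma>" "\<sigma> ` {..k} \<subseteq> {..n}" "degen k A"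
    "\<And>i. (\<lambda>x. y x i) \<in> literals" "\<And>x. cfg B {} x = \<sigma> ` A (y x)" using cfg_eq_degen[OF B] by metis
  let ?x = "y (\<lambda>_. False)"
  have "A (bits k (pnt k ?x)) = A ?x" by (rule degenD(3)[OF *(3)]) (simp add: bits_pnt)
  then have "B = \<sigma> ` A (bits k (pnt k ?x))" using *(5)[of "\<lambda>_. False"] unfolding cfg_def by simp
  then have "(\<lambda>_\<in>cube m. B) = (\<lambda>v\<in>cube m. \<sigma> ` A (bits k ((\<lambda>_\<in>cube m. pnt k ?x) v)))"
    by (intro restrict_ext) simp
  then show ?thesis using K_Val_I[OF const_Arr_Box[OF pnt_in_cube] *(1-3)] by metis
qed

lemma Act_K: "Act (K n) l m \<phi> a = compose (cube l) a \<phi>"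
  unfolding K_def by simp

lemma Val_Kstar: "Val (FObj Kstar X) n = presheaf_hom Box (K n) X"
  and Act_Kstar: "Act (FObj Kstar X) m n \<sigma> \<theta> = (\<lambda>p. \<lambda>a\<in>Val (K m) p. \<theta> p (\<lambda>v\<in>cube p. \<sigma> ` a v))"
  unfolding Kstar_def by simp_all

lemma Obj_Simplex [simp]: "n \<in> Obj Simplex"
  unfolding Simplex_def by simp

lemma presheaf_homD:
  assumes "\<theta> \<in> presheaf_hom B P Q" "x \<in> Obj B"
  shows "a \<in> Val P x \<Longrightarrow> \<theta> x a \<in> Val Q x" "\<theta> x \<in> extensional (Val P x)"
    "y \<in> Obj B \<Longrightarrow> f \<in> Arr B x y \<Longrightarrow> b \<in> Val P y \<Longrightarrow> \<theta> x (Act P x y f b) = Act Q x y f (\<theta> y b)"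
  using assms unfolding presheaf_hom_def by (auto simp: PiE_iff)

lemma presheaf_homI:
  assumes "\<And>x a. x \<in> Obj B \<Longrightarrow> a \<in> Val P x \<Longrightarrow> \<theta> x a \<in> Val Q x"
    and "\<And>x. x \<in> Obj B \<Longrightarrow> \<theta> x \<in> extensional (Val P x)" "\<theta> \<in> extensional (Obj B)"
    and "\<And>x y f b. x \<in> Obj B \<Longrightarrow> y \<in> Obj B \<Longrightarrow> f \<in> Arr B x y \<Longrightarrow> b \<in> Val P y \<Longrightarrow> \<theta> x (Act P x y f b) = Act Q x y f (\<theta> y b)"
  shows "\<theta> \<in> presheaf_hom B P Q"
  using assms unfolding presheaf_hom_def by (auto simp: PiE_iff)

lemma Box_extensional [simp]: "\<theta> \<in> extensional (Obj Box)" "\<theta>' \<in> extensional (Obj Simplex)"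
  unfolding Box_def Simplex_def by (auto simp: extensional_def)

lemma Kstar_Act_hom:
  assumes \<theta>: "\<theta> \<in> presheaf_hom Box (K n) X" and \<sigma>: "\<sigma> \<in> Arr Simplex m n"
  shows "Act (FObj Kstar X) m n \<sigma> \<theta> \<in> presheaf_hom Box (K m) X"
  unfolding Act_Kstar
proof (rule presheaf_homI)
  show "(\<lambda>a\<in>Val (K m) p. \<theta> p (\<lambda>v\<in>cube p. \<sigma> ` a v)) a \<in> Val X p" if "a \<in> Val (K m) p" for p a
    using presheaf_homD(1)[OF \<theta> _ K_Val_push[OF that \<sigma>]] that by simp
  fix p q f b assume f: "f \<in> Arr Box p q" and b: "b \<in> Val (K m) q"
  have "(\<lambda>v\<in>cube p. \<sigma> ` compose (cube p) b f v) = compose (cube p) (\<lambda>v\<in>cube q. \<sigma> ` b v) f"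
    unfolding compose_def using Arr_BoxD(2)[OF f] by (intro restrict_ext) simp
  then show "(\<lambda>a\<in>Val (K m) p. \<theta> p (\<lambda>v\<in>cube p. \<sigma> ` a v)) (Act (K m) p q f b) =
      Act X p q f ((\<lambda>a\<in>Val (K m) q. \<theta> q (\<lambda>v\<in>cube q. \<sigma> ` a v)) b)"
    using presheaf_homD(3)[OF \<theta> _ _ f K_Val_push[OF b \<sigma>]] b K_Val_comp[OF b f] by (simp add: Act_K)
qed simp_all

lemma Kstar_presheaf: "is_presheaf Simplex (FObj Kstar X)"
  unfolding is_presheaf_def
proof (intro conjI ballI)
  show "Act (FObj Kstar X) m n \<sigma> \<in> Val (FObj Kstar X) n \<rightarrow> Val (FObj Kstar X) m" if "\<sigma> \<in> Arr Simplex m n" for m n \<sigma>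
    using Kstar_Act_hom[OF _ that] unfolding Val_Kstar by blast
  show "Act (FObj Kstar X) n n (Idn Simplex n) \<theta> = \<theta>" if \<theta>: "\<theta> \<in> Val (FObj Kstar X) n" for n \<theta>
  proof (rule ext)
    fix p
    have "(\<lambda>a\<in>Val (K n) p. \<theta> p (\<lambda>v\<in>cube p. Idn Simplex n ` a v)) = (\<lambda>a\<in>Val (K n) p. \<theta> p a)"
    proof (rule restrict_ext)
      fix a assume a: "a \<in> Val (K n) p"
      have "Idn Simplex n ` a v = a v" if "v \<in> cube p" for v
        using K_Val_Sub[OF a that] unfolding Simplex_def Sub_def by force
      then have "(\<lambda>v\<in>cube p. Idn Simplex n ` a v) = (\<lambda>v\<in>cube p. a v)" by (rule restrict_ext)
      then show "\<theta> p (\<lambda>v\<in>cube p. Idn Simplex n ` a v) = \<theta> p a" using K_Val_ext[OF a] by simp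
    qed
    also have "\<dots> = \<theta> p" using presheaf_homD(2)[of \<theta> Box "K n" X p] \<theta> unfolding Val_Kstar
      by (simp add: extensional_restrict)
    finally show "Act (FObj Kstar X) n n (Idn Simplex n) \<theta> p = \<theta> p" unfolding Act_Kstar .
  qed
  fix l m n \<sigma> \<tau> \<theta> assume \<sigma>: "\<sigma> \<in> Arr Simplex l m" and \<tau>: "\<tau> \<in> Arr Simplex m n"
  show "Act (FObj Kstar X) l n (Cmp Simplex l m n \<tau> \<sigma>) \<theta> =
      Act (FObj Kstar X) l m \<sigma> (Act (FObj Kstar X) m n \<tau> \<theta>)" unfolding Act_Kstar
  proof (rule ext)
    fix p show "(\<lambda>a\<in>Val (K l) p. \<theta> p (\<lambda>v\<in>cube p. Cmp Simplex l m n \<tau> \<sigma> ` a v)) =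
      (\<lambda>a\<in>Val (K l) p. (\<lambda>a\<in>Val (K m) p. \<theta> p (\<lambda>v\<in>cube p. \<tau> ` a v)) (\<lambda>v\<in>cube p. \<sigma> ` a v))"
    proof (rule restrict_ext)
      fix a assume a: "a \<in> Val (K l) p"
      have "Cmp Simplex l m n \<tau> \<sigma> ` a v = \<tau> ` \<sigma> ` a v" if "v \<in> cube p" for v
      proof -
        have "a v \<subseteq> {..l}" using K_Val_Sub[OF a that] unfolding Sub_def by auto
        then have "Cmp Simplex l m n \<tau> \<sigma> ` a v = (\<lambda>i. \<tau> (\<sigma> i)) ` a v"
          by (intro image_cong) (auto simp: Simplex_def compose_def)
        then show ?thesis by (simp add: image_image)
      qed
      then have "(\<lambda>v\<in>cube p. Cmp Simplex l m n \<tau> \<sigma> ` a v) = (\<lambda>v\<in>cube p. \<tau> ` (\<lambda>v\<in>cube p. \<sigma> ` a v) v)"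
        by (intro restrict_ext) simp
      then show "\<theta> p (\<lambda>v\<in>cube p. Cmp Simplex l m n \<tau> \<sigma> ` a v) = (\<lambda>a\<in>Val (K m) p. \<theta> p (\<lambda>v\<in>cube p. \<tau> ` a v)) (\<lambda>v\<in>cube p. \<sigma> ` a v)"
        using K_Val_push[OF a \<sigma>] by simp
    qed
  qed
qed

text \<open>The function on label sets that a simplex induces on vertices.\<close>

definition kval :: "(nat \<Rightarrow> ((nat \<Rightarrow> int) \<Rightarrow> nat set) \<Rightarrow> 'a) \<Rightarrow> nat set \<Rightarrow> 'a" where
  "kval \<theta> B = \<theta> 0 (\<lambda>_\<in>cube 0. B)"

lemma kval_Act:
  assumes "B \<in> Sub m" shows "kval (Act (FObj Kstar X) m n \<sigma> \<theta>) B = kval \<theta> (\<sigma> ` B)"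
proof -
  have "(\<lambda>v\<in>cube 0. \<sigma> ` (\<lambda>_\<in>cube 0. B) v) = (\<lambda>_\<in>cube 0. \<sigma> ` B)" by (rule restrict_ext) simp
  then show ?thesis unfolding kval_def Act_Kstar using K_Val_const[OF assms, of 0] by simp
qed

context presheaf_on_Box begin

lemma hom_vertex:
  assumes \<theta>: "\<theta> \<in> presheaf_hom Box (K n) X" and a: "a \<in> Val (K n) p" and v: "v \<in> cube p"
  shows "vertex X p (\<theta> p a) v = kval \<theta> (a v)"
proof -
  have "vertex X p (\<theta> p a) v = \<theta> 0 (Act (K n) 0 p (\<lambda>_\<in>cube 0. v) a)"
    unfolding vertex_def using presheaf_homD(3)[OF \<theta> _ _ const_Arr_Box[OF v] a] by simp
  also have "Act (K n) 0 p (\<lambda>_\<in>cube 0. v) a = (\<lambda>_\<in>cube 0. a v)"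
    unfolding Act_K compose_def by (rule restrict_ext) simp
  finally show ?thesis unfolding kval_def .
qed

end

context concrete_presheaf begin

lemma hom_eqI:
  assumes \<theta>: "\<theta> \<in> presheaf_hom Box (K n) X" and \<theta>': "\<theta>' \<in> presheaf_hom Box (K n) X"
    and eq: "\<And>B. B \<in> Sub n \<Longrightarrow> kval \<theta> B = kval \<theta>' B"
  shows "\<theta> = \<theta>'"
proof (rule ext)
  fix p
  show "\<theta> p = \<theta>' p"
  proof (rule extensionalityI)
    show "\<theta> p \<in> extensional (Val (K n) p)" "\<theta>' p \<in> extensional (Val (K n) p)"
      using presheaf_homD(2)[OF \<theta>, of p] presheaf_homD(2)[OF \<theta>', of p] by simp_all
    fix a assume a: "a \<in> Val (K n) p"
    show "\<theta> p a = \<theta>' p a"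
    proof (rule concrete_eqI[OF concrete])
      show "\<theta> p a \<in> Val X p" "\<theta>' p a \<in> Val X p"
        using presheaf_homD(1)[OF \<theta> _ a] presheaf_homD(1)[OF \<theta>' _ a] by simp_all
      show "vertex X p (\<theta> p a) v = vertex X p (\<theta>' p a) v" if "v \<in> cube p" for v
        using hom_vertex[OF \<theta> a that] hom_vertex[OF \<theta>' a that] eq[OF K_Val_Sub[OF a that]] by simp
    qed
  qed
qed

end

locale fibrant_presheaf = concrete_presheaf +
  assumes fibrant: "fibrant_cubeset X"

sublocale fibrant_presheaf \<subseteq> cube_system "cubes X"
  by (rule cube_system_cubes[OF fibrant])

context fibrant_presheaf begin

lemma good_kval:
  assumes \<theta>: "\<theta> \<in> presheaf_hom Box (K n) X" shows "good (kval \<theta>) {..n}"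
proof (rule goodI_degen)
  fix k \<sigma> A assume *: "mono_on {..k} \<sigma>" "\<sigma> ` {..k} \<subseteq> {..n}" "degen k A"
  let ?a = "\<lambda>v\<in>cube k. \<sigma> ` A (bits k ((\<lambda>v\<in>cube k. v) v))"
  have a: "?a \<in> Val (K n) k" by (rule K_Val_I[OF id_Arr_Box *])
  have "(\<lambda>x. vertex X k (\<theta> k ?a) (pnt k x)) \<in> cubes X"
    using presheaf_homD(1)[OF \<theta> _ a] by (intro vertex_in_cubes) simp
  moreover have "vertex X k (\<theta> k ?a) (pnt k x) = kval \<theta> (\<sigma> ` A x)" for x
  proof -
    have "A (bits k (pnt k x)) = A x" by (rule degenD(3)[OF *(3)]) (simp add: bits_pnt)
    then show ?thesis using hom_vertex[OF \<theta> a, of "pnt k x"] by simp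
  qed
  ultimately show "(\<lambda>x. kval \<theta> (\<sigma> ` A x)) \<in> cubes X" by simp
qed

text \<open>Cubes of \<open>K n\<close> are pushed forward degenerable cubes, and
  \<open>good_push\<close> with \<open>good_imp_degen\<close> sends them to cubes of
  \<open>X\<close>. Together with \<open>good_kval\<close> and \<open>hom_eqI\<close> this
  identifies simplices with good functions on label sets.\<close>

lemma hom_of_good:
  assumes good: "good g {..n}"
  obtains \<theta> where "\<theta> \<in> presheaf_hom Box (K n) X" "\<And>B. B \<in> Sub n \<Longrightarrow> kval \<theta> B = g B"
proof -
  define \<theta> where "\<theta> p = (\<lambda>a\<in>Val (K n) p. cell p (\<lambda>v. g (a v)))" for p
  have ex: "\<exists>q\<in>Val X p. \<forall>v\<in>cube p. vertex X p q v = g (a v)" if a: "a \<in> Val (K n) p" for a p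
    using a
  proof (rule K_Val_E)
    fix k \<phi> \<sigma> A assume *: "\<phi> \<in> Arr Box p k" "mono_on {..k} \<sigma>" "\<sigma> ` {..k} \<subseteq> {..n}" "degen k A" "a = (\<lambda>v\<in>cube p. \<sigma> ` A (bits k (\<phi> v)))"
    have "(\<lambda>x. g (\<sigma> ` A x)) \<in> cubes X"
      using good_imp_degen[OF good_push[OF good *(2,3)] *(4)] .
    from cubes_subst[OF this, of "\<lambda>i x. bits k (\<phi> (pnt p x)) i"] Arr_Box_literal[OF *(1)]
    have "(\<lambda>x. g (\<sigma> ` A (bits k (\<phi> (pnt p x))))) \<in> cubes X" by simp
    from cubes_realize[OF this, of p] show ?thesis unfolding *(5) by simp
  qed
  have \<theta>: "\<theta> \<in> presheaf_hom Box (K n) X"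
  proof (rule presheaf_homI)
    show "\<theta> p a \<in> Val X p" if "a \<in> Val (K n) p" for p a unfolding \<theta>_def using cell(1)[OF ex[OF that]] that by simp
    then have mem: "\<theta> p a \<in> Val X p" if "a \<in> Val (K n) p" for p a using that .
    fix l m f b assume f: "f \<in> Arr Box l m" and b: "b \<in> Val (K n) m"
    have c: "compose (cube l) b f \<in> Val (K n) l" by (rule K_Val_comp[OF b f])
    have q: "\<theta> m b \<in> Val X m" by (rule mem[OF b])
    show "\<theta> l (Act (K n) l m f b) = Act X l m f (\<theta> m b)" unfolding Act_K
    proof (rule concrete_eqI[OF concrete])
      show "\<theta> l (compose (cube l) b f) \<in> Val X l" by (rule mem[OF c])
      show "Act X l m f (\<theta> m b) \<in> Val X l" using is_presheafD(1)[OF presheaf _ _ f q] by simp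
      fix v assume v: "v \<in> cube l"
      have "vertex X l (\<theta> l (compose (cube l) b f)) v = g (b (f v))"
        unfolding \<theta>_def using cell(2)[OF ex[OF c] v] c v by (simp add: compose_def)
      also have "\<dots> = vertex X m (\<theta> m b) (f v)"
        unfolding \<theta>_def using cell(2)[OF ex[OF b] Arr_BoxD(2)[OF f v]] b by simp
      finally show "vertex X l (\<theta> l (compose (cube l) b f)) v = vertex X l (Act X l m f (\<theta> m b)) v"
        using vertex_Act[OF presheaf f q v] by simp
    qed
  qed (auto simp: \<theta>_def)
  moreover have "kval \<theta> B = g B" if B: "B \<in> Sub n" for B
  proof -
    let ?b = "\<lambda>_\<in>cube 0. B"
    have b: "?b \<in> Val (K n) 0" by (rule K_Val_const[OF B])
    have u: "(\<lambda>_. undefined) \<in> cube 0" by (simp add: cube_0)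
    have "kval \<theta> B = vertex X 0 (cell 0 (\<lambda>v. g (?b v))) (\<lambda>_. undefined)"
      using vertex_0[OF presheaf cell(1)[OF ex[OF b]] u] b unfolding kval_def \<theta>_def by simp
    also have "\<dots> = g B" using cell(2)[OF ex[OF b] u] u by simp
    finally show ?thesis .
  qed
  ultimately show thesis by (rule that)
qed

end

text \<open>A monotone retraction of {0..n} onto \<open>B\<close>. It represents the face spanned by
  \<open>B\<close> by a simplex of the same dimension \<open>n\<close>, which avoids renumbering the
  vertices of faces.\<close>

definition retr :: "nat \<Rightarrow> nat set \<Rightarrow> nat \<Rightarrow> nat" where
  "retr n B = (\<lambda>i\<in>{..n}. if \<exists>b\<in>B. b \<le> i then Max {b \<in> B. b \<le> i} else Min B)"

lemma retr:
  assumes "B \<in> Sub n"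
  shows "retr n B \<in> Arr Simplex n n" "i \<le> n \<Longrightarrow> retr n B i \<in> B" "b \<in> B \<Longrightarrow> retr n B b = b"
    "retr n B ` B = B" "retr n B ` {..n} = B"
proof -
  have B: "finite B" "B \<noteq> {}" "B \<subseteq> {..n}" using assms unfolding Sub_def by (auto intro: finite_subset)
  have mem: "retr n B i \<in> B" if "i \<le> n" for i
  proof (cases "\<exists>b\<in>B. b \<le> i")
    case True
    then have "Max {b \<in> B. b \<le> i} \<in> {b \<in> B. b \<le> i}" using B(1) by (intro Max_in) auto
    then show ?thesis using True that unfolding retr_def by auto
  next
    case False
    then show ?thesis using that Min_in[OF B(1,2)] unfolding retr_def by auto
  qed
  then show "i \<le> n \<Longrightarrow> retr n B i \<in> B" for i .
  show fixB: "retr n B b = b" if "b \<in> B" for b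
  proof -
    have "Max {b' \<in> B. b' \<le> b} = b" using B(1) that by (intro Max_eqI) auto
    then show ?thesis using that B(3) unfolding retr_def by auto
  qed
  show im: "retr n B ` B = B" using fixB by force
  then show "retr n B ` {..n} = B" using mem B(3) by blast
  show "retr n B \<in> Arr Simplex n n" unfolding Arr_Simplex_iff
  proof (intro conjI mono_onI)
    show "retr n B \<in> {..n} \<rightarrow>\<^sub>E {..n}"
    proof (rule PiE_I)
      show "retr n B i \<in> {..n}" if "i \<in> {..n}" for i using mem[of i] B(3) that by auto
      show "retr n B i = undefined" if "i \<notin> {..n}" for i using that unfolding retr_def by simp
    qed
    fix r s assume rs: "r \<in> {..n}" "s \<in> {..n}" "r \<le> s"
    show "retr n B r \<le> retr n B s"
    proof (cases "\<exists>b\<in>B. b \<le> r")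
      case True
      then have "\<exists>b\<in>B. b \<le> s" using rs(3) by (meson le_trans)
      moreover have "Max {b \<in> B. b \<le> r} \<le> Max {b \<in> B. b \<le> s}"
        using True rs(3) B(1) by (intro Max_mono) auto
      ultimately show ?thesis using True rs unfolding retr_def by auto
    next
      case False
      then show ?thesis using rs mem[of s] Min_le[OF B(1)] unfolding retr_def by auto
    qed
  qed
qed

context fibrant_presheaf begin

theorem Kan_complex_Kstar: "Kan_complex (FObj Kstar X)"
  unfolding Kan_complex_def extends_from_def
proof (intro allI impI ballI)
  fix n k :: nat and \<theta> assume n: "n \<ge> 1" and k: "k \<le> n"
    and \<theta>: "\<theta> \<in> presheaf_hom Simplex (horn n k) (FObj Kstar X)"
  let ?Y = "FObj Kstar X"
  have horn: "\<sigma> \<in> Val (horn n k) m \<longleftrightarrow> \<sigma> \<in> Arr Simplex m n \<and> (\<exists>j\<le>n. j \<noteq> k \<and> j \<notin> \<sigma> ` {..m})" for \<sigma> m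
    unfolding horn_def by simp
  have act: "Act (horn n k) l m \<tau> \<sigma> = compose {..l} \<sigma> \<tau>" for l m \<tau> \<sigma>
    unfolding horn_def representable_def Simplex_def by simp
  have hom: "\<theta> m \<sigma> \<in> presheaf_hom Box (K m) X" if "\<sigma> \<in> Val (horn n k) m" for m \<sigma>
    using presheaf_homD(1)[OF \<theta> _ that] unfolding Val_Kstar by simp
  have nat: "kval (\<theta> l (compose {..l} \<sigma> \<tau>)) B = kval (\<theta> m \<sigma>) (\<tau> ` B)"
    if "\<tau> \<in> Arr Simplex l m" "\<sigma> \<in> Val (horn n k) m" "B \<in> Sub l" for l m \<sigma> \<tau> B
    using presheaf_homD(3)[OF \<theta> _ _ that(1,2)] kval_Act[OF that(3), of X m \<tau> "\<theta> m \<sigma>"] unfolding act by simp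
  \<comment> \<open>A label set avoiding some \<open>j \<noteq> k\<close> is seen by the horn
    through the retraction onto it; \<open>val\<close> shows that every simplex of the horn yields
    the same value.\<close>
  define g where "g B = kval (\<theta> n (retr n B)) B" for B
  have rB: "retr n B \<in> Val (horn n k) n" if "B \<in> Sub n" "j \<le> n" "j \<noteq> k" "j \<notin> B" for B j
    using horn retr(1,5)[OF that(1)] that by auto
  have val: "kval (\<theta> m \<sigma>) A = g (\<sigma> ` A)" if \<sigma>: "\<sigma> \<in> Val (horn n k) m" and A: "A \<in> Sub m" for m \<sigma> A
  proof -
    \<comment> \<open>A simplex of the horn with image \<open>?B\<close>. It factors through
      \<open>\<sigma>\<close>, and it is fixed by the retraction onto \<open>?B\<close>, so it links
      the two ways of computing the value.\<close>
    let ?\<tau> = "compose {..m} \<sigma> (retr m A)" and ?B = "\<sigma> ` A"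
    obtain j where j: "\<sigma> \<in> Arr Simplex m n" "j \<le> n" "j \<noteq> k" "j \<notin> \<sigma> ` {..m}" using \<sigma> horn by blast
    have Am: "A \<subseteq> {..m}" "A \<noteq> {}" using A unfolding Sub_def by auto
    have B: "?B \<in> Sub n" using Am j(1) unfolding Sub_def Arr_Simplex_iff by auto
    have \<tau>: "?\<tau> \<in> Arr Simplex m n"
      using j(1) retr(1)[OF A] unfolding Arr_Simplex_iff mono_on_def by (auto simp: compose_def PiE_iff)
    have \<tau>A: "?\<tau> ` A = ?B" using retr(3)[OF A] Am by (auto simp: compose_def subset_iff image_iff)
    have "retr n ?B (\<sigma> (retr m A i)) = \<sigma> (retr m A i)" if "i \<le> m" for i
      using retr(3)[OF B] retr(2)[OF A that] by simp
    then have comp: "compose {..m} (retr n ?B) ?\<tau> = ?\<tau>" unfolding compose_def by (intro restrict_ext) simp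
    have "kval (\<theta> m \<sigma>) A = kval (\<theta> m ?\<tau>) A"
      using nat[OF retr(1)[OF A] \<sigma> A] retr(4)[OF A] by simp
    also have "\<dots> = kval (\<theta> m (compose {..m} (retr n ?B) ?\<tau>)) A" unfolding comp ..
    also have "\<dots> = kval (\<theta> n (retr n ?B)) (?\<tau> ` A)"
      by (rule nat[OF \<tau> rB[OF B j(2,3)] A]) (use j(4) Am in auto)
    finally show ?thesis unfolding \<tau>A g_def .
  qed
  have "\<exists>g'. good g' {..n} \<and> (\<forall>B j. B \<subseteq> {..n} \<longrightarrow> j \<le> n \<longrightarrow> j \<noteq> k \<longrightarrow> j \<notin> B \<longrightarrow> g' B = g B)"
  proof (rule horn_extension[OF n k])
    fix Z T j assume sep: "sep Z T" "Z \<union> T \<subseteq> {..n}" and j: "j \<le> n" "j \<noteq> k" "j \<notin> Z \<union> T"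
    have B: "Z \<union> T \<in> Sub n" using sep unfolding Sub_def sep_def by auto
    note r = rB[OF B j]
    \<comment> \<open>The single simplex given by the retraction onto \<open>Z \<union> T\<close>
      computes all values that occur in the pattern.\<close>
    have "cond (kval (\<theta> n (retr n (Z \<union> T)))) Z T"
      using good_kval[OF hom[OF r]] sep unfolding good_def by blast
    then show "cond g Z T"
    proof (rule cond_cong)
      fix D assume D: "Z \<subseteq> D" "D \<subseteq> Z \<union> T"
      then have "D \<in> Sub n" using sep unfolding Sub_def sep_def by auto
      moreover have "retr n (Z \<union> T) ` D = D" using retr(3)[OF B] D(2) by force
      ultimately show "kval (\<theta> n (retr n (Z \<union> T))) D = g D" using val[OF r] by simp
    qed
  qed
  then obtain g' where g': "good g' {..n}" "\<And>B j. B \<subseteq> {..n} \<Longrightarrow> j \<le> n \<Longrightarrow> j \<noteq> k \<Longrightarrow> j \<notin> B \<Longrightarrow> g' B = g B"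
    by blast
  obtain \<Theta> where \<Theta>: "\<Theta> \<in> presheaf_hom Box (K n) X" "\<And>B. B \<in> Sub n \<Longrightarrow> kval \<Theta> B = g' B"
    using hom_of_good[OF g'(1)] by blast
  define \<eta> where "\<eta> m = (\<lambda>\<sigma>\<in>Arr Simplex m n. Act ?Y m n \<sigma> \<Theta>)" for m
  have rep: "Val (representable Simplex n) m = Arr Simplex m n"
    "Act (representable Simplex n) l m \<tau> \<sigma> = Cmp Simplex l m n \<sigma> \<tau>" for l m \<sigma> \<tau>
    unfolding representable_def by simp_all
  have SimplexComp: "Cmp Simplex l m n \<sigma> \<tau> \<in> Arr Simplex l n" if "\<tau> \<in> Arr Simplex l m" "\<sigma> \<in> Arr Simplex m n" for l m \<sigma> \<tau>
    using that unfolding Arr_Simplex_iff by (auto simp: Simplex_def compose_def mono_on_def PiE_iff)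
  have "\<eta> \<in> presheaf_hom Simplex (representable Simplex n) ?Y"
  proof (rule presheaf_homI)
    show "\<eta> m \<sigma> \<in> Val ?Y m" if "\<sigma> \<in> Val (representable Simplex n) m" for m \<sigma>
      using that Kstar_Act_hom[OF \<Theta>(1)] unfolding \<eta>_def rep Val_Kstar by simp
    fix l m \<tau> \<sigma> assume \<tau>: "\<tau> \<in> Arr Simplex l m" and \<sigma>: "\<sigma> \<in> Val (representable Simplex n) m"
    then show "\<eta> l (Act (representable Simplex n) l m \<tau> \<sigma>) = Act ?Y l m \<tau> (\<eta> m \<sigma>)"
      using SimplexComp[OF \<tau>] is_presheafD(3)[OF Kstar_presheaf[of X] _ _ \<tau>, of n \<sigma> \<Theta>] \<Theta>(1)
      unfolding rep \<eta>_def Val_Kstar by simp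
  qed (auto simp: \<eta>_def rep)
  moreover have "\<eta> m \<sigma> = \<theta> m \<sigma>" if \<sigma>: "\<sigma> \<in> Val (horn n k) m" for m \<sigma>
  proof (rule hom_eqI[OF _ hom[OF \<sigma>]])
    obtain j where j: "\<sigma> \<in> Arr Simplex m n" "j \<le> n" "j \<noteq> k" "j \<notin> \<sigma> ` {..m}" using \<sigma> horn by blast
    show "\<eta> m \<sigma> \<in> presheaf_hom Box (K m) X" using Kstar_Act_hom[OF \<Theta>(1) j(1)] j(1) unfolding \<eta>_def by simp
    fix A assume A: "A \<in> Sub m"
    then have Am: "A \<subseteq> {..m}" "A \<noteq> {}" unfolding Sub_def by auto
    have B: "\<sigma> ` A \<in> Sub n" using Am j(1) unfolding Sub_def Arr_Simplex_iff by auto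
    have "kval (\<eta> m \<sigma>) A = g' (\<sigma> ` A)" using kval_Act[OF A, of X n \<sigma> \<Theta>] \<Theta>(2)[OF B] j(1) unfolding \<eta>_def by simp
    also have "\<dots> = g (\<sigma> ` A)" using g'(2)[of "\<sigma> ` A" j] B j Am unfolding Sub_def by auto
    finally show "kval (\<eta> m \<sigma>) A = kval (\<theta> m \<sigma>) A" using val[OF \<sigma> A] by simp
  qed
  ultimately show "\<exists>\<eta>\<in>presheaf_hom Simplex (representable Simplex n) ?Y.
      \<forall>m\<in>Obj Simplex. \<forall>a\<in>Val (horn n k) m. \<eta> m a = \<theta> m a" by blast
qed

end

section \<open>Structure groups and homotopy groups\<close>

text \<open>Both groups are quotients of sets identified with a set \<open>U\<close> of top vertices, by the same relation \<open>e\<close> and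
  with the same product \<open>P\<close>.\<close>

locale quotient_model =
  fixes A :: "'x set" and t :: "'x \<Rightarrow> 'p" and U :: "'p set" and e :: "'p \<Rightarrow> 'p \<Rightarrow> bool"
    and P :: "'p \<Rightarrow> 'p \<Rightarrow> 'p \<Rightarrow> bool" and R :: "('x \<times> 'x) set" and Pr :: "'x \<Rightarrow> 'x \<Rightarrow> 'x \<Rightarrow> bool"
  assumes bij: "bij_betw t A U"
    and refl: "p \<in> U \<Longrightarrow> e p p" and sym: "e p q \<Longrightarrow> e q p" and trans: "e p q \<Longrightarrow> e q r \<Longrightarrow> e p r"
    and R: "R = {(a, a'). a \<in> A \<and> a' \<in> A \<and> e (t a) (t a')}"
    and P_ex: "p \<in> U \<Longrightarrow> q \<in> U \<Longrightarrow> \<exists>r\<in>U. P p q r"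
    and P_unique: "P p q r \<Longrightarrow> P p' q' r' \<Longrightarrow> e p p' \<Longrightarrow> e q q' \<Longrightarrow> e r r'"
    and Pr_P: "a \<in> A \<Longrightarrow> a' \<in> A \<Longrightarrow> a'' \<in> A \<Longrightarrow> Pr a a' a'' \<Longrightarrow> \<exists>u. e (t a'') u \<and> P (t a) (t a') u"
    and P_Pr: "a \<in> A \<Longrightarrow> a' \<in> A \<Longrightarrow> a'' \<in> A \<Longrightarrow> P (t a) (t a') (t a'') \<Longrightarrow> Pr a a' a''"
begin

definition cls :: "'p \<Rightarrow> 'x set" where
  "cls p = {a \<in> A. e p (t a)}"

lemma t_U: "a \<in> A \<Longrightarrow> t a \<in> U"
  using bij bij_betwE by blast

lemma t_onto: assumes "p \<in> U" obtains a where "a \<in> A" "t a = p"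
  using assms bij unfolding bij_betw_def by blast

lemma cls_nonempty: assumes "p \<in> U" obtains a where "a \<in> cls p" "a \<in> A" "t a = p"
  using t_onto[OF assms] refl[OF assms] unfolding cls_def by (metis (mono_tags, lifting) mem_Collect_eq)

lemma quotient_eq: "A // R = cls ` U"
proof -
  have "R `` {a} = cls (t a)" if "a \<in> A" for a using that unfolding R cls_def by auto
  then have "A // R = cls ` t ` A" unfolding quotient_def by auto
  then show ?thesis using bij unfolding bij_betw_def by simp
qed

lemma cls_eq_iff: assumes "p \<in> U" "q \<in> U" shows "cls p = cls q \<longleftrightarrow> e p q"
proof
  assume "cls p = cls q"
  moreover obtain a where "a \<in> cls q" "t a = q" using cls_nonempty[OF assms(2)] by blast
  ultimately show "e p q" unfolding cls_def by blast
next
  assume "e p q"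
  then show "cls p = cls q" unfolding cls_def using sym trans by blast
qed

text \<open>Evaluates the definite description in the multiplication. Representatives with top
  vertices exactly \<open>p\<close>, \<open>q\<close>, \<open>r\<close> show existence. For
  uniqueness, products of related representatives are related, and it suffices that a witness of
  \<open>Pr\<close> determines the product up to \<open>e\<close>.\<close>

lemma mult_cls:
  assumes pq: "p \<in> U" "q \<in> U" "r \<in> U" and P: "P p q r"
  shows "(THE T. T \<in> A // R \<and> (\<exists>c\<in>cls p. \<exists>d\<in>cls q. \<exists>e\<in>T. Pr c d e)) = cls r"
proof (rule the_equality)
  obtain a where a: "a \<in> cls p" "a \<in> A" "t a = p" using cls_nonempty[OF pq(1)] .
  obtain b where b: "b \<in> cls q" "b \<in> A" "t b = q" using cls_nonempty[OF pq(2)] .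
  obtain c where c: "c \<in> cls r" "c \<in> A" "t c = r" using cls_nonempty[OF pq(3)] .
  have "Pr a b c" using P_Pr a b c P by simp
  then show "cls r \<in> A // R \<and> (\<exists>c\<in>cls p. \<exists>d\<in>cls q. \<exists>e\<in>cls r. Pr c d e)"
    unfolding quotient_eq using a(1) b(1) c(1) pq(3) by blast
  fix T assume T: "T \<in> A // R \<and> (\<exists>c\<in>cls p. \<exists>d\<in>cls q. \<exists>e\<in>T. Pr c d e)"
  then obtain r' where r': "r' \<in> U" "T = cls r'" unfolding quotient_eq by blast
  obtain c d f where cdf: "c \<in> cls p" "d \<in> cls q" "f \<in> cls r'" "Pr c d f" using T r' by blast
  then have cA: "c \<in> A" "d \<in> A" "f \<in> A" "e p (t c)" "e q (t d)" "e r' (t f)" unfolding cls_def by simp_all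
  obtain u where u: "e (t f) u" "P (t c) (t d) u" using Pr_P[OF cA(1-3) cdf(4)] by blast
  have "e r u" using P_unique[OF P u(2) cA(4,5)] .
  then have "e r' r" using cA(6) u(1) sym trans by blast
  then show "T = cls r" using cls_eq_iff[OF r'(1) pq(3)] r'(2) by simp
qed

end

lemma pnt_eq_ones_iff: "pnt n x = ones n \<longleftrightarrow> (\<forall>i<n. x i)"
proof
  assume "pnt n x = ones n"
  then have eq: "pnt n x i = ones n i" for i by simp
  show "\<forall>i<n. x i"
  proof (intro allI impI)
    show "x i" if "i < n" for i using eq[of i] that by (simp add: pnt_def ones_def split: if_splits)
  qed
next
  assume "\<forall>i<n. x i"
  then show "pnt n x = ones n" unfolding pnt_def ones_def by (intro restrict_ext) simp
qed

lemma if_swap: "(if P then if R then a else b else c) = (if R then if P then a else c else if P then b else c)"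
  by simp

lemma ones_in_cube [simp]: "ones n \<in> cube n"
  unfolding ones_def cube_def by auto

lemma eq_ones_iff: "v \<in> cube n \<Longrightarrow> v = ones n \<longleftrightarrow> (\<forall>i<n. bits n v i)"
  using pnt_eq_ones_iff[of n "bits n v"] by simp

context presheaf_on_Box begin

lemma cubes_iff_realized:
  assumes "\<And>x y. (\<And>i. i < k \<Longrightarrow> x i = y i) \<Longrightarrow> F x = F y"
  shows "F \<in> cubes X \<longleftrightarrow> (\<exists>q\<in>Val X k. \<forall>v\<in>cube k. vertex X k q v = F (bits k v))"
proof
  assume "F \<in> cubes X"
  then show "\<exists>q\<in>Val X k. \<forall>v\<in>cube k. vertex X k q v = F (bits k v)" by (rule cubes_realize)
next
  assume "\<exists>q\<in>Val X k. \<forall>v\<in>cube k. vertex X k q v = F (bits k v)"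
  then obtain q where q: "q \<in> Val X k" "\<forall>v\<in>cube k. vertex X k q v = F (bits k v)" by blast
  have "vertex X k q (pnt k x) = F x" for x
  proof -
    have "F (bits k (pnt k x)) = F x" by (rule assms) (simp add: bits_pnt)
    then show ?thesis using q(2) by simp
  qed
  then show "F \<in> cubes X" using vertex_in_cubes[OF q(1)] by simp
qed

end

context fibrant_presheaf begin

abbreviation top_cube :: "nat \<Rightarrow> 'a \<Rightarrow> 'a" where
  "top_cube m c \<equiv> vertex X (Suc m) c (ones (Suc m))"

lemma pointed_cube_vertex:
  assumes "c \<in> pointed_cubes X (Suc m) x" "v \<in> cube (Suc m)"
  shows "vertex X (Suc m) c v = (if \<forall>i<Suc m. bits (Suc m) v i then top_cube m c else x)"
  using assms eq_ones_iff[OF assms(2)] unfolding pointed_cubes_def by auto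

lemma bij_top_cube: "bij_betw (top_cube m) (pointed_cubes X (Suc m) x) {p. pt x m p}"
proof (rule bij_betwI')
  let ?n = "Suc m"
  show "(top_cube m c = top_cube m d) = (c = d)"
    if c: "c \<in> pointed_cubes X ?n x" and d: "d \<in> pointed_cubes X ?n x" for c d
  proof
    assume eq: "top_cube m c = top_cube m d"
    have V: "c \<in> Val X ?n" "d \<in> Val X ?n" using c d unfolding pointed_cubes_def by simp_all
    show "c = d" by (rule concrete_eqI[OF concrete V]) (simp only: pointed_cube_vertex[OF c] pointed_cube_vertex[OF d] eq)
  qed simp
  have dep: "(if \<forall>i<?n. y i then p else x) = (if \<forall>i<?n. z i then p else x)" if "\<And>i. i < ?n \<Longrightarrow> y i = z i" for p y z
    using that by simp
  have real: "pt x m p \<longleftrightarrow> (\<exists>q\<in>Val X ?n. \<forall>v\<in>cube ?n. vertex X ?n q v = (if \<forall>i<?n. bits ?n v i then p else x))" for p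
    unfolding pt_iff by (rule cubes_iff_realized[OF dep])
  show "top_cube m c \<in> {p. pt x m p}" if c: "c \<in> pointed_cubes X ?n x" for c
    using pointed_cube_vertex[OF c] c unfolding real pointed_cubes_def mem_Collect_eq by blast
  show "\<exists>c\<in>pointed_cubes X ?n x. p = top_cube m c" if p: "p \<in> {p. pt x m p}" for p
  proof -
    obtain q where q: "q \<in> Val X ?n" "\<And>v. v \<in> cube ?n \<Longrightarrow> vertex X ?n q v = (if \<forall>i<?n. bits ?n v i then p else x)"
      using p unfolding real by blast
    have "vertex X ?n q v = x" if "v \<in> cube ?n" "v \<noteq> ones ?n" for v
      using q(2)[OF that(1)] eq_ones_iff[OF that(1)] that(2) by auto
    moreover have "top_cube m q = p" using q(2)[of "ones ?n"] eq_ones_iff[of "ones ?n" ?n] by auto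
    ultimately show ?thesis using q(1) unfolding pointed_cubes_def by blast
  qed
qed

lemma peq_iff: "peq x m p q \<longleftrightarrow> (\<lambda>y. if \<forall>i<Suc m. y i then if y (Suc m) then q else p else x) \<in> cubes X"
proof -
  have "(\<lambda>y. top_slot x m (if y m then if y (Suc m) then q else p else if y (Suc m) then x else x) y) =
    (\<lambda>y. if \<forall>i<Suc m. y i then if y (Suc m) then q else p else x)"
    by (rule ext) (auto simp: top_slot_def All_less_Suc)
  then show ?thesis unfolding peq_def sq_def by simp
qed

lemma bits_insert_coord:
  assumes "v \<in> cube n" "j \<le> n" "e = 0 \<or> e = 1"
  shows "insert_coord n j e v = pnt (Suc n) (\<lambda>i. if i < j then bits n v i else if i = j then e = 1 else bits n v (i - 1))"
proof -
  have "v i = (if bits n v i then 1 else 0)" if "i < n" for i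
    using cube_coord[OF assms(1) that] that unfolding bits_def by auto
  then show ?thesis using assms(2,3) unfolding insert_coord_def pnt_def by (intro restrict_ext) auto
qed

text \<open>The relation leaves the direction \<open>j\<close> of comparison open, while
  \<open>peq\<close> compares along the last coordinate; renaming coordinates moves one to the
  other.\<close>

lemma cube_rel_eq:
  "cube_rel X (Suc m) x = {(c, d). c \<in> pointed_cubes X (Suc m) x \<and> d \<in> pointed_cubes X (Suc m) x \<and>
     peq x m (top_cube m c) (top_cube m d)}"
proof -
  let ?n = "Suc m"
  have "(\<exists>q\<in>Val X (Suc ?n). \<exists>j\<le>?n. \<forall>v\<in>cube ?n. vertex X (Suc ?n) q (insert_coord ?n j 0 v) = vertex X ?n c v \<and>
        vertex X (Suc ?n) q (insert_coord ?n j 1 v) = vertex X ?n d v) \<longleftrightarrow> peq x m (top_cube m c) (top_cube m d)"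
    (is "?L \<longleftrightarrow> _")
    if c: "c \<in> pointed_cubes X ?n x" and d: "d \<in> pointed_cubes X ?n x" for c d
  proof
    assume ?L
    then obtain q j where q: "q \<in> Val X (Suc ?n)" "j \<le> ?n"
      "\<And>v. v \<in> cube ?n \<Longrightarrow> vertex X (Suc ?n) q (insert_coord ?n j 0 v) = vertex X ?n c v"
      "\<And>v. v \<in> cube ?n \<Longrightarrow> vertex X (Suc ?n) q (insert_coord ?n j 1 v) = vertex X ?n d v" by blast
    let ?y = "\<lambda>y i. if i < j then y i else if i = j then y ?n else y (i - 1)"
    show "peq x m (top_cube m c) (top_cube m d)" unfolding peq_iff
    proof (rule subst_eq[where y = ?y, OF vertex_in_cubes[OF q(1)]])
      show "(\<lambda>x. ?y x i) \<in> literals" for i by (intro literals_if literals_var)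
      fix y :: "nat \<Rightarrow> bool"
      let ?v = "pnt ?n y"
      have all: "(\<forall>i<?n. bits ?n ?v i) \<longleftrightarrow> (\<forall>i<?n. y i)" by (simp add: bits_pnt)
      let ?e = "if y ?n then 1 else 0 :: int"
      have "insert_coord ?n j ?e ?v = pnt (Suc ?n) (\<lambda>i. if i < j then bits ?n ?v i else if i = j then ?e = 1 else bits ?n ?v (i - 1))"
        by (rule bits_insert_coord[OF pnt_in_cube q(2)]) simp
      also have "\<dots> = pnt (Suc ?n) (?y y)"
      proof (rule pnt_cong)
        fix i assume "i < Suc ?n"
        then consider "i < j" | "i = j" | "j < i" "i - 1 < ?n" by linarith
        then show "(if i < j then bits ?n ?v i else if i = j then ?e = 1 else bits ?n ?v (i - 1)) = ?y y i"
        proof cases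
          case 1 then show ?thesis using q(2) by (simp add: bits_pnt)
        next
          case 2 then show ?thesis by simp
        next
          case 3 then show ?thesis using bits_pnt[OF 3(2)] by simp
        qed
      qed
      finally have "pnt (Suc ?n) (?y y) = insert_coord ?n j ?e ?v" by (rule sym)
      then have "vertex X (Suc ?n) q (pnt (Suc ?n) (?y y)) = (if y ?n then vertex X ?n d ?v else vertex X ?n c ?v)"
        using q(3,4)[OF pnt_in_cube] by simp
      then show "(if \<forall>i<?n. y i then if y ?n then top_cube m d else top_cube m c else x) = vertex X (Suc ?n) q (pnt (Suc ?n) (?y y))"
        unfolding pointed_cube_vertex[OF c pnt_in_cube] pointed_cube_vertex[OF d pnt_in_cube] all
        by (cases "y ?n"; cases "\<forall>i<?n. y i"; simp only: if_True if_False simp_thms if_cancel)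
    qed
  next
    assume "peq x m (top_cube m c) (top_cube m d)"
    from cubes_realize[OF this[unfolded peq_iff], of "Suc ?n"]
    obtain q where q: "q \<in> Val X (Suc ?n)" "\<And>v. v \<in> cube (Suc ?n) \<Longrightarrow> vertex X (Suc ?n) q v =
       (if \<forall>i<?n. bits (Suc ?n) v i then if bits (Suc ?n) v ?n then top_cube m d else top_cube m c else x)" by blast
    have "vertex X (Suc ?n) q (insert_coord ?n ?n e v) = (if e = 1 then vertex X ?n d v else vertex X ?n c v)"
      if v: "v \<in> cube ?n" and e: "e = 0 \<or> e = 1" for v e
    proof -
      have i: "insert_coord ?n ?n e v = pnt (Suc ?n) (\<lambda>i. if i < ?n then bits ?n v i else if i = ?n then e = 1 else bits ?n v (i - 1))"
        by (rule bits_insert_coord[OF v _ e]) simp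
      have b: "bits (Suc ?n) (insert_coord ?n ?n e v) i = bits ?n v i" if "i < ?n" for i
        unfolding i using that by (subst bits_pnt) simp_all
      have b': "bits (Suc ?n) (insert_coord ?n ?n e v) ?n \<longleftrightarrow> e = 1" unfolding i by (subst bits_pnt) simp_all
      have all: "(\<forall>i<?n. bits (Suc ?n) (insert_coord ?n ?n e v) i) \<longleftrightarrow> (\<forall>i<?n. bits ?n v i)" using b by simp
      have mem: "insert_coord ?n ?n e v \<in> cube (Suc ?n)" unfolding i by simp
      show ?thesis unfolding q(2)[OF mem] pointed_cube_vertex[OF c v] pointed_cube_vertex[OF d v] all b'
        by (rule if_swap)
    qed
    from this[of _ 0] this[of _ 1] show ?L using q(1)
      by (intro bexI[of _ q] exI[of _ ?n]) auto
  qed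
  then show ?thesis unfolding cube_rel_def by blast
qed

lemma cube_product_iff:
  "cube_product X (Suc m) x c d e \<longleftrightarrow> prd x m (top_cube m c) (top_cube m d) (top_cube m e)"
proof -
  let ?n = "Suc m"
  let ?F = "\<lambda>y. top_slot x m (if y m then if y ?n then top_cube m e else top_cube m c else if y ?n then top_cube m d else x) y"
  have dep: "?F y = ?F z" if "\<And>i. i < Suc ?n \<Longrightarrow> y i = z i" for y z
  proof -
    have "y m = z m" "y ?n = z ?n" "(\<forall>i<m. y i) = (\<forall>i<m. z i)" using that by auto
    then show ?thesis unfolding top_slot_def by (simp only:)
  qed
  have "(if v = (ones (Suc ?n))(?n := 0) then top_cube m c
         else if v = (ones (Suc ?n))(?n - 1 := 0) then top_cube m d
         else if v = ones (Suc ?n) then top_cube m e else x) = ?F (bits (Suc ?n) v)" if v: "v \<in> cube (Suc ?n)" for v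
  proof -
    let ?b = "bits (Suc ?n) v"
    have o: "(ones (Suc ?n))(j := 0) \<in> cube (Suc ?n)" if "j \<le> ?n" for j
      using that unfolding ones_def cube_def by (auto simp: PiE_iff extensional_def)
    have ev: "v = w \<longleftrightarrow> (\<forall>i<Suc ?n. ?b i \<longleftrightarrow> w i = 1)" if w: "w \<in> cube (Suc ?n)" for w
    proof
      assume r: "\<forall>i<Suc ?n. ?b i \<longleftrightarrow> w i = 1"
      show "v = w"
      proof (rule cube_eqI[OF v w])
        fix i assume "i < Suc ?n"
        then show "v i = w i" using r cube_coord[OF v, of i] cube_coord[OF w, of i] unfolding bits_def by auto
      qed
    qed (simp add: bits_def)
    have 1: "v = (ones (Suc ?n))(?n := 0) \<longleftrightarrow> (\<forall>i<m. ?b i) \<and> ?b m \<and> \<not> ?b ?n"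
      unfolding ev[OF o[OF order_refl]] by (auto simp: ones_def All_less_Suc)
    have "m \<le> ?n" by simp
    have 2: "v = (ones (Suc ?n))(?n - 1 := 0) \<longleftrightarrow> (\<forall>i<m. ?b i) \<and> \<not> ?b m \<and> ?b ?n"
      unfolding diff_Suc_1 ev[OF o[OF \<open>m \<le> ?n\<close>]] by (auto simp: ones_def All_less_Suc)
    have 3: "v = ones (Suc ?n) \<longleftrightarrow> (\<forall>i<m. ?b i) \<and> ?b m \<and> ?b ?n"
      unfolding ev[OF ones_in_cube] by (auto simp: ones_def All_less_Suc)
    show ?thesis unfolding 1 2 3 top_slot_def
      by (cases "\<forall>i<m. ?b i"; cases "?b m"; cases "?b ?n"; simp only: if_True if_False simp_thms if_cancel)
  qed
  then have "cube_product X ?n x c d e \<longleftrightarrow> (\<exists>q\<in>Val X (Suc ?n). \<forall>v\<in>cube (Suc ?n). vertex X (Suc ?n) q v = ?F (bits (Suc ?n) v))"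
    unfolding cube_product_def by (metis (no_types, lifting))
  also have "\<dots> \<longleftrightarrow> ?F \<in> cubes X" by (rule cubes_iff_realized[symmetric, OF dep])
  finally show ?thesis unfolding prd_def sq_def .
qed

lemma cube_model:
  "quotient_model (pointed_cubes X (Suc m) x) (top_cube m) {p. pt x m p} (peq x m) (prd x m)
     (cube_rel X (Suc m) x) (cube_product X (Suc m) x)"
proof
  show "\<exists>r\<in>{p. pt x m p}. prd x m p q r" if "p \<in> {p. pt x m p}" "q \<in> {p. pt x m p}" for p q
    using prd_exists[of x m p q] prd_pt that by blast
  show "\<exists>u. peq x m (top_cube m c) u \<and> prd x m (top_cube m a) (top_cube m b) u"
    if "cube_product X (Suc m) x a b c" "c \<in> pointed_cubes X (Suc m) x" for a b c
    using that peq_refl bij_betwE[OF bij_top_cube[of m x]] unfolding cube_product_iff by blast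
qed (use bij_top_cube cube_rel_eq cube_product_iff peq_refl in \<open>auto intro: peq_sym peq_trans prd_unique\<close>)

end

context presheaf_on_Box begin

lemma Kstar_point_hom:
  assumes x: "x \<in> Val X 0" shows "Kstar_point X x \<in> presheaf_hom Box (K 0) X"
proof (rule presheaf_homI)
  have u: "(\<lambda>_. undefined) \<in> cube 0" by (simp add: cube_0)
  show "Kstar_point X x p a \<in> Val X p" if "a \<in> Val (K 0) p" for p a
    unfolding Kstar_point_def const_cube_def using that is_presheafD(1)[OF presheaf _ _ const_Arr_Box[OF u] x] by simp
  fix l m f b assume f: "f \<in> Arr Box l m" and b: "b \<in> Val (K 0) m"
  have "Cmp Box l m 0 (\<lambda>_\<in>cube m. (\<lambda>_. undefined)) f = (\<lambda>_\<in>cube l. (\<lambda>_. undefined))"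
    unfolding Cmp_Box compose_def using Arr_BoxD(2)[OF f] by (intro restrict_ext) simp
  then have "const_cube X l x = Act X l m f (const_cube X m x)"
    unfolding const_cube_def using is_presheafD(3)[OF presheaf _ _ f _ const_Arr_Box[OF u] x] by simp
  then show "Kstar_point X x l (Act (K 0) l m f b) = Act X l m f (Kstar_point X x m b)"
    unfolding Kstar_point_def Act_K using K_Val_comp[OF b f] b by simp
qed (simp_all add: Kstar_point_def)

lemma kval_point: assumes "x \<in> Val X 0" shows "kval (Kstar_point X x) {0} = x"
proof -
  have "{0} \<in> Sub 0" unfolding Sub_def by simp
  then have "kval (Kstar_point X x) {0} = const_cube X 0 x"
    unfolding kval_def Kstar_point_def using K_Val_const[of "{0}" 0 0] by simp
  also have "\<dots> = vertex X 0 x (\<lambda>_. undefined)" unfolding const_cube_def vertex_def by simp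
  also have "\<dots> = x" by (rule vertex_0[OF presheaf assms]) (simp add: cube_0)
  finally show ?thesis .
qed

end

context fibrant_presheaf begin

abbreviation KX :: "'a K_map simplicial_set" where "KX \<equiv> FObj Kstar X"

lemma const_simplex_hom:
  assumes x: "x \<in> Val X 0"
  shows "const_simplex KX n (Kstar_point X x) \<in> presheaf_hom Box (K n) X"
    "B \<in> Sub n \<Longrightarrow> kval (const_simplex KX n (Kstar_point X x)) B = x"
proof -
  have "(\<lambda>_\<in>{..n}. 0) \<in> Arr Simplex n 0" unfolding Arr_Simplex_iff mono_on_def by auto
  then show "const_simplex KX n (Kstar_point X x) \<in> presheaf_hom Box (K n) X"
    unfolding const_simplex_def by (rule Kstar_Act_hom[OF Kstar_point_hom[OF x]])
  assume B: "B \<in> Sub n"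
  then have "(\<lambda>_\<in>{..n}. 0) ` B = {0::nat}" unfolding Sub_def by (auto simp: image_iff)
  then show "kval (const_simplex KX n (Kstar_point X x)) B = x"
    unfolding const_simplex_def kval_Act[OF B] using kval_point[OF x] by simp
qed

definition dmap :: "nat \<Rightarrow> nat \<Rightarrow> nat \<Rightarrow> nat" where
  "dmap n i = (\<lambda>j\<in>{..n}. if j < i then j else Suc j)"

lemma dmap:
  assumes "i \<le> Suc n"
  shows "dmap n i \<in> Arr Simplex n (Suc n)" "dmap n i ` {..n} = {..Suc n} - {i}"
    "B \<in> Sub n \<Longrightarrow> dmap n i ` B \<in> Sub (Suc n) \<and> i \<notin> dmap n i ` B"
    "D \<in> Sub (Suc n) \<Longrightarrow> i \<notin> D \<Longrightarrow> \<exists>B\<in>Sub n. D = dmap n i ` B"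
    "B \<subseteq> {..n} \<Longrightarrow> dmap n i ` B = {..Suc n} - {i} \<longleftrightarrow> B = {..n}"
proof -
  show "dmap n i \<in> Arr Simplex n (Suc n)" unfolding Arr_Simplex_iff mono_on_def dmap_def by (auto simp: PiE_iff)
  show im: "dmap n i ` {..n} = {..Suc n} - {i}"
  proof (intro equalityI subsetI)
    fix j assume j: "j \<in> {..Suc n} - {i}"
    show "j \<in> dmap n i ` {..n}"
    proof (cases "j < i")
      case True
      then have "dmap n i j = j" "j \<le> n" using assms unfolding dmap_def by auto
      then show ?thesis by (metis atMost_iff imageI)
    next
      case False
      then have "dmap n i (j - 1) = j" "j - 1 \<le> n" using j unfolding dmap_def by auto
      then show ?thesis by (metis atMost_iff imageI)
    qed
  qed (auto simp: dmap_def split: if_splits)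
  have inj: "inj_on (dmap n i) {..n}" unfolding dmap_def inj_on_def by auto
  show "dmap n i ` B \<in> Sub (Suc n) \<and> i \<notin> dmap n i ` B" if "B \<in> Sub n"
    using that im unfolding Sub_def by blast
  show "\<exists>B\<in>Sub n. D = dmap n i ` B" if D: "D \<in> Sub (Suc n)" "i \<notin> D"
  proof -
    have "D \<subseteq> dmap n i ` {..n}" using D unfolding im Sub_def by blast
    then obtain B where "B \<subseteq> {..n}" "D = dmap n i ` B" by (meson subset_imageE)
    then show ?thesis using D unfolding Sub_def by auto
  qed
  show "dmap n i ` B = {..Suc n} - {i} \<longleftrightarrow> B = {..n}" if "B \<subseteq> {..n}"
    unfolding im[symmetric] using inj_on_image_eq_iff[OF inj that order_refl] .
qed

lemma face_eq: "face KX n i \<theta> = Act KX n (Suc n) (dmap n i) \<theta>"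
  unfolding face_def dmap_def ..

lemma face_eq_iff:
  assumes "i \<le> Suc n" "w \<in> presheaf_hom Box (K (Suc n)) X" "s \<in> presheaf_hom Box (K n) X"
  shows "face KX n i w = s \<longleftrightarrow> (\<forall>B\<in>Sub n. kval w (dmap n i ` B) = kval s B)"
proof
  assume "face KX n i w = s"
  then show "\<forall>B\<in>Sub n. kval w (dmap n i ` B) = kval s B" unfolding face_eq using kval_Act[of _ n X "Suc n" "dmap n i" w] by metis
next
  assume *: "\<forall>B\<in>Sub n. kval w (dmap n i ` B) = kval s B"
  show "face KX n i w = s" unfolding face_eq
    by (rule hom_eqI[OF Kstar_Act_hom[OF assms(2) dmap(1)[OF assms(1)]] assms(3)])
      (use * kval_Act[of _ n X "Suc n" "dmap n i" w] in simp)
qed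

text \<open>A proper label set avoids some \<open>i\<close> and hence lies in the image of the
  \<open>i\<close>-th face map.\<close>

lemma pointed_simplices_iff:
  assumes x: "x \<in> Val X 0"
  shows "s \<in> pointed_simplices KX (Suc m) (Kstar_point X x) \<longleftrightarrow>
    s \<in> presheaf_hom Box (K (Suc m)) X \<and> (\<forall>B\<in>Sub (Suc m). B \<noteq> {..Suc m} \<longrightarrow> kval s B = x)"
proof -
  have "(\<forall>i\<le>Suc m. face KX (Suc m - 1) i s = const_simplex KX (Suc m - 1) (Kstar_point X x)) \<longleftrightarrow>
     (\<forall>B\<in>Sub (Suc m). B \<noteq> {..Suc m} \<longrightarrow> kval s B = x)" (is "?L \<longleftrightarrow> ?R") if s: "s \<in> presheaf_hom Box (K (Suc m)) X"
  proof -
    have "?L \<longleftrightarrow> (\<forall>i\<le>Suc m. \<forall>B\<in>Sub m. kval s (dmap m i ` B) = x)"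
      using face_eq_iff[OF _ s const_simplex_hom(1)[OF x]] const_simplex_hom(2)[OF x] by simp
    also have "\<dots> \<longleftrightarrow> ?R"
    proof (intro iffI ballI impI allI)
      fix B assume *: "\<forall>i\<le>Suc m. \<forall>B\<in>Sub m. kval s (dmap m i ` B) = x" and B: "B \<in> Sub (Suc m)" "B \<noteq> {..Suc m}"
      then obtain i where i: "i \<le> Suc m" "i \<notin> B" unfolding Sub_def by auto
      then obtain B' where "B' \<in> Sub m" "B = dmap m i ` B'" using dmap(4)[OF i(1) B(1)] by blast
      then show "kval s B = x" using * i by blast
    next
      fix i B assume *: ?R and i: "i \<le> Suc m" and B: "B \<in> Sub m"
      then have "dmap m i ` B \<in> Sub (Suc m)" "i \<notin> dmap m i ` B" using dmap(3)[OF i] by blast+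
      moreover then have "dmap m i ` B \<noteq> {..Suc m}" using i by blast
      ultimately show "kval s (dmap m i ` B) = x" using * by blast
    qed
    finally show ?thesis .
  qed
  then show ?thesis unfolding pointed_simplices_def Val_Kstar by blast
qed

abbreviation top_simplex :: "nat \<Rightarrow> 'a K_map \<Rightarrow> 'a" where
  "top_simplex m s \<equiv> kval s {..Suc m}"

lemma Sub_full [simp]: "{..n} \<in> Sub n"
  unfolding Sub_def by auto

text \<open>A function with one exceptional value, at the top, is good exactly under the condition
  \<open>pt\<close>, which also characterises the top vertices of pointed cubes in
  \<open>bij_top_cube\<close>.\<close>

lemma bij_top_simplex:
  assumes x: "x \<in> Val X 0"
  shows "bij_betw (top_simplex m) (pointed_simplices KX (Suc m) (Kstar_point X x)) {p. pt x m p}"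
proof (rule bij_betwI')
  note iff = pointed_simplices_iff[OF x]
  show "(top_simplex m s = top_simplex m t) = (s = t)"
    if s: "s \<in> pointed_simplices KX (Suc m) (Kstar_point X x)" and t: "t \<in> pointed_simplices KX (Suc m) (Kstar_point X x)" for s t
  proof
    assume "top_simplex m s = top_simplex m t"
    then show "s = t" using s t unfolding iff by (intro hom_eqI[where n = "Suc m"]) auto
  qed simp
  show "top_simplex m s \<in> {p. pt x m p}" if s: "s \<in> pointed_simplices KX (Suc m) (Kstar_point X x)" for s
  proof -
    have "good (kval s) {..Suc m} \<longleftrightarrow> pt x m (top_simplex m s)"
      by (rule good_top_iff) (use s in \<open>auto simp: iff Sub_def\<close>)
    then show ?thesis using good_kval s iff by blast
  qed
  show "\<exists>s\<in>pointed_simplices KX (Suc m) (Kstar_point X x). p = top_simplex m s" if p: "p \<in> {p. pt x m p}" for p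
  proof -
    let ?g = "\<lambda>B. if B = {..Suc m} then p else x"
    have "good ?g {..Suc m} \<longleftrightarrow> pt x m p" by (rule good_top_iff) auto
    then have "good ?g {..Suc m}" using p by blast
    then obtain s where "s \<in> presheaf_hom Box (K (Suc m)) X" "\<And>B. B \<in> Sub (Suc m) \<Longrightarrow> kval s B = ?g B"
      using hom_of_good[of ?g "Suc m"] by blast
    then show ?thesis unfolding Bex_def iff by (intro exI[of _ s]) simp
  qed
qed

text \<open>The face conditions prescribe a witness on all proper label sets and leave its top value
  \<open>u\<close> free; \<open>good_product_iff\<close> says which \<open>u\<close> are possible.
  Since \<open>r\<close> is a face and \<open>u\<close> the top, \<open>r\<close> is determined by
  the product only up to \<open>peq\<close>.\<close>

lemma simplex_product_iff:
  assumes x: "x \<in> Val X 0"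
    and s: "s \<in> pointed_simplices KX (Suc m) (Kstar_point X x)"
    and t: "t \<in> pointed_simplices KX (Suc m) (Kstar_point X x)"
    and r: "r \<in> pointed_simplices KX (Suc m) (Kstar_point X x)"
  shows "simplex_product KX (Suc m) (Kstar_point X x) s t r \<longleftrightarrow>
    (\<exists>u. peq x m (top_simplex m r) u \<and> prd x m (top_simplex m s) (top_simplex m t) u)"
proof -
  let ?n = "Suc m" and ?N = "Suc (Suc m)"
  note iff = pointed_simplices_iff[OF x]
  have pts: "pt x m (top_simplex m s)" "pt x m (top_simplex m t)" "pt x m (top_simplex m r)"
    using bij_betwE[OF bij_top_simplex[OF x, of m]] s t r by blast+
  have homs: "s \<in> presheaf_hom Box (K ?n) X" "t \<in> presheaf_hom Box (K ?n) X" "r \<in> presheaf_hom Box (K ?n) X"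
    using s t r unfolding iff by blast+
  have val: "kval a B = (if B = {..?n} then top_simplex m a else x)"
    if "a \<in> pointed_simplices KX ?n (Kstar_point X x)" "B \<in> Sub ?n" for a B
    using that unfolding iff by auto
  have faces: "face KX ?n i w = a \<longleftrightarrow> (\<forall>D\<in>Sub ?N. i \<notin> D \<longrightarrow> kval w D = (if D = {..?N} - {i} then top_simplex m a else x))"
    if w: "w \<in> presheaf_hom Box (K ?N) X" and i: "i \<le> ?N" and a: "a \<in> pointed_simplices KX ?n (Kstar_point X x)" for w i a
  proof -
    have "face KX ?n i w = a \<longleftrightarrow> (\<forall>B\<in>Sub ?n. kval w (dmap ?n i ` B) = kval a B)"
      by (rule face_eq_iff[OF i w]) (use a iff in blast)
    also have "\<dots> \<longleftrightarrow> (\<forall>B\<in>Sub ?n. kval w (dmap ?n i ` B) = (if dmap ?n i ` B = {..?N} - {i} then top_simplex m a else x))"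
    proof (rule ball_cong[OF HOL.refl])
      fix B assume B: "B \<in> Sub ?n"
      then have Bn: "B \<subseteq> {..?n}" unfolding Sub_def by blast
      show "(kval w (dmap ?n i ` B) = kval a B) = (kval w (dmap ?n i ` B) = (if dmap ?n i ` B = {..?N} - {i} then top_simplex m a else x))"
        unfolding dmap(5)[OF i Bn] val[OF a B] by (rule HOL.refl)
    qed
    also have "\<dots> \<longleftrightarrow> (\<forall>D\<in>Sub ?N. i \<notin> D \<longrightarrow> kval w D = (if D = {..?N} - {i} then top_simplex m a else x))"
    proof (intro iffI ballI impI)
      fix D assume *: "\<forall>B\<in>Sub ?n. kval w (dmap ?n i ` B) = (if dmap ?n i ` B = {..?N} - {i} then top_simplex m a else x)"
        and D: "D \<in> Sub ?N" "i \<notin> D"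
      then obtain B where "B \<in> Sub ?n" "D = dmap ?n i ` B" using dmap(4)[OF i D] by blast
      then show "kval w D = (if D = {..?N} - {i} then top_simplex m a else x)" using * by (simp only:)
    next
      fix B assume *: "\<forall>D\<in>Sub ?N. i \<notin> D \<longrightarrow> kval w D = (if D = {..?N} - {i} then top_simplex m a else x)"
        and B: "B \<in> Sub ?n"
      then show "kval w (dmap ?n i ` B) = (if dmap ?n i ` B = {..?N} - {i} then top_simplex m a else x)"
        using dmap(3)[OF i B] by blast
    qed
    finally show ?thesis .
  qed
  define c where "c = const_simplex KX ?n (Kstar_point X x)"
  have ctop: "top_simplex m c = x" unfolding c_def by (rule const_simplex_hom(2)[OF x Sub_full])
  have c: "c \<in> pointed_simplices KX ?n (Kstar_point X x)"
    unfolding iff c_def using const_simplex_hom[OF x] by blast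
  define p q r' where pqr: "p = top_simplex m s" "q = top_simplex m t" "r' = top_simplex m r"
  \<comment> \<open>The face conditions as values of a function: three exceptional sets of
    codimension one, and \<open>x\<close> on all other proper sets.\<close>
  define spec where "spec g \<longleftrightarrow> g ({..?N} - {m}) = p \<and> g ({..?N} - {?n}) = r' \<and> g ({..?N} - {?N}) = q \<and>
    (\<forall>B\<in>Sub ?N. B \<noteq> {..?N} \<longrightarrow> B \<noteq> {..?N} - {m} \<longrightarrow> B \<noteq> {..?N} - {?n} \<longrightarrow> B \<noteq> {..?N} - {?N} \<longrightarrow> g B = x)" for g
  have SubN: "{..?N} - {i} \<in> Sub ?N" for i
  proof -
    have "(if i = 0 then 1 else 0) \<in> {..?N} - {i}" by auto
    then show ?thesis unfolding Sub_def by blast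
  qed
  have nN: "{..?N} - {i} \<noteq> {..?N}" if "i \<le> ?N" for i using that by auto
  have ne: "{..?N} - {i} = {..?N} - {j} \<longleftrightarrow> i = j" if "i \<le> ?N" "j \<le> ?N" for i j using that by auto
  have spec: "face KX ?n m w = s \<and> face KX ?n ?N w = t \<and> face KX ?n ?n w = r \<and> (\<forall>i<m. face KX ?n i w = c) \<longleftrightarrow> spec (kval w)"
    (is "?L \<longleftrightarrow> _") if w: "w \<in> presheaf_hom Box (K ?N) X" for w
  proof -
    let ?f = "\<lambda>i v. \<forall>D\<in>Sub ?N. i \<notin> D \<longrightarrow> kval w D = (if D = {..?N} - {i} then v else x)"
    have L: "?L \<longleftrightarrow> ?f m p \<and> ?f ?N q \<and> ?f ?n r' \<and> (\<forall>i<m. ?f i x)"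
      using faces[OF w _ s, of m] faces[OF w _ t, of ?N] faces[OF w _ r, of ?n] faces[OF w _ c] unfolding pqr ctop
      by auto
    show ?thesis unfolding L
    proof
      assume *: "?f m p \<and> ?f ?N q \<and> ?f ?n r' \<and> (\<forall>i<m. ?f i x)"
      show "spec (kval w)" unfolding spec_def
      proof (intro conjI ballI impI)
        show "kval w ({..?N} - {m}) = p" using *[THEN conjunct1, rule_format, OF SubN, of m] by simp
        show "kval w ({..?N} - {?n}) = r'" using *[THEN conjunct2, THEN conjunct2, THEN conjunct1, rule_format, OF SubN, of ?n] by simp
        show "kval w ({..?N} - {?N}) = q" using *[THEN conjunct2, THEN conjunct1, rule_format, OF SubN, of ?N] by simp
        fix B assume B: "B \<in> Sub ?N" "B \<noteq> {..?N}" "B \<noteq> {..?N} - {m}" "B \<noteq> {..?N} - {?n}" "B \<noteq> {..?N} - {?N}"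
        then obtain i where i: "i \<le> ?N" "i \<notin> B" unfolding Sub_def by auto
        then consider "i < m" | "i = m" | "i = ?n" | "i = ?N" by linarith
        then show "kval w B = x"
        proof cases
          case 1 then show ?thesis using *[THEN conjunct2, THEN conjunct2, THEN conjunct2, rule_format, OF 1 B(1) i(2)] by simp
        next
          case 2 then show ?thesis using *[THEN conjunct1, rule_format, OF B(1)] i(2) B(3) by simp
        next
          case 3 then show ?thesis using *[THEN conjunct2, THEN conjunct2, THEN conjunct1, rule_format, OF B(1)] i(2) B(4) by simp
        next
          case 4 then show ?thesis using *[THEN conjunct2, THEN conjunct1, rule_format, OF B(1)] i(2) B(5) by simp
        qed
      qed
    next
      assume sp: "spec (kval w)"
      have gen: "kval w D = (if D = {..?N} - {i} then v else x)"
        if i: "i \<le> ?N" and v: "kval w ({..?N} - {i}) = v" and D: "D \<in> Sub ?N" "i \<notin> D" for i v D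
      proof (cases "D = {..?N} - {i}")
        case True then show ?thesis using v by simp
      next
        case False
        have "D \<subseteq> {..?N} - {i}" using D unfolding Sub_def by blast
        then have "D \<noteq> {..?N} - {j}" if "j \<le> ?N" for j using False ne[OF i that] i that D(2)
          by (metis Diff_iff atMost_iff singletonD)
        moreover have "D \<noteq> {..?N}" using D(2) i by auto
        ultimately have "kval w D = x" using sp D(1) unfolding spec_def by simp
        then show ?thesis using False by simp
      qed
      have low: "kval w ({..?N} - {i}) = x" if "i < m" for i
        using sp SubN[of i] nN[of i] ne[of i] that unfolding spec_def by simp
      show "?f m p \<and> ?f ?N q \<and> ?f ?n r' \<and> (\<forall>i<m. ?f i x)"
      proof (intro conjI allI impI ballI)
        fix D assume D: "D \<in> Sub ?N"
        show "kval w D = (if D = {..?N} - {m} then p else x)" if "m \<notin> D"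
          by (rule gen[OF _ _ D that]) (use sp in \<open>simp_all add: spec_def\<close>)
        show "kval w D = (if D = {..?N} - {?N} then q else x)" if "?N \<notin> D"
          by (rule gen[OF _ _ D that]) (use sp in \<open>simp_all add: spec_def\<close>)
        show "kval w D = (if D = {..?N} - {?n} then r' else x)" if "?n \<notin> D"
          by (rule gen[OF _ _ D that]) (use sp in \<open>simp_all add: spec_def\<close>)
        fix i assume i: "i < m" "i \<notin> D"
        then have "i \<le> ?N" by simp
        then show "kval w D = (if D = {..?N} - {i} then x else x)"
          by (rule gen[OF _ low[OF i(1)] D i(2)])
      qed
    qed
  qed
  have prod: "good g {..?N} \<longleftrightarrow> peq x m r' (g {..?N}) \<and> prd x m p q (g {..?N})" if "spec g" for g
    by (rule good_product_iff) (use pts that in \<open>auto simp: pqr spec_def Sub_def\<close>)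
  have "simplex_product KX ?n (Kstar_point X x) s t r \<longleftrightarrow> (\<exists>w\<in>presheaf_hom Box (K ?N) X. spec (kval w))"
    unfolding simplex_product_def Val_Kstar c_def[symmetric] diff_Suc_1 using spec by auto
  also have "\<dots> \<longleftrightarrow> (\<exists>u. peq x m r' u \<and> prd x m p q u)"
  proof
    assume "\<exists>w\<in>presheaf_hom Box (K ?N) X. spec (kval w)"
    then obtain w where w: "w \<in> presheaf_hom Box (K ?N) X" "spec (kval w)" by blast
    then show "\<exists>u. peq x m r' u \<and> prd x m p q u" using prod[OF w(2)] good_kval[OF w(1)] by blast
  next
    assume "\<exists>u. peq x m r' u \<and> prd x m p q u"
    then obtain u where u: "peq x m r' u" "prd x m p q u" by blast
    define g where "g B = (if B = {..?N} then u else if B = {..?N} - {m} then p else if B = {..?N} - {?n} then r'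
      else if B = {..?N} - {?N} then q else x)" for B
    have sg: "spec g" unfolding spec_def g_def using nN ne by simp
    have "g {..?N} = u" unfolding g_def by simp
    then have "good g {..?N}" using prod[OF sg] u by simp
    then obtain w where w: "w \<in> presheaf_hom Box (K ?N) X" "\<And>B. B \<in> Sub ?N \<Longrightarrow> kval w B = g B"
      using hom_of_good[of g ?N] by blast
    have "spec (kval w)" using sg w(2) SubN unfolding spec_def by simp
    then show "\<exists>w\<in>presheaf_hom Box (K ?N) X. spec (kval w)" using w(1) by blast
  qed
  finally show ?thesis unfolding pqr .
qed

text \<open>A witness of the relation is a witness of a product whose first factor is the constant
  simplex, and \<open>prd\<close> with a factor \<open>x\<close> is \<open>peq\<close>.\<close>

lemma simplex_rel_eq:
  assumes x: "x \<in> Val X 0"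
  shows "simplex_rel KX (Suc m) (Kstar_point X x) = {(s, t). s \<in> pointed_simplices KX (Suc m) (Kstar_point X x) \<and>
     t \<in> pointed_simplices KX (Suc m) (Kstar_point X x) \<and> peq x m (top_simplex m s) (top_simplex m t)}"
proof -
  let ?y = "Kstar_point X x" and ?n = "Suc m"
  let ?c = "const_simplex KX ?n ?y"
  have ctop: "top_simplex m ?c = x" by (rule const_simplex_hom(2)[OF x Sub_full])
  have c: "?c \<in> pointed_simplices KX ?n ?y"
    unfolding pointed_simplices_iff[OF x] using const_simplex_hom[OF x] by blast
  have "(\<exists>w\<in>Val KX (Suc ?n). face KX ?n ?n w = s \<and> face KX ?n (Suc ?n) w = t \<and> (\<forall>i<?n. face KX ?n i w = ?c)) \<longleftrightarrow>
     peq x m (top_simplex m s) (top_simplex m t)" (is "?L \<longleftrightarrow> _")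
    if s: "s \<in> pointed_simplices KX ?n ?y" and t: "t \<in> pointed_simplices KX ?n ?y" for s t
  proof -
    have "?L \<longleftrightarrow> simplex_product KX ?n ?y ?c t s"
      unfolding simplex_product_def diff_Suc_1 All_less_Suc by blast
    also have "\<dots> \<longleftrightarrow> (\<exists>u. peq x m (top_simplex m s) u \<and> peq x m (top_simplex m t) u)"
      unfolding simplex_product_iff[OF x c t s] ctop using prd_commute prd_base by blast
    also have "\<dots> \<longleftrightarrow> peq x m (top_simplex m s) (top_simplex m t)"
    proof -
      have "pt x m (top_simplex m t)" using bij_betwE[OF bij_top_simplex[OF x, of m]] t by blast
      then show ?thesis using peq_refl peq_sym peq_trans by blast
    qed
    finally show ?thesis .
  qed
  then show ?thesis unfolding simplex_rel_def by blast
qed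

lemma simplex_model:
  assumes x: "x \<in> Val X 0"
  shows "quotient_model (pointed_simplices KX (Suc m) (Kstar_point X x)) (top_simplex m) {p. pt x m p} (peq x m) (prd x m)
     (simplex_rel KX (Suc m) (Kstar_point X x)) (simplex_product KX (Suc m) (Kstar_point X x))"
proof
  show "\<exists>r\<in>{p. pt x m p}. prd x m p q r" if "p \<in> {p. pt x m p}" "q \<in> {p. pt x m p}" for p q
    using prd_exists[of x m p q] prd_pt that by blast
  fix a b c assume abc: "a \<in> pointed_simplices KX (Suc m) (Kstar_point X x)"
    "b \<in> pointed_simplices KX (Suc m) (Kstar_point X x)" "c \<in> pointed_simplices KX (Suc m) (Kstar_point X x)"
  show "\<exists>u. peq x m (top_simplex m c) u \<and> prd x m (top_simplex m a) (top_simplex m b) u"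
    if "simplex_product KX (Suc m) (Kstar_point X x) a b c" using that simplex_product_iff[OF x abc] by blast
  show "simplex_product KX (Suc m) (Kstar_point X x) a b c"
    if "prd x m (top_simplex m a) (top_simplex m b) (top_simplex m c)"
    unfolding simplex_product_iff[OF x abc] using that prd_pt peq_refl by blast
qed (use bij_top_simplex[OF x] simplex_rel_eq[OF x] peq_refl in \<open>auto intro: peq_sym peq_trans prd_unique\<close>)

end

section \<open>Condensed objects\<close>

lemma is_functorD:
  assumes "is_functor C D F"
  shows "x \<in> Obj C \<Longrightarrow> FObj F x \<in> Obj D"
    and "x \<in> Obj C \<Longrightarrow> y \<in> Obj C \<Longrightarrow> f \<in> Arr C x y \<Longrightarrow> FArr F x y f \<in> Arr D (FObj F x) (FObj F y)"
    and "x \<in> Obj C \<Longrightarrow> FArr F x x (Idn C x) = Idn D (FObj F x)"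
    and "x \<in> Obj C \<Longrightarrow> y \<in> Obj C \<Longrightarrow> z \<in> Obj C \<Longrightarrow> f \<in> Arr C x y \<Longrightarrow> g \<in> Arr C y z \<Longrightarrow>
      FArr F x z (Cmp C x y z g f) = Cmp D (FObj F x) (FObj F y) (FObj F z) (FArr F y z g) (FArr F x y f)"
  using assms unfolding is_functor_def by simp_all

lemma is_functorI:
  assumes "\<And>x. x \<in> Obj C \<Longrightarrow> FObj F x \<in> Obj D"
    and "\<And>x y f. x \<in> Obj C \<Longrightarrow> y \<in> Obj C \<Longrightarrow> f \<in> Arr C x y \<Longrightarrow> FArr F x y f \<in> Arr D (FObj F x) (FObj F y)"
    and "\<And>x. x \<in> Obj C \<Longrightarrow> FArr F x x (Idn C x) = Idn D (FObj F x)"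
    and "\<And>x y z f g. x \<in> Obj C \<Longrightarrow> y \<in> Obj C \<Longrightarrow> z \<in> Obj C \<Longrightarrow> f \<in> Arr C x y \<Longrightarrow> g \<in> Arr C y z \<Longrightarrow>
      FArr F x z (Cmp C x y z g f) = Cmp D (FObj F x) (FObj F y) (FObj F z) (FArr F y z g) (FArr F x y f)"
  shows "is_functor C D F"
  using assms unfolding is_functor_def by simp

lemma functor_cat_simps:
  "Obj (functor_cat C D) = {F. is_functor C D F}"
  "Idn (functor_cat C D) F = (\<lambda>x\<in>Obj C. Idn D (FObj F x))"
  "Cmp (functor_cat C D) F G H \<beta> \<alpha> = (\<lambda>x\<in>Obj C. Cmp D (FObj F x) (FObj G x) (FObj H x) (\<beta> x) (\<alpha> x))"
  "\<eta> \<in> Arr (functor_cat C D) F G \<longleftrightarrow> \<eta> \<in> (\<Pi>\<^sub>E x\<in>Obj C. Arr D (FObj F x) (FObj G x)) \<and>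
     (\<forall>x\<in>Obj C. \<forall>y\<in>Obj C. \<forall>f\<in>Arr C x y.
          Cmp D (FObj F x) (FObj F y) (FObj G y) (\<eta> y) (FArr F x y f) =
          Cmp D (FObj F x) (FObj G x) (FObj G y) (FArr G x y f) (\<eta> x))"
  unfolding functor_cat_def by simp_all

lemma presheaf_cat_simps:
  "Obj (presheaf_cat B) = {P. is_presheaf B P}"
  "Arr (presheaf_cat B) = presheaf_hom B"
  "Idn (presheaf_cat B) P = (\<lambda>x\<in>Obj B. \<lambda>a\<in>Val P x. a)"
  "Cmp (presheaf_cat B) P Q R \<beta> \<alpha> = (\<lambda>x\<in>Obj B. \<lambda>a\<in>Val P x. \<beta> x (\<alpha> x a))"
  unfolding presheaf_cat_def by simp_all

lemma op_cat_simps: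
  "Obj (op_cat C) = Obj C" "Arr (op_cat C) x y = Arr C y x" "Idn (op_cat C) = Idn C"
  "Cmp (op_cat C) x y z g f = Cmp C z y x f g"
  unfolding op_cat_def by simp_all

lemma full_sub_simps:
  "Obj (full_sub C P) = {x \<in> Obj C. P x}" "Arr (full_sub C P) = Arr C" "Idn (full_sub C P) = Idn C"
  "Cmp (full_sub C P) = Cmp C"
  unfolding full_sub_def by simp_all

lemma comp_functor_simps:
  "FObj (comp_functor G F) x = FObj G (FObj F x)"
  "FArr (comp_functor G F) x y f = FArr G (FObj F x) (FObj F y) (FArr F x y f)"
  unfolding comp_functor_def by simp_all

lemma postcompose_simps:
  "FObj (postcompose C G) = comp_functor G"
  "FArr (postcompose C G) X Y \<eta> = (\<lambda>c\<in>Obj C. FArr G (FObj X c) (FObj Y c) (\<eta> c))"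
  unfolding postcompose_def by simp_all

lemma is_functor_comp:
  assumes F: "is_functor C D F" and G: "is_functor D D' G" shows "is_functor C D' (comp_functor G F)"
proof (rule is_functorI, unfold comp_functor_simps)
  fix x y z f g assume *: "x \<in> Obj C" "y \<in> Obj C" "z \<in> Obj C" "f \<in> Arr C x y" "g \<in> Arr C y z"
  show "FArr G (FObj F x) (FObj F z) (FArr F x z (Cmp C x y z g f)) =
     Cmp D' (FObj G (FObj F x)) (FObj G (FObj F y)) (FObj G (FObj F z))
        (FArr G (FObj F y) (FObj F z) (FArr F y z g)) (FArr G (FObj F x) (FObj F y) (FArr F x y f))"
    unfolding is_functorD(4)[OF F *]
    by (rule is_functorD(4)[OF G]) (use * is_functorD[OF F] in simp_all)
qed (simp_all add: is_functorD[OF F] is_functorD[OF G])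

lemma is_functor_postcompose:
  assumes G: "is_functor D D' G"
  shows "is_functor (functor_cat C D) (functor_cat C D') (postcompose C G)"
proof (rule is_functorI, unfold postcompose_simps)
  show "comp_functor G X \<in> Obj (functor_cat C D')" if "X \<in> Obj (functor_cat C D)" for X
    using that is_functor_comp[OF _ G] unfolding functor_cat_simps by simp
  fix X Y Z \<eta> \<beta>
  assume X: "X \<in> Obj (functor_cat C D)" and Y: "Y \<in> Obj (functor_cat C D)" and \<eta>: "\<eta> \<in> Arr (functor_cat C D) X Y"
  note FX = X[unfolded functor_cat_simps mem_Collect_eq] and FY = Y[unfolded functor_cat_simps mem_Collect_eq]
  have \<eta>c: "\<eta> c \<in> Arr D (FObj X c) (FObj Y c)" if "c \<in> Obj C" for c using \<eta> that unfolding functor_cat_simps by auto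
  show "(\<lambda>c\<in>Obj C. FArr G (FObj X c) (FObj Y c) (\<eta> c)) \<in> Arr (functor_cat C D') (comp_functor G X) (comp_functor G Y)"
    unfolding functor_cat_simps(4) comp_functor_simps
  proof (intro conjI ballI)
    show "(\<lambda>c\<in>Obj C. FArr G (FObj X c) (FObj Y c) (\<eta> c)) \<in> (\<Pi>\<^sub>E x\<in>Obj C. Arr D' (FObj G (FObj X x)) (FObj G (FObj Y x)))"
      using \<eta>c is_functorD(1)[OF FX] is_functorD(1)[OF FY] by (auto intro!: is_functorD(2)[OF G])
    fix x y f assume *: "x \<in> Obj C" "y \<in> Obj C" "f \<in> Arr C x y"
    note o = is_functorD(1)[OF FX *(1)] is_functorD(1)[OF FX *(2)] is_functorD(1)[OF FY *(1)] is_functorD(1)[OF FY *(2)]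
    note a = is_functorD(2)[OF FX *] is_functorD(2)[OF FY *] \<eta>c[OF *(1)] \<eta>c[OF *(2)]
    have "Cmp D (FObj X x) (FObj X y) (FObj Y y) (\<eta> y) (FArr X x y f) = Cmp D (FObj X x) (FObj Y x) (FObj Y y) (FArr Y x y f) (\<eta> x)"
      using \<eta> * unfolding functor_cat_simps by simp
    from arg_cong[OF this, of "FArr G (FObj X x) (FObj Y y)"]
    show "Cmp D' (FObj G (FObj X x)) (FObj G (FObj X y)) (FObj G (FObj Y y))
         ((\<lambda>c\<in>Obj C. FArr G (FObj X c) (FObj Y c) (\<eta> c)) y) (FArr G (FObj X x) (FObj X y) (FArr X x y f)) =
        Cmp D' (FObj G (FObj X x)) (FObj G (FObj Y x)) (FObj G (FObj Y y))
         (FArr G (FObj Y x) (FObj Y y) (FArr Y x y f)) ((\<lambda>c\<in>Obj C. FArr G (FObj X c) (FObj Y c) (\<eta> c)) x)"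
      using * by (simp add: is_functorD(4)[OF G o(1,2,4) a(1,4)] is_functorD(4)[OF G o(1,3,4) a(3,2)])
  qed
  assume Z: "Z \<in> Obj (functor_cat C D)" and \<beta>: "\<beta> \<in> Arr (functor_cat C D) Y Z"
  note FZ = Z[unfolded functor_cat_simps mem_Collect_eq]
  have \<beta>c: "\<beta> c \<in> Arr D (FObj Y c) (FObj Z c)" if "c \<in> Obj C" for c using \<beta> that unfolding functor_cat_simps by auto
  show "(\<lambda>c\<in>Obj C. FArr G (FObj X c) (FObj Z c) (Cmp (functor_cat C D) X Y Z \<beta> \<eta> c)) =
      Cmp (functor_cat C D') (comp_functor G X) (comp_functor G Y) (comp_functor G Z)
        (\<lambda>c\<in>Obj C. FArr G (FObj Y c) (FObj Z c) (\<beta> c)) (\<lambda>c\<in>Obj C. FArr G (FObj X c) (FObj Y c) (\<eta> c))"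
    unfolding functor_cat_simps(3) comp_functor_simps
    by (rule restrict_ext) (simp add: is_functorD(4)[OF G is_functorD(1)[OF FX] is_functorD(1)[OF FY] is_functorD(1)[OF FZ] \<eta>c \<beta>c])
next
  fix X assume "X \<in> Obj (functor_cat C D)"
  then have FX: "is_functor C D X" unfolding functor_cat_simps by simp
  show "(\<lambda>c\<in>Obj C. FArr G (FObj X c) (FObj X c) (Idn (functor_cat C D) X c)) = Idn (functor_cat C D') (comp_functor G X)"
    unfolding functor_cat_simps(2) comp_functor_simps
    by (rule restrict_ext) (simp add: is_functorD(3)[OF G is_functorD(1)[OF FX]])
qed

lemma Kstar_FArr: "FArr Kstar X Y \<eta> = (\<lambda>n. \<lambda>\<theta>\<in>presheaf_hom Box (K n) X. \<lambda>p. \<lambda>a\<in>Val (K n) p. \<eta> p (\<theta> p a))"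
  unfolding Kstar_def by simp

lemma hom_postcompose:
  assumes \<eta>: "\<eta> \<in> presheaf_hom Box X Y" and \<theta>: "\<theta> \<in> presheaf_hom Box (K n) X"
  shows "(\<lambda>p. \<lambda>a\<in>Val (K n) p. \<eta> p (\<theta> p a)) \<in> presheaf_hom Box (K n) Y"
proof (rule presheaf_homI)
  show "(\<lambda>a\<in>Val (K n) p. \<eta> p (\<theta> p a)) a \<in> Val Y p" if "a \<in> Val (K n) p" for p a
    using that presheaf_homD(1)[OF \<eta> _ presheaf_homD(1)[OF \<theta> _ that]] by simp
  fix l m f b assume f: "f \<in> Arr Box l m" and b: "b \<in> Val (K n) m"
  then show "(\<lambda>a\<in>Val (K n) l. \<eta> l (\<theta> l a)) (Act (K n) l m f b) = Act Y l m f ((\<lambda>a\<in>Val (K n) m. \<eta> m (\<theta> m a)) b)"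
    using presheaf_homD(3)[OF \<theta> _ _ f b] presheaf_homD(3)[OF \<eta> _ _ f presheaf_homD(1)[OF \<theta> _ b]]
      K_Val_comp[OF b f] by (simp add: Act_K)
qed simp_all

lemma hom_restrict: "\<theta> \<in> presheaf_hom Box (K n) X \<Longrightarrow> (\<lambda>p. \<lambda>a\<in>Val (K n) p. \<theta> p a) = \<theta>"
  using presheaf_homD(2)[of \<theta> Box "K n" X] by (intro ext) (simp add: extensional_restrict)

lemma Kstar_FArr_hom:
  assumes \<eta>: "\<eta> \<in> presheaf_hom Box X Y"
  shows "FArr Kstar X Y \<eta> \<in> presheaf_hom Simplex (FObj Kstar X) (FObj Kstar Y)"
proof (rule presheaf_homI)
  show "FArr Kstar X Y \<eta> n \<theta> \<in> Val (FObj Kstar Y) n" if "\<theta> \<in> Val (FObj Kstar X) n" for n \<theta>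
    using that hom_postcompose[OF \<eta>] unfolding Val_Kstar Kstar_FArr by simp
  show "FArr Kstar X Y \<eta> n \<in> extensional (Val (FObj Kstar X) n)" for n
    unfolding Val_Kstar Kstar_FArr by simp
  fix m n \<sigma> \<theta> assume \<sigma>: "\<sigma> \<in> Arr Simplex m n" and \<theta>: "\<theta> \<in> Val (FObj Kstar X) n"
  then have h: "Act (FObj Kstar X) m n \<sigma> \<theta> \<in> presheaf_hom Box (K m) X" "\<theta> \<in> presheaf_hom Box (K n) X"
    using Kstar_Act_hom unfolding Val_Kstar by blast+
  show "FArr Kstar X Y \<eta> m (Act (FObj Kstar X) m n \<sigma> \<theta>) = Act (FObj Kstar Y) m n \<sigma> (FArr Kstar X Y \<eta> n \<theta>)"
  proof (rule ext)
    fix p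
    have "(\<lambda>a\<in>Val (K m) p. \<eta> p (Act (FObj Kstar X) m n \<sigma> \<theta> p a)) =
       (\<lambda>a\<in>Val (K m) p. (\<lambda>a\<in>Val (K n) p. \<eta> p (\<theta> p a)) (\<lambda>v\<in>cube p. \<sigma> ` a v))"
      by (rule restrict_ext) (use K_Val_push[OF _ \<sigma>] in \<open>simp add: Act_Kstar\<close>)
    then show "FArr Kstar X Y \<eta> m (Act (FObj Kstar X) m n \<sigma> \<theta>) p = Act (FObj Kstar Y) m n \<sigma> (FArr Kstar X Y \<eta> n \<theta>) p"
      unfolding Kstar_FArr Act_Kstar[of Y] using h by simp
  qed
qed simp_all

lemma Kstar_functor:
  "is_functor (presheaf_cat Box :: ('a cubeset, _) category) (presheaf_cat Simplex) Kstar"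
proof (rule is_functorI, unfold presheaf_cat_simps mem_Collect_eq)
  show "is_presheaf Simplex (FObj Kstar X)" for X :: "'a cubeset" by (rule Kstar_presheaf)
  show "FArr Kstar X Y \<eta> \<in> presheaf_hom Simplex (FObj Kstar X) (FObj Kstar Y)" if "\<eta> \<in> presheaf_hom Box X Y"
    for X Y :: "'a cubeset" and \<eta> by (rule Kstar_FArr_hom[OF that])
  show "FArr Kstar X X (\<lambda>x\<in>Obj Box. \<lambda>a\<in>Val X x. a) = (\<lambda>x\<in>Obj Simplex. \<lambda>a\<in>Val (FObj Kstar X) x. a)" for X :: "'a cubeset"
  proof (rule ext)
    fix n
    have "(\<lambda>p. \<lambda>a\<in>Val (K n) p. (\<lambda>x\<in>Obj Box. \<lambda>a\<in>Val X x. a) p (\<theta> p a)) = \<theta>" if \<theta>: "\<theta> \<in> presheaf_hom Box (K n) X" for \<theta>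
    proof -
      have "(\<lambda>p. \<lambda>a\<in>Val (K n) p. (\<lambda>x\<in>Obj Box. \<lambda>a\<in>Val X x. a) p (\<theta> p a)) = (\<lambda>p. \<lambda>a\<in>Val (K n) p. \<theta> p a)"
        by (intro ext restrict_ext[THEN fun_cong]) (use presheaf_homD(1)[OF \<theta>] in simp)
      then show ?thesis using hom_restrict[OF \<theta>] by simp
    qed
    then have "(\<lambda>\<theta>\<in>presheaf_hom Box (K n) X. \<lambda>p. \<lambda>a\<in>Val (K n) p. (\<lambda>x\<in>Obj Box. \<lambda>a\<in>Val X x. a) p (\<theta> p a)) =
      (\<lambda>\<theta>\<in>presheaf_hom Box (K n) X. \<theta>)" by (intro restrict_ext)
    then show "FArr Kstar X X (\<lambda>x\<in>Obj Box. \<lambda>a\<in>Val X x. a) n = (\<lambda>x\<in>Obj Simplex. \<lambda>a\<in>Val (FObj Kstar X) x. a) n"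
      unfolding Kstar_FArr Val_Kstar by simp
  qed
  fix X Y Z :: "'a cubeset" and \<alpha> \<beta> assume \<alpha>: "\<alpha> \<in> presheaf_hom Box X Y"
  show "FArr Kstar X Z (\<lambda>x\<in>Obj Box. \<lambda>a\<in>Val X x. \<beta> x (\<alpha> x a)) =
       (\<lambda>x\<in>Obj Simplex. \<lambda>a\<in>Val (FObj Kstar X) x. FArr Kstar Y Z \<beta> x (FArr Kstar X Y \<alpha> x a))"
  proof (rule ext)
    fix n
    have "(\<lambda>\<theta>\<in>presheaf_hom Box (K n) X. \<lambda>p. \<lambda>a\<in>Val (K n) p. (\<lambda>x\<in>Obj Box. \<lambda>a\<in>Val X x. \<beta> x (\<alpha> x a)) p (\<theta> p a)) =
      (\<lambda>\<theta>\<in>presheaf_hom Box (K n) X. FArr Kstar Y Z \<beta> n (FArr Kstar X Y \<alpha> n \<theta>))"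
    proof (rule restrict_ext)
      fix \<theta> assume \<theta>: "\<theta> \<in> presheaf_hom Box (K n) X"
      have "(\<lambda>p. \<lambda>a\<in>Val (K n) p. (\<lambda>x\<in>Obj Box. \<lambda>a\<in>Val X x. \<beta> x (\<alpha> x a)) p (\<theta> p a)) =
        (\<lambda>p. \<lambda>a\<in>Val (K n) p. \<beta> p ((\<lambda>p. \<lambda>a\<in>Val (K n) p. \<alpha> p (\<theta> p a)) p a))"
        by (intro ext restrict_ext[THEN fun_cong]) (use presheaf_homD(1)[OF \<theta>] in simp)
      then show "(\<lambda>p. \<lambda>a\<in>Val (K n) p. (\<lambda>x\<in>Obj Box. \<lambda>a\<in>Val X x. \<beta> x (\<alpha> x a)) p (\<theta> p a)) =
        FArr Kstar Y Z \<beta> n (FArr Kstar X Y \<alpha> n \<theta>)"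
        unfolding Kstar_FArr using \<theta> hom_postcompose[OF \<alpha> \<theta>] by simp
    qed
    then show "FArr Kstar X Z (\<lambda>x\<in>Obj Box. \<lambda>a\<in>Val X x. \<beta> x (\<alpha> x a)) n =
       (\<lambda>x\<in>Obj Simplex. \<lambda>a\<in>Val (FObj Kstar X) x. FArr Kstar Y Z \<beta> x (FArr Kstar X Y \<alpha> x a)) n"
      unfolding Kstar_FArr[of X Z] Val_Kstar by simp
  qed
qed

lemma restrict_eq_iff: "(\<lambda>i\<in>I. f i) = (\<lambda>i\<in>I. g i) \<longleftrightarrow> (\<forall>i\<in>I. f i = g i)"
proof
  assume l: "(\<lambda>i\<in>I. f i) = (\<lambda>i\<in>I. g i)"
  show "\<forall>i\<in>I. f i = g i"
  proof
    fix i assume "i \<in> I"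
    then show "f i = g i" using fun_cong[OF l, of i] by simp
  qed
qed (intro restrict_ext, blast)

lemma bij_betw_ex1:
  assumes "bij_betw f A B" "b \<in> B" shows "\<exists>!a. a \<in> A \<and> f a = b"
proof -
  obtain a where a: "a \<in> A" "f a = b" using assms unfolding bij_betw_def by blast
  moreover have "a' = a" if "a' \<in> A \<and> f a' = b" for a'
    using inj_onD[OF bij_betw_imp_inj_on[OF assms(1)], of a' a] a that by simp
  ultimately show ?thesis by blast
qed

text \<open>Morphisms into a presheaf that is jointly monic over a family, given by lifting a family of
  morphisms elementwise; this covers limits as well as the product condition for condensed objects.\<close>

lemma hom_lift:
  assumes L: "is_presheaf B L" and P: "\<And>x y f a. x \<in> Obj B \<Longrightarrow> y \<in> Obj B \<Longrightarrow> f \<in> Arr B x y \<Longrightarrow> a \<in> Val P y \<Longrightarrow> Act P x y f a \<in> Val P x"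
    and r: "\<And>j. j \<in> I \<Longrightarrow> r j \<in> presheaf_hom B L (G j)"
    and \<theta>: "\<And>j. j \<in> I \<Longrightarrow> \<theta> j \<in> presheaf_hom B P (G j)"
    and ex: "\<And>x a. x \<in> Obj B \<Longrightarrow> a \<in> Val P x \<Longrightarrow> \<exists>!l. l \<in> Val L x \<and> (\<forall>j\<in>I. r j x l = \<theta> j x a)"
  shows "\<exists>!\<eta>. \<eta> \<in> presheaf_hom B P L \<and> (\<forall>j\<in>I. \<forall>x\<in>Obj B. \<forall>a\<in>Val P x. r j x (\<eta> x a) = \<theta> j x a)"
proof -
  define \<eta> where "\<eta> = (\<lambda>x\<in>Obj B. \<lambda>a\<in>Val P x. THE l. l \<in> Val L x \<and> (\<forall>j\<in>I. r j x l = \<theta> j x a))"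
  have \<eta>: "\<eta> x a \<in> Val L x \<and> (\<forall>j\<in>I. r j x (\<eta> x a) = \<theta> j x a)" if "x \<in> Obj B" "a \<in> Val P x" for x a
    using theI'[OF ex[OF that]] that unfolding \<eta>_def by simp
  show ?thesis
  proof (rule ex1I[of _ \<eta>])
    show "\<eta> \<in> presheaf_hom B P L \<and> (\<forall>j\<in>I. \<forall>x\<in>Obj B. \<forall>a\<in>Val P x. r j x (\<eta> x a) = \<theta> j x a)"
    proof
      show "\<eta> \<in> presheaf_hom B P L"
      proof (rule presheaf_homI)
        fix x y f b assume x: "x \<in> Obj B" and y: "y \<in> Obj B" and f: "f \<in> Arr B x y" and b: "b \<in> Val P y"
        have a: "Act P x y f b \<in> Val P x" by (rule P[OF x y f b])
        have l: "Act L x y f (\<eta> y b) \<in> Val L x" using is_presheafD(1)[OF L x y f] \<eta>[OF y b] by blast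
        have "r j x (Act L x y f (\<eta> y b)) = \<theta> j x (Act P x y f b)" if j: "j \<in> I" for j
          using presheaf_homD(3)[OF r[OF j] x y f, of "\<eta> y b"] presheaf_homD(3)[OF \<theta>[OF j] x y f b] \<eta>[OF y b] j by simp
        then show "\<eta> x (Act P x y f b) = Act L x y f (\<eta> y b)" using ex[OF x a] \<eta>[OF x a] l by blast
      qed (use \<eta> in \<open>auto simp: \<eta>_def\<close>)
    qed (use \<eta> in blast)
    fix \<eta>' assume *: "\<eta>' \<in> presheaf_hom B P L \<and> (\<forall>j\<in>I. \<forall>x\<in>Obj B. \<forall>a\<in>Val P x. r j x (\<eta>' x a) = \<theta> j x a)"
    show "\<eta>' = \<eta>"
    proof (rule extensionalityI[of _ "Obj B"])
      show "\<eta>' \<in> extensional (Obj B)" using * unfolding presheaf_hom_def by (auto simp: PiE_iff)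
      show "\<eta> \<in> extensional (Obj B)" unfolding \<eta>_def by simp
      fix x assume x: "x \<in> Obj B"
      show "\<eta>' x = \<eta> x"
      proof (rule extensionalityI[of _ "Val P x"])
        show "\<eta>' x \<in> extensional (Val P x)" using presheaf_homD(2)[of \<eta>' B P L x] * x by blast
        show "\<eta> x \<in> extensional (Val P x)" using x unfolding \<eta>_def by simp
        fix a assume a: "a \<in> Val P x"
        have "\<eta>' x a \<in> Val L x" using presheaf_homD(1)[of \<eta>' B P L x a] * x a by blast
        then show "\<eta>' x a = \<eta> x a" using ex[OF x a] \<eta>[OF x a] * x a by blast
      qed
    qed
  qed
qed

lemma K_Act: "a \<in> Val (K n) m \<Longrightarrow> f \<in> Arr Box l m \<Longrightarrow> Act (K n) l m f a \<in> Val (K n) l"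
  unfolding Act_K by (rule K_Val_comp)

lemma condensed_Obj_iff:
  "X \<in> Obj (condensed_cat \<kappa> B) \<longleftrightarrow> is_functor (op_cat (Extr \<kappa>)) (presheaf_cat B) X \<and> disjoint_unions_to_products \<kappa> B X"
  unfolding condensed_cat_def full_sub_simps functor_cat_simps by simp

lemma condensed_ObjD:
  assumes "X \<in> Obj (condensed_cat \<kappa> B)" "E \<in> Obj (Extr \<kappa>)" "F \<in> Obj (Extr \<kappa>)"
  shows "is_presheaf B (FObj X E)"
    and "f \<in> Arr (Extr \<kappa>) F E \<Longrightarrow> FArr X E F f \<in> presheaf_hom B (FObj X E) (FObj X F)"
    and "x \<in> Obj B \<Longrightarrow> a \<in> Val (FObj X E) x \<Longrightarrow> FArr X E E (\<lambda>t\<in>topspace E. t) x a = a"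
    and "G \<in> Obj (Extr \<kappa>) \<Longrightarrow> f \<in> Arr (Extr \<kappa>) F E \<Longrightarrow> g \<in> Arr (Extr \<kappa>) G F \<Longrightarrow> x \<in> Obj B \<Longrightarrow> a \<in> Val (FObj X E) x \<Longrightarrow>
      FArr X E G (compose (topspace G) f g) x a = FArr X F G g x (FArr X E F f x a)"
proof -
  note F = assms(1)[unfolded condensed_Obj_iff, THEN conjunct1]
  show "is_presheaf B (FObj X E)"
    using is_functorD(1)[OF F] assms(2) unfolding op_cat_simps presheaf_cat_simps by simp
  show "f \<in> Arr (Extr \<kappa>) F E \<Longrightarrow> FArr X E F f \<in> presheaf_hom B (FObj X E) (FObj X F)"
    using is_functorD(2)[OF F] assms(2,3) unfolding op_cat_simps presheaf_cat_simps by simp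
  have "Idn (Extr \<kappa>) E = (\<lambda>t\<in>topspace E. t)" unfolding Extr_def by simp
  then show "x \<in> Obj B \<Longrightarrow> a \<in> Val (FObj X E) x \<Longrightarrow> FArr X E E (\<lambda>t\<in>topspace E. t) x a = a"
    using is_functorD(3)[OF F, of E] assms(2) unfolding op_cat_simps presheaf_cat_simps by simp
  have "Cmp (Extr \<kappa>) G F E f g = compose (topspace G) f g" for G f g unfolding Extr_def by simp
  then show "G \<in> Obj (Extr \<kappa>) \<Longrightarrow> f \<in> Arr (Extr \<kappa>) F E \<Longrightarrow> g \<in> Arr (Extr \<kappa>) G F \<Longrightarrow> x \<in> Obj B \<Longrightarrow> a \<in> Val (FObj X E) x \<Longrightarrow>
      FArr X E G (compose (topspace G) f g) x a = FArr X F G g x (FArr X E F f x a)"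
    using is_functorD(4)[OF F, of E F G f g] assms(2,3) unfolding op_cat_simps presheaf_cat_simps by simp
qed

lemma condensed_Arr_iff:
  assumes X: "X \<in> Obj (condensed_cat \<kappa> B)" and Y: "Y \<in> Obj (condensed_cat \<kappa> B)"
  shows "\<eta> \<in> Arr (condensed_cat \<kappa> B) X Y \<longleftrightarrow> \<eta> \<in> extensional (Obj (Extr \<kappa>)) \<and>
    (\<forall>E\<in>Obj (Extr \<kappa>). \<eta> E \<in> presheaf_hom B (FObj X E) (FObj Y E)) \<and>
    (\<forall>E\<in>Obj (Extr \<kappa>). \<forall>F\<in>Obj (Extr \<kappa>). \<forall>f\<in>Arr (Extr \<kappa>) F E. \<forall>x\<in>Obj B. \<forall>a\<in>Val (FObj X E) x.
       \<eta> F x (FArr X E F f x a) = FArr Y E F f x (\<eta> E x a))"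
proof -
  show ?thesis
    unfolding condensed_cat_def full_sub_simps functor_cat_simps(4) op_cat_simps presheaf_cat_simps restrict_eq_iff
    by (auto simp: PiE_iff)
qed

lemma presheaf_hom_eqI:
  assumes "\<theta> \<in> presheaf_hom B P Q" "\<theta>' \<in> presheaf_hom B P Q"
    and "\<And>x a. x \<in> Obj B \<Longrightarrow> a \<in> Val P x \<Longrightarrow> \<theta> x a = \<theta>' x a"
  shows "\<theta> = \<theta>'"
proof (rule extensionalityI[of _ "Obj B"])
  show "\<theta> \<in> extensional (Obj B)" "\<theta>' \<in> extensional (Obj B)" using assms(1,2) unfolding presheaf_hom_def by (auto simp: PiE_iff)
  show "\<theta> x = \<theta>' x" if x: "x \<in> Obj B" for x
    by (rule extensionalityI[OF presheaf_homD(2)[OF assms(1) x] presheaf_homD(2)[OF assms(2) x] assms(3)[OF x]])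
qed

lemma Extr_Obj_iff:
  "E \<in> Obj (Extr \<kappa>) \<longleftrightarrow> compact_space E \<and> Hausdorff_space E \<and> extremally_disconnected E \<and> |topspace E| <o \<kappa>"
  and Extr_Arr_iff: "f \<in> Arr (Extr \<kappa>) E F \<longleftrightarrow> f \<in> topspace E \<rightarrow>\<^sub>E topspace F \<and> continuous_map E F f"
  unfolding Extr_def by simp_all

lemma Extr_ArrD:
  assumes "g \<in> Arr (Extr \<kappa>) F' F"
  shows "t \<in> topspace F' \<Longrightarrow> g t \<in> topspace F" "continuous_map F' F g"
  using assms unfolding Extr_Arr_iff by auto

lemma Extr_compose_Arr:
  assumes f: "f \<in> Arr (Extr \<kappa>) F E" and g: "g \<in> Arr (Extr \<kappa>) G F"
  shows "compose (topspace G) f g \<in> Arr (Extr \<kappa>) G E"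
proof -
  have "continuous_map G E (compose (topspace G) f g)"
    by (rule continuous_map_eq[OF continuous_map_compose[OF Extr_ArrD(2)[OF g] Extr_ArrD(2)[OF f]]]) (simp add: compose_def)
  then show ?thesis unfolding Extr_Arr_iff using Extr_ArrD(1)[OF g] Extr_ArrD(1)[OF f] by (auto simp: compose_def)
qed

text \<open>Replaces the bijection by unique existence of a glued element, the form in which
  elements are lifted by \<open>hom_lift\<close> and \<open>Kstar_lift\<close>.\<close>

lemma disjoint_unions_to_productsI:
  fixes X :: "('k, 'o, 'm, 'a) condensed"
  assumes mem: "\<And>E F f x l. E \<in> Obj (Extr \<kappa>) \<Longrightarrow> F \<in> Obj (Extr \<kappa>) \<Longrightarrow> f \<in> Arr (Extr \<kappa>) F E \<Longrightarrow> x \<in> Obj B \<Longrightarrow>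
      l \<in> Val (FObj X E) x \<Longrightarrow> FArr X E F f x l \<in> Val (FObj X F) x"
    and sheaf: "\<And>(I :: nat set) Es E \<iota> x z. finite I \<Longrightarrow> E \<in> Obj (Extr \<kappa>) \<Longrightarrow> (\<And>i. i \<in> I \<Longrightarrow> Es i \<in> Obj (Extr \<kappa>)) \<Longrightarrow>
      (\<And>i. i \<in> I \<Longrightarrow> \<iota> i \<in> Arr (Extr \<kappa>) (Es i) E) \<Longrightarrow> homeomorphic_map (sum_topology Es I) E (\<lambda>(i, e). \<iota> i e) \<Longrightarrow>
      x \<in> Obj B \<Longrightarrow> (\<And>i. i \<in> I \<Longrightarrow> z i \<in> Val (FObj X (Es i)) x) \<Longrightarrow>
      \<exists>!l. l \<in> Val (FObj X E) x \<and> (\<forall>i\<in>I. FArr X E (Es i) (\<iota> i) x l = z i)"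
  shows "disjoint_unions_to_products \<kappa> B X"
  unfolding disjoint_unions_to_products_def
proof (intro allI impI ballI)
  fix I :: "nat set" and Es E \<iota> x
  assume *: "finite I \<and> E \<in> Obj (Extr \<kappa>) \<and> (\<forall>i\<in>I. Es i \<in> Obj (Extr \<kappa>) \<and> \<iota> i \<in> Arr (Extr \<kappa>) (Es i) E) \<and>
      homeomorphic_map (sum_topology Es I) E (\<lambda>(i, e). \<iota> i e)" and x: "x \<in> Obj B"
  then have E: "finite I" "E \<in> Obj (Extr \<kappa>)" "homeomorphic_map (sum_topology Es I) E (\<lambda>(i, e). \<iota> i e)"
    and Es: "\<And>i. i \<in> I \<Longrightarrow> Es i \<in> Obj (Extr \<kappa>)" "\<And>i. i \<in> I \<Longrightarrow> \<iota> i \<in> Arr (Extr \<kappa>) (Es i) E" by blast+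
  note ex = sheaf[OF E(1,2) Es E(3) x]
  have mem': "FArr X E (Es i) (\<iota> i) x l \<in> Val (FObj X (Es i)) x" if "i \<in> I" "l \<in> Val (FObj X E) x" for i l
    by (rule mem[OF E(2) Es(1)[OF that(1)] Es(2)[OF that(1)] x that(2)])
  show "bij_betw (\<lambda>l. \<lambda>i\<in>I. FArr X E (Es i) (\<iota> i) x l) (Val (FObj X E) x) (\<Pi>\<^sub>E i\<in>I. Val (FObj X (Es i)) x)"
  proof (rule bij_betwI')
    fix l l' assume l: "l \<in> Val (FObj X E) x" "l' \<in> Val (FObj X E) x"
    have "\<exists>!l'. l' \<in> Val (FObj X E) x \<and> (\<forall>i\<in>I. FArr X E (Es i) (\<iota> i) x l' = FArr X E (Es i) (\<iota> i) x l)"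
      by (rule ex) (simp_all add: mem' l(1))
    then have "l' = l" if "\<forall>i\<in>I. FArr X E (Es i) (\<iota> i) x l' = FArr X E (Es i) (\<iota> i) x l" using l that by blast
    then show "((\<lambda>i\<in>I. FArr X E (Es i) (\<iota> i) x l) = (\<lambda>i\<in>I. FArr X E (Es i) (\<iota> i) x l')) = (l = l')"
      unfolding restrict_eq_iff by (metis (no_types, lifting))
  next
    fix z assume z: "z \<in> (\<Pi>\<^sub>E i\<in>I. Val (FObj X (Es i)) x)"
    have "\<exists>!l. l \<in> Val (FObj X E) x \<and> (\<forall>i\<in>I. FArr X E (Es i) (\<iota> i) x l = z i)"
      by (rule ex) (use z in auto)
    then obtain l where "l \<in> Val (FObj X E) x" "\<forall>i\<in>I. FArr X E (Es i) (\<iota> i) x l = z i" by blast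
    moreover from this(2) have "(\<lambda>i\<in>I. FArr X E (Es i) (\<iota> i) x l) = (\<lambda>i\<in>I. z i)" unfolding restrict_eq_iff .
    moreover have "(\<lambda>i\<in>I. z i) = z" using z by (simp add: PiE_iff extensional_restrict)
    ultimately show "\<exists>l\<in>Val (FObj X E) x. z = (\<lambda>i\<in>I. FArr X E (Es i) (\<iota> i) x l)" by metis
  qed (use mem' in simp)
qed

lemma condensed_ObjI:
  fixes X :: "('k, 'o, 'm, 'a) condensed"
  assumes P: "\<And>E. E \<in> Obj (Extr \<kappa>) \<Longrightarrow> is_presheaf B (FObj X E)"
    and hom: "\<And>E F f. E \<in> Obj (Extr \<kappa>) \<Longrightarrow> F \<in> Obj (Extr \<kappa>) \<Longrightarrow> f \<in> Arr (Extr \<kappa>) F E \<Longrightarrow>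
      FArr X E F f \<in> presheaf_hom B (FObj X E) (FObj X F)"
    and id: "\<And>E x a. E \<in> Obj (Extr \<kappa>) \<Longrightarrow> x \<in> Obj B \<Longrightarrow> a \<in> Val (FObj X E) x \<Longrightarrow> FArr X E E (\<lambda>t\<in>topspace E. t) x a = a"
    and comp: "\<And>E F G f g x a. E \<in> Obj (Extr \<kappa>) \<Longrightarrow> F \<in> Obj (Extr \<kappa>) \<Longrightarrow> G \<in> Obj (Extr \<kappa>) \<Longrightarrow>
      f \<in> Arr (Extr \<kappa>) F E \<Longrightarrow> g \<in> Arr (Extr \<kappa>) G F \<Longrightarrow> x \<in> Obj B \<Longrightarrow> a \<in> Val (FObj X E) x \<Longrightarrow>
      FArr X E G (compose (topspace G) f g) x a = FArr X F G g x (FArr X E F f x a)"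
    and sheaf: "\<And>(I :: nat set) Es E \<iota> x z. finite I \<Longrightarrow> E \<in> Obj (Extr \<kappa>) \<Longrightarrow> (\<And>i. i \<in> I \<Longrightarrow> Es i \<in> Obj (Extr \<kappa>)) \<Longrightarrow>
      (\<And>i. i \<in> I \<Longrightarrow> \<iota> i \<in> Arr (Extr \<kappa>) (Es i) E) \<Longrightarrow> homeomorphic_map (sum_topology Es I) E (\<lambda>(i, e). \<iota> i e) \<Longrightarrow>
      x \<in> Obj B \<Longrightarrow> (\<And>i. i \<in> I \<Longrightarrow> z i \<in> Val (FObj X (Es i)) x) \<Longrightarrow>
      \<exists>!l. l \<in> Val (FObj X E) x \<and> (\<forall>i\<in>I. FArr X E (Es i) (\<iota> i) x l = z i)"
  shows "X \<in> Obj (condensed_cat \<kappa> B)"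
  unfolding condensed_Obj_iff
proof
  have idn: "Idn (Extr \<kappa>) E = (\<lambda>t\<in>topspace E. t)" "Cmp (Extr \<kappa>) G F E f g = compose (topspace G) f g" for E F G f g
    unfolding Extr_def by simp_all
  have id_Arr: "(\<lambda>t\<in>topspace E. t) \<in> Arr (Extr \<kappa>) E E" for E
    unfolding Extr_Arr_iff by (auto intro: continuous_map_eq[OF continuous_map_id])
  show "is_functor (op_cat (Extr \<kappa>)) (presheaf_cat B) X"
  proof (rule is_functorI, unfold op_cat_simps presheaf_cat_simps mem_Collect_eq idn)
    show "is_presheaf B (FObj X E)" if "E \<in> Obj (Extr \<kappa>)" for E by (rule P[OF that])
    show "FArr X E F f \<in> presheaf_hom B (FObj X E) (FObj X F)" if "E \<in> Obj (Extr \<kappa>)" "F \<in> Obj (Extr \<kappa>)" "f \<in> Arr (Extr \<kappa>) F E" for E F f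
      by (rule hom[OF that])
    show "FArr X E E (\<lambda>t\<in>topspace E. t) = (\<lambda>x\<in>Obj B. \<lambda>a\<in>Val (FObj X E) x. a)" if E: "E \<in> Obj (Extr \<kappa>)" for E
      by (rule presheaf_hom_eqI[OF hom[OF E E id_Arr]])
        (use id[OF E] is_presheafD(1)[OF P[OF E]] in \<open>auto intro!: presheaf_homI\<close>)
    fix E F G f g assume *: "E \<in> Obj (Extr \<kappa>)" "F \<in> Obj (Extr \<kappa>)" "G \<in> Obj (Extr \<kappa>)" "f \<in> Arr (Extr \<kappa>) F E" "g \<in> Arr (Extr \<kappa>) G F"
    note h = hom[OF *(1,2,4)] hom[OF *(2,3,5)]
    show "FArr X E G (compose (topspace G) f g) = (\<lambda>x\<in>Obj B. \<lambda>a\<in>Val (FObj X E) x. FArr X F G g x (FArr X E F f x a))"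
    proof (rule presheaf_hom_eqI[OF hom[OF *(1,3) Extr_compose_Arr[OF *(4,5)]]])
      show "(\<lambda>x\<in>Obj B. \<lambda>a\<in>Val (FObj X E) x. FArr X F G g x (FArr X E F f x a)) \<in> presheaf_hom B (FObj X E) (FObj X G)"
      proof (rule presheaf_homI)
        fix x y u b assume xy: "x \<in> Obj B" "y \<in> Obj B" "u \<in> Arr B x y" and b: "b \<in> Val (FObj X E) y"
        note v = is_presheafD(1)[OF P[OF *(1)] xy b] presheaf_homD(1)[OF h(1) xy(2) b]
        show "(\<lambda>x\<in>Obj B. \<lambda>a\<in>Val (FObj X E) x. FArr X F G g x (FArr X E F f x a)) x (Act (FObj X E) x y u b) =
           Act (FObj X G) x y u ((\<lambda>x\<in>Obj B. \<lambda>a\<in>Val (FObj X E) x. FArr X F G g x (FArr X E F f x a)) y b)"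
          using xy b v presheaf_homD(3)[OF h(1) xy b] presheaf_homD(3)[OF h(2) xy v(2)] by simp
      qed (use presheaf_homD(1)[OF h(1)] presheaf_homD(1)[OF h(2)] in simp_all)
    qed (use comp[OF *] in simp)
  qed
  show "disjoint_unions_to_products \<kappa> B X"
    by (rule disjoint_unions_to_productsI) (simp_all only: presheaf_homD(1)[OF hom] sheaf)
qed

lemma condensed_sheaf:
  assumes X: "X \<in> Obj (condensed_cat \<kappa> B)" and I: "finite (I :: nat set)" and E: "E \<in> Obj (Extr \<kappa>)"
    and Es: "\<And>i. i \<in> I \<Longrightarrow> Es i \<in> Obj (Extr \<kappa>)" "\<And>i. i \<in> I \<Longrightarrow> \<iota> i \<in> Arr (Extr \<kappa>) (Es i) E"
    and h: "homeomorphic_map (sum_topology Es I) E (\<lambda>(i, e). \<iota> i e)" and x: "x \<in> Obj B"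
    and z: "\<And>i. i \<in> I \<Longrightarrow> z i \<in> Val (FObj X (Es i)) x"
  shows "\<exists>!l. l \<in> Val (FObj X E) x \<and> (\<forall>i\<in>I. FArr X E (Es i) (\<iota> i) x l = z i)"
proof -
  have D: "disjoint_unions_to_products \<kappa> B X" using X unfolding condensed_Obj_iff by (rule conjunct2)
  have "bij_betw (\<lambda>l. \<lambda>i\<in>I. FArr X E (Es i) (\<iota> i) x l) (Val (FObj X E) x) (\<Pi>\<^sub>E i\<in>I. Val (FObj X (Es i)) x)"
    by (rule D[unfolded disjoint_unions_to_products_def, rule_format, OF _ x]) (intro conjI ballI I E Es h)
  moreover have "(\<lambda>i\<in>I. z i) \<in> (\<Pi>\<^sub>E i\<in>I. Val (FObj X (Es i)) x)" using z by auto
  ultimately have "\<exists>!l. l \<in> Val (FObj X E) x \<and> (\<lambda>i\<in>I. FArr X E (Es i) (\<iota> i) x l) = (\<lambda>i\<in>I. z i)" by (rule bij_betw_ex1)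
  then show ?thesis unfolding restrict_eq_iff .
qed

text \<open>The limit of sets at every \<open>E\<close> and \<open>x\<close>, in the unique
  existence form that the lifting lemmas use; that \<open>\<pi>\<close> is a cone is asked for
  separately.\<close>

definition is_pointwise_limit ::
  "('j, 'i) category \<Rightarrow> 'k rel \<Rightarrow> ('o, 'm) category \<Rightarrow>
   ('j, 'i, ('k, 'o, 'm, 'a) condensed, 'k topology \<Rightarrow> 'o \<Rightarrow> 'a \<Rightarrow> 'a) cfunctor \<Rightarrow>
   ('k, 'o, 'm, 'a) condensed \<Rightarrow> ('j \<Rightarrow> 'k topology \<Rightarrow> 'o \<Rightarrow> 'a \<Rightarrow> 'a) \<Rightarrow> bool" where
  "is_pointwise_limit J \<kappa> B G L \<pi> \<longleftrightarrow>
     (\<forall>E\<in>Obj (Extr \<kappa>). \<forall>x\<in>Obj B. \<forall>z. (\<forall>j\<in>Obj J. z j \<in> Val (FObj (FObj G j) E) x) \<longrightarrow>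
        (\<forall>i\<in>Obj J. \<forall>j\<in>Obj J. \<forall>f\<in>Arr J i j. FArr G i j f E x (z i) = z j) \<longrightarrow>
        (\<exists>!l. l \<in> Val (FObj L E) x \<and> (\<forall>j\<in>Obj J. \<pi> j E x l = z j)))"

lemma Cmp_condensed:
  "Cmp (condensed_cat \<kappa> B) X Y Z \<beta> \<alpha> = (\<lambda>E\<in>Obj (Extr \<kappa>). \<lambda>x\<in>Obj B. \<lambda>a\<in>Val (FObj X E) x. \<beta> E x (\<alpha> E x a))"
  unfolding condensed_cat_def full_sub_simps functor_cat_simps op_cat_simps presheaf_cat_simps ..

lemma condensed_Cmp_eq_iff:
  assumes X: "X \<in> Obj (condensed_cat \<kappa> B)" and Y: "Y \<in> Obj (condensed_cat \<kappa> B)"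
    and \<gamma>: "\<gamma> \<in> Arr (condensed_cat \<kappa> B) X Y"
  shows "Cmp (condensed_cat \<kappa> B) X Z Y \<beta> \<alpha> = \<gamma> \<longleftrightarrow>
    (\<forall>E\<in>Obj (Extr \<kappa>). \<forall>x\<in>Obj B. \<forall>a\<in>Val (FObj X E) x. \<beta> E x (\<alpha> E x a) = \<gamma> E x a)"
proof
  assume l: "Cmp (condensed_cat \<kappa> B) X Z Y \<beta> \<alpha> = \<gamma>"
  show "\<forall>E\<in>Obj (Extr \<kappa>). \<forall>x\<in>Obj B. \<forall>a\<in>Val (FObj X E) x. \<beta> E x (\<alpha> E x a) = \<gamma> E x a"
    unfolding l[symmetric] Cmp_condensed by simp
next
  assume r: "\<forall>E\<in>Obj (Extr \<kappa>). \<forall>x\<in>Obj B. \<forall>a\<in>Val (FObj X E) x. \<beta> E x (\<alpha> E x a) = \<gamma> E x a"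
  note g = \<gamma>[unfolded condensed_Arr_iff[OF X Y]]
  show "Cmp (condensed_cat \<kappa> B) X Z Y \<beta> \<alpha> = \<gamma>" unfolding Cmp_condensed
  proof (rule extensionalityI[of _ "Obj (Extr \<kappa>)"])
    fix E assume E: "E \<in> Obj (Extr \<kappa>)"
    have h: "\<gamma> E \<in> presheaf_hom B (FObj X E) (FObj Y E)" using g E by blast
    have "(\<lambda>x\<in>Obj B. \<lambda>a\<in>Val (FObj X E) x. \<beta> E x (\<alpha> E x a)) = \<gamma> E"
    proof (rule extensionalityI[of _ "Obj B"])
      show "\<gamma> E \<in> extensional (Obj B)" using h unfolding presheaf_hom_def by (auto simp: PiE_iff)
      fix x assume x: "x \<in> Obj B"
      have "(\<lambda>a\<in>Val (FObj X E) x. \<beta> E x (\<alpha> E x a)) = \<gamma> E x"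
        by (rule extensionalityI[of _ "Val (FObj X E) x"]) (use presheaf_homD(2)[OF h x] r E x in simp_all)
      then show "(\<lambda>x\<in>Obj B. \<lambda>a\<in>Val (FObj X E) x. \<beta> E x (\<alpha> E x a)) x = \<gamma> E x" using x by simp
    qed simp
    then show "(\<lambda>E\<in>Obj (Extr \<kappa>). \<lambda>x\<in>Obj B. \<lambda>a\<in>Val (FObj X E) x. \<beta> E x (\<alpha> E x a)) E = \<gamma> E" using E by simp
  qed (use g in simp_all)
qed

lemma condensed_Arr_eqI:
  assumes X: "X \<in> Obj (condensed_cat \<kappa> B)" and Y: "Y \<in> Obj (condensed_cat \<kappa> B)"
    and \<eta>: "\<eta> \<in> Arr (condensed_cat \<kappa> B) X Y" and \<eta>': "\<eta>' \<in> Arr (condensed_cat \<kappa> B) X Y"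
    and eq: "\<And>E x a. E \<in> Obj (Extr \<kappa>) \<Longrightarrow> x \<in> Obj B \<Longrightarrow> a \<in> Val (FObj X E) x \<Longrightarrow> \<eta> E x a = \<eta>' E x a"
  shows "\<eta> = \<eta>'"
proof -
  have "Cmp (condensed_cat \<kappa> B) X X Y (\<lambda>E x a. a) \<eta>' = \<eta>"
    using eq by (subst condensed_Cmp_eq_iff[OF X Y \<eta>]) simp
  moreover have "Cmp (condensed_cat \<kappa> B) X X Y (\<lambda>E x a. a) \<eta>' = \<eta>'"
    by (subst condensed_Cmp_eq_iff[OF X Y \<eta>']) simp
  ultimately show ?thesis by simp
qed

lemma condensed_cone_iff:
  assumes G: "is_functor J (condensed_cat \<kappa> B) G"
  shows "is_cone J (condensed_cat \<kappa> B) G M \<mu> \<longleftrightarrow> M \<in> Obj (condensed_cat \<kappa> B) \<and> \<mu> \<in> extensional (Obj J) \<and>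
     (\<forall>j\<in>Obj J. \<mu> j \<in> Arr (condensed_cat \<kappa> B) M (FObj G j)) \<and>
     (\<forall>i\<in>Obj J. \<forall>j\<in>Obj J. \<forall>f\<in>Arr J i j. \<forall>E\<in>Obj (Extr \<kappa>). \<forall>x\<in>Obj B. \<forall>a\<in>Val (FObj M E) x.
        FArr G i j f E x (\<mu> i E x a) = \<mu> j E x a)"
proof -
  have "Cmp (condensed_cat \<kappa> B) M (FObj G i) (FObj G j) (FArr G i j f) (\<mu> i) = \<mu> j \<longleftrightarrow>
     (\<forall>E\<in>Obj (Extr \<kappa>). \<forall>x\<in>Obj B. \<forall>a\<in>Val (FObj M E) x. FArr G i j f E x (\<mu> i E x a) = \<mu> j E x a)"
    if "M \<in> Obj (condensed_cat \<kappa> B)" "j \<in> Obj J" "\<mu> j \<in> Arr (condensed_cat \<kappa> B) M (FObj G j)" for i j f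
    using condensed_Cmp_eq_iff[OF that(1) is_functorD(1)[OF G that(2)] that(3)] .
  then show ?thesis unfolding is_cone_def PiE_iff by auto
qed

text \<open>\<open>hom_lift\<close> gives the mediating map for each \<open>E\<close> separately. It
  is natural in \<open>E\<close> because an element of the limit is determined by its
  components.\<close>

lemma limit_of_pointwise_limit:
  assumes G: "is_functor J (condensed_cat \<kappa> B) G" and cone: "is_cone J (condensed_cat \<kappa> B) G L \<pi>"
    and pw: "is_pointwise_limit J \<kappa> B G L \<pi>"
  shows "is_limit_cone J (condensed_cat \<kappa> B) G L \<pi>"
  unfolding is_limit_cone_def
proof (intro conjI allI impI cone)
  let ?C = "condensed_cat \<kappa> B"
  note c = cone[unfolded condensed_cone_iff[OF G]]
  have L: "L \<in> Obj ?C" using c by blast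
  have \<pi>: "\<pi> j \<in> Arr ?C L (FObj G j)" "FObj G j \<in> Obj ?C" if "j \<in> Obj J" for j
    using c that is_functorD(1)[OF G] by blast+
  fix M \<mu> assume "is_cone J ?C G M \<mu>"
  note d = this[unfolded condensed_cone_iff[OF G]]
  have M: "M \<in> Obj ?C" using d by blast
  have \<mu>: "\<mu> j \<in> Arr ?C M (FObj G j)" if "j \<in> Obj J" for j using d that by blast
  have \<pi>h: "\<pi> j E \<in> presheaf_hom B (FObj L E) (FObj (FObj G j) E)"
    and \<mu>h: "\<mu> j E \<in> presheaf_hom B (FObj M E) (FObj (FObj G j) E)" if "j \<in> Obj J" "E \<in> Obj (Extr \<kappa>)" for j E
    using \<pi>(1)[OF that(1)] \<mu>[OF that(1)] that unfolding condensed_Arr_iff[OF L \<pi>(2)[OF that(1)]] condensed_Arr_iff[OF M \<pi>(2)[OF that(1)]]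
    by blast+
  have ex: "\<exists>!l. l \<in> Val (FObj L E) x \<and> (\<forall>j\<in>Obj J. \<pi> j E x l = \<mu> j E x a)"
    if E: "E \<in> Obj (Extr \<kappa>)" and x: "x \<in> Obj B" and a: "a \<in> Val (FObj M E) x" for E x a
  proof (rule pw[unfolded is_pointwise_limit_def, rule_format, OF E x])
    show "\<mu> j E x a \<in> Val (FObj (FObj G j) E) x" if "j \<in> Obj J" for j
      using presheaf_homD(1)[OF \<mu>h[OF that E] x a] .
    show "FArr G i j f E x (\<mu> i E x a) = \<mu> j E x a" if "i \<in> Obj J" "j \<in> Obj J" "f \<in> Arr J i j" for i j f
      using d that E x a by blast
  qed
  have lift: "\<exists>!\<eta>. \<eta> \<in> presheaf_hom B (FObj M E) (FObj L E) \<and> (\<forall>j\<in>Obj J. \<forall>x\<in>Obj B. \<forall>a\<in>Val (FObj M E) x. \<pi> j E x (\<eta> x a) = \<mu> j E x a)"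
    if E: "E \<in> Obj (Extr \<kappa>)" for E
    by (rule hom_lift[where r = "\<lambda>j. \<pi> j E" and \<theta> = "\<lambda>j. \<mu> j E", OF condensed_ObjD(1)[OF L E E] is_presheafD(1)[OF condensed_ObjD(1)[OF M E E]] \<pi>h[OF _ E] \<mu>h[OF _ E] ex[OF E]])
  define h where "h = (\<lambda>E\<in>Obj (Extr \<kappa>). THE \<eta>. \<eta> \<in> presheaf_hom B (FObj M E) (FObj L E) \<and>
     (\<forall>j\<in>Obj J. \<forall>x\<in>Obj B. \<forall>a\<in>Val (FObj M E) x. \<pi> j E x (\<eta> x a) = \<mu> j E x a))"
  have h1: "h E \<in> presheaf_hom B (FObj M E) (FObj L E)"
    and h2: "j \<in> Obj J \<Longrightarrow> x \<in> Obj B \<Longrightarrow> a \<in> Val (FObj M E) x \<Longrightarrow> \<pi> j E x (h E x a) = \<mu> j E x a"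
    if E: "E \<in> Obj (Extr \<kappa>)" for E j x a
    using theI'[OF lift[OF E]] E unfolding h_def by simp_all
  have hA: "h \<in> Arr ?C M L" unfolding condensed_Arr_iff[OF M L]
  proof (intro conjI ballI)
    show "h \<in> extensional (Obj (Extr \<kappa>))" unfolding h_def by simp
    show "h E \<in> presheaf_hom B (FObj M E) (FObj L E)" if "E \<in> Obj (Extr \<kappa>)" for E by (rule h1[OF that])
    fix E F f x a assume E: "E \<in> Obj (Extr \<kappa>)" and F: "F \<in> Obj (Extr \<kappa>)" and f: "f \<in> Arr (Extr \<kappa>) F E"
      and x: "x \<in> Obj B" and a: "a \<in> Val (FObj M E) x"
    have a': "FArr M E F f x a \<in> Val (FObj M F) x" using presheaf_homD(1)[OF condensed_ObjD(2)[OF M E F f] x a] .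
    have l: "h E x a \<in> Val (FObj L E) x" using presheaf_homD(1)[OF h1[OF E] x a] .
    have l': "FArr L E F f x (h E x a) \<in> Val (FObj L F) x" using presheaf_homD(1)[OF condensed_ObjD(2)[OF L E F f] x l] .
    have "\<pi> j F x (FArr L E F f x (h E x a)) = \<mu> j F x (FArr M E F f x a)" if j: "j \<in> Obj J" for j
    proof -
      have "\<pi> j F x (FArr L E F f x (h E x a)) = FArr (FObj G j) E F f x (\<pi> j E x (h E x a))"
        using \<pi>(1)[OF j] E F f x l unfolding condensed_Arr_iff[OF L \<pi>(2)[OF j]] by blast
      also have "\<dots> = FArr (FObj G j) E F f x (\<mu> j E x a)" using h2[OF E j x a] by simp
      also have "\<dots> = \<mu> j F x (FArr M E F f x a)"
        using \<mu>[OF j] E F f x a unfolding condensed_Arr_iff[OF M \<pi>(2)[OF j]] by simp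
      finally show ?thesis .
    qed
    moreover have "h F x (FArr M E F f x a) \<in> Val (FObj L F) x" using presheaf_homD(1)[OF h1[OF F] x a'] .
    ultimately show "h F x (FArr M E F f x a) = FArr L E F f x (h E x a)"
      using ex[OF F x a'] h2[OF F _ x a'] l' by blast
  qed
  show "\<exists>!h. h \<in> Arr ?C M L \<and> (\<forall>j\<in>Obj J. Cmp ?C M L (FObj G j) (\<pi> j) h = \<mu> j)"
  proof (rule ex1I[of _ h])
    show "h \<in> Arr ?C M L \<and> (\<forall>j\<in>Obj J. Cmp ?C M L (FObj G j) (\<pi> j) h = \<mu> j)"
    proof (intro conjI ballI hA)
      show "Cmp ?C M L (FObj G j) (\<pi> j) h = \<mu> j" if j: "j \<in> Obj J" for j
        unfolding condensed_Cmp_eq_iff[OF M \<pi>(2)[OF j] \<mu>[OF j]] using h2 j by simp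
    qed
    fix h' assume *: "h' \<in> Arr ?C M L \<and> (\<forall>j\<in>Obj J. Cmp ?C M L (FObj G j) (\<pi> j) h' = \<mu> j)"
    show "h' = h"
    proof (rule condensed_Arr_eqI[OF M L _ hA])
      show "h' \<in> Arr ?C M L" using * by blast
      fix E x a assume E: "E \<in> Obj (Extr \<kappa>)" and x: "x \<in> Obj B" and a: "a \<in> Val (FObj M E) x"
      have "\<pi> j E x (h' E x a) = \<mu> j E x a" if j: "j \<in> Obj J" for j
        using *[THEN conjunct2, rule_format, OF j] E x a unfolding condensed_Cmp_eq_iff[OF M \<pi>(2)[OF j] \<mu>[OF j]] by simp
      moreover have "h' E \<in> presheaf_hom B (FObj M E) (FObj L E)" using * E unfolding condensed_Arr_iff[OF M L] by blast
      then have "h' E x a \<in> Val (FObj L E) x" by (rule presheaf_homD(1)[OF _ x a])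
      moreover have "h E x a \<in> Val (FObj L E) x" using presheaf_homD(1)[OF h1[OF E] x a] .
      ultimately show "h' E x a = h E x a" using ex[OF E x a] h2[OF E _ x a] by blast
    qed
  qed
qed

section \<open>The functor on condensed cubesets: values, faithfulness, pointwise limits\<close>

lemma condensed_Kstar_simps:
  "FObj (FObj (condensed_Kstar \<kappa>) X) E = FObj Kstar (FObj X E)"
  "FArr (FObj (condensed_Kstar \<kappa>) X) E F f = FArr Kstar (FObj X E) (FObj X F) (FArr X E F f)"
  "FArr (condensed_Kstar \<kappa>) X Y \<eta> = (\<lambda>E\<in>Obj (Extr \<kappa>). FArr Kstar (FObj X E) (FObj Y E) (\<eta> E))"
  unfolding condensed_Kstar_def postcompose_simps comp_functor_simps op_cat_simps by simp_all

lemma Kstar_hom_restrict_iff: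
  assumes "\<eta> \<in> presheaf_hom Box (K n) X" "\<mu> \<in> presheaf_hom Box (K n) Y"
  shows "FArr Kstar X Y r n \<eta> = \<mu> \<longleftrightarrow> (\<forall>p. \<forall>a\<in>Val (K n) p. r p (\<eta> p a) = \<mu> p a)"
proof
  assume l: "FArr Kstar X Y r n \<eta> = \<mu>"
  show "\<forall>p. \<forall>a\<in>Val (K n) p. r p (\<eta> p a) = \<mu> p a" unfolding l[symmetric] Kstar_FArr using assms(1) by simp
next
  assume r: "\<forall>p. \<forall>a\<in>Val (K n) p. r p (\<eta> p a) = \<mu> p a"
  have "(\<lambda>p. \<lambda>a\<in>Val (K n) p. r p (\<eta> p a)) = (\<lambda>p. \<lambda>a\<in>Val (K n) p. \<mu> p a)"
    using r by (intro ext restrict_ext[THEN fun_cong]) simp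
  then show "FArr Kstar X Y r n \<eta> = \<mu>" unfolding Kstar_FArr using assms(1) hom_restrict[OF assms(2)] by simp
qed

text \<open>Maps out of \<open>K n\<close> lift wherever elements lift uniquely. This serves twice:
  for the product condition on disjoint unions and for limits.\<close>

lemma Kstar_lift:
  assumes L: "is_presheaf Box L" and r: "\<And>j. j \<in> I \<Longrightarrow> r j \<in> presheaf_hom Box L (G j)"
    and z: "\<And>j. j \<in> I \<Longrightarrow> z j \<in> presheaf_hom Box (K n) (G j)"
    and ex: "\<And>p a. a \<in> Val (K n) p \<Longrightarrow> \<exists>!l. l \<in> Val L p \<and> (\<forall>j\<in>I. r j p l = z j p a)"
  shows "\<exists>!\<eta>. \<eta> \<in> presheaf_hom Box (K n) L \<and> (\<forall>j\<in>I. FArr Kstar L (G j) (r j) n \<eta> = z j)"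
proof -
  have "\<exists>!\<eta>. \<eta> \<in> presheaf_hom Box (K n) L \<and> (\<forall>j\<in>I. \<forall>p\<in>Obj Box. \<forall>a\<in>Val (K n) p. r j p (\<eta> p a) = z j p a)"
    by (rule hom_lift[where r = r, OF L K_Act r z ex])
  moreover have "(\<eta> \<in> presheaf_hom Box (K n) L \<and> (\<forall>j\<in>I. \<forall>p\<in>Obj Box. \<forall>a\<in>Val (K n) p. r j p (\<eta> p a) = z j p a)) \<longleftrightarrow>
    \<eta> \<in> presheaf_hom Box (K n) L \<and> (\<forall>j\<in>I. FArr Kstar L (G j) (r j) n \<eta> = z j)" for \<eta>
    using Kstar_hom_restrict_iff[OF _ z] by (auto simp: Ball_def)
  ultimately show ?thesis by simp
qed

lemma condensed_Kstar_Obj: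
  assumes X: "X \<in> Obj (cubespaces \<kappa>)"
  shows "FObj (condensed_Kstar \<kappa>) X \<in> Obj (condensed_simplicial_sets \<kappa>)"
  unfolding condensed_Obj_iff
proof
  show "is_functor (op_cat (Extr \<kappa>)) (presheaf_cat Simplex) (FObj (condensed_Kstar \<kappa>) X)"
    unfolding condensed_Kstar_def postcompose_simps
    by (rule is_functor_comp[OF _ Kstar_functor]) (use X in \<open>simp add: condensed_Obj_iff\<close>)
  show "disjoint_unions_to_products \<kappa> Simplex (FObj (condensed_Kstar \<kappa>) X)"
  proof (rule disjoint_unions_to_productsI, unfold condensed_Kstar_simps)
    show "FArr Kstar (FObj X E) (FObj X F) (FArr X E F f) n \<theta> \<in> Val (FObj Kstar (FObj X F)) n"
      if "E \<in> Obj (Extr \<kappa>)" "F \<in> Obj (Extr \<kappa>)" "f \<in> Arr (Extr \<kappa>) F E" "n \<in> Obj Simplex" "\<theta> \<in> Val (FObj Kstar (FObj X E)) n" for E F f n \<theta>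
      by (rule presheaf_homD(1)[OF Kstar_FArr_hom[OF condensed_ObjD(2)[OF X that(1-3)]] that(4,5)])
    fix I :: "nat set" and Es E \<iota> n z
    assume I: "finite I" and E: "E \<in> Obj (Extr \<kappa>)"
      and Es: "\<And>i. i \<in> I \<Longrightarrow> Es i \<in> Obj (Extr \<kappa>)" "\<And>i. i \<in> I \<Longrightarrow> \<iota> i \<in> Arr (Extr \<kappa>) (Es i) E"
      and h: "homeomorphic_map (sum_topology Es I) E (\<lambda>(i, e). \<iota> i e)"
      and z: "\<And>i. i \<in> I \<Longrightarrow> z i \<in> Val (FObj Kstar (FObj X (Es i))) n"
    have zh: "z i \<in> presheaf_hom Box (K n) (FObj X (Es i))" if "i \<in> I" for i using z[OF that] unfolding Val_Kstar .
    have ex: "\<exists>!l. l \<in> Val (FObj X E) p \<and> (\<forall>i\<in>I. FArr X E (Es i) (\<iota> i) p l = z i p a)" if "a \<in> Val (K n) p" for p a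
      by (rule condensed_sheaf[OF X I E Es h Obj_Box presheaf_homD(1)[OF zh Obj_Box that]])
    show "\<exists>!\<eta>. \<eta> \<in> Val (FObj Kstar (FObj X E)) n \<and>
        (\<forall>i\<in>I. FArr Kstar (FObj X E) (FObj X (Es i)) (FArr X E (Es i) (\<iota> i)) n \<eta> = z i)"
      unfolding Val_Kstar
      by (rule Kstar_lift[where r = "\<lambda>i. FArr X E (Es i) (\<iota> i)" and G = "\<lambda>i. FObj X (Es i)" and z = z,
          OF condensed_ObjD(1)[OF X E E] condensed_ObjD(2)[OF X E Es] zh ex])
  qed
qed

lemma condensed_Kstar_functor:
  "is_functor (cubespaces \<kappa>) (condensed_simplicial_sets \<kappa>) (condensed_Kstar \<kappa> :: ('k, 'a, 'a K_map) realization)"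
proof (rule is_functorI)
  let ?C = "functor_cat (op_cat (Extr \<kappa>)) (presheaf_cat Box) :: (('k, 'a) cubespace, _) category"
  let ?D = "functor_cat (op_cat (Extr \<kappa>)) (presheaf_cat Simplex) :: (('k, 'a K_map) condensed_simplicial_set, _) category"
  let ?K = "condensed_Kstar \<kappa> :: ('k, 'a, 'a K_map) realization"
  have F: "is_functor ?C ?D ?K"
    unfolding condensed_Kstar_def by (rule is_functor_postcompose[OF Kstar_functor])
  have o: "X \<in> Obj ?C" if "X \<in> Obj (cubespaces \<kappa>)" for X
    using that unfolding condensed_cat_def full_sub_simps by blast
  show "FObj ?K X \<in> Obj (condensed_simplicial_sets \<kappa>)" if "X \<in> Obj (cubespaces \<kappa>)" for X
    by (rule condensed_Kstar_Obj[OF that])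
  show "FArr ?K X X (Idn (cubespaces \<kappa>) X) = Idn (condensed_simplicial_sets \<kappa>) (FObj ?K X)" if "X \<in> Obj (cubespaces \<kappa>)" for X
    using is_functorD(3)[OF F o[OF that]] unfolding condensed_cat_def full_sub_simps .
  fix X Y Z :: "('k, 'a) cubespace" and f g assume XY: "X \<in> Obj (cubespaces \<kappa>)" "Y \<in> Obj (cubespaces \<kappa>)" and f: "f \<in> Arr (cubespaces \<kappa>) X Y"
  have f': "f \<in> Arr ?C X Y" using f unfolding condensed_cat_def full_sub_simps .
  show "FArr ?K X Y f \<in> Arr (condensed_simplicial_sets \<kappa>) (FObj ?K X) (FObj ?K Y)"
    using is_functorD(2)[OF F o[OF XY(1)] o[OF XY(2)] f'] unfolding condensed_cat_def full_sub_simps .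
  assume Z: "Z \<in> Obj (cubespaces \<kappa>)" and g: "g \<in> Arr (cubespaces \<kappa>) Y Z"
  have g': "g \<in> Arr ?C Y Z" using g unfolding condensed_cat_def full_sub_simps .
  show "FArr ?K X Z (Cmp (cubespaces \<kappa>) X Y Z g f) =
      Cmp (condensed_simplicial_sets \<kappa>) (FObj ?K X) (FObj ?K Y) (FObj ?K Z) (FArr ?K Y Z g) (FArr ?K X Y f)"
    using is_functorD(4)[OF F o[OF XY(1)] o[OF XY(2)] o[OF Z] f' g'] unfolding condensed_cat_def full_sub_simps .
qed

text \<open>Points of \<open>X\<close> give 0-simplices of its image, so morphisms with the same
  image agree on points, and concreteness of the target then forces them to agree on all
  cubes.\<close>

lemma condensed_Kstar_faithful:
  "is_faithful (full_sub (cubespaces \<kappa>) (concrete \<kappa>)) (condensed_Kstar \<kappa> :: ('k, 'a, 'a K_map) realization)"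
  unfolding is_faithful_def full_sub_simps
proof (intro ballI inj_onI)
  fix X Y :: "('k, 'a) cubespace" and \<eta> \<eta>'
  assume "X \<in> {X \<in> Obj (cubespaces \<kappa>). concrete \<kappa> X}" "Y \<in> {X \<in> Obj (cubespaces \<kappa>). concrete \<kappa> X}"
    and \<eta>: "\<eta> \<in> Arr (cubespaces \<kappa>) X Y" and \<eta>': "\<eta>' \<in> Arr (cubespaces \<kappa>) X Y"
    and eq: "FArr (condensed_Kstar \<kappa>) X Y \<eta> = FArr (condensed_Kstar \<kappa>) X Y \<eta>'"
  then have X: "X \<in> Obj (cubespaces \<kappa>)" and Y: "Y \<in> Obj (cubespaces \<kappa>)" and conc: "concrete \<kappa> Y" by auto
  show "\<eta> = \<eta>'"
  proof (rule condensed_Arr_eqI[OF X Y \<eta> \<eta>'])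
    fix E p c assume E: "E \<in> Obj (Extr \<kappa>)" and c: "c \<in> Val (FObj X E) p"
    have h: "\<eta> E \<in> presheaf_hom Box (FObj X E) (FObj Y E)" "\<eta>' E \<in> presheaf_hom Box (FObj X E) (FObj Y E)"
      using \<eta> \<eta>' E unfolding condensed_Arr_iff[OF X Y] by blast+
    interpret X: presheaf_on_Box "FObj X E" by unfold_locales (rule condensed_ObjD(1)[OF X E E])
    interpret Y: presheaf_on_Box "FObj Y E" by unfold_locales (rule condensed_ObjD(1)[OF Y E E])
    have vert: "vertex (FObj Y E) p (\<epsilon> p c) v = \<epsilon> 0 (vertex (FObj X E) p c v)"
      if "\<epsilon> \<in> presheaf_hom Box (FObj X E) (FObj Y E)" "v \<in> cube p" for \<epsilon> v
      unfolding vertex_def using presheaf_homD(3)[OF that(1) _ _ const_Arr_Box[OF that(2)] c] by simp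
    have pts: "\<eta> E 0 y = \<eta>' E 0 y" if y: "y \<in> Val (FObj X E) 0" for y
    proof -
      let ?\<theta> = "Kstar_point (FObj X E) y"
      have u: "(\<lambda>_. undefined) \<in> cube 0" by (simp add: cube_0)
      have t: "?\<theta> \<in> presheaf_hom Box (K 0) (FObj X E)" by (rule X.Kstar_point_hom[OF y])
      have k: "(\<lambda>_\<in>cube 0. {0}) \<in> Val (K 0) 0" by (rule K_Val_const) (simp add: Sub_def)
      have v: "?\<theta> 0 (\<lambda>_\<in>cube 0. {0}) = y" using X.kval_point[OF y] unfolding kval_def .
      have "FArr (condensed_Kstar \<kappa>) X Y \<epsilon> E 0 ?\<theta> 0 (\<lambda>_\<in>cube 0. {0}) = \<epsilon> E 0 y" for \<epsilon>
        unfolding condensed_Kstar_simps Kstar_FArr using E t k v by simp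
      then show ?thesis using eq by metis
    qed
    show "\<eta> E p c = \<eta>' E p c"
    proof (rule concrete_eqI)
      show "concrete_cubeset (FObj Y E)" using conc E unfolding concrete_def by blast
      show "\<eta> E p c \<in> Val (FObj Y E) p" "\<eta>' E p c \<in> Val (FObj Y E) p"
        using presheaf_homD(1)[OF h(1) _ c] presheaf_homD(1)[OF h(2) _ c] by simp_all
      show "vertex (FObj Y E) p (\<eta> E p c) v = vertex (FObj Y E) p (\<eta>' E p c) v" if v: "v \<in> cube p" for v
        using vert[OF h(1) v] vert[OF h(2) v] pts vertex_in_Val[OF X.presheaf c v] by simp
    qed
  qed
qed

lemma cone_image:
  assumes F: "is_functor C D F" and G: "is_functor J C G" and cone: "is_cone J C G L \<pi>"
  shows "is_cone J D (comp_functor F G) (FObj F L) (\<lambda>j\<in>Obj J. FArr F L (FObj G j) (\<pi> j))"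
proof -
  have L: "L \<in> Obj C" and \<pi>: "\<And>j. j \<in> Obj J \<Longrightarrow> \<pi> j \<in> Arr C L (FObj G j)"
    and eq: "\<And>i j f. i \<in> Obj J \<Longrightarrow> j \<in> Obj J \<Longrightarrow> f \<in> Arr J i j \<Longrightarrow> Cmp C L (FObj G i) (FObj G j) (FArr G i j f) (\<pi> i) = \<pi> j"
    using cone unfolding is_cone_def PiE_iff by auto
  note o = is_functorD(1)[OF G]
  have "Cmp D (FObj F L) (FObj F (FObj G i)) (FObj F (FObj G j)) (FArr F (FObj G i) (FObj G j) (FArr G i j f)) (FArr F L (FObj G i) (\<pi> i)) =
     FArr F L (FObj G j) (\<pi> j)" if "i \<in> Obj J" "j \<in> Obj J" "f \<in> Arr J i j" for i j f
    using is_functorD(4)[OF F L o[OF that(1)] o[OF that(2)] \<pi>[OF that(1)] is_functorD(2)[OF G that]] eq[OF that] by simp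
  then show ?thesis
    unfolding is_cone_def comp_functor_simps
    using is_functorD(1)[OF F L] is_functorD(2)[OF F L o \<pi>] by simp
qed

text \<open>A compatible family of maps out of \<open>K n\<close> is a compatible family of cubes at
  each cube of \<open>K n\<close>.\<close>

lemma limit_Kstar_of_pointwise_limit:
  fixes G :: "('j, 'i, ('k, 'a) cubespace, 'k topology \<Rightarrow> nat \<Rightarrow> 'a \<Rightarrow> 'a) cfunctor"
  assumes G: "is_functor J (cubespaces \<kappa>) G" and cone: "is_cone J (cubespaces \<kappa>) G L \<pi>"
    and pw: "is_pointwise_limit J \<kappa> Box G L \<pi>"
  shows "is_limit_cone J (condensed_simplicial_sets \<kappa>) (comp_functor (condensed_Kstar \<kappa>) G)
    (FObj (condensed_Kstar \<kappa>) L) (\<lambda>j\<in>Obj J. FArr (condensed_Kstar \<kappa>) L (FObj G j) (\<pi> j))"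
proof (rule limit_of_pointwise_limit)
  show "is_functor J (condensed_simplicial_sets \<kappa>) (comp_functor (condensed_Kstar \<kappa>) G)"
    by (rule is_functor_comp[OF G condensed_Kstar_functor])
  show "is_cone J (condensed_simplicial_sets \<kappa>) (comp_functor (condensed_Kstar \<kappa>) G)
    (FObj (condensed_Kstar \<kappa>) L) (\<lambda>j\<in>Obj J. FArr (condensed_Kstar \<kappa>) L (FObj G j) (\<pi> j))"
    by (rule cone_image[OF condensed_Kstar_functor G cone])
  note c = cone[unfolded condensed_cone_iff[OF G]]
  have L: "L \<in> Obj (cubespaces \<kappa>)" using c by blast
  show "is_pointwise_limit J \<kappa> Simplex (comp_functor (condensed_Kstar \<kappa>) G) (FObj (condensed_Kstar \<kappa>) L)
     (\<lambda>j\<in>Obj J. FArr (condensed_Kstar \<kappa>) L (FObj G j) (\<pi> j))"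
    unfolding is_pointwise_limit_def
  proof (intro ballI allI impI)
    fix E n z assume E: "E \<in> Obj (Extr \<kappa>)"
      and z0: "\<forall>j\<in>Obj J. z j \<in> Val (FObj (FObj (comp_functor (condensed_Kstar \<kappa>) G) j) E) n"
      and z1: "\<forall>i\<in>Obj J. \<forall>j\<in>Obj J. \<forall>f\<in>Arr J i j. FArr (comp_functor (condensed_Kstar \<kappa>) G) i j f E n (z i) = z j"
    have z: "z j \<in> presheaf_hom Box (K n) (FObj (FObj G j) E)" if "j \<in> Obj J" for j
      using z0 that unfolding comp_functor_simps condensed_Kstar_simps Val_Kstar by blast
    have zc: "FArr G i j f E p (z i p a) = z j p a"
      if "i \<in> Obj J" "j \<in> Obj J" "f \<in> Arr J i j" "a \<in> Val (K n) p" for i j f p a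
    proof -
      have "FArr Kstar (FObj (FObj G i) E) (FObj (FObj G j) E) (FArr G i j f E) n (z i) = z j"
        using z1 that(1-3) E unfolding comp_functor_simps condensed_Kstar_simps by simp
      then show ?thesis using that(4) unfolding Kstar_hom_restrict_iff[OF z[OF that(1)] z[OF that(2)]] by blast
    qed
    have \<pi>: "\<pi> j E \<in> presheaf_hom Box (FObj L E) (FObj (FObj G j) E)" if j: "j \<in> Obj J" for j
      using c that E condensed_Arr_iff[OF L is_functorD(1)[OF G j]] by blast
    have ex: "\<exists>!l. l \<in> Val (FObj L E) p \<and> (\<forall>j\<in>Obj J. \<pi> j E p l = z j p a)" if a: "a \<in> Val (K n) p" for p a
    proof (rule pw[unfolded is_pointwise_limit_def, rule_format, OF E])
      show "z j p a \<in> Val (FObj (FObj G j) E) p" if "j \<in> Obj J" for j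
        by (rule presheaf_homD(1)[OF z[OF that] _ a]) simp
      show "FArr G i j f E p (z i p a) = z j p a" if "i \<in> Obj J" "j \<in> Obj J" "f \<in> Arr J i j" for i j f
        by (rule zc[OF that a])
    qed simp
    have "\<exists>!\<eta>. \<eta> \<in> presheaf_hom Box (K n) (FObj L E) \<and>
      (\<forall>j\<in>Obj J. FArr Kstar (FObj L E) (FObj (FObj G j) E) (\<pi> j E) n \<eta> = z j)"
      by (rule Kstar_lift[where r = "\<lambda>j. \<pi> j E", OF condensed_ObjD(1)[OF L E E] \<pi> z ex])
    then show "\<exists>!\<eta>. \<eta> \<in> Val (FObj (FObj (condensed_Kstar \<kappa>) L) E) n \<and>
      (\<forall>j\<in>Obj J. (\<lambda>j\<in>Obj J. FArr (condensed_Kstar \<kappa>) L (FObj G j) (\<pi> j)) j E n \<eta> = z j)"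
      unfolding condensed_Kstar_simps Val_Kstar using E by simp
  qed
qed

section \<open>Encoding test objects in the universe of values\<close>

lemma card_Times_less:
  assumes \<kappa>: "natLeq <o \<kappa>" and A: "|A| <o \<kappa>" and B: "|B| <o \<kappa>"
  shows "|A \<times> B| <o \<kappa>"
proof (cases "finite A \<and> finite B")
  case True
  then have "|A \<times> B| <o natLeq" using finite_iff_ordLess_natLeq by blast
  then show ?thesis using \<kappa> ordLess_transitive by blast
next
  case False
  consider "|A| \<le>o |B|" | "|B| \<le>o |A|" using ordLeq_total[OF card_of_Well_order card_of_Well_order] by blast
  then show ?thesis
  proof cases
    case 1
    then have "infinite B" using False card_of_ordLeq_finite by blast
    then have "|A \<times> B| \<le>o |B|"
      by (intro card_of_Times_ordLeq_infinite_Field[OF _ 1 ordLeq_reflexive[OF card_of_Well_order] card_of_Card_order]) (simp add: Field_card_of)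
    then show ?thesis using B ordLeq_ordLess_trans by blast
  next
    case 2
    then have "infinite A" using False card_of_ordLeq_finite by blast
    then have "|A \<times> B| \<le>o |A|"
      by (intro card_of_Times_ordLeq_infinite_Field[OF _ ordLeq_reflexive[OF card_of_Well_order] 2 card_of_Card_order]) (simp add: Field_card_of)
    then show ?thesis using A ordLeq_ordLess_trans by blast
  qed
qed

text \<open>A function is coded by its graph, a subset of \<open>A \<times> B\<close>. The strong
  limit property speaks of subsets of \<open>'k\<close>, so the product is first injected there; the
  power set of its image is still below \<open>\<kappa>\<close> and fits into
  \<open>'a\<close>.\<close>

lemma function_encoding:
  fixes \<kappa> :: "'k rel" and A :: "'x set" and B :: "'y set"
  assumes \<kappa>: "uncountable_strong_limit \<kappa>" "\<kappa> \<le>o |UNIV :: 'a set|" and A: "|A| <o \<kappa>" and B: "|B| <o \<kappa>"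
  shows "\<exists>e :: ('x \<Rightarrow> 'y) \<Rightarrow> 'a. inj_on e (A \<rightarrow>\<^sub>E B)"
proof -
  have k: "Card_order \<kappa>" "natLeq <o \<kappa>" and lim: "\<And>A :: 'k set. |A| <o \<kappa> \<Longrightarrow> |Pow A| <o \<kappa>"
    using \<kappa>(1) unfolding uncountable_strong_limit_def by blast+
  have AB: "|A \<times> B| <o \<kappa>" by (rule card_Times_less[OF k(2) A B])
  moreover have "\<kappa> \<le>o |Field \<kappa>|" using k(1) Card_order_iff_ordLeq_card_of by blast
  ultimately have "|A \<times> B| \<le>o |Field \<kappa>|" using ordLess_imp_ordLeq ordLeq_transitive by blast
  then have "\<exists>g. inj_on g (A \<times> B) \<and> g ` (A \<times> B) \<subseteq> Field \<kappa>" by (rule iffD2[OF card_of_ordLeq])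
  then obtain g :: "'x \<times> 'y \<Rightarrow> 'k" where g: "inj_on g (A \<times> B)" by (elim exE conjE) (rule that)
  have "|g ` (A \<times> B)| <o \<kappa>" using card_of_image AB ordLeq_ordLess_trans by blast
  then have "|Pow (g ` (A \<times> B))| <o \<kappa>" by (rule lim)
  then have "|Pow (g ` (A \<times> B))| \<le>o |UNIV :: 'a set|" using \<kappa>(2) ordLess_imp_ordLeq ordLeq_transitive by blast
  then have "\<exists>q. inj_on q (Pow (g ` (A \<times> B))) \<and> q ` Pow (g ` (A \<times> B)) \<subseteq> (UNIV :: 'a set)"
    by (rule iffD2[OF card_of_ordLeq])
  then obtain q :: "'k set \<Rightarrow> 'a" where q: "inj_on q (Pow (g ` (A \<times> B)))" by (elim exE conjE) (rule that)
  let ?gr = "\<lambda>h. (\<lambda>x. (x, h x)) ` A"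
  have "inj_on (\<lambda>h. q (g ` ?gr h)) (A \<rightarrow>\<^sub>E B)"
  proof (rule inj_onI)
    fix h h' assume h: "h \<in> A \<rightarrow>\<^sub>E B" "h' \<in> A \<rightarrow>\<^sub>E B" and eq: "q (g ` ?gr h) = q (g ` ?gr h')"
    have sub: "?gr h \<subseteq> A \<times> B" "?gr h' \<subseteq> A \<times> B" using h by (auto simp: PiE_iff)
    have "g ` ?gr h = g ` ?gr h'" by (rule inj_onD[OF q eq]) (use sub in blast)+
    then have gr: "?gr h = ?gr h'" using inj_on_image_eq_iff[OF g sub] by blast
    show "h = h'"
    proof (rule PiE_ext[OF h])
      fix x assume "x \<in> A"
      then have "(x, h x) \<in> ?gr h'" using gr by blast
      then show "h x = h' x" by blast
    qed
  qed
  then show ?thesis by blast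
qed

section \<open>Decomposing a space into clopen fibres\<close>

definition fibre :: "'k topology \<Rightarrow> ('k \<Rightarrow> 'c) \<Rightarrow> 'c \<Rightarrow> 'k topology" where
  "fibre F s a = subtopology F {x \<in> topspace F. s x = a}"

definition fibre_incl :: "'k topology \<Rightarrow> ('k \<Rightarrow> 'c) \<Rightarrow> 'c \<Rightarrow> 'k \<Rightarrow> 'k" where
  "fibre_incl F s a = (\<lambda>x\<in>topspace (fibre F s a). x)"

lemma topspace_fibre [simp]: "topspace (fibre F s a) = {x \<in> topspace F. s x = a}"
  unfolding fibre_def by auto

lemma clopen_fibre:
  assumes "continuous_map F (discrete_topology A) s"
  shows "openin F {x \<in> topspace F. s x = a}" "closedin F {x \<in> topspace F. s x = a}"
proof -
  have eq: "{x \<in> topspace F. s x = a} = {x \<in> topspace F. s x \<in> A \<inter> {a}}"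
    using continuous_map_funspace[OF assms] by auto
  show "openin F {x \<in> topspace F. s x = a}" unfolding eq
    by (rule openin_continuous_map_preimage[OF assms]) simp
  show "closedin F {x \<in> topspace F. s x = a}" unfolding eq
    by (rule closedin_continuous_map_preimage[OF assms]) simp
qed

text \<open>The fibre is open, so open sets and their closures are inherited from \<open>F\<close>,
  and it is closed, so compactness is inherited too.\<close>

lemma fibre_Extr:
  assumes F: "F \<in> Obj (Extr \<kappa>)" and s: "continuous_map F (discrete_topology A) s"
  shows "fibre F s a \<in> Obj (Extr \<kappa>)" "fibre_incl F s a \<in> Arr (Extr \<kappa>) (fibre F s a) F"
proof -
  let ?S = "{x \<in> topspace F. s x = a}"
  note clopen = clopen_fibre[OF s, of a]
  have "openin (fibre F s a) (fibre F s a closure_of U)" if "openin (fibre F s a) U" for U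
  proof -
    have U: "openin F U" using that openin_open_subtopology[OF clopen(1)] unfolding fibre_def by blast
    have "openin F (F closure_of U)" using U F unfolding Extr_Obj_iff extremally_disconnected_def by blast
    then show ?thesis
      unfolding fibre_def openin_open_subtopology[OF clopen(1)] closure_of_subtopology_open[OF disjI1[OF clopen(1)]]
      using clopen(1) by blast
  qed
  moreover have "|?S| \<le>o |topspace F|" by (rule card_of_mono1) blast
  then have "|?S| <o \<kappa>" using F ordLeq_ordLess_trans unfolding Extr_Obj_iff by blast
  moreover have "compact_space (fibre F s a)" unfolding fibre_def
    using F closedin_compact_space[OF _ clopen(2)] compact_space_subtopology unfolding Extr_Obj_iff by blast
  moreover have "Hausdorff_space (fibre F s a)" unfolding fibre_def
    using F Hausdorff_space_subtopology unfolding Extr_Obj_iff by blast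
  ultimately show "fibre F s a \<in> Obj (Extr \<kappa>)" unfolding Extr_Obj_iff extremally_disconnected_def by simp
  have "continuous_map (fibre F s a) F (\<lambda>x. x)" unfolding fibre_def by (simp add: continuous_map_from_subtopology)
  then have "continuous_map (fibre F s a) F (fibre_incl F s a)"
    by (rule continuous_map_eq) (simp add: fibre_incl_def)
  then show "fibre_incl F s a \<in> Arr (Extr \<kappa>) (fibre F s a) F"
    unfolding Extr_Arr_iff by (auto simp: fibre_incl_def)
qed

lemma fibre_factor:
  assumes k: "k \<in> Arr (Extr \<kappa>) H F" and a: "\<And>t. t \<in> topspace H \<Longrightarrow> s (k t) = a"
  shows "k \<in> Arr (Extr \<kappa>) H (fibre F s a)" "compose (topspace H) (fibre_incl F s a) k = k"
proof -
  have t: "k t \<in> topspace (fibre F s a)" if "t \<in> topspace H" for t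
    using k a that unfolding Extr_Arr_iff by auto
  then show "k \<in> Arr (Extr \<kappa>) H (fibre F s a)"
    using k unfolding Extr_Arr_iff fibre_def continuous_map_in_subtopology by auto
  show "compose (topspace H) (fibre_incl F s a) k = k"
    by (rule extensionalityI[of _ "topspace H"]) (use k t in \<open>auto simp: Extr_Arr_iff compose_def fibre_incl_def PiE_iff\<close>)
qed

lemma fibres_homeomorphic_map:
  assumes s: "continuous_map F (discrete_topology A) s" and b: "bij_betw b I A"
  shows "homeomorphic_map (sum_topology (\<lambda>i. fibre F s (b i)) I) F (\<lambda>(i, e). fibre_incl F s (b i) e)"
proof (rule bijective_open_imp_homeomorphic_map)
  let ?T = "sum_topology (\<lambda>i. fibre F s (b i)) I" and ?f = "\<lambda>(i, e). fibre_incl F s (b i) e"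
  have sA: "s x \<in> A" if "x \<in> topspace F" for x using continuous_map_funspace[OF s] that by auto
  have top: "topspace ?T = {(i, e). i \<in> I \<and> e \<in> topspace F \<and> s e = b i}" by auto
  have f: "?f p = snd p" if "p \<in> topspace ?T" for p using that unfolding top by (auto simp: fibre_incl_def)
  show "continuous_map ?T F ?f"
    unfolding continuous_map_def
  proof (intro conjI allI impI)
    show "?f \<in> topspace ?T \<rightarrow> topspace F" using f unfolding top by auto
    fix U assume U: "openin F U"
    have "{p \<in> topspace ?T. ?f p \<in> U} = Sigma I (\<lambda>i. U \<inter> {x \<in> topspace F. s x = b i})"
      unfolding top using openin_subset[OF U] by (auto simp: fibre_incl_def)
    moreover have "openin (fibre F s (b i)) (U \<inter> {x \<in> topspace F. s x = b i})" for i
      unfolding fibre_def openin_open_subtopology[OF clopen_fibre(1)[OF s]] using U clopen_fibre(1)[OF s] by blast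
    ultimately show "openin ?T {p \<in> topspace ?T. ?f p \<in> U}" unfolding openin_sum_topology_alt by blast
  qed
  show "open_map ?T F ?f" unfolding open_map_def
  proof (intro allI impI)
    fix U assume U: "openin ?T U"
    then obtain W where W: "U = Sigma I W" "\<And>i. i \<in> I \<Longrightarrow> openin (fibre F s (b i)) (W i)" unfolding openin_sum_topology_alt by blast
    have W': "openin F (W i)" if "i \<in> I" for i
      using W(2)[OF that] unfolding fibre_def openin_open_subtopology[OF clopen_fibre(1)[OF s]] by blast
    have "?f ` U = snd ` U" using f openin_subset[OF U] by (intro image_cong) auto
    also have "\<dots> = (\<Union>i\<in>I. W i)" unfolding W(1) by force
    finally show "openin F (?f ` U)" using W' by (simp only:) (rule openin_Union, blast)
  qed
  have "?f ` topspace ?T = snd ` topspace ?T" using f by (intro image_cong) auto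
  also have "\<dots> = topspace F"
  proof -
    have "\<exists>i\<in>I. s x = b i" if "x \<in> topspace F" for x using sA[OF that] b unfolding bij_betw_def by blast
    then show ?thesis unfolding top by force
  qed
  finally show "?f ` topspace ?T = topspace F" .
  show "inj_on ?f (topspace ?T)"
  proof (rule inj_onI)
    fix p q assume p: "p \<in> topspace ?T" and q: "q \<in> topspace ?T" and "?f p = ?f q"
    then have e: "snd p = snd q" using f by simp
    then have "b (fst p) = b (fst q)" using p q unfolding top by auto
    moreover have "fst p \<in> I" "fst q \<in> I" using p q unfolding top by auto
    ultimately have "fst p = fst q" using inj_onD[OF bij_betw_imp_inj_on[OF b]] by simp
    then show "p = q" using e by (simp add: prod_eq_iff)
  qed
qed

text \<open>The product condition is indexed by sets of natural numbers, so the finite set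
  \<open>A\<close> is enumerated first. Empty fibres may occur and are members of the union like the
  others.\<close>

lemma glue_fibres:
  assumes X: "X \<in> Obj (condensed_cat \<kappa> B)" and F: "F \<in> Obj (Extr \<kappa>)" and s: "continuous_map F (discrete_topology A) s"
    and A: "finite A" and x: "x \<in> Obj B"
    and w: "\<And>a. a \<in> A \<Longrightarrow> w a \<in> Val (FObj X (fibre F s a)) x"
  shows "\<exists>!u. u \<in> Val (FObj X F) x \<and> (\<forall>a\<in>A. FArr X F (fibre F s a) (fibre_incl F s a) x u = w a)"
proof -
  obtain b where b: "bij_betw b {0..<card A} A" using ex_bij_betw_nat_finite[OF A] by blast
  have "\<exists>!u. u \<in> Val (FObj X F) x \<and> (\<forall>i\<in>{0..<card A}. FArr X F (fibre F s (b i)) (fibre_incl F s (b i)) x u = w (b i))"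
    by (rule condensed_sheaf[OF X finite_atLeastLessThan F fibre_Extr[OF F s] fibres_homeomorphic_map[OF s b] x w[OF bij_betwE[OF b, rule_format]]])
  moreover have "(\<forall>i\<in>{0..<card A}. FArr X F (fibre F s (b i)) (fibre_incl F s (b i)) x u = w (b i)) \<longleftrightarrow>
      (\<forall>a\<in>A. FArr X F (fibre F s a) (fibre_incl F s a) x u = w a)" for u
    using bij_betw_ball[OF b, of "\<lambda>a. FArr X F (fibre F s a) (fibre_incl F s a) x u = w a"] by blast
  ultimately show ?thesis by simp
qed

text \<open>Renames values along injections. The represented objects have values in a type of
  functions, whereas a limit is tested only against objects with values in
  \<open>'a\<close>.\<close>

definition transport ::
  "('o, 'm) category \<Rightarrow> ('k topology \<Rightarrow> 'o \<Rightarrow> 'd \<Rightarrow> 'a) \<Rightarrow> ('k, 'o, 'm, 'd) condensed \<Rightarrow> ('k, 'o, 'm, 'a) condensed" where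
  "transport B e Y = \<lparr>
     FObj = (\<lambda>F. \<lparr>Val = (\<lambda>x. e F x ` Val (FObj Y F) x),
       Act = (\<lambda>x y f c. e F x (Act (FObj Y F) x y f (inv_into (Val (FObj Y F) y) (e F y) c)))\<rparr>),
     FArr = (\<lambda>F F' g. \<lambda>x\<in>Obj B. \<lambda>c\<in>e F x ` Val (FObj Y F) x. e F' x (FArr Y F F' g x (inv_into (Val (FObj Y F) x) (e F x) c)))\<rparr>"

context
  fixes Y :: "('k, 'o, 'm, 'd) condensed" and e :: "'k topology \<Rightarrow> 'o \<Rightarrow> 'd \<Rightarrow> 'a" and \<kappa> B
  assumes Y: "Y \<in> Obj (condensed_cat \<kappa> B)"
    and inj: "\<And>F x. F \<in> Obj (Extr \<kappa>) \<Longrightarrow> x \<in> Obj B \<Longrightarrow> inj_on (e F x) (Val (FObj Y F) x)"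
begin

lemma transport_Val: "Val (FObj (transport B e Y) F) x = e F x ` Val (FObj Y F) x"
  unfolding transport_def by simp

lemma transport_Act:
  assumes "F \<in> Obj (Extr \<kappa>)" "y \<in> Obj B" "h \<in> Val (FObj Y F) y"
  shows "Act (FObj (transport B e Y) F) x y f (e F y h) = e F x (Act (FObj Y F) x y f h)"
  unfolding transport_def using inv_into_f_f[OF inj[OF assms(1,2)] assms(3)] by simp

lemma transport_FArr:
  assumes "F \<in> Obj (Extr \<kappa>)" "x \<in> Obj B" "h \<in> Val (FObj Y F) x"
  shows "FArr (transport B e Y) F F' g x (e F x h) = e F' x (FArr Y F F' g x h)"
  unfolding transport_def using inv_into_f_f[OF inj[OF assms(1,2)] assms(3)] assms(2,3) by simp

lemma transport_Obj: "transport B e Y \<in> Obj (condensed_cat \<kappa> B)"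
proof (rule condensed_ObjI)
  note D = condensed_ObjD[OF Y]
  show "is_presheaf B (FObj (transport B e Y) E)" if E: "E \<in> Obj (Extr \<kappa>)" for E
    unfolding is_presheaf_def transport_Val
  proof (intro conjI ballI funcsetI, goal_cases)
    case (1 x y f c) then show ?case using transport_Act[OF E] is_presheafD(1)[OF D(1)[OF E E]] by auto
  next
    case (2 x c)
    then obtain h where h: "h \<in> Val (FObj Y E) x" "c = e E x h" by blast
    have "Act (FObj Y E) x x (Idn B x) h = h"
      using D(1)[OF E E] 2(1) h(1) unfolding is_presheaf_def by blast
    then show ?case using transport_Act[OF E 2(1) h(1), of x] h(2) by simp
  next
    case (3 x y z f g c)
    then obtain h where h: "h \<in> Val (FObj Y E) z" "c = e E z h" by blast
    note m = is_presheafD(1)[OF D(1)[OF E E] 3(2,3,5) h(1)]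
    show ?case unfolding h(2) transport_Act[OF E 3(3) h(1)] transport_Act[OF E 3(2) m]
      using is_presheafD(3)[OF D(1)[OF E E] 3(1,2,4,3,5) h(1)] by simp
  qed
  show "FArr (transport B e Y) E F f \<in> presheaf_hom B (FObj (transport B e Y) E) (FObj (transport B e Y) F)"
    if E: "E \<in> Obj (Extr \<kappa>)" and F: "F \<in> Obj (Extr \<kappa>)" and f: "f \<in> Arr (Extr \<kappa>) F E" for E F f
  proof (rule presheaf_homI)
    note hom = D(2)[OF E F f]
    fix x assume x: "x \<in> Obj B"
    show "FArr (transport B e Y) E F f x c \<in> Val (FObj (transport B e Y) F) x" if "c \<in> Val (FObj (transport B e Y) E) x" for c
      using that transport_FArr[OF E x] presheaf_homD(1)[OF hom x] unfolding transport_Val by auto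
    show "FArr (transport B e Y) E F f x \<in> extensional (Val (FObj (transport B e Y) E) x)"
      unfolding transport_Val using x unfolding transport_def by simp
    fix y u c assume y: "y \<in> Obj B" and u: "u \<in> Arr B x y" and c: "c \<in> Val (FObj (transport B e Y) E) y"
    then obtain h where h: "h \<in> Val (FObj Y E) y" "c = e E y h" unfolding transport_Val by blast
    show "FArr (transport B e Y) E F f x (Act (FObj (transport B e Y) E) x y u c) =
       Act (FObj (transport B e Y) F) x y u (FArr (transport B e Y) E F f y c)"
      unfolding h(2) transport_Act[OF E y h(1)] transport_FArr[OF E y h(1)]
        transport_Act[OF F y presheaf_homD(1)[OF hom y h(1)]]
        transport_FArr[OF E x is_presheafD(1)[OF D(1)[OF E E] x y u h(1)]] presheaf_homD(3)[OF hom x y u h(1)] ..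
  qed (simp add: transport_def)
  show "FArr (transport B e Y) E E (\<lambda>t\<in>topspace E. t) x c = c"
    if E: "E \<in> Obj (Extr \<kappa>)" and x: "x \<in> Obj B" and c: "c \<in> Val (FObj (transport B e Y) E) x" for E x c
    using c transport_FArr[OF E x] D(3)[OF E E x] unfolding transport_Val by auto
  show "FArr (transport B e Y) E G (compose (topspace G) f g) x c = FArr (transport B e Y) F G g x (FArr (transport B e Y) E F f x c)"
    if *: "E \<in> Obj (Extr \<kappa>)" "F \<in> Obj (Extr \<kappa>)" "G \<in> Obj (Extr \<kappa>)" "f \<in> Arr (Extr \<kappa>) F E" "g \<in> Arr (Extr \<kappa>) G F"
      and x: "x \<in> Obj B" and c: "c \<in> Val (FObj (transport B e Y) E) x" for E F G f g x c
  proof -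
    obtain h where h: "h \<in> Val (FObj Y E) x" "c = e E x h" using c unfolding transport_Val by blast
    show ?thesis unfolding h(2) transport_FArr[OF *(1) x h(1)]
        transport_FArr[OF *(2) x presheaf_homD(1)[OF D(2)[OF *(1,2,4)] x h(1)]] D(4)[OF *(1,2,3,4,5) x h(1)] ..
  qed
  show "\<exists>!l. l \<in> Val (FObj (transport B e Y) E) x \<and> (\<forall>i\<in>I. FArr (transport B e Y) E (Es i) (\<iota> i) x l = z i)"
    if I: "finite I" and E: "E \<in> Obj (Extr \<kappa>)" and Es: "\<And>i. i \<in> I \<Longrightarrow> Es i \<in> Obj (Extr \<kappa>)" "\<And>i. i \<in> I \<Longrightarrow> \<iota> i \<in> Arr (Extr \<kappa>) (Es i) E"
      and h: "homeomorphic_map (sum_topology Es I) E (\<lambda>(i, e). \<iota> i e)" and x: "x \<in> Obj B"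
      and z: "\<And>i. i \<in> I \<Longrightarrow> z i \<in> Val (FObj (transport B e Y) (Es i)) x" for I :: "nat set" and Es E \<iota> x z
  proof -
    let ?i = "\<lambda>F. inv_into (Val (FObj Y F) x) (e F x)"
    have zi: "?i (Es i) (z i) \<in> Val (FObj Y (Es i)) x" "e (Es i) x (?i (Es i) (z i)) = z i" if "i \<in> I" for i
      using z[OF that] unfolding transport_Val by (auto intro: inv_into_into f_inv_into_f)
    have "\<exists>!l. l \<in> Val (FObj Y E) x \<and> (\<forall>i\<in>I. FArr Y E (Es i) (\<iota> i) x l = ?i (Es i) (z i))"
      by (rule condensed_sheaf[OF Y I E Es h x zi(1)])
    then obtain l where l: "l \<in> Val (FObj Y E) x" "\<And>i. i \<in> I \<Longrightarrow> FArr Y E (Es i) (\<iota> i) x l = ?i (Es i) (z i)"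
      and un: "\<And>l'. l' \<in> Val (FObj Y E) x \<Longrightarrow> (\<forall>i\<in>I. FArr Y E (Es i) (\<iota> i) x l' = ?i (Es i) (z i)) \<Longrightarrow> l' = l" by blast
    show ?thesis
    proof (rule ex1I[of _ "e E x l"])
      show "e E x l \<in> Val (FObj (transport B e Y) E) x \<and> (\<forall>i\<in>I. FArr (transport B e Y) E (Es i) (\<iota> i) x (e E x l) = z i)"
        unfolding transport_Val using l transport_FArr[OF E x l(1)] zi(2) by simp
      fix c assume c: "c \<in> Val (FObj (transport B e Y) E) x \<and> (\<forall>i\<in>I. FArr (transport B e Y) E (Es i) (\<iota> i) x c = z i)"
      then obtain h where h: "h \<in> Val (FObj Y E) x" "c = e E x h" unfolding transport_Val by blast
      have "FArr Y E (Es i) (\<iota> i) x h = ?i (Es i) (z i)" if i: "i \<in> I" for i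
      proof -
        have "e (Es i) x (FArr Y E (Es i) (\<iota> i) x h) = z i" using c i transport_FArr[OF E x h(1)] h(2) by simp
        moreover have "FArr Y E (Es i) (\<iota> i) x h \<in> Val (FObj Y (Es i)) x"
          by (rule presheaf_homD(1)[OF D(2)[OF E Es(1)[OF i] Es(2)[OF i]] x h(1)])
        ultimately show ?thesis using inv_into_f_f[OF inj[OF Es(1)[OF i] x]] by metis
      qed
      then show "c = e E x l" using un[OF h(1)] h(2) by simp
    qed
  qed
qed

lemma transport_Arr:
  assumes X: "X \<in> Obj (condensed_cat \<kappa> B)"
    and \<Phi>: "\<And>F x h. F \<in> Obj (Extr \<kappa>) \<Longrightarrow> x \<in> Obj B \<Longrightarrow> h \<in> Val (FObj Y F) x \<Longrightarrow> \<Phi> F x h \<in> Val (FObj X F) x"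
    and act: "\<And>F x y f h. F \<in> Obj (Extr \<kappa>) \<Longrightarrow> x \<in> Obj B \<Longrightarrow> y \<in> Obj B \<Longrightarrow> f \<in> Arr B x y \<Longrightarrow> h \<in> Val (FObj Y F) y \<Longrightarrow>
      \<Phi> F x (Act (FObj Y F) x y f h) = Act (FObj X F) x y f (\<Phi> F y h)"
    and nat: "\<And>F F' g x h. F \<in> Obj (Extr \<kappa>) \<Longrightarrow> F' \<in> Obj (Extr \<kappa>) \<Longrightarrow> g \<in> Arr (Extr \<kappa>) F' F \<Longrightarrow> x \<in> Obj B \<Longrightarrow> h \<in> Val (FObj Y F) x \<Longrightarrow>
      \<Phi> F' x (FArr Y F F' g x h) = FArr X F F' g x (\<Phi> F x h)"
  obtains \<eta> where "\<eta> \<in> Arr (condensed_cat \<kappa> B) (transport B e Y) X"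
    "\<And>F x h. F \<in> Obj (Extr \<kappa>) \<Longrightarrow> x \<in> Obj B \<Longrightarrow> h \<in> Val (FObj Y F) x \<Longrightarrow> \<eta> F x (e F x h) = \<Phi> F x h"
proof
  let ?\<eta> = "\<lambda>F\<in>Obj (Extr \<kappa>). \<lambda>x\<in>Obj B. \<lambda>c\<in>e F x ` Val (FObj Y F) x. \<Phi> F x (inv_into (Val (FObj Y F) x) (e F x) c)"
  show val: "?\<eta> F x (e F x h) = \<Phi> F x h" if "F \<in> Obj (Extr \<kappa>)" "x \<in> Obj B" "h \<in> Val (FObj Y F) x" for F x h
    using inv_into_f_f[OF inj[OF that(1,2)] that(3)] that by simp
  note D = condensed_ObjD[OF Y]
  show "?\<eta> \<in> Arr (condensed_cat \<kappa> B) (transport B e Y) X"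
    unfolding condensed_Arr_iff[OF transport_Obj X]
  proof (intro conjI ballI)
    show "?\<eta> F \<in> presheaf_hom B (FObj (transport B e Y) F) (FObj X F)" if F: "F \<in> Obj (Extr \<kappa>)" for F
    proof (rule presheaf_homI)
      show "?\<eta> F x c \<in> Val (FObj X F) x" if x: "x \<in> Obj B" and "c \<in> Val (FObj (transport B e Y) F) x" for x c
        using that(2) val[OF F x] \<Phi>[OF F x] unfolding transport_Val by auto
      show "?\<eta> F x \<in> extensional (Val (FObj (transport B e Y) F) x)" if "x \<in> Obj B" for x
        unfolding transport_Val using that F by simp
      show "?\<eta> F \<in> extensional (Obj B)" using F by simp
      fix x y f c assume xy: "x \<in> Obj B" "y \<in> Obj B" "f \<in> Arr B x y" and "c \<in> Val (FObj (transport B e Y) F) y"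
      then obtain h where h: "h \<in> Val (FObj Y F) y" "c = e F y h" unfolding transport_Val by blast
      show "?\<eta> F x (Act (FObj (transport B e Y) F) x y f c) = Act (FObj X F) x y f (?\<eta> F y c)"
        unfolding h(2) transport_Act[OF F xy(2) h(1)] val[OF F xy(2) h(1)]
          val[OF F xy(1) is_presheafD(1)[OF D(1)[OF F F] xy h(1)]] by (rule act[OF F xy h(1)])
    qed
    fix F F' g x c assume F: "F \<in> Obj (Extr \<kappa>)" "F' \<in> Obj (Extr \<kappa>)" "g \<in> Arr (Extr \<kappa>) F' F" and x: "x \<in> Obj B"
      and "c \<in> Val (FObj (transport B e Y) F) x"
    then obtain h where h: "h \<in> Val (FObj Y F) x" "c = e F x h" unfolding transport_Val by blast
    show "?\<eta> F' x (FArr (transport B e Y) F F' g x c) = FArr X F F' g x (?\<eta> F x c)"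
      unfolding h(2) transport_FArr[OF F(1) x h(1)] val[OF F(1) x h(1)] val[OF F(2) x presheaf_homD(1)[OF D(2)[OF F] x h(1)]]
      by (rule nat[OF F x h(1)])
  qed simp
qed

end

section \<open>Limits of condensed cubesets are computed pointwise\<close>

definition box_topology :: "'k topology \<Rightarrow> nat \<Rightarrow> nat \<Rightarrow> ('k \<times> ((nat \<Rightarrow> int) \<Rightarrow> (nat \<Rightarrow> int))) topology" where
  "box_topology E m n = prod_topology E (discrete_topology (Arr Box m n))"

text \<open>Continuous maps into \<open>E \<times> Arr Box m n\<close>, rather than pairs of a map to \<open>E\<close> and one arrow of the
  cube category: this is the sheafification of the naive representable, and it takes disjoint unions
  to products.\<close>

definition yoneda ::
  "'k topology \<Rightarrow> nat \<Rightarrow> ('k, nat, (nat \<Rightarrow> int) \<Rightarrow> (nat \<Rightarrow> int), 'k \<Rightarrow> 'k \<times> ((nat \<Rightarrow> int) \<Rightarrow> (nat \<Rightarrow> int))) condensed" where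
  "yoneda E n = \<lparr>
     FObj = (\<lambda>F. \<lparr>
        Val = (\<lambda>m. {h \<in> extensional (topspace F). continuous_map F (box_topology E m n) h}),
        Act = (\<lambda>l m \<xi> h. \<lambda>t\<in>topspace F. (fst (h t), Cmp Box l m n (snd (h t)) \<xi>))\<rparr>),
     FArr = (\<lambda>F F' g. \<lambda>m. \<lambda>h\<in>{h \<in> extensional (topspace F). continuous_map F (box_topology E m n) h}.
        compose (topspace F') h g)\<rparr>"

lemma yoneda_Val: "Val (FObj (yoneda E n) F) m = {h \<in> extensional (topspace F). continuous_map F (box_topology E m n) h}"
  and yoneda_Act: "Act (FObj (yoneda E n) F) l m \<xi> h = (\<lambda>t\<in>topspace F. (fst (h t), Cmp Box l m n (snd (h t)) \<xi>))"
  and yoneda_FArr: "h \<in> Val (FObj (yoneda E n) F) m \<Longrightarrow> FArr (yoneda E n) F F' g m h = compose (topspace F') h g"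
  unfolding yoneda_def by simp_all

lemma yoneda_ValD:
  assumes "h \<in> Val (FObj (yoneda E n) F) m"
  shows "h \<in> extensional (topspace F)" "continuous_map F (box_topology E m n) h"
    and "continuous_map F E (\<lambda>t. fst (h t))" "continuous_map F (discrete_topology (Arr Box m n)) (\<lambda>t. snd (h t))"
    and "t \<in> topspace F \<Longrightarrow> fst (h t) \<in> topspace E" "t \<in> topspace F \<Longrightarrow> snd (h t) \<in> Arr Box m n"
proof -
  show ext: "h \<in> extensional (topspace F)" and c: "continuous_map F (box_topology E m n) h"
    using assms unfolding yoneda_Val by simp_all
  show "continuous_map F E (\<lambda>t. fst (h t))" "continuous_map F (discrete_topology (Arr Box m n)) (\<lambda>t. snd (h t))"
    using c unfolding box_topology_def continuous_map_pairwise comp_def by simp_all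
  have "h t \<in> topspace E \<times> Arr Box m n" if "t \<in> topspace F" for t
    using funcset_mem[OF continuous_map_funspace[OF c] that] unfolding box_topology_def by simp
  then show "t \<in> topspace F \<Longrightarrow> fst (h t) \<in> topspace E" "t \<in> topspace F \<Longrightarrow> snd (h t) \<in> Arr Box m n"
    by (simp_all add: mem_Times_iff)
qed

lemma yoneda_ValI:
  assumes "h \<in> extensional (topspace F)" "continuous_map F E (\<lambda>t. fst (h t))"
    "continuous_map F (discrete_topology (Arr Box m n)) (\<lambda>t. snd (h t))"
  shows "h \<in> Val (FObj (yoneda E n) F) m"
  using assms unfolding yoneda_Val box_topology_def continuous_map_pairwise comp_def by simp

lemma Cmp_Box_id: "\<phi> \<in> Arr Box m n \<Longrightarrow> Cmp Box m m n \<phi> (Idn Box m) = \<phi>"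
  unfolding Cmp_Box using Arr_BoxD(1)[of \<phi> m n]
  by (intro extensionalityI[of _ "cube m"]) (auto simp: Box_def compose_def PiE_iff)

lemma Cmp_Box_assoc:
  assumes "f \<in> Arr Box k l"
  shows "Cmp Box k m n h (Cmp Box k l m g f) = Cmp Box k l n (Cmp Box l m n h g) f"
  unfolding Cmp_Box compose_def using Arr_BoxD(2)[OF assms] by (intro restrict_ext) simp

lemma Cmp_Box_Arr: "f \<in> Arr Box l m \<Longrightarrow> g \<in> Arr Box m n \<Longrightarrow> Cmp Box l m n g f \<in> Arr Box l n"
  unfolding Cmp_Box by (rule comp_Arr_Box)

lemma yoneda_Act_Val:
  assumes h: "h \<in> Val (FObj (yoneda E n) F) m" and \<xi>: "\<xi> \<in> Arr Box l m"
  shows "Act (FObj (yoneda E n) F) l m \<xi> h \<in> Val (FObj (yoneda E n) F) l"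
proof (rule yoneda_ValI)
  show "continuous_map F E (\<lambda>t. fst (Act (FObj (yoneda E n) F) l m \<xi> h t))"
    by (rule continuous_map_eq[OF yoneda_ValD(3)[OF h]]) (simp add: yoneda_Act)
  have "continuous_map (discrete_topology (Arr Box m n)) (discrete_topology (Arr Box l n)) (\<lambda>\<phi>. Cmp Box l m n \<phi> \<xi>)"
    using Cmp_Box_Arr[OF \<xi>] by simp
  then have "continuous_map F (discrete_topology (Arr Box l n)) ((\<lambda>\<phi>. Cmp Box l m n \<phi> \<xi>) \<circ> (\<lambda>t. snd (h t)))"
    by (rule continuous_map_compose[OF yoneda_ValD(4)[OF h]])
  then show "continuous_map F (discrete_topology (Arr Box l n)) (\<lambda>t. snd (Act (FObj (yoneda E n) F) l m \<xi> h t))"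
    by (rule continuous_map_eq) (simp add: yoneda_Act)
qed (simp add: yoneda_Act)

lemma yoneda_pull_Val:
  assumes h: "h \<in> Val (FObj (yoneda E n) F) m" and g: "g \<in> Arr (Extr \<kappa>) F' F"
  shows "compose (topspace F') h g \<in> Val (FObj (yoneda E n) F') m"
proof -
  have "continuous_map F' (box_topology E m n) (h \<circ> g)"
    by (rule continuous_map_compose[OF Extr_ArrD(2)[OF g] yoneda_ValD(2)[OF h]])
  then have "continuous_map F' (box_topology E m n) (compose (topspace F') h g)"
    by (rule continuous_map_eq) (simp add: compose_def)
  then show ?thesis unfolding yoneda_Val by simp
qed

lemma continuous_map_from_union:
  assumes h: "homeomorphic_map (sum_topology Es I) E (\<lambda>(i, e). \<iota> i e)"
    and k: "\<And>i. i \<in> I \<Longrightarrow> continuous_map (Es i) T (k i)"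
  shows "\<exists>!l. l \<in> extensional (topspace E) \<and> continuous_map E T l \<and> (\<forall>i\<in>I. \<forall>e\<in>topspace (Es i). l (\<iota> i e) = k i e)"
proof -
  let ?S = "sum_topology Es I"
  obtain g where g: "continuous_map E ?S g" "\<And>p. p \<in> topspace ?S \<Longrightarrow> g ((\<lambda>(i, e). \<iota> i e) p) = p"
    "\<And>x. x \<in> topspace E \<Longrightarrow> (\<lambda>(i, e). \<iota> i e) (g x) = x"
    using h unfolding homeomorphic_map_maps homeomorphic_maps_def by blast
  have gi: "g (\<iota> i e) = (i, e)" if "i \<in> I" "e \<in> topspace (Es i)" for i e using g(2)[of "(i, e)"] that by simp
  have ks: "continuous_map ?S T (\<lambda>(i, e). k i e)"
    unfolding continuous_map_def
  proof (intro conjI allI impI)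
    show "(\<lambda>(i, e). k i e) \<in> topspace ?S \<rightarrow> topspace T" 
      using funcset_mem[OF continuous_map_funspace[OF k]] by auto
    fix U assume U: "openin T U"
    have "{p \<in> topspace ?S. (case p of (i, e) \<Rightarrow> k i e) \<in> U} = Sigma I (\<lambda>i. {e \<in> topspace (Es i). k i e \<in> U})" by auto
    moreover have "\<forall>i\<in>I. openin (Es i) {e \<in> topspace (Es i). k i e \<in> U}"
      using openin_continuous_map_preimage[OF k U] by blast
    ultimately show "openin ?S {p \<in> topspace ?S. (case p of (i, e) \<Rightarrow> k i e) \<in> U}" unfolding openin_sum_topology_alt by blast
  qed
  let ?l = "\<lambda>x\<in>topspace E. (\<lambda>(i, e). k i e) (g x)"
  have "continuous_map E T ?l"
    by (rule continuous_map_eq[OF continuous_map_compose[OF g(1) ks]]) simp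
  moreover have img: "\<iota> i e \<in> topspace E" if "i \<in> I" "e \<in> topspace (Es i)" for i e
    using homeomorphic_imp_surjective_map[OF h] that by force
  have "?l (\<iota> i e) = k i e" if "i \<in> I" "e \<in> topspace (Es i)" for i e
    using gi[OF that] img[OF that] by simp
  moreover have "l = ?l" if l: "l \<in> extensional (topspace E)" "\<forall>i\<in>I. \<forall>e\<in>topspace (Es i). l (\<iota> i e) = k i e" for l
  proof (rule extensionalityI[OF l(1)])
    fix x assume x: "x \<in> topspace E"
    have "g x \<in> topspace ?S" using continuous_map_funspace[OF g(1)] x by blast
    then obtain i e where ie: "g x = (i, e)" "i \<in> I" "e \<in> topspace (Es i)" by auto
    have "x = \<iota> i e" using g(3)[OF x] ie(1) by simp
    then show "l x = ?l x" using l(2) ie x by simp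
  qed simp
  ultimately show ?thesis by (intro ex1I[of _ ?l]) auto
qed

lemma yoneda_Obj: "yoneda E n \<in> Obj (cubespaces \<kappa>)"
proof (rule condensed_ObjI)
  show "is_presheaf Box (FObj (yoneda E n) F)" for F
    unfolding is_presheaf_def
  proof (intro conjI ballI funcsetI, goal_cases)
    case (1 l m \<xi> h) then show ?case by (intro yoneda_Act_Val)
  next
    case (2 m h) then show ?case unfolding yoneda_Act
      using yoneda_ValD(6)[OF 2(2)] yoneda_ValD(1)[OF 2(2)] by (intro extensionalityI[of _ "topspace F"]) (simp_all add: Cmp_Box_id)
  next
    case (3 k l m f g h) show ?case unfolding yoneda_Act using Cmp_Box_assoc[OF 3(4)] by (intro restrict_ext) simp
  qed
  show "FArr (yoneda E n) F F' g \<in> presheaf_hom Box (FObj (yoneda E n) F) (FObj (yoneda E n) F')"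
    if g: "g \<in> Arr (Extr \<kappa>) F' F" for F F' g
  proof (rule presheaf_homI)
    show "FArr (yoneda E n) F F' g m h \<in> Val (FObj (yoneda E n) F') m" if "h \<in> Val (FObj (yoneda E n) F) m" for m h
      unfolding yoneda_FArr[OF that] by (rule yoneda_pull_Val[OF that g])
    show "FArr (yoneda E n) F F' g m \<in> extensional (Val (FObj (yoneda E n) F) m)" for m
      unfolding yoneda_Val unfolding yoneda_def by simp
    fix l m \<xi> h assume \<xi>: "\<xi> \<in> Arr Box l m" and h: "h \<in> Val (FObj (yoneda E n) F) m"
    show "FArr (yoneda E n) F F' g l (Act (FObj (yoneda E n) F) l m \<xi> h) = Act (FObj (yoneda E n) F') l m \<xi> (FArr (yoneda E n) F F' g m h)"
      unfolding yoneda_FArr[OF yoneda_Act_Val[OF h \<xi>]] yoneda_FArr[OF h] unfolding yoneda_Act compose_def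
      by (intro restrict_ext) (simp add: Extr_ArrD(1)[OF g])
  qed simp
  show "FArr (yoneda E n) F F (\<lambda>t\<in>topspace F. t) m h = h" if h: "h \<in> Val (FObj (yoneda E n) F) m" for F m h
    unfolding yoneda_FArr[OF h] using yoneda_ValD(1)[OF h]
    by (intro extensionalityI[of _ "topspace F"]) (simp_all add: compose_def)
  show "FArr (yoneda E n) F H (compose (topspace H) f g) m h = FArr (yoneda E n) G H g m (FArr (yoneda E n) F G f m h)"
    if f: "f \<in> Arr (Extr \<kappa>) G F" and g: "g \<in> Arr (Extr \<kappa>) H G" and h: "h \<in> Val (FObj (yoneda E n) F) m" for F G H f g m h
    unfolding yoneda_FArr[OF h] yoneda_FArr[OF yoneda_pull_Val[OF h f]] unfolding compose_def
    by (intro restrict_ext) (simp add: Extr_ArrD(1)[OF g])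
  show "\<exists>!l. l \<in> Val (FObj (yoneda E n) F) m \<and> (\<forall>i\<in>I. FArr (yoneda E n) F (Es i) (\<iota> i) m l = z i)"
    if h: "homeomorphic_map (sum_topology Es I) F (\<lambda>(i, e). \<iota> i e)"
      and z: "\<And>i. i \<in> I \<Longrightarrow> z i \<in> Val (FObj (yoneda E n) (Es i)) m" for I :: "nat set" and Es F \<iota> m z
  proof -
    have eq: "FArr (yoneda E n) F (Es i) (\<iota> i) m l = z i \<longleftrightarrow> (\<forall>e\<in>topspace (Es i). l (\<iota> i e) = z i e)"
      if l: "l \<in> Val (FObj (yoneda E n) F) m" and i: "i \<in> I" for l i
    proof -
      have "z i = (\<lambda>e\<in>topspace (Es i). z i e)" using yoneda_ValD(1)[OF z[OF i]] by (simp add: extensional_restrict)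
      then have "FArr (yoneda E n) F (Es i) (\<iota> i) m l = z i \<longleftrightarrow>
         (\<lambda>e\<in>topspace (Es i). l (\<iota> i e)) = (\<lambda>e\<in>topspace (Es i). z i e)"
        unfolding yoneda_FArr[OF l] compose_def by simp
      then show ?thesis unfolding restrict_eq_iff .
    qed
    have "\<exists>!l. l \<in> extensional (topspace F) \<and> continuous_map F (box_topology E m n) l \<and> (\<forall>i\<in>I. \<forall>e\<in>topspace (Es i). l (\<iota> i e) = z i e)"
      by (rule continuous_map_from_union[OF h yoneda_ValD(2)[OF z]])
    moreover have "(l \<in> extensional (topspace F) \<and> continuous_map F (box_topology E m n) l \<and> (\<forall>i\<in>I. \<forall>e\<in>topspace (Es i). l (\<iota> i e) = z i e)) \<longleftrightarrow>
      l \<in> Val (FObj (yoneda E n) F) m \<and> (\<forall>i\<in>I. FArr (yoneda E n) F (Es i) (\<iota> i) m l = z i)" for l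
    proof (cases "l \<in> Val (FObj (yoneda E n) F) m")
      case True
      then show ?thesis using eq[OF True] unfolding yoneda_Val by simp
    next
      case False then show ?thesis unfolding yoneda_Val by blast
    qed
    ultimately show ?thesis by simp
  qed
qed

lemma finite_Arr_Box: "finite (Arr Box m n)"
proof -
  have "finite (cube k)" for k unfolding cube_def by (intro finite_PiE) simp_all
  then have "finite (cube m \<rightarrow>\<^sub>E cube n)" by (intro finite_PiE)
  moreover have "Arr Box m n \<subseteq> cube m \<rightarrow>\<^sub>E cube n" using Arr_BoxD(1) by blast
  ultimately show ?thesis using finite_subset by blast
qed

lemma yoneda_encoding:
  fixes \<kappa> :: "'k rel"
  assumes \<kappa>: "uncountable_strong_limit \<kappa>" "\<kappa> \<le>o |UNIV :: 'a set|" and E: "E \<in> Obj (Extr \<kappa>)" and F: "F \<in> Obj (Extr \<kappa>)"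
  shows "\<exists>e :: _ \<Rightarrow> 'a. inj_on e (Val (FObj (yoneda E n) F) m)"
proof -
  have k: "natLeq <o \<kappa>" using \<kappa>(1) unfolding uncountable_strong_limit_def by blast
  have "|Arr Box m n| <o \<kappa>" using finite_Arr_Box finite_iff_ordLess_natLeq k ordLess_transitive by blast
  then have "|topspace E \<times> Arr Box m n| <o \<kappa>" using card_Times_less[OF k] E unfolding Extr_Obj_iff by blast
  moreover have "|topspace F| <o \<kappa>" using F unfolding Extr_Obj_iff by blast
  ultimately obtain e :: "_ \<Rightarrow> 'a" where e: "inj_on e (topspace F \<rightarrow>\<^sub>E topspace E \<times> Arr Box m n)"
    using function_encoding[OF \<kappa>] by blast
  have "Val (FObj (yoneda E n) F) m \<subseteq> topspace F \<rightarrow>\<^sub>E topspace E \<times> Arr Box m n"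
  proof
    fix h assume h: "h \<in> Val (FObj (yoneda E n) F) m"
    have "h t \<in> topspace E \<times> Arr Box m n" if "t \<in> topspace F" for t
      using yoneda_ValD(5,6)[OF h that] by (simp add: mem_Times_iff)
    then show "h \<in> topspace F \<rightarrow>\<^sub>E topspace E \<times> Arr Box m n" using yoneda_ValD(1)[OF h] by (simp add: PiE_iff)
  qed
  then show ?thesis using inj_on_subset[OF e] by blast
qed

text \<open>The empty space is the disjoint union of no spaces, so the product condition makes its
  values singletons.\<close>

lemma empty_value_unique:
  assumes X: "X \<in> Obj (condensed_cat \<kappa> B)" and F: "F \<in> Obj (Extr \<kappa>)" and e: "topspace F = {}" and x: "x \<in> Obj B"
    and "u \<in> Val (FObj X F) x" "v \<in> Val (FObj X F) x"
  shows "u = v"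
proof -
  have s: "continuous_map F (discrete_topology {}) (\<lambda>_. ())"
    unfolding continuous_map_def using e by simp
  have "\<exists>!u. u \<in> Val (FObj X F) x \<and> (\<forall>a\<in>{}. FArr X F (fibre F (\<lambda>_. ()) a) (fibre_incl F (\<lambda>_. ()) a) x u = undefined a)"
    by (rule glue_fibres[OF X F s _ x]) simp_all
  then show ?thesis using assms(5,6) by blast
qed

text \<open>The element at which the Yoneda bijection evaluates: the identity of \<open>E\<close>
  paired with the identity arrow.\<close>

definition universal_point :: "'k topology \<Rightarrow> nat \<Rightarrow> 'k \<Rightarrow> 'k \<times> ((nat \<Rightarrow> int) \<Rightarrow> (nat \<Rightarrow> int))" where
  "universal_point E n = (\<lambda>t\<in>topspace E. (t, Idn Box n))"

lemma universal_point_Val: "universal_point E n \<in> Val (FObj (yoneda E n) E) n"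
proof (rule yoneda_ValI)
  show "continuous_map E E (\<lambda>t. fst (universal_point E n t))"
    by (rule continuous_map_eq[OF continuous_map_id]) (simp add: universal_point_def)
  have "Idn Box n \<in> Arr Box n n" using id_Arr_Box unfolding Box_def by simp
  then have "continuous_map E (discrete_topology (Arr Box n n)) (\<lambda>_. Idn Box n)" by simp
  then show "continuous_map E (discrete_topology (Arr Box n n)) (\<lambda>t. snd (universal_point E n t))"
    by (rule continuous_map_eq) (simp add: universal_point_def)
qed (simp add: universal_point_def)

section \<open>Elements of \<open>X(E)(n)\<close> as maps from the represented object\<close>

locale yoneda_map =
  fixes \<kappa> :: "'k rel" and X :: "('k, 'a) cubespace" and E :: "'k topology" and n :: nat and z :: 'a
  assumes X: "X \<in> Obj (cubespaces \<kappa>)" and E: "E \<in> Obj (Extr \<kappa>)" and z: "z \<in> Val (FObj X E) n"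
begin

text \<open>The value forced on the pair of \<open>f\<close> and \<open>\<phi>\<close> once the
  universal point goes to \<open>z\<close>.\<close>

definition pull :: "'k topology \<Rightarrow> ('k \<Rightarrow> 'k) \<Rightarrow> nat \<Rightarrow> ((nat \<Rightarrow> int) \<Rightarrow> (nat \<Rightarrow> int)) \<Rightarrow> 'a" where
  "pull H f m \<phi> = Act (FObj X H) m n \<phi> (FArr X E H f n z)"

lemma pull_Val:
  assumes "H \<in> Obj (Extr \<kappa>)" "f \<in> Arr (Extr \<kappa>) H E" "\<phi> \<in> Arr Box m n" shows "pull H f m \<phi> \<in> Val (FObj X H) m"
  unfolding pull_def
  by (rule is_presheafD(1)[OF condensed_ObjD(1)[OF X assms(1,1)] _ _ assms(3)])
    (simp_all add: presheaf_homD(1)[OF condensed_ObjD(2)[OF X E assms(1,2)] _ z])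

lemma pull_FArr:
  assumes H: "H \<in> Obj (Extr \<kappa>)" "H' \<in> Obj (Extr \<kappa>)" "f \<in> Arr (Extr \<kappa>) H E" "k \<in> Arr (Extr \<kappa>) H' H" and \<phi>: "\<phi> \<in> Arr Box m n"
  shows "FArr X H H' k m (pull H f m \<phi>) = pull H' (compose (topspace H') f k) m \<phi>"
proof -
  have v: "FArr X E H f n z \<in> Val (FObj X H) n" by (rule presheaf_homD(1)[OF condensed_ObjD(2)[OF X E H(1,3)] _ z]) simp
  show ?thesis unfolding pull_def condensed_ObjD(4)[OF X E H(1,2,3,4) Obj_Box z]
    by (rule presheaf_homD(3)[OF condensed_ObjD(2)[OF X H(1,2,4)] _ _ \<phi> v]) simp_all
qed

lemma pull_Act:
  assumes H: "H \<in> Obj (Extr \<kappa>)" "f \<in> Arr (Extr \<kappa>) H E" and \<phi>: "\<phi> \<in> Arr Box m n" and \<xi>: "\<xi> \<in> Arr Box l m"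
  shows "Act (FObj X H) l m \<xi> (pull H f m \<phi>) = pull H f l (Cmp Box l m n \<phi> \<xi>)"
proof -
  have v: "FArr X E H f n z \<in> Val (FObj X H) n" by (rule presheaf_homD(1)[OF condensed_ObjD(2)[OF X E H] _ z]) simp
  show ?thesis unfolding pull_def
    by (rule is_presheafD(3)[OF condensed_ObjD(1)[OF X H(1,1)] _ _ \<xi> _ \<phi> v, symmetric]) simp_all
qed

abbreviation Y where "Y \<equiv> yoneda E n"

text \<open>Where the arrow component of \<open>h\<close> is constant, \<open>h\<close> is an honest
  pair and its image is forced. Asking this for all \<open>H\<close> over \<open>F\<close>, and not
  just for the fibres, makes the notion stable under pullback.\<close>

definition is_section :: "'k topology \<Rightarrow> nat \<Rightarrow> ('k \<Rightarrow> 'k \<times> ((nat \<Rightarrow> int) \<Rightarrow> (nat \<Rightarrow> int))) \<Rightarrow> 'a \<Rightarrow> bool" where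
  "is_section F m h w \<longleftrightarrow> w \<in> Val (FObj X F) m \<and>
     (\<forall>H\<in>Obj (Extr \<kappa>). \<forall>k\<in>Arr (Extr \<kappa>) H F. \<forall>\<phi>\<in>Arr Box m n. (\<forall>t\<in>topspace H. snd (h (k t)) = \<phi>) \<longrightarrow>
        FArr X F H k m w = pull H (\<lambda>t\<in>topspace H. fst (h (k t))) m \<phi>)"

lemma is_sectionD:
  assumes "is_section F m h w" shows "w \<in> Val (FObj X F) m"
    and "H \<in> Obj (Extr \<kappa>) \<Longrightarrow> k \<in> Arr (Extr \<kappa>) H F \<Longrightarrow> \<phi> \<in> Arr Box m n \<Longrightarrow> (\<And>t. t \<in> topspace H \<Longrightarrow> snd (h (k t)) = \<phi>) \<Longrightarrow>
        FArr X F H k m w = pull H (\<lambda>t\<in>topspace H. fst (h (k t))) m \<phi>"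
  using assms unfolding is_section_def by blast+

lemma base_map_Arr:
  assumes h: "h \<in> Val (FObj Y F) m" and k: "k \<in> Arr (Extr \<kappa>) H F"
  shows "(\<lambda>t\<in>topspace H. fst (h (k t))) \<in> Arr (Extr \<kappa>) H E"
proof -
  have "continuous_map H E (\<lambda>t\<in>topspace H. fst (h (k t)))"
    by (rule continuous_map_eq[OF continuous_map_compose[OF Extr_ArrD(2)[OF k] yoneda_ValD(3)[OF h]]]) simp
  then show ?thesis unfolding Extr_Arr_iff using yoneda_ValD(5)[OF h Extr_ArrD(1)[OF k]] by auto
qed

text \<open>There are finitely many arrows, so \<open>F\<close> is the disjoint union of the clopen
  fibres on which the arrow component is constant, and the forced values on them are glued.\<close>

lemma section_ex1:
  assumes F: "F \<in> Obj (Extr \<kappa>)" and h: "h \<in> Val (FObj Y F) m"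
  shows "\<exists>!w. is_section F m h w"
proof -
  let ?s = "\<lambda>t. snd (h t)" let ?A = "Arr Box m n"
  note s = yoneda_ValD(4)[OF h]
  note fib = fibre_Extr[OF F s]
  let ?w = "\<lambda>a. pull (fibre F ?s a) (\<lambda>t\<in>topspace (fibre F ?s a). fst (h (fibre_incl F ?s a t))) m a"
  have "\<exists>!u. u \<in> Val (FObj X F) m \<and> (\<forall>a\<in>?A. FArr X F (fibre F ?s a) (fibre_incl F ?s a) m u = ?w a)"
    by (rule glue_fibres[OF X F s finite_Arr_Box]) (simp_all only: Obj_Box pull_Val[OF fib(1) base_map_Arr[OF h fib(2)]])
  moreover have "u \<in> Val (FObj X F) m \<and> (\<forall>a\<in>?A. FArr X F (fibre F ?s a) (fibre_incl F ?s a) m u = ?w a) \<longleftrightarrow> is_section F m h u" for u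
  proof (intro iffI conjI ballI)
    assume *: "u \<in> Val (FObj X F) m \<and> (\<forall>a\<in>?A. FArr X F (fibre F ?s a) (fibre_incl F ?s a) m u = ?w a)"
    then have u: "u \<in> Val (FObj X F) m" by blast
    show "is_section F m h u" unfolding is_section_def
    proof (intro conjI ballI impI u)
      fix H k \<phi> assume H: "H \<in> Obj (Extr \<kappa>)" and k: "k \<in> Arr (Extr \<kappa>) H F" and \<phi>: "\<phi> \<in> ?A" and c: "\<forall>t\<in>topspace H. snd (h (k t)) = \<phi>"
      have k': "k \<in> Arr (Extr \<kappa>) H (fibre F ?s \<phi>)" "compose (topspace H) (fibre_incl F ?s \<phi>) k = k"
        using fibre_factor[of k \<kappa> H F ?s \<phi>, OF k] c by blast+
      have "FArr X F H k m u = FArr X F H (compose (topspace H) (fibre_incl F ?s \<phi>) k) m u" unfolding k'(2) ..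
      also have "\<dots> = FArr X (fibre F ?s \<phi>) H k m (FArr X F (fibre F ?s \<phi>) (fibre_incl F ?s \<phi>) m u)"
        by (rule condensed_ObjD(4)[OF X F fib(1) H fib(2) k'(1) Obj_Box u])
      also have "\<dots> = FArr X (fibre F ?s \<phi>) H k m (?w \<phi>)" using * \<phi> by (simp only:)
      also have "\<dots> = pull H (compose (topspace H) (\<lambda>t\<in>topspace (fibre F ?s \<phi>). fst (h (fibre_incl F ?s \<phi> t))) k) m \<phi>"
        by (rule pull_FArr[OF fib(1) H base_map_Arr[OF h fib(2)] k'(1) \<phi>])
      also have "compose (topspace H) (\<lambda>t\<in>topspace (fibre F ?s \<phi>). fst (h (fibre_incl F ?s \<phi> t))) k = (\<lambda>t\<in>topspace H. fst (h (k t)))"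
        unfolding compose_def using Extr_ArrD(1)[OF k'(1)] by (intro restrict_ext) (simp add: fibre_incl_def)
      finally show "FArr X F H k m u = pull H (\<lambda>t\<in>topspace H. fst (h (k t))) m \<phi>" .
    qed
  next
    fix a assume u: "is_section F m h u"
    then show "u \<in> Val (FObj X F) m" by (rule is_sectionD(1))
    assume a: "a \<in> ?A"
    show "FArr X F (fibre F ?s a) (fibre_incl F ?s a) m u = ?w a"
      by (rule is_sectionD(2)[OF u fib a]) (simp add: fibre_incl_def)
  qed
  ultimately show ?thesis by simp
qed

lemma section_FArr:
  assumes w: "is_section F m h w" and F: "F \<in> Obj (Extr \<kappa>)" "F' \<in> Obj (Extr \<kappa>)" and g: "g \<in> Arr (Extr \<kappa>) F' F"
  shows "is_section F' m (compose (topspace F') h g) (FArr X F F' g m w)"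
  unfolding is_section_def
proof (intro conjI ballI impI)
  note wV = is_sectionD(1)[OF w]
  show "FArr X F F' g m w \<in> Val (FObj X F') m" by (rule presheaf_homD(1)[OF condensed_ObjD(2)[OF X F g] _ wV]) simp
  fix H k \<phi> assume H: "H \<in> Obj (Extr \<kappa>)" and k: "k \<in> Arr (Extr \<kappa>) H F'" and \<phi>: "\<phi> \<in> Arr Box m n"
    and c: "\<forall>t\<in>topspace H. snd (compose (topspace F') h g (k t)) = \<phi>"
  have e: "compose (topspace F') h g (k t) = h (compose (topspace H) g k t)" if "t \<in> topspace H" for t
    using Extr_ArrD(1)[OF k that] that by (simp add: compose_def)
  have "FArr X F' H k m (FArr X F F' g m w) = FArr X F H (compose (topspace H) g k) m w"
    by (rule condensed_ObjD(4)[OF X F(1,2) H g k Obj_Box wV, symmetric])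
  also have "\<dots> = pull H (\<lambda>t\<in>topspace H. fst (h (compose (topspace H) g k t))) m \<phi>"
    by (rule is_sectionD(2)[OF w H Extr_compose_Arr[OF g k] \<phi>]) (use c e in auto)
  also have "(\<lambda>t\<in>topspace H. fst (h (compose (topspace H) g k t))) = (\<lambda>t\<in>topspace H. fst (compose (topspace F') h g (k t)))"
    using e by (intro restrict_ext) simp
  finally show "FArr X F' H k m (FArr X F F' g m w) = pull H (\<lambda>t\<in>topspace H. fst (compose (topspace F') h g (k t))) m \<phi>" .
qed

text \<open>Different arrows may become equal after composition with \<open>\<xi>\<close>. So
  \<open>H\<close> is cut by the arrow component of \<open>h\<close> itself, and the two elements
  are compared on these finer fibres.\<close>

lemma section_Act:
  assumes w: "is_section F m h w" and F: "F \<in> Obj (Extr \<kappa>)" and h: "h \<in> Val (FObj Y F) m" and \<xi>: "\<xi> \<in> Arr Box l m"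
  shows "is_section F l (Act (FObj Y F) l m \<xi> h) (Act (FObj X F) l m \<xi> w)"
  unfolding is_section_def
proof (intro conjI ballI impI)
  note wV = is_sectionD(1)[OF w]
  let ?h = "Act (FObj Y F) l m \<xi> h"
  show aV: "Act (FObj X F) l m \<xi> w \<in> Val (FObj X F) l"
    by (rule is_presheafD(1)[OF condensed_ObjD(1)[OF X F F] _ _ \<xi> wV]) simp_all
  fix H k \<phi> assume H: "H \<in> Obj (Extr \<kappa>)" and k: "k \<in> Arr (Extr \<kappa>) H F" and \<phi>: "\<phi> \<in> Arr Box l n"
    and c: "\<forall>t\<in>topspace H. snd (?h (k t)) = \<phi>"
  let ?s = "\<lambda>t. snd (h (k t))" let ?f = "\<lambda>t\<in>topspace H. fst (h (k t))"
  have f: "(\<lambda>t\<in>topspace H. fst (?h (k t))) = ?f"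
    unfolding yoneda_Act using Extr_ArrD(1)[OF k] by (intro restrict_ext) simp
  have fA: "?f \<in> Arr (Extr \<kappa>) H E" by (rule base_map_Arr[OF h k])
  have c': "Cmp Box l m n (?s t) \<xi> = \<phi>" if "t \<in> topspace H" for t
    using bspec[OF c that] Extr_ArrD(1)[OF k that] unfolding yoneda_Act by simp
  have s: "continuous_map H (discrete_topology (Arr Box m n)) ?s"
    using continuous_map_compose[OF Extr_ArrD(2)[OF k] yoneda_ValD(4)[OF h]] unfolding comp_def .
  note fib = fibre_Extr[OF H s]
  have kw: "FArr X F H k m w \<in> Val (FObj X H) m" by (rule presheaf_homD(1)[OF condensed_ObjD(2)[OF X F H k] _ wV]) simp
  let ?u = "FArr X F H k l (Act (FObj X F) l m \<xi> w)" let ?v = "pull H ?f l \<phi>"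
  have uV: "?u \<in> Val (FObj X H) l" by (rule presheaf_homD(1)[OF condensed_ObjD(2)[OF X F H k] _ aV]) simp
  have vV: "?v \<in> Val (FObj X H) l" by (rule pull_Val[OF H fA \<phi>])
  have fibV: "FArr X H (fibre H ?s a) (fibre_incl H ?s a) l ?v \<in> Val (FObj X (fibre H ?s a)) l" for a
    by (rule presheaf_homD(1)[OF condensed_ObjD(2)[OF X H fib] _ vV]) simp
  have eq: "FArr X H (fibre H ?s a) (fibre_incl H ?s a) l ?u = FArr X H (fibre H ?s a) (fibre_incl H ?s a) l ?v"
    if a: "a \<in> Arr Box m n" for a
  \<comment> \<open>On an empty fibre the composite of \<open>a\<close> with \<open>\<xi>\<close>
    need not be \<open>\<phi>\<close>, but there any two values agree.\<close>
  proof (cases "topspace (fibre H ?s a) = {}")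
    case True
    show ?thesis
      by (rule empty_value_unique[OF X fib(1) True Obj_Box presheaf_homD(1)[OF condensed_ObjD(2)[OF X H fib] Obj_Box uV] fibV])
  next
    case False
    then obtain t where "t \<in> topspace H" "?s t = a" by auto
    then have a\<xi>: "Cmp Box l m n a \<xi> = \<phi>" using c' by blast
    let ?k = "compose (topspace (fibre H ?s a)) k (fibre_incl H ?s a)"
    let ?fa = "compose (topspace (fibre H ?s a)) ?f (fibre_incl H ?s a)"
    have faA: "?fa \<in> Arr (Extr \<kappa>) (fibre H ?s a) E" by (rule Extr_compose_Arr[OF fA fib(2)])
    have u1: "?u = Act (FObj X H) l m \<xi> (FArr X F H k m w)"
      by (rule presheaf_homD(3)[OF condensed_ObjD(2)[OF X F H k] _ _ \<xi> wV]) simp_all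
    have "FArr X H (fibre H ?s a) (fibre_incl H ?s a) l ?u =
      Act (FObj X (fibre H ?s a)) l m \<xi> (FArr X H (fibre H ?s a) (fibre_incl H ?s a) m (FArr X F H k m w))"
      unfolding u1 by (rule presheaf_homD(3)[OF condensed_ObjD(2)[OF X H fib] _ _ \<xi> kw]) simp_all
    also have "FArr X H (fibre H ?s a) (fibre_incl H ?s a) m (FArr X F H k m w) = FArr X F (fibre H ?s a) ?k m w"
      by (rule condensed_ObjD(4)[OF X F H fib(1) k fib(2) Obj_Box wV, symmetric])
    also have "\<dots> = pull (fibre H ?s a) (\<lambda>t\<in>topspace (fibre H ?s a). fst (h (?k t))) m a"
      by (rule is_sectionD(2)[OF w fib(1) Extr_compose_Arr[OF k fib(2)] a]) (simp add: compose_def fibre_incl_def)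
    also have "(\<lambda>t\<in>topspace (fibre H ?s a). fst (h (?k t))) = ?fa"
      unfolding compose_def by (intro restrict_ext) (simp add: fibre_incl_def)
    also have "Act (FObj X (fibre H ?s a)) l m \<xi> (pull (fibre H ?s a) ?fa m a) = pull (fibre H ?s a) ?fa l \<phi>"
      unfolding pull_Act[OF fib(1) faA a \<xi>] a\<xi> ..
    also have "\<dots> = FArr X H (fibre H ?s a) (fibre_incl H ?s a) l ?v"
      by (rule pull_FArr[OF H fib(1) fA fib(2) \<phi>, symmetric])
    finally show ?thesis .
  qed
  have "\<exists>!x. x \<in> Val (FObj X H) l \<and> (\<forall>a\<in>Arr Box m n. FArr X H (fibre H ?s a) (fibre_incl H ?s a) l x =
     FArr X H (fibre H ?s a) (fibre_incl H ?s a) l ?v)"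
    by (rule glue_fibres[OF X H s finite_Arr_Box Obj_Box fibV])
  then have "?u = ?v" using eq uV vV by (elim ex1E) metis
  then show "FArr X F H k l (Act (FObj X F) l m \<xi> w) = pull H (\<lambda>t\<in>topspace H. fst (?h (k t))) l \<phi>"
    unfolding f .
qed

lemma section_universal_point: "is_section E n (universal_point E n) z"
  unfolding is_section_def
proof (intro conjI ballI impI z)
  fix H k \<phi> assume H: "H \<in> Obj (Extr \<kappa>)" and k: "k \<in> Arr (Extr \<kappa>) H E" and \<phi>: "\<phi> \<in> Arr Box n n"
    and c: "\<forall>t\<in>topspace H. snd (universal_point E n (k t)) = \<phi>"
  let ?f = "\<lambda>t\<in>topspace H. fst (universal_point E n (k t))"
  have "?f = (\<lambda>t\<in>topspace H. k t)" unfolding universal_point_def using Extr_ArrD(1)[OF k] by (intro restrict_ext) simp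
  then have f: "?f = k" using k unfolding Extr_Arr_iff by (simp add: PiE_iff extensional_restrict)
  have v: "FArr X E H k n z \<in> Val (FObj X H) n" by (rule presheaf_homD(1)[OF condensed_ObjD(2)[OF X E H k] _ z]) simp
  show "FArr X E H k n z = pull H ?f n \<phi>"
  \<comment> \<open>Only on a nonempty space does the hypothesis force \<open>\<phi>\<close> to be
    the identity.\<close>
  proof (cases "topspace H = {}")
    case True
    show ?thesis unfolding f by (rule empty_value_unique[OF X H True Obj_Box v pull_Val[OF H k \<phi>]])
  next
    case False
    then have "\<phi> = Idn Box n" using c Extr_ArrD(1)[OF k] unfolding universal_point_def by fastforce
    then have "pull H k n \<phi> = FArr X E H k n z"
      unfolding pull_def using is_presheafD(2)[OF condensed_ObjD(1)[OF X H H] Obj_Box Obj_Box id_Arr_Box v] by simp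
    then show ?thesis unfolding f by simp
  qed
qed

definition evaluation :: "'k topology \<Rightarrow> nat \<Rightarrow> ('k \<Rightarrow> 'k \<times> ((nat \<Rightarrow> int) \<Rightarrow> (nat \<Rightarrow> int))) \<Rightarrow> 'a" where
  "evaluation F m h = (THE w. is_section F m h w)"

lemma evaluation_eqI: "F \<in> Obj (Extr \<kappa>) \<Longrightarrow> h \<in> Val (FObj Y F) m \<Longrightarrow> is_section F m h w \<Longrightarrow> evaluation F m h = w"
  unfolding evaluation_def by (rule the1_equality[OF section_ex1])

lemma evaluation_section: "F \<in> Obj (Extr \<kappa>) \<Longrightarrow> h \<in> Val (FObj Y F) m \<Longrightarrow> is_section F m h (evaluation F m h)"
  unfolding evaluation_def by (rule theI'[OF section_ex1])

lemma evaluation_Arr: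
  assumes inj: "\<And>F m. F \<in> Obj (Extr \<kappa>) \<Longrightarrow> m \<in> Obj Box \<Longrightarrow> inj_on (e F m) (Val (FObj Y F) m)"
  obtains \<eta> where "\<eta> \<in> Arr (cubespaces \<kappa>) (transport Box e Y) X"
    "\<And>F m h. F \<in> Obj (Extr \<kappa>) \<Longrightarrow> h \<in> Val (FObj Y F) m \<Longrightarrow> \<eta> F m (e F m h) = evaluation F m h"
proof -
  have 1: "evaluation F m h \<in> Val (FObj X F) m" if "F \<in> Obj (Extr \<kappa>)" "m \<in> Obj Box" "h \<in> Val (FObj Y F) m" for F m h
    by (rule is_sectionD(1)[OF evaluation_section[OF that(1,3)]])
  have 2: "evaluation F l (Act (FObj Y F) l m \<xi> h) = Act (FObj X F) l m \<xi> (evaluation F m h)"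
    if "F \<in> Obj (Extr \<kappa>)" "l \<in> Obj Box" "m \<in> Obj Box" "\<xi> \<in> Arr Box l m" "h \<in> Val (FObj Y F) m" for F l m \<xi> h
    by (rule evaluation_eqI[OF that(1) yoneda_Act_Val[OF that(5,4)] section_Act[OF evaluation_section[OF that(1,5)] that(1,5,4)]])
  have 3: "evaluation F' m (FArr Y F F' g m h) = FArr X F F' g m (evaluation F m h)"
    if "F \<in> Obj (Extr \<kappa>)" "F' \<in> Obj (Extr \<kappa>)" "g \<in> Arr (Extr \<kappa>) F' F" "m \<in> Obj Box" "h \<in> Val (FObj Y F) m" for F F' g m h
    unfolding yoneda_FArr[OF that(5)]
    by (rule evaluation_eqI[OF that(2) yoneda_pull_Val[OF that(5,3)] section_FArr[OF evaluation_section[OF that(1,5)] that(1,2,3)]])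
  show thesis
    by (rule transport_Arr[where Y = Y and B = Box and e = e and X = X and \<Phi> = evaluation and \<kappa> = \<kappa>])
      (use yoneda_Obj inj X 1 2 3 that in auto)
qed

end

text \<open>A morphism carries the values forced by \<open>z\<close> to those forced by its image,
  so uniqueness of sections gives naturality in \<open>X\<close>.\<close>

lemma evaluation_hom:
  assumes "yoneda_map \<kappa> X E n z" and X': "X' \<in> Obj (cubespaces \<kappa>)" and \<eta>: "\<eta> \<in> Arr (cubespaces \<kappa>) X X'"
    and F: "F \<in> Obj (Extr \<kappa>)" and h: "h \<in> Val (FObj (yoneda E n) F) m"
  shows "yoneda_map.evaluation \<kappa> X' E n (\<eta> E n z) F m h = \<eta> F m (yoneda_map.evaluation \<kappa> X E n z F m h)"
proof -
  interpret yoneda_map \<kappa> X E n z by fact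
  note A = \<eta>[unfolded condensed_Arr_iff[OF X X']]
  have hom: "\<eta> F \<in> presheaf_hom Box (FObj X F) (FObj X' F)" if "F \<in> Obj (Extr \<kappa>)" for F using A that by blast
  have nat: "\<eta> G m (FArr X F G g m a) = FArr X' F G g m (\<eta> F m a)"
    if "F \<in> Obj (Extr \<kappa>)" "G \<in> Obj (Extr \<kappa>)" "g \<in> Arr (Extr \<kappa>) G F" "a \<in> Val (FObj X F) m" for F G g m a
    using A that by simp
  interpret X': yoneda_map \<kappa> X' E n "\<eta> E n z"
    by unfold_locales (use X' E presheaf_homD(1)[OF hom[OF E] Obj_Box z] in simp_all)
  note w = evaluation_section[OF F h]
  note wV = is_sectionD(1)[OF w]
  show ?thesis
  proof (rule X'.evaluation_eqI[OF F h])
    show "X'.is_section F m h (\<eta> F m (evaluation F m h))" unfolding X'.is_section_def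
    proof (intro conjI ballI impI)
      show "\<eta> F m (evaluation F m h) \<in> Val (FObj X' F) m" by (rule presheaf_homD(1)[OF hom[OF F] Obj_Box wV])
      fix H k \<phi> assume H: "H \<in> Obj (Extr \<kappa>)" and k: "k \<in> Arr (Extr \<kappa>) H F" and \<phi>: "\<phi> \<in> Arr Box m n"
        and c: "\<forall>t\<in>topspace H. snd (h (k t)) = \<phi>"
      let ?f = "\<lambda>t\<in>topspace H. fst (h (k t))"
      have fA: "?f \<in> Arr (Extr \<kappa>) H E" by (rule base_map_Arr[OF h k])
      have v: "FArr X E H ?f n z \<in> Val (FObj X H) n" by (rule presheaf_homD(1)[OF condensed_ObjD(2)[OF X E H fA] Obj_Box z])
      have "FArr X' F H k m (\<eta> F m (evaluation F m h)) = \<eta> H m (FArr X F H k m (evaluation F m h))"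
        by (rule nat[OF F H k wV, symmetric])
      also have "FArr X F H k m (evaluation F m h) = pull H ?f m \<phi>"
        by (rule is_sectionD(2)[OF w H k \<phi>]) (use c in blast)
      also have "\<eta> H m (pull H ?f m \<phi>) = Act (FObj X' H) m n \<phi> (\<eta> H n (FArr X E H ?f n z))"
        unfolding pull_def by (rule presheaf_homD(3)[OF hom[OF H] Obj_Box Obj_Box \<phi> v])
      also have "\<eta> H n (FArr X E H ?f n z) = FArr X' E H ?f n (\<eta> E n z)" by (rule nat[OF E H fA z])
      finally show "FArr X' F H k m (\<eta> F m (evaluation F m h)) = X'.pull H ?f m \<phi>" unfolding X'.pull_def .
    qed
  qed
qed

text \<open>A limit cone is tested against the condensed cubesets represented by \<open>(E, n)\<close>: maps out of them
  are the elements of \<open>X(E)(n)\<close>. The strong limit hypothesis keeps their values inside the universe.\<close>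

theorem limit_is_pointwise:
  fixes \<kappa> :: "'k rel" and G :: "('j, 'i, ('k, 'a) cubespace, 'k topology \<Rightarrow> nat \<Rightarrow> 'a \<Rightarrow> 'a) cfunctor"
  assumes \<kappa>: "uncountable_strong_limit \<kappa>" "\<kappa> \<le>o |UNIV :: 'a set|"
    and G: "is_functor J (cubespaces \<kappa>) G" and lim: "is_limit_cone J (cubespaces \<kappa>) G L \<pi>"
  shows "is_pointwise_limit J \<kappa> Box G L \<pi>"
  unfolding is_pointwise_limit_def
proof (intro ballI allI impI)
  fix E n z assume E: "E \<in> Obj (Extr \<kappa>)" and z: "\<forall>j\<in>Obj J. z j \<in> Val (FObj (FObj G j) E) n"
    and zc: "\<forall>i\<in>Obj J. \<forall>j\<in>Obj J. \<forall>f\<in>Arr J i j. FArr G i j f E n (z i) = z j"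
  have cone: "is_cone J (cubespaces \<kappa>) G L \<pi>"
    and un: "\<And>M \<mu>. is_cone J (cubespaces \<kappa>) G M \<mu> \<Longrightarrow>
        (\<exists>!h. h \<in> Arr (cubespaces \<kappa>) M L \<and> (\<forall>j\<in>Obj J. Cmp (cubespaces \<kappa>) M L (FObj G j) (\<pi> j) h = \<mu> j))"
    using lim unfolding is_limit_cone_def by blast+
  note c = cone[unfolded condensed_cone_iff[OF G]]
  have L: "L \<in> Obj (cubespaces \<kappa>)" using c by blast
  have Gj: "FObj G j \<in> Obj (cubespaces \<kappa>)" and \<pi>: "\<pi> j \<in> Arr (cubespaces \<kappa>) L (FObj G j)" if "j \<in> Obj J" for j
    using c that is_functorD(1)[OF G] by blast+
  have "\<forall>F m. \<exists>e :: _ \<Rightarrow> 'a. F \<in> Obj (Extr \<kappa>) \<longrightarrow> inj_on e (Val (FObj (yoneda E n) F) m)"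
    using yoneda_encoding[OF \<kappa> E] by blast
  then obtain e :: "'k topology \<Rightarrow> nat \<Rightarrow> _ \<Rightarrow> 'a" where e: "\<And>F m. F \<in> Obj (Extr \<kappa>) \<Longrightarrow> inj_on (e F m) (Val (FObj (yoneda E n) F) m)"
    by metis
  let ?T = "transport Box e (yoneda E n)"
  have T: "?T \<in> Obj (cubespaces \<kappa>)" by (rule transport_Obj[OF yoneda_Obj e])
  have TV: "Val (FObj ?T F) m = e F m ` Val (FObj (yoneda E n) F) m" for F m unfolding transport_def by simp
  have ym: "yoneda_map \<kappa> (FObj G j) E n (z j)" if "j \<in> Obj J" for j
    by unfold_locales (use Gj[OF that] E z that in simp_all)
  have "\<exists>\<eta>. \<eta> \<in> Arr (cubespaces \<kappa>) ?T (FObj G j) \<and> (\<forall>F\<in>Obj (Extr \<kappa>). \<forall>m. \<forall>h\<in>Val (FObj (yoneda E n) F) m.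
     \<eta> F m (e F m h) = yoneda_map.evaluation \<kappa> (FObj G j) E n (z j) F m h)" if j: "j \<in> Obj J" for j
    by (rule yoneda_map.evaluation_Arr[OF ym[OF j] e]) blast+
  then obtain \<mu> where \<mu>: "\<And>j. j \<in> Obj J \<Longrightarrow> \<mu> j \<in> Arr (cubespaces \<kappa>) ?T (FObj G j)"
    "\<And>j F m h. j \<in> Obj J \<Longrightarrow> F \<in> Obj (Extr \<kappa>) \<Longrightarrow> h \<in> Val (FObj (yoneda E n) F) m \<Longrightarrow>
       \<mu> j F m (e F m h) = yoneda_map.evaluation \<kappa> (FObj G j) E n (z j) F m h"
    by metis
  let ?\<mu> = "\<lambda>j\<in>Obj J. \<mu> j"
  \<comment> \<open>The compatible family \<open>z\<close> has become a cone whose apex is the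
    renamed representable.\<close>
  have "is_cone J (cubespaces \<kappa>) G ?T ?\<mu>"
    unfolding condensed_cone_iff[OF G]
  proof (intro conjI ballI T)
    show "?\<mu> j \<in> Arr (cubespaces \<kappa>) ?T (FObj G j)" if "j \<in> Obj J" for j using \<mu>(1) that by simp
    fix i j f F m a assume ij: "i \<in> Obj J" "j \<in> Obj J" "f \<in> Arr J i j" and F: "F \<in> Obj (Extr \<kappa>)" and "a \<in> Val (FObj ?T F) m"
    then obtain h where h: "h \<in> Val (FObj (yoneda E n) F) m" "a = e F m h" unfolding TV by blast
    have "FArr G i j f E n (z i) = z j" using zc ij by blast
    then show "FArr G i j f F m (?\<mu> i F m a) = ?\<mu> j F m a"
      using evaluation_hom[OF ym[OF ij(1)] Gj[OF ij(2)] is_functorD(2)[OF G ij] F h(1)]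
        \<mu>(2)[OF ij(1) F h(1)] \<mu>(2)[OF ij(2) F h(1)] ij h(2) by simp
  qed simp
  then have ex1: "\<exists>!g. g \<in> Arr (cubespaces \<kappa>) ?T L \<and> (\<forall>j\<in>Obj J. Cmp (cubespaces \<kappa>) ?T L (FObj G j) (\<pi> j) g = ?\<mu> j)"
    by (rule un)
  obtain g where gq: "g \<in> Arr (cubespaces \<kappa>) ?T L \<and> (\<forall>j\<in>Obj J. Cmp (cubespaces \<kappa>) ?T L (FObj G j) (\<pi> j) g = ?\<mu> j)"
    using ex1_implies_ex[OF ex1] by (rule exE)
  have g: "g \<in> Arr (cubespaces \<kappa>) ?T L" "\<And>j. j \<in> Obj J \<Longrightarrow> Cmp (cubespaces \<kappa>) ?T L (FObj G j) (\<pi> j) g = \<mu> j"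
    using gq by simp_all
  have g_un: "g' = g" if "g' \<in> Arr (cubespaces \<kappa>) ?T L" and c': "\<And>j. j \<in> Obj J \<Longrightarrow> Cmp (cubespaces \<kappa>) ?T L (FObj G j) (\<pi> j) g' = \<mu> j" for g'
  proof -
    have q: "g' \<in> Arr (cubespaces \<kappa>) ?T L \<and> (\<forall>j\<in>Obj J. Cmp (cubespaces \<kappa>) ?T L (FObj G j) (\<pi> j) g' = ?\<mu> j)"
      by (intro conjI ballI that(1)) (simp add: c')
    show ?thesis by (rule trans[OF the1_equality[OF ex1, OF q, symmetric] the1_equality[OF ex1, OF gq]])
  qed
  let ?p = "universal_point E n"
  note pV = universal_point_Val[of E n]
  have eval_p: "yoneda_map.evaluation \<kappa> X E n x E n ?p = x" if y: "yoneda_map \<kappa> X E n x" for X :: "('k, 'a) cubespace" and x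
    by (rule yoneda_map.evaluation_eqI[OF y E pV yoneda_map.section_universal_point[OF y]])
  have gc: "\<pi> j F m (g F m a) = \<mu> j F m a" if "j \<in> Obj J" "F \<in> Obj (Extr \<kappa>)" "a \<in> Val (FObj ?T F) m" for j F m a
    using g(2)[OF that(1)] that(2,3) unfolding condensed_Cmp_eq_iff[OF T Gj[OF that(1)] \<mu>(1)[OF that(1)]] by simp
  have epV: "e E n ?p \<in> Val (FObj ?T E) n" unfolding TV using pV by blast
  have gE: "g E \<in> presheaf_hom Box (FObj ?T E) (FObj L E)" using g(1) E unfolding condensed_Arr_iff[OF T L] by blast
  show "\<exists>!l. l \<in> Val (FObj L E) n \<and> (\<forall>j\<in>Obj J. \<pi> j E n l = z j)"
  \<comment> \<open>The element sought is the image of the universal point under the mediating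
    map.\<close>
  proof (rule ex1I[of _ "g E n (e E n ?p)"])
    show "g E n (e E n ?p) \<in> Val (FObj L E) n \<and> (\<forall>j\<in>Obj J. \<pi> j E n (g E n (e E n ?p)) = z j)"
      using presheaf_homD(1)[OF gE Obj_Box epV] gc[OF _ E epV] \<mu>(2)[OF _ E pV] eval_p[OF ym] by simp
    fix l assume l: "l \<in> Val (FObj L E) n \<and> (\<forall>j\<in>Obj J. \<pi> j E n l = z j)"
    \<comment> \<open>Another solution \<open>l\<close> yields another mediating map, hence the same
      one; evaluation at the universal point recovers \<open>l\<close>.\<close>
    have yl: "yoneda_map \<kappa> L E n l" by unfold_locales (use L E l in simp_all)
    obtain g' where g': "g' \<in> Arr (cubespaces \<kappa>) ?T L"
      "\<And>F m h. F \<in> Obj (Extr \<kappa>) \<Longrightarrow> h \<in> Val (FObj (yoneda E n) F) m \<Longrightarrow> g' F m (e F m h) = yoneda_map.evaluation \<kappa> L E n l F m h"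
      by (rule yoneda_map.evaluation_Arr[OF yl e]) blast+
    have "Cmp (cubespaces \<kappa>) ?T L (FObj G j) (\<pi> j) g' = \<mu> j" if j: "j \<in> Obj J" for j
      unfolding condensed_Cmp_eq_iff[OF T Gj[OF j] \<mu>(1)[OF j]]
    proof (intro ballI)
      fix F m a assume F: "F \<in> Obj (Extr \<kappa>)" and "a \<in> Val (FObj ?T F) m"
      then obtain h where h: "h \<in> Val (FObj (yoneda E n) F) m" "a = e F m h" unfolding TV by blast
      have "\<pi> j E n l = z j" using l j by blast
      then show "\<pi> j F m (g' F m a) = \<mu> j F m a"
        using evaluation_hom[OF yl Gj[OF j] \<pi>[OF j] F h(1)] g'(2)[OF F h(1)] \<mu>(2)[OF j F h(1)] h(2) by simp
    qed
    then have "g' = g" by (rule g_un[OF g'(1)])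
    then show "l = g E n (e E n ?p)" using g'(2)[OF E pV] eval_p[OF yl] by simp
  qed
qed

section \<open>The isomorphism of condensed groups\<close>

text \<open>Passes from classes of cubes to classes of simplices by equality of top vertices,
  without choosing representatives.\<close>

definition match_classes :: "'y set \<Rightarrow> ('y \<Rightarrow> 'p) \<Rightarrow> ('x \<Rightarrow> 'p) \<Rightarrow> 'x set \<Rightarrow> 'y set" where
  "match_classes A' t' t S = {a' \<in> A'. \<exists>a\<in>S. t' a' = t a}"

lemma match_classes_cls:
  assumes "quotient_model A t U e P R Pr" "quotient_model A' t' U e P R' Pr'"
  shows "match_classes A' t' t (quotient_model.cls A t e p) = quotient_model.cls A' t' e p"
proof -
  interpret M: quotient_model A t U e P R Pr by fact
  interpret M': quotient_model A' t' U e P R' Pr' by fact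
  have "\<exists>a\<in>A. t a = t' a'" if "a' \<in> A'" for a' using M.t_onto[OF M'.t_U[OF that]] by metis
  then show ?thesis unfolding match_classes_def M.cls_def M'.cls_def by (auto; metis)
qed

text \<open>Both multiplications are evaluated by \<open>mult_cls\<close> from the same relation
  \<open>P\<close> on top vertices.\<close>

lemma match_classes_iso:
  assumes M: "quotient_model A t U e P R Pr" and M': "quotient_model A' t' U e P R' Pr'"
    and G: "carrier G = A // R" "\<And>S T. mult G S T = (THE Q. Q \<in> A // R \<and> (\<exists>c\<in>S. \<exists>d\<in>T. \<exists>e\<in>Q. Pr c d e))"
    and G': "carrier G' = A' // R'" "\<And>S T. mult G' S T = (THE Q. Q \<in> A' // R' \<and> (\<exists>c\<in>S. \<exists>d\<in>T. \<exists>e\<in>Q. Pr' c d e))"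
  shows "match_classes A' t' t \<in> iso G G'"
proof -
  interpret M: quotient_model A t U e P R Pr by fact
  interpret M': quotient_model A' t' U e P R' Pr' by fact
  note \<psi> = match_classes_cls[OF M M']
  have bij: "bij_betw (match_classes A' t' t) (carrier G) (carrier G')"
    unfolding G(1) G'(1) M.quotient_eq M'.quotient_eq
  proof (rule bij_betw_imageI)
    show "inj_on (match_classes A' t' t) (M.cls ` U)"
    proof (rule inj_onI, elim imageE)
      fix S T p q assume *: "match_classes A' t' t S = match_classes A' t' t T" "S = M.cls p" "T = M.cls q" "p \<in> U" "q \<in> U"
      then show "S = T" unfolding *(2,3) \<psi> M'.cls_eq_iff[OF *(4,5)] M.cls_eq_iff[OF *(4,5)] by simp
    qed
    show "match_classes A' t' t ` M.cls ` U = M'.cls ` U" by (simp add: image_image \<psi>)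
  qed
  have "match_classes A' t' t (mult G S T) = mult G' (match_classes A' t' t S) (match_classes A' t' t T)"
    if ST: "S \<in> carrier G" "T \<in> carrier G" for S T
  proof -
    obtain p q where pq: "p \<in> U" "S = M.cls p" "q \<in> U" "T = M.cls q" using ST unfolding G(1) M.quotient_eq by blast
    obtain r where r: "r \<in> U" "P p q r" using M.P_ex[OF pq(1,3)] by blast
    show ?thesis unfolding pq(2,4) \<psi> G(2) G'(2) M.mult_cls[OF pq(1,3) r] M'.mult_cls[OF pq(1,3) r] ..
  qed
  then have "match_classes A' t' t \<in> hom G G'" unfolding hom_def using bij_betwE[OF bij] by blast
  then show ?thesis unfolding iso_def using bij by blast
qed

text \<open>On classes described by top vertices the induced map is just \<open>u\<close>. The image
  of a class may be smaller than a class, and saturation by \<open>R'\<close> completes it.\<close>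

lemma cls_image:
  assumes "quotient_model A t U e P R Pr" "quotient_model B s V d P' R' Pr'"
    and a: "\<And>x. x \<in> A \<Longrightarrow> a x \<in> B" "\<And>x. x \<in> A \<Longrightarrow> s (a x) = u (t x)" and u: "\<And>p q. e p q \<Longrightarrow> d (u p) (u q)"
    and p: "p \<in> U"
  shows "R' `` (a ` quotient_model.cls A t e p) = quotient_model.cls B s d (u p)"
proof -
  interpret M: quotient_model A t U e P R Pr by fact
  interpret N: quotient_model B s V d P' R' Pr' by fact
  obtain y where y: "y \<in> M.cls p" "y \<in> A" "t y = p" using M.cls_nonempty[OF p] .
  show ?thesis
  proof (intro equalityI subsetI)
    fix b assume "b \<in> R' `` (a ` M.cls p)"
    then obtain x where x: "x \<in> M.cls p" "(a x, b) \<in> R'" by blast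
    then have "d (u p) (u (t x))" "x \<in> A" using u unfolding M.cls_def by simp_all
    moreover have "b \<in> B" "d (s (a x)) (s b)" using x(2) unfolding N.R by simp_all
    ultimately show "b \<in> N.cls (u p)" unfolding N.cls_def using N.trans a(2)[of x] by fastforce
  next
    fix b assume b: "b \<in> N.cls (u p)"
    then have "(a y, b) \<in> R'" unfolding N.R N.cls_def using a[OF y(2)] y(3) by simp
    then show "b \<in> R' `` (a ` M.cls p)" using y(1) by blast
  qed
qed

lemma hom_vertex_cube:
  assumes \<eta>: "\<eta> \<in> presheaf_hom Box X Y" and c: "c \<in> Val X n" and v: "v \<in> cube n"
  shows "vertex Y n (\<eta> n c) v = \<eta> 0 (vertex X n c v)"
  unfolding vertex_def by (rule presheaf_homD(3)[OF \<eta> _ _ const_Arr_Box[OF v] c, symmetric]) simp_all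

lemma hom_pointed_cube:
  assumes \<eta>: "\<eta> \<in> presheaf_hom Box X Y" and c: "c \<in> pointed_cubes X n x"
  shows "\<eta> n c \<in> pointed_cubes Y n (\<eta> 0 x)" "vertex Y n (\<eta> n c) (ones n) = \<eta> 0 (vertex X n c (ones n))"
proof -
  have cV: "c \<in> Val X n" using c unfolding pointed_cubes_def by blast
  note vert = hom_vertex_cube[OF \<eta> cV]
  show "\<eta> n c \<in> pointed_cubes Y n (\<eta> 0 x)"
    unfolding pointed_cubes_def using presheaf_homD(1)[OF \<eta> _ cV] vert c unfolding pointed_cubes_def by simp
  show "vertex Y n (\<eta> n c) (ones n) = \<eta> 0 (vertex X n c (ones n))" by (rule vert) simp
qed

lemma kval_Kstar_FArr:
  assumes "\<theta> \<in> presheaf_hom Box (K n) X" "B \<in> Sub n"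
  shows "kval (FArr Kstar X Y \<eta> n \<theta>) B = \<eta> 0 (kval \<theta> B)"
  unfolding Kstar_FArr kval_def using assms(1) K_Val_const[OF assms(2)] by simp

lemma hom_pointed_simplex:
  assumes fX: "fibrant_presheaf X" and fY: "fibrant_presheaf Y" and \<eta>: "\<eta> \<in> presheaf_hom Box X Y" and x: "x \<in> Val X 0"
    and s: "s \<in> pointed_simplices (FObj Kstar X) (Suc m) (Kstar_point X x)"
  shows "FArr Kstar X Y \<eta> (Suc m) s \<in> pointed_simplices (FObj Kstar Y) (Suc m) (Kstar_point Y (\<eta> 0 x))"
    "kval (FArr Kstar X Y \<eta> (Suc m) s) {..Suc m} = \<eta> 0 (kval s {..Suc m})"
proof -
  interpret X: fibrant_presheaf X by fact
  interpret Y: fibrant_presheaf Y by fact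
  have y: "\<eta> 0 x \<in> Val Y 0" by (rule presheaf_homD(1)[OF \<eta> _ x]) simp
  note sX = s[unfolded X.pointed_simplices_iff[OF x]]
  note val = kval_Kstar_FArr[OF sX[THEN conjunct1]]
  have "FArr Kstar X Y \<eta> (Suc m) s \<in> presheaf_hom Box (K (Suc m)) Y"
    using presheaf_homD(1)[OF Kstar_FArr_hom[OF \<eta>], of "Suc m" s] sX unfolding Val_Kstar by simp
  then show "FArr Kstar X Y \<eta> (Suc m) s \<in> pointed_simplices (FObj Kstar Y) (Suc m) (Kstar_point Y (\<eta> 0 x))"
    unfolding Y.pointed_simplices_iff[OF y] using sX val by simp
  show "kval (FArr Kstar X Y \<eta> (Suc m) s) {..Suc m} = \<eta> 0 (kval s {..Suc m})" by (rule val) simp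
qed

lemma hom_peq:
  assumes "fibrant_presheaf X" "fibrant_presheaf Y" and \<eta>: "\<eta> \<in> presheaf_hom Box X Y"
    and pq: "cube_system.peq (cubes X) x m p q"
  shows "cube_system.peq (cubes Y) (\<eta> 0 x) m (\<eta> 0 p) (\<eta> 0 q)"
proof -
  interpret X: fibrant_presheaf X by fact
  interpret Y: fibrant_presheaf Y by fact
  obtain k c where c: "c \<in> Val X k" "\<And>y. (if \<forall>i<Suc m. y i then if y (Suc m) then q else p else x) = vertex X k c (pnt k y)"
    using pq[unfolded X.peq_iff] unfolding cubes_def by blast
  have "(\<lambda>y. if \<forall>i<Suc m. y i then if y (Suc m) then \<eta> 0 q else \<eta> 0 p else \<eta> 0 x) = (\<lambda>y. vertex Y k (\<eta> k c) (pnt k y))"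
    unfolding hom_vertex_cube[OF \<eta> c(1) pnt_in_cube] c(2)[symmetric] by (rule ext) auto
  then show ?thesis unfolding Y.peq_iff using Y.vertex_in_cubes[OF presheaf_homD(1)[OF \<eta> _ c(1)]] by simp
qed

lemma condensed_group_iso:
  assumes X: "X \<in> Obj (cubespaces \<kappa>)" and conc: "concrete \<kappa> X" and fib: "fibrant \<kappa> X"
    and x0: "\<And>E. E \<in> Obj (Extr \<kappa>) \<Longrightarrow> x E \<in> Val (FObj X E) 0"
    and nat: "\<And>E F f. E \<in> Obj (Extr \<kappa>) \<Longrightarrow> F \<in> Obj (Extr \<kappa>) \<Longrightarrow> f \<in> Arr (Extr \<kappa>) F E \<Longrightarrow> FArr X E F f 0 (x E) = x F"
    and y: "\<And>E. E \<in> Obj (Extr \<kappa>) \<Longrightarrow> y E = Kstar_point (FObj X E) (x E)" and n: "n \<ge> 1"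
  shows "condensed_group_isomorphic \<kappa> (condensed_structure_group X n x)
     (condensed_homotopy_group (FObj (condensed_Kstar \<kappa>) X) n y)"
proof -
  obtain m where m: "n = Suc m" using n by (cases n) auto
  have fX: "fibrant_presheaf (FObj X E)" if "E \<in> Obj (Extr \<kappa>)" for E
    using condensed_ObjD(1)[OF X that that] conc fib that unfolding concrete_def fibrant_def by unfold_locales blast+
  let ?A = "\<lambda>E. pointed_cubes (FObj X E) n (x E)" and ?t = "\<lambda>E c. vertex (FObj X E) n c (ones n)"
  let ?A' = "\<lambda>E. pointed_simplices (FObj Kstar (FObj X E)) n (Kstar_point (FObj X E) (x E))" and ?t' = "\<lambda>s. kval s {..n}"
  let ?e = "\<lambda>E. cube_system.peq (cubes (FObj X E)) (x E) m"
  let ?R = "\<lambda>E. cube_rel (FObj X E) n (x E)" and ?R' = "\<lambda>E. simplex_rel (FObj Kstar (FObj X E)) n (Kstar_point (FObj X E) (x E))"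
  note M = fibrant_presheaf.cube_model[OF fX, of _ m "x _", folded m]
  note M' = fibrant_presheaf.simplex_model[OF fX x0, of _ m, folded m]
  define \<psi> where "\<psi> E = match_classes (?A' E) ?t' (?t E)" for E
  have iso: "\<psi> E \<in> iso (structure_group (FObj X E) n (x E)) (homotopy_group (FObj Kstar (FObj X E)) n (Kstar_point (FObj X E) (x E)))"
    if E: "E \<in> Obj (Extr \<kappa>)" for E
    unfolding \<psi>_def
    by (rule match_classes_iso[OF M[OF E] M'[OF E E]]) (simp_all add: structure_group_def homotopy_group_def)
  \<comment> \<open>Naturality: on top vertices both induced maps are the restriction of points
    along \<open>f\<close>.\<close>
  have "\<psi> F (?R F `` (FArr X E F f n ` S)) = ?R' F `` (FArr Kstar (FObj X E) (FObj X F) (FArr X E F f) n ` \<psi> E S)"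
    if E: "E \<in> Obj (Extr \<kappa>)" and F: "F \<in> Obj (Extr \<kappa>)" and f: "f \<in> Arr (Extr \<kappa>) F E" and S: "S \<in> ?A E // ?R E" for E F f S
  proof -
    note \<eta> = condensed_ObjD(2)[OF X E F f]
    let ?u = "FArr X E F f 0"
    obtain p where p: "p \<in> {p. cube_system.pt (cubes (FObj X E)) (x E) m p}" "S = quotient_model.cls (?A E) (?t E) (?e E) p"
      using S unfolding quotient_model.quotient_eq[OF M[OF E]] by blast
    have u: "?e F (?u q) (?u r)" if "?e E q r" for q r
      using hom_peq[OF fX[OF E] fX[OF F] \<eta> that] unfolding nat[OF E F f] .
    have "?R F `` (FArr X E F f n ` quotient_model.cls (?A E) (?t E) (?e E) p) = quotient_model.cls (?A F) (?t F) (?e F) (?u p)"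
      by (rule cls_image[OF M[OF E] M[OF F] _ _ u p(1)])
        (use hom_pointed_cube[OF \<eta>, of _ n "x E"] nat[OF E F f] in simp_all)
    moreover have "?R' F `` (FArr Kstar (FObj X E) (FObj X F) (FArr X E F f) n ` quotient_model.cls (?A' E) ?t' (?e E) p) =
       quotient_model.cls (?A' F) ?t' (?e F) (?u p)"
      by (rule cls_image[OF M'[OF E E] M'[OF F F] _ _ u p(1)])
        (use hom_pointed_simplex[OF fX[OF E] fX[OF F] \<eta> x0[OF E], of _ m, folded m] nat[OF E F f] in simp_all)
    ultimately show ?thesis
      unfolding p(2) \<psi>_def match_classes_cls[OF M[OF E] M'[OF E E]] by (simp add: match_classes_cls[OF M[OF F] M'[OF F F]])
  qed
  moreover have "\<psi> E S \<in> carrier (homotopy_group (FObj Kstar (FObj X E)) n (Kstar_point (FObj X E) (x E)))"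
    if "E \<in> Obj (Extr \<kappa>)" "S \<in> carrier (structure_group (FObj X E) n (x E))" for E S
    using iso[OF that(1)] that(2) unfolding iso_def by (auto dest: bij_betwE)
  ultimately show ?thesis
    unfolding condensed_group_isomorphic_def op_cat_simps condensed_structure_group_def condensed_homotopy_group_def
      condensed_Kstar_simps cfunctor.select_convs
    by (intro exI[of _ \<psi>]) (use iso y in \<open>simp add: structure_group_def\<close>)
qed

lemma point_naturality:
  fixes \<kappa> :: "'k rel" and X :: "('k, 'a) cubespace"
  assumes X: "X \<in> Obj (cubespaces \<kappa>)" and x0: "x0 \<in> Arr (cubespaces \<kappa>) (point_cubespace \<kappa>) X" and E: "E \<in> Obj (Extr \<kappa>)"
  shows "x0 E \<in> presheaf_hom Box (FObj (point_cubespace \<kappa>) E) (FObj X E)"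
    and "basepoint x0 E \<in> Val (FObj X E) 0"
    and "F \<in> Obj (Extr \<kappa>) \<Longrightarrow> f \<in> Arr (Extr \<kappa>) F E \<Longrightarrow> FArr X E F f 0 (basepoint x0 E) = basepoint x0 F"
proof -
  have pV: "Val (FObj (point_cubespace \<kappa> :: ('k, 'a) cubespace) E) m = {undefined}" for E m unfolding point_cubespace_def by simp
  note A = x0[unfolded condensed_cat_def full_sub_simps functor_cat_simps(4) op_cat_simps presheaf_cat_simps]
  show h: "x0 E \<in> presheaf_hom Box (FObj (point_cubespace \<kappa>) E) (FObj X E)" using A E by auto
  show "basepoint x0 E \<in> Val (FObj X E) 0" unfolding basepoint_def by (rule presheaf_homD(1)[OF h]) (simp_all add: pV)
  assume F: "F \<in> Obj (Extr \<kappa>)" and f: "f \<in> Arr (Extr \<kappa>) F E"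
  have "(\<lambda>m\<in>Obj Box. \<lambda>a\<in>Val (FObj (point_cubespace \<kappa>) E) m. x0 F m (FArr (point_cubespace \<kappa>) E F f m a)) =
     (\<lambda>m\<in>Obj Box. \<lambda>a\<in>Val (FObj (point_cubespace \<kappa>) E) m. FArr X E F f m (x0 E m a))"
    using A E F f by blast
  then have "x0 F 0 (FArr (point_cubespace \<kappa>) E F f 0 undefined) = FArr X E F f 0 (x0 E 0 undefined)"
    unfolding restrict_eq_iff by (simp add: pV)
  then show "FArr X E F f 0 (basepoint x0 E) = basepoint x0 F" unfolding basepoint_def by (simp add: point_cubespace_def)
qed

text \<open>There is only one map from \<open>K 0\<close> to the one-point cubeset, so
  \<open>the_elem\<close> picks it; its image under \<open>x0\<close> is constant at the
  basepoint.\<close>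

lemma image_basepoint_Kstar:
  fixes \<kappa> :: "'k rel" and X :: "('k, 'a) cubespace"
  assumes X: "X \<in> Obj (cubespaces \<kappa>)" and x0: "x0 \<in> Arr (cubespaces \<kappa>) (point_cubespace \<kappa>) X" and E: "E \<in> Obj (Extr \<kappa>)"
  shows "image_basepoint \<kappa> (condensed_Kstar \<kappa>) X x0 E = Kstar_point (FObj X E) (basepoint x0 E)"
proof -
  let ?P = "FObj (point_cubespace \<kappa> :: ('k, 'a) cubespace) E"
  note h = point_naturality(1)[OF assms]
  have pV: "Val ?P m = {undefined}" "Act ?P l m \<phi> a = a" for l m \<phi> a unfolding point_cubespace_def by simp_all
  define \<theta> where "\<theta> = (\<lambda>p. \<lambda>a\<in>Val (K 0) p. (undefined :: 'a))"
  have "presheaf_hom Box (K 0) ?P = {\<theta>}"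
  proof (intro equalityI subsetI)
    fix \<theta>' assume t: "\<theta>' \<in> presheaf_hom Box (K 0) ?P"
    have "(\<lambda>a\<in>Val (K 0) p. \<theta>' p a) = (\<lambda>a\<in>Val (K 0) p. undefined)" for p
      using presheaf_homD(1)[OF t, of p] unfolding pV by (intro restrict_ext) simp
    then show "\<theta>' \<in> {\<theta>}" using hom_restrict[OF t] unfolding \<theta>_def by simp
  next
    fix \<theta>' assume "\<theta>' \<in> {\<theta>}"
    then show "\<theta>' \<in> presheaf_hom Box (K 0) ?P"
      using K_Act by (auto intro!: presheaf_homI simp: \<theta>_def pV)
  qed
  then have the: "the_elem (Val (FObj (FObj (condensed_Kstar \<kappa>) (point_cubespace \<kappa>)) E) 0) = \<theta>"
    and \<theta>: "\<theta> \<in> presheaf_hom Box (K 0) ?P" unfolding condensed_Kstar_simps Val_Kstar by simp_all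
  have "x0 E p (\<theta> p a) = const_cube (FObj X E) p (basepoint x0 E)" if a: "a \<in> Val (K 0) p" for p a
  proof -
    have u: "(\<lambda>_. undefined) \<in> cube 0" by (simp add: cube_0)
    have "x0 E p (Act ?P p 0 (\<lambda>_\<in>cube p. (\<lambda>_. undefined)) undefined) = const_cube (FObj X E) p (x0 E 0 undefined)"
      unfolding const_cube_def by (rule presheaf_homD(3)[OF h _ _ const_Arr_Box[OF u]]) (simp_all add: pV)
    then show ?thesis unfolding basepoint_def using a by (simp add: pV \<theta>_def)
  qed
  then have "(\<lambda>p. \<lambda>a\<in>Val (K 0) p. x0 E p (\<theta> p a)) = Kstar_point (FObj X E) (basepoint x0 E)"
    unfolding Kstar_point_def by (intro ext restrict_ext[THEN fun_cong]) simp
  then show ?thesis unfolding image_basepoint_def the unfolding condensed_Kstar_simps Kstar_FArr using E \<theta> by simp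
qed

theorem mainTheorem1:
  fixes \<kappa> :: "'k rel"
  assumes "uncountable_strong_limit \<kappa>"
    and universe: "\<kappa> \<le>o |UNIV :: 'a set|"
  shows
    "is_functor (cubespaces \<kappa>) (condensed_simplicial_sets \<kappa>)
       (condensed_Kstar \<kappa> :: ('k, 'a, 'a K_map) realization) \<and>
     (\<forall>J :: ('j, 'i) category. is_category J \<longrightarrow>
        preserves_limits_of_shape J (cubespaces \<kappa>) (condensed_simplicial_sets \<kappa>)
          (condensed_Kstar \<kappa> :: ('k, 'a, 'a K_map) realization)) \<and>
     is_faithful (full_sub (cubespaces \<kappa>) (concrete \<kappa>))
       (condensed_Kstar \<kappa> :: ('k, 'a, 'a K_map) realization) \<and>
     (\<forall>X :: ('k, 'a) cubespace. X \<in> Obj (cubespaces \<kappa>) \<and> concrete \<kappa> X \<and> fibrant \<kappa> X \<longrightarrow>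
        condensed_Kan \<kappa> (FObj (condensed_Kstar \<kappa>) X) \<and>
        (\<forall>x0\<in>Arr (cubespaces \<kappa>) (point_cubespace \<kappa>) X. \<forall>n\<ge>1.
           condensed_group_isomorphic \<kappa>
             (condensed_structure_group X n (basepoint x0))
             (condensed_homotopy_group (FObj (condensed_Kstar \<kappa>) X) n
                (\<lambda>E. Kstar_point (FObj X E) (basepoint x0 E))))) \<and>
     (\<exists>F :: ('k, 'a, 'a K_map) realization.
        is_functor (cubespaces \<kappa>) (condensed_simplicial_sets \<kappa>) F \<and>
        (\<forall>J :: ('j, 'i) category. is_category J \<longrightarrow>
           preserves_limits_of_shape J (cubespaces \<kappa>) (condensed_simplicial_sets \<kappa>) F) \<and>
        is_faithful (full_sub (cubespaces \<kappa>) (concrete \<kappa>)) F \<and>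
        (\<forall>X. X \<in> Obj (cubespaces \<kappa>) \<and> concrete \<kappa> X \<and> fibrant \<kappa> X \<longrightarrow>
           condensed_Kan \<kappa> (FObj F X) \<and>
           (\<forall>x0\<in>Arr (cubespaces \<kappa>) (point_cubespace \<kappa>) X. \<forall>n\<ge>1.
              condensed_group_isomorphic \<kappa>
                (condensed_structure_group X n (basepoint x0))
                (condensed_homotopy_group (FObj F X) n (image_basepoint \<kappa> F X x0)))))"
proof -
  let ?K = "condensed_Kstar \<kappa> :: ('k, 'a, 'a K_map) realization"
  \<comment> \<open>A limit of cubespaces is pointwise, and a pointwise limit is sent to a
    limit.\<close>
  have lim: "preserves_limits_of_shape J (cubespaces \<kappa>) (condensed_simplicial_sets \<kappa>) ?K" for J :: "('j, 'i) category"
    unfolding preserves_limits_of_shape_def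
  proof (intro allI impI)
    fix G :: "('j, 'i, ('k, 'a) cubespace, 'k topology \<Rightarrow> nat \<Rightarrow> 'a \<Rightarrow> 'a) cfunctor" and L \<pi>
    assume "is_functor J (cubespaces \<kappa>) G \<and> is_limit_cone J (cubespaces \<kappa>) G L \<pi>"
    then have G: "is_functor J (cubespaces \<kappa>) G" and l: "is_limit_cone J (cubespaces \<kappa>) G L \<pi>" by blast+
    then have "is_cone J (cubespaces \<kappa>) G L \<pi>" unfolding is_limit_cone_def by blast
    then show "is_limit_cone J (condensed_simplicial_sets \<kappa>) (comp_functor ?K G) (FObj ?K L) (\<lambda>j\<in>Obj J. FArr ?K L (FObj G j) (\<pi> j))"
      by (rule limit_Kstar_of_pointwise_limit[OF G _ limit_is_pointwise[OF assms G l]])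
  qed
  have kan: "condensed_Kan \<kappa> (FObj ?K X)" if X: "X \<in> Obj (cubespaces \<kappa>)" "concrete \<kappa> X" "fibrant \<kappa> X" for X
    unfolding condensed_Kan_def condensed_Kstar_simps
  proof
    fix E assume E: "E \<in> Obj (Extr \<kappa>)"
    interpret fibrant_presheaf "FObj X E"
      using condensed_ObjD(1)[OF X(1) E E] X(2,3) E unfolding concrete_def fibrant_def by unfold_locales blast+
    show "Kan_complex (FObj Kstar (FObj X E))" by (rule Kan_complex_Kstar)
  qed
  \<comment> \<open>Stated for any family \<open>y\<close> that agrees with the basepoints on
    \<open>Extr \<kappa>\<close>, to serve both descriptions of the basepoint.\<close>
  have grp: "condensed_group_isomorphic \<kappa> (condensed_structure_group X n (basepoint x0)) (condensed_homotopy_group (FObj ?K X) n y)"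
    if X: "X \<in> Obj (cubespaces \<kappa>)" "concrete \<kappa> X" "fibrant \<kappa> X" and x0: "x0 \<in> Arr (cubespaces \<kappa>) (point_cubespace \<kappa>) X"
      and n: "n \<ge> 1" and y: "\<And>E. E \<in> Obj (Extr \<kappa>) \<Longrightarrow> y E = Kstar_point (FObj X E) (basepoint x0 E)" for X x0 n y
    by (rule condensed_group_iso[OF X point_naturality(2,3)[OF X(1) x0] y n])
  have grp1: "condensed_group_isomorphic \<kappa> (condensed_structure_group X n (basepoint x0))
      (condensed_homotopy_group (FObj ?K X) n (\<lambda>E. Kstar_point (FObj X E) (basepoint x0 E)))"
    if X: "X \<in> Obj (cubespaces \<kappa>)" "concrete \<kappa> X" "fibrant \<kappa> X" and x0: "x0 \<in> Arr (cubespaces \<kappa>) (point_cubespace \<kappa>) X"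
      and n: "n \<ge> 1" for X x0 n
    by (rule grp[OF X x0 n]) (rule refl)
  have grp2: "condensed_group_isomorphic \<kappa> (condensed_structure_group X n (basepoint x0))
      (condensed_homotopy_group (FObj ?K X) n (image_basepoint \<kappa> ?K X x0))"
    if X: "X \<in> Obj (cubespaces \<kappa>)" "concrete \<kappa> X" "fibrant \<kappa> X" and x0: "x0 \<in> Arr (cubespaces \<kappa>) (point_cubespace \<kappa>) X"
      and n: "n \<ge> 1" for X x0 n
    by (rule grp[OF X x0 n]) (rule image_basepoint_Kstar[OF X(1) x0])
  show ?thesis
    by (intro conjI exI[of _ ?K] allI impI ballI condensed_Kstar_functor lim condensed_Kstar_faithful)
      (elim conjE, (rule kan grp1 grp2; assumption))+
qed

end
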